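(* Let $X=\{X_{\underline n}\}_{\underline n\in\mathbb Z_+^N}$ be a unital product system of finite rank over a C*-algebra $A$ and let $\beta>0$. Then: (1) For $F=\emptyset$ there is a bijection $\Phi^\infty\colon\{\tau\in\mathrm{AVT}_\beta(A)\mid\tau|_{\mathfrak I_{\{1,\dots,N\}}}=0\}\to\mathrm{G\text{-}E}^\infty_\beta(\mathcal{NT}(X))$ such that $\Phi^\infty_\tau(\pi(a))=\tau(a)$ for all $a\in A$. (2) For $\emptyset\ne F\subseteq\{1,\dots,N\}$ there is a bijection $\Phi^F\colon\{\tau\in\mathrm T_\beta^F(A)\mid\tau|_{\mathfrak I_{F^c}}=0\}\to\mathrm{G\text{-}E}_\beta^F(\mathcal{NT}(X))$ such that $$\Phi^F_\tau(Q_F)\cdot c^F_{\tau,\beta}=1\quad\text{and}\quad\Phi^F_\tau(Q_F\pi(a)Q_F)=\Phi^F_\tau(Q_F)\cdot\tau(a)\ \text{ for all }a\in A.$$ If $x=\{x_{i,j}\mid j=1,\dots,d_i,\ i=1,\dots,N\}$ is a unit decomposition for $X$ then $$\Phi^F_\tau(t(\xi_{\underline n})t(\eta_{\underline m})^* )=\delta_{\underline n,\underline m}\,(c^F_{\tau,\beta})^{-1}\sum_{\ell(\underline\mu)\in F}e^{-(|\underline n|+|\underline\mu|)\beta}\,\tau(\langle\eta_{\underline m}\otimes x_{\underline\mu},\xi_{\underline n}\otimes x_{\underline\mu}\rangle).$$ This description is independent of the choice of the decomposition. (3) Every $\Phi^F$ for $F\neq\emptyset$ respects convex combinations in the sense that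 if $\lambda\in(0,1)$ then $$\Phi^F(\tau)=\lambda\frac{c^F_{\tau_1,\beta}}{c^F_{\tau,\beta}}\Phi^F(\tau_1)+(1-\lambda)\frac{c^F_{\tau_2,\beta}}{c^F_{\tau,\beta}}\Phi^F(\tau_2)$$ for $\tau=\lambda\tau_1+(1-\lambda)\tau_2$ with $\tau_1,\tau_2\in\mathrm T_\beta^F(A)$ annihilating $\mathfrak I_{F^c}$, and $$(\Phi^F)^{-1}(\varphi)=\lambda\frac{\varphi_1(Q_F)}{\varphi(Q_F)}(\Phi^F)^{-1}(\varphi_1)+(1-\lambda)\frac{\varphi_2(Q_F)}{\varphi(Q_F)}(\Phi^F)^{-1}(\varphi_2)$$ for $\varphi=\lambda\varphi_1+(1-\lambda)\varphi_2$ with $\varphi_1,\varphi_2\in\mathrm{G\text{-}E}_\beta^F(\mathcal{NT}(X))$. Therefore the parametrizations preserve the extreme points of the simplices.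
   Context: Notation. $N\geq 1$ is a finite integer and $\mathbf{1},\dots,\mathbf{N}$ are the free generators of $\mathbb Z_+^N$; $\mathbf{i}$ is the $i$-th one. For $\underline n=(n_1,\dots,n_N)$ put $|\underline n|=\sum_i n_i$ (a signed sum for $\underline n\in\mathbb Z^N$) and $\operatorname{supp}\underline n=\{i\mid n_i\neq 0\}$. For $F\subseteq\{1,\dots,N\}$, $\underline n\in F$ means $\operatorname{supp}\underline n\subseteq F$, $\underline n\perp F$ means $\operatorname{supp}\underline n\cap F=\emptyset$, $\underline n_F=\sum_{i\in F}n_i\mathbf i$, $\underline 1_F=\sum_{i\in F}\mathbf i$, and $F^c=\{1,\dots,N\}\setminus F$. The order on $\mathbb Z_+^N$ is coordinatewise. Product systems. A C*-correspondence over $A$ is a right Hilbert $A$-module $Y$ with a $*$-homomorphism $\phi_Y\colon A\to\mathcal L(Y)$, $a\xi:=\phi_Y(a)\xi$. A product system $X=\{X_{\underline n}\}_{\underline n\in\mathbb Z_+^N}$ over $A$ is a family of C*-correspondences over $A$ (left actions $\phi_{\underline n}$) with $X_{\underline 0}=A$ and associative unitary equivalences $X_{\underline n}\otimes_A X_{\underline m}\to X_{\underline n+\underline m}$, $\xi_{\underline n}\otimes\xi_{\underline m}\mapsto\xi_{\underline n}\xi_{\underline m}$. It is unital if $A$ is unital and $\phi_{\underline n}(1_A)=\mathrm{id}$ for all $\underline n$. It has finite rank if for each $i$ there are $x_{i,1},\dots,x_{i,d_i}\in X_{\mathbf i}$, $d_i<\infty$, with $\xi=\sum_{j=1}^{d_i}x_{i,j}\langle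 x_{i,j},\xi\rangle$ for all $\xi\in X_{\mathbf i}$; $x=\{x_{i,j}\}$ is then called a unit decomposition of $X$. For $\underline\mu=(\mu_1,\dots,\mu_N)$ with $\mu_i$ a finite word in the symbols $\{1,\dots,d_i\}$, put $\ell(\underline\mu)=(|\mu_1|,\dots,|\mu_N|)$, $|\underline\mu|=\sum_i|\mu_i|$, $x_{i,\mu_i}=x_{i,j_1}\cdots x_{i,j_r}$ for $\mu_i=j_1\cdots j_r$, and $x_{\underline\mu}\in X_{\ell(\underline\mu)}$ the product of the $x_{i,\mu_i}$ with $\mu_i\ne\emptyset$ in increasing order of $i$ ($x_{\underline\mu}=1_A$ if all are empty). Algebras. On the full Fock space $\mathcal F X=\bigoplus_{\underline m}X_{\underline m}$ let $\pi(a)\eta_{\underline m}=\phi_{\underline m}(a)\eta_{\underline m}$ and $t(\xi_{\underline n})\eta_{\underline m}=\xi_{\underline n}\eta_{\underline m}$. The Toeplitz-Nica-Pimsner algebra $\mathcal{NT}(X)$ is the C*-algebra generated by all $\pi(a)$, $t(\xi_{\underline n})$; it is the closed span of the $t(\xi_{\underline n})t(\eta_{\underline m})^*$. The gauge action $\gamma$ of $\mathbb T^N$ satisfies $\gamma_{\underline z}(\pi(a))=\pi(a)$, $\gamma_{\underline z}(t(\xi_{\underline n}))=\underline z^{\underline n}t(\xi_{\underline n})$, and $E$ is the conditional expectation onto its fixed point algebra. Put $P_{\mathbf i}=\sum_{j=1}^{d_i}t(x_{i,j})t(x_{i,j})^*$, $Q_{\mathbf i}=1-P_{\mathbf i}$,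 $Q_F=\prod_{i\in F}(1-P_{\mathbf i})$ (with $Q_\emptyset=1$), and $Q_F^{\underline n}=\sum_{\ell(\underline\mu)=\underline n}t(x_{\underline\mu})Q_Ft(x_{\underline\mu})^*$. $\langle S\rangle$ denotes the closed two-sided ideal generated by $S$. Equilibrium states. Let $\sigma_r=\gamma_{(e^{ir},\dots,e^{ir})}$, $r\in\mathbb R$. $\mathrm E_\beta(\mathcal{NT}(X))$ is the set of $(\sigma,\beta)$-KMS states, i.e. states $\varphi$ with $\varphi(t(\xi_{\underline n})t(\eta_{\underline m})^*\cdot t(\xi_{\underline k})t(\eta_{\underline w})^* )=e^{-|\underline n-\underline m|\beta}\varphi(t(\xi_{\underline k})t(\eta_{\underline w})^*\cdot t(\xi_{\underline n})t(\eta_{\underline m})^* )$ always. For $F\subseteq\{1,\dots,N\}$, $\mathrm E^F_\beta(\mathcal{NT}(X))$ is the set of $\varphi\in\mathrm E_\beta(\mathcal{NT}(X))$ with $\sum_{\underline n\in F}\varphi(Q_F^{\underline n})=1$ and $\varphi(Q_{\mathbf i})=0$ for all $i\notin F$; $\mathrm E_\beta^\infty:=\mathrm E_\beta^\emptyset$. The prefix $\mathrm{G\text{-}}$ denotes the subset of states with $\varphi=\varphi E$. Traces and ideals. $\mathrm T(A)$ is the set of tracial states of $A$. For $\tau\in\mathrm T(A)$ put $c^F_{\tau,\beta}=\sum\{e^{-|\underline\mu|\beta}\tau(\langle x_{\underline\mu},x_{\underline\mu}\rangle)\mid\ell(\underline\mu)\in F\}$, and let $\mathrm T^F_\beta(A)$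 be the set of $\tau\in\mathrm T(A)$ with $c^F_{\tau,\beta}<\infty$ and $e^\beta\tau(a)=\sum_{j=1}^{d_i}\tau(\langle x_{i,j},ax_{i,j}\rangle)$ for all $a\in A$, $i\notin F$ (these do not depend on the unit decomposition). $\mathrm{AVT}_\beta(A)$ is the set of $\tau\in\mathrm T(A)$ with $e^\beta\tau(a)=\sum_{j=1}^{d_i}\tau(\langle x_{i,j},ax_{i,j}\rangle)$ for all $a\in A$ and $i=1,\dots,N$. For $F\subseteq\{1,\dots,N\}$, $\mathfrak I_F$ is the kernel of the map $A\to\mathcal{NT}(X)/\langle Q_{\mathbf i}\mid i\in F\rangle$ induced by $\pi$ (so $\mathfrak I_\emptyset=(0)$). *)

theory Defs
  imports "HOL-Analysis.Analysis" "HOL-Library.Function_Algebras"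
begin

section \<open>Complex vector spaces and unital C*-algebras\<close>

class complex_vector = real_vector +
  fixes scaleC :: "complex \<Rightarrow> 'a \<Rightarrow> 'a"  (infixr \<open>*\<^sub>C\<close> 75)
  assumes scaleC_of_real: "complex_of_real r *\<^sub>C a = r *\<^sub>R a"
    and scaleC_add_right: "c *\<^sub>C (a + b) = c *\<^sub>C a + c *\<^sub>C b"
    and scaleC_add_left: "(c + d) *\<^sub>C a = c *\<^sub>C a + d *\<^sub>C a"
    and scaleC_scaleC: "c *\<^sub>C (d *\<^sub>C a) = (c * d) *\<^sub>C a"

instantiation complex :: complex_vector
begin
definition "scaleC (c :: complex) a = c * a"
instance
  by standard (simp_all add: scaleC_complex_def scaleR_conv_of_real algebra_simps)
end

instantiation "fun" :: (type, real_vector) real_vector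
begin
definition "scaleR r f = (\<lambda>x. r *\<^sub>R f x)"
instance
  by standard (simp_all add: scaleR_fun_def fun_eq_iff scaleR_add_right scaleR_add_left)
end

instantiation "fun" :: (type, complex_vector) complex_vector
begin
definition "scaleC c f = (\<lambda>x. c *\<^sub>C f x)"
instance
  by standard (simp_all add: scaleC_fun_def scaleR_fun_def fun_eq_iff scaleC_of_real
      scaleC_add_right scaleC_add_left scaleC_scaleC)
end

text \<open>The unit may be zero, so that the zero algebra is included.\<close>

class unital_cstar_algebra = complex_vector + real_normed_algebra + complete_space + monoid_mult +
  fixes star :: "'a \<Rightarrow> 'a"
  assumes scaleC_mult_left: "(c *\<^sub>C a) * b = c *\<^sub>C (a * b)"
    and scaleC_mult_right: "a * (c *\<^sub>C b) = c *\<^sub>C (a * b)"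
    and star_add: "star (a + b) = star a + star b"
    and star_scaleC: "star (c *\<^sub>C a) = cnj c *\<^sub>C star a"
    and star_mult: "star (a * b) = star b * star a"
    and star_star: "star (star a) = a"
    and norm_star_mult_self: "norm (star a * a) = (norm a)\<^sup>2"

definition positive_element :: "'a::unital_cstar_algebra \<Rightarrow> bool" where
  "positive_element a \<longleftrightarrow> (\<exists>b. a = star b * b)"

definition tracial_states :: "('a::unital_cstar_algebra \<Rightarrow> complex) set" where
  "tracial_states = {\<tau>. (\<forall>a b. \<tau> (a + b) = \<tau> a + \<tau> b) \<and> (\<forall>c a. \<tau> (c *\<^sub>C a) = c * \<tau> a) \<and>
     (\<forall>a. \<tau> (star a * a) \<in> \<real>\<^sub>\<ge>\<^sub>0) \<and> \<tau> 1 = 1 \<and> (\<forall>a b. \<tau> (a * b) = \<tau> (b * a))}"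

section \<open>Hilbert modules and C*-correspondences\<close>

text \<open>
  The carrier is a linear subspace of an ambient complex vector space \<open>'x\<close>, which only provides
  the vector space operations.  The field \<open>lact\<close> is irrelevant for a Hilbert module.
\<close>

record ('a, 'x) corr =
  carrier :: "'x set"
  ip :: "'x \<Rightarrow> 'x \<Rightarrow> 'a"
  ract :: "'x \<Rightarrow> 'a \<Rightarrow> 'x"
  lact :: "'a \<Rightarrow> 'x \<Rightarrow> 'x"

definition mnorm :: "('a::unital_cstar_algebra, 'x) corr \<Rightarrow> 'x \<Rightarrow> real" where
  "mnorm Y \<xi> = sqrt (norm (ip Y \<xi> \<xi>))"

locale hilbert_module =
  fixes Y :: "('a::unital_cstar_algebra, 'x::complex_vector) corr"
  assumes zero_closed: "0 \<in> carrier Y"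
    and add_closed: "\<xi> \<in> carrier Y \<Longrightarrow> \<eta> \<in> carrier Y \<Longrightarrow> \<xi> + \<eta> \<in> carrier Y"
    and scaleC_closed: "\<xi> \<in> carrier Y \<Longrightarrow> c *\<^sub>C \<xi> \<in> carrier Y"
    and ract_closed: "\<xi> \<in> carrier Y \<Longrightarrow> ract Y \<xi> a \<in> carrier Y"
    and ract_add_left: "\<xi> \<in> carrier Y \<Longrightarrow> \<eta> \<in> carrier Y \<Longrightarrow> ract Y (\<xi> + \<eta>) a = ract Y \<xi> a + ract Y \<eta> a"
    and ract_add_right: "\<xi> \<in> carrier Y \<Longrightarrow> ract Y \<xi> (a + b) = ract Y \<xi> a + ract Y \<xi> b"
    and ract_scaleC_left: "\<xi> \<in> carrier Y \<Longrightarrow> ract Y (c *\<^sub>C \<xi>) a = c *\<^sub>C ract Y \<xi> a"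
    and ract_scaleC_right: "\<xi> \<in> carrier Y \<Longrightarrow> ract Y \<xi> (c *\<^sub>C a) = c *\<^sub>C ract Y \<xi> a"
    and ract_mult: "\<xi> \<in> carrier Y \<Longrightarrow> ract Y \<xi> (a * b) = ract Y (ract Y \<xi> a) b"
    and ip_add_right: "\<lbrakk>\<xi> \<in> carrier Y; \<eta> \<in> carrier Y; \<zeta> \<in> carrier Y\<rbrakk> \<Longrightarrow> ip Y \<xi> (\<eta> + \<zeta>) = ip Y \<xi> \<eta> + ip Y \<xi> \<zeta>"
    and ip_scaleC_right: "\<xi> \<in> carrier Y \<Longrightarrow> \<eta> \<in> carrier Y \<Longrightarrow> ip Y \<xi> (c *\<^sub>C \<eta>) = c *\<^sub>C ip Y \<xi> \<eta>"
    and ip_ract: "\<xi> \<in> carrier Y \<Longrightarrow> \<eta> \<in> carrier Y \<Longrightarrow> ip Y \<xi> (ract Y \<eta> a) = ip Y \<xi> \<eta> * a"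
    and ip_star: "\<xi> \<in> carrier Y \<Longrightarrow> \<eta> \<in> carrier Y \<Longrightarrow> star (ip Y \<xi> \<eta>) = ip Y \<eta> \<xi>"
    and ip_positive: "\<xi> \<in> carrier Y \<Longrightarrow> positive_element (ip Y \<xi> \<xi>)"
    and ip_definite: "\<xi> \<in> carrier Y \<Longrightarrow> ip Y \<xi> \<xi> = 0 \<Longrightarrow> \<xi> = 0"
    and complete: "\<lbrakk>\<And>k. s k \<in> carrier Y; \<forall>\<epsilon>>0. \<exists>K. \<forall>p\<ge>K. \<forall>q\<ge>K. mnorm Y (s p - s q) < \<epsilon>\<rbrakk>
            \<Longrightarrow> \<exists>\<xi>\<in>carrier Y. (\<lambda>k::nat. mnorm Y (s k - \<xi>)) \<longlonglongrightarrow> 0"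

text \<open>
  Maps \<open>Y \<rightarrow> Y\<close> are represented by functions that are zero off the carrier, so that equality of
  operators is equality of functions.
\<close>

definition restr :: "('a, 'x) corr \<Rightarrow> ('x \<Rightarrow> 'x) \<Rightarrow> 'x \<Rightarrow> 'x::zero" where
  "restr Y f = (\<lambda>\<xi>. if \<xi> \<in> carrier Y then f \<xi> else 0)"

definition id_op :: "('a, 'x) corr \<Rightarrow> 'x \<Rightarrow> 'x::zero" where
  "id_op Y = restr Y (\<lambda>\<xi>. \<xi>)"

definition maps :: "('a, 'x) corr \<Rightarrow> ('x \<Rightarrow> 'x::zero) set" where
  "maps Y = {T. (\<forall>\<xi>\<in>carrier Y. T \<xi> \<in> carrier Y) \<and> (\<forall>\<xi>. \<xi> \<notin> carrier Y \<longrightarrow> T \<xi> = 0)}"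

definition is_adjoint :: "('a, 'x) corr \<Rightarrow> ('x \<Rightarrow> 'x) \<Rightarrow> ('x \<Rightarrow> 'x::zero) \<Rightarrow> bool" where
  "is_adjoint Y T S \<longleftrightarrow> T \<in> maps Y \<and> S \<in> maps Y \<and>
     (\<forall>\<xi>\<in>carrier Y. \<forall>\<eta>\<in>carrier Y. ip Y (T \<xi>) \<eta> = ip Y \<xi> (S \<eta>))"

definition adjointables :: "('a, 'x) corr \<Rightarrow> ('x \<Rightarrow> 'x::zero) set"  (\<open>\<L>\<close>) where
  "\<L> Y = {T. \<exists>S. is_adjoint Y T S}"

definition adj :: "('a, 'x) corr \<Rightarrow> ('x \<Rightarrow> 'x) \<Rightarrow> 'x \<Rightarrow> 'x::zero" where
  "adj Y T = (THE S. is_adjoint Y T S)"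

definition opnorm :: "('a::unital_cstar_algebra, 'x) corr \<Rightarrow> ('x \<Rightarrow> 'x) \<Rightarrow> real" where
  "opnorm Y T = Sup {mnorm Y (T \<xi>) |\<xi>. \<xi> \<in> carrier Y \<and> mnorm Y \<xi> \<le> 1}"

definition left_op :: "('a, 'x) corr \<Rightarrow> 'a \<Rightarrow> 'x \<Rightarrow> 'x::zero" where
  "left_op Y a = restr Y (lact Y a)"

locale correspondence = hilbert_module Y
  for Y :: "('a::unital_cstar_algebra, 'x::complex_vector) corr" +
  assumes left_op_add: "left_op Y (a + b) = left_op Y a + left_op Y b"
    and left_op_scaleC: "left_op Y (c *\<^sub>C a) = c *\<^sub>C left_op Y a"
    and left_op_mult: "left_op Y (a * b) = left_op Y a \<circ> left_op Y b"
    and left_op_star: "is_adjoint Y (left_op Y a) (left_op Y (star a))"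

text \<open>
  \<open>W\<close> is the interior tensor product of \<open>Y\<close> and \<open>Z\<close> with \<open>p \<xi> \<eta>\<close> in the role of the elementary
  tensor, that is, \<open>\<xi> \<otimes> \<eta> \<mapsto> p \<xi> \<eta>\<close> extends to a unitary equivalence of correspondences from
  \<open>Y \<otimes>\<^sub>A Z\<close> onto \<open>W\<close>.
\<close>

locale interior_tensor =
  fixes Y Z W :: "('a::unital_cstar_algebra, 'x::complex_vector) corr"
    and p :: "'x \<Rightarrow> 'x \<Rightarrow> 'x"
  assumes p_closed: "\<xi> \<in> carrier Y \<Longrightarrow> \<eta> \<in> carrier Z \<Longrightarrow> p \<xi> \<eta> \<in> carrier W"
    and p_add_left: "\<lbrakk>\<xi> \<in> carrier Y; \<xi>' \<in> carrier Y; \<eta> \<in> carrier Z\<rbrakk> \<Longrightarrow> p (\<xi> + \<xi>') \<eta> = p \<xi> \<eta> + p \<xi>' \<eta>"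
    and p_add_right: "\<lbrakk>\<xi> \<in> carrier Y; \<eta> \<in> carrier Z; \<eta>' \<in> carrier Z\<rbrakk> \<Longrightarrow> p \<xi> (\<eta> + \<eta>') = p \<xi> \<eta> + p \<xi> \<eta>'"
    and p_scaleC_left: "\<xi> \<in> carrier Y \<Longrightarrow> \<eta> \<in> carrier Z \<Longrightarrow> p (c *\<^sub>C \<xi>) \<eta> = c *\<^sub>C p \<xi> \<eta>"
    and p_scaleC_right: "\<xi> \<in> carrier Y \<Longrightarrow> \<eta> \<in> carrier Z \<Longrightarrow> p \<xi> (c *\<^sub>C \<eta>) = c *\<^sub>C p \<xi> \<eta>"
    and p_balanced: "\<xi> \<in> carrier Y \<Longrightarrow> \<eta> \<in> carrier Z \<Longrightarrow> p (ract Y \<xi> a) \<eta> = p \<xi> (lact Z a \<eta>)"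
    and p_ip: "\<lbrakk>\<xi> \<in> carrier Y; \<xi>' \<in> carrier Y; \<eta> \<in> carrier Z; \<eta>' \<in> carrier Z\<rbrakk>
      \<Longrightarrow> ip W (p \<xi> \<eta>) (p \<xi>' \<eta>') = ip Z \<eta> (lact Z (ip Y \<xi> \<xi>') \<eta>')"
    and p_lact: "\<xi> \<in> carrier Y \<Longrightarrow> \<eta> \<in> carrier Z \<Longrightarrow> lact W a (p \<xi> \<eta>) = p (lact Y a \<xi>) \<eta>"
    and p_ract: "\<xi> \<in> carrier Y \<Longrightarrow> \<eta> \<in> carrier Z \<Longrightarrow> ract W (p \<xi> \<eta>) a = p \<xi> (ract Z \<eta> a)"
    and p_total: "\<zeta> \<in> carrier W \<Longrightarrow> \<epsilon> > 0 \<Longrightarrow>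
      \<exists>(k::nat) s s'. (\<forall>j<k. s j \<in> carrier Y \<and> s' j \<in> carrier Z) \<and>
        mnorm W (\<zeta> - (\<Sum>j<k. p (s j) (s' j))) < \<epsilon>"

section \<open>C*-algebras of operators, ideals and states\<close>

definition closed_in :: "('a::unital_cstar_algebra, 'x::complex_vector) corr \<Rightarrow> ('x \<Rightarrow> 'x) set \<Rightarrow> ('x \<Rightarrow> 'x) set \<Rightarrow> bool" where
  "closed_in Y B J \<longleftrightarrow> (\<forall>T\<in>B. (\<forall>\<epsilon>>0. \<exists>S\<in>J. opnorm Y (T - S) < \<epsilon>) \<longrightarrow> T \<in> J)"

definition cstar_subalgebra :: "('a::unital_cstar_algebra, 'x::complex_vector) corr \<Rightarrow> ('x \<Rightarrow> 'x) set \<Rightarrow> bool" where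
  "cstar_subalgebra Y B \<longleftrightarrow> B \<subseteq> \<L> Y \<and> 0 \<in> B \<and> (\<forall>S\<in>B. \<forall>T\<in>B. S + T \<in> B \<and> S \<circ> T \<in> B) \<and>
     (\<forall>T\<in>B. adj Y T \<in> B \<and> (\<forall>c. c *\<^sub>C T \<in> B)) \<and> closed_in Y (\<L> Y) B"

definition cstar_generated :: "('a::unital_cstar_algebra, 'x::complex_vector) corr \<Rightarrow> ('x \<Rightarrow> 'x) set \<Rightarrow> ('x \<Rightarrow> 'x) set" where
  "cstar_generated Y G = \<Inter>{B. G \<subseteq> B \<and> cstar_subalgebra Y B}"

definition closed_ideal :: "('a::unital_cstar_algebra, 'x::complex_vector) corr \<Rightarrow> ('x \<Rightarrow> 'x) set \<Rightarrow> ('x \<Rightarrow> 'x) set \<Rightarrow> bool" where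
  "closed_ideal Y B J \<longleftrightarrow> J \<subseteq> B \<and> 0 \<in> J \<and> (\<forall>S\<in>J. \<forall>T\<in>J. S + T \<in> J) \<and> (\<forall>T\<in>J. \<forall>c. c *\<^sub>C T \<in> J) \<and>
     (\<forall>T\<in>J. \<forall>S\<in>B. S \<circ> T \<in> J \<and> T \<circ> S \<in> J) \<and> closed_in Y B J"

definition ideal_generated :: "('a::unital_cstar_algebra, 'x::complex_vector) corr \<Rightarrow> ('x \<Rightarrow> 'x) set \<Rightarrow> ('x \<Rightarrow> 'x) set \<Rightarrow> ('x \<Rightarrow> 'x) set" where
  "ideal_generated Y B G = \<Inter>{J. G \<subseteq> J \<and> closed_ideal Y B J}"

text \<open>
  States of a C*-algebra \<open>B\<close> of operators containing the identity.  A functional on \<open>B\<close> is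
  represented by its extension by zero.
\<close>

definition states :: "('a::unital_cstar_algebra, 'x::complex_vector) corr \<Rightarrow> ('x \<Rightarrow> 'x) set \<Rightarrow> (('x \<Rightarrow> 'x) \<Rightarrow> complex) set" where
  "states Y B = {\<phi>. (\<forall>T. T \<notin> B \<longrightarrow> \<phi> T = 0) \<and> (\<forall>S\<in>B. \<forall>T\<in>B. \<phi> (S + T) = \<phi> S + \<phi> T) \<and>
     (\<forall>c. \<forall>T\<in>B. \<phi> (c *\<^sub>C T) = c * \<phi> T) \<and> (\<forall>T\<in>B. \<phi> (adj Y T \<circ> T) \<in> \<real>\<^sub>\<ge>\<^sub>0) \<and> \<phi> (id_op Y) = 1}"

section \<open>Product systems\<close>

text \<open>
  Multi-indices are functions \<open>'i \<Rightarrow> nat\<close> on a finite linearly ordered type \<open>'i\<close>, which plays the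
  role of \<open>{1, \<dots>, N}\<close>; the order on \<open>'i\<close> is only used to order factors of products.
\<close>

definition unit_vec :: "'i \<Rightarrow> 'i \<Rightarrow> nat" where
  "unit_vec i = (\<lambda>k. if k = i then 1 else 0)"

definition supp :: "('i \<Rightarrow> nat) \<Rightarrow> 'i set" where
  "supp n = {i. n i \<noteq> 0}"

definition tdeg :: "('i::finite \<Rightarrow> nat) \<Rightarrow> nat" where
  "tdeg n = (\<Sum>i\<in>UNIV. n i)"

text \<open>
  \<open>emb\<close> is the identification of \<open>A\<close> with the fibre over \<open>0\<close>; multiplication by elements of that
  fibre is given by the module actions.
\<close>

record ('i, 'a, 'x) prod_sys =
  fib :: "('i \<Rightarrow> nat) \<Rightarrow> ('a, 'x) corr"
  pmul :: "('i \<Rightarrow> nat) \<Rightarrow> ('i \<Rightarrow> nat) \<Rightarrow> 'x \<Rightarrow> 'x \<Rightarrow> 'x"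
  emb :: "'a \<Rightarrow> 'x"

locale product_system =
  fixes X :: "('i::{finite,linorder}, 'a::unital_cstar_algebra, 'x::complex_vector) prod_sys"
  assumes fibre: "correspondence (fib X n)"
    and emb_bij: "bij_betw (emb X) UNIV (carrier (fib X 0))"
    and emb_add: "emb X (a + b) = emb X a + emb X b"
    and emb_scaleC: "emb X (c *\<^sub>C a) = c *\<^sub>C emb X a"
    and emb_ip: "ip (fib X 0) (emb X a) (emb X b) = star a * b"
    and emb_ract: "ract (fib X 0) (emb X a) b = emb X (a * b)"
    and emb_lact: "lact (fib X 0) a (emb X b) = emb X (a * b)"
    and tensor: "interior_tensor (fib X n) (fib X m) (fib X (n + m)) (pmul X n m)"
    and assoc: "\<lbrakk>\<xi> \<in> carrier (fib X n); \<eta> \<in> carrier (fib X m); \<zeta> \<in> carrier (fib X k)\<rbrakk>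
      \<Longrightarrow> pmul X (n + m) k (pmul X n m \<xi> \<eta>) \<zeta> = pmul X n (m + k) \<xi> (pmul X m k \<eta> \<zeta>)"
    and pmul_emb_left: "\<xi> \<in> carrier (fib X n) \<Longrightarrow> pmul X 0 n (emb X a) \<xi> = lact (fib X n) a \<xi>"
    and pmul_emb_right: "\<xi> \<in> carrier (fib X n) \<Longrightarrow> pmul X n 0 \<xi> (emb X a) = ract (fib X n) \<xi> a"

locale unital_product_system = product_system +
  assumes left_op_one: "left_op (fib X n) 1 = id_op (fib X n)"

text \<open>The list \<open>x i\<close> consists of \<open>x\<^sub>i\<^sub>,\<^sub>1, \<dots>, x\<^sub>i\<^sub>,\<^sub>d\<close>; indices are counted from \<open>0\<close> below.\<close>

definition unit_decomposition :: "('i, 'a::unital_cstar_algebra, 'x::complex_vector) prod_sys \<Rightarrow> ('i \<Rightarrow> 'x list) \<Rightarrow> bool" where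
  "unit_decomposition X x \<longleftrightarrow> (\<forall>i. let Y = fib X (unit_vec i) in
     set (x i) \<subseteq> carrier Y \<and>
     (\<forall>\<xi>\<in>carrier Y. \<xi> = (\<Sum>j<length (x i). ract Y (x i ! j) (ip Y (x i ! j) \<xi>))))"

definition finite_rank :: "('i, 'a::unital_cstar_algebra, 'x::complex_vector) prod_sys \<Rightarrow> bool" where
  "finite_rank X \<longleftrightarrow> (\<exists>x. unit_decomposition X x)"

definition words :: "('i \<Rightarrow> 'x list) \<Rightarrow> 'i set \<Rightarrow> ('i \<Rightarrow> nat list) set" where
  "words x F = {\<mu>. (\<forall>i. set (\<mu> i) \<subseteq> {..<length (x i)}) \<and> supp (\<lambda>i. length (\<mu> i)) \<subseteq> F}"

abbreviation wlen :: "('i \<Rightarrow> nat list) \<Rightarrow> 'i \<Rightarrow> nat" where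
  "wlen \<mu> \<equiv> (\<lambda>i. length (\<mu> i))"

primrec letter_prod :: "('i, 'a::one, 'x) prod_sys \<Rightarrow> ('i \<Rightarrow> 'x list) \<Rightarrow> ('i \<times> nat) list \<Rightarrow> 'x" where
  "letter_prod X x [] = emb X 1"
| "letter_prod X x (p # w) =
     pmul X (unit_vec (fst p)) (\<Sum>q\<leftarrow>w. unit_vec (fst q)) (x (fst p) ! snd p) (letter_prod X x w)"

text \<open>
  The element \<open>x\<^sub>\<mu>\<close>: the letters of \<open>\<mu> i\<close> are multiplied in the order of the word, and the words
  are taken in increasing order of \<open>i\<close>.
\<close>

definition word_elt :: "('i::{finite,linorder}, 'a::one, 'x) prod_sys \<Rightarrow> ('i \<Rightarrow> 'x list) \<Rightarrow> ('i \<Rightarrow> nat list) \<Rightarrow> 'x" where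
  "word_elt X x \<mu> = letter_prod X x (concat (map (\<lambda>i. map (Pair i) (\<mu> i)) (sorted_list_of_set UNIV)))"

section \<open>The Fock module and the Toeplitz-Nica-Pimsner algebra\<close>

definition fock :: "('i, 'a::unital_cstar_algebra, 'x::complex_vector) prod_sys \<Rightarrow> ('a, ('i \<Rightarrow> nat) \<Rightarrow> 'x) corr" where
  "fock X = \<lparr>
     carrier = {\<eta>. (\<forall>m. \<eta> m \<in> carrier (fib X m)) \<and> (\<lambda>m. ip (fib X m) (\<eta> m) (\<eta> m)) summable_on UNIV},
     ip = (\<lambda>\<eta> \<zeta>. \<Sum>\<^sub>\<infinity>m. ip (fib X m) (\<eta> m) (\<zeta> m)),
     ract = (\<lambda>\<eta> a m. ract (fib X m) (\<eta> m) a),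
     lact = (\<lambda>a \<eta> m. lact (fib X m) a (\<eta> m)) \<rparr>"

definition pi_rep :: "('i, 'a::unital_cstar_algebra, 'x::complex_vector) prod_sys \<Rightarrow> 'a \<Rightarrow> (('i \<Rightarrow> nat) \<Rightarrow> 'x) \<Rightarrow> ('i \<Rightarrow> nat) \<Rightarrow> 'x" where
  "pi_rep X a = left_op (fock X) a"

definition t_op :: "('i, 'a::unital_cstar_algebra, 'x::complex_vector) prod_sys \<Rightarrow> ('i \<Rightarrow> nat) \<Rightarrow> 'x \<Rightarrow> (('i \<Rightarrow> nat) \<Rightarrow> 'x) \<Rightarrow> ('i \<Rightarrow> nat) \<Rightarrow> 'x" where
  "t_op X n \<xi> = restr (fock X) (\<lambda>\<eta> k. if n \<le> k then pmul X n (k - n) \<xi> (\<eta> (k - n)) else 0)"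

abbreviation tt :: "('i, 'a::unital_cstar_algebra, 'x::complex_vector) prod_sys \<Rightarrow> ('i \<Rightarrow> nat) \<Rightarrow> 'x \<Rightarrow> ('i \<Rightarrow> nat) \<Rightarrow> 'x \<Rightarrow> (('i \<Rightarrow> nat) \<Rightarrow> 'x) \<Rightarrow> ('i \<Rightarrow> nat) \<Rightarrow> 'x" where
  "tt X n \<xi> m \<eta> \<equiv> t_op X n \<xi> \<circ> adj (fock X) (t_op X m \<eta>)"

definition NT :: "('i, 'a::unital_cstar_algebra, 'x::complex_vector) prod_sys \<Rightarrow> ((('i \<Rightarrow> nat) \<Rightarrow> 'x) \<Rightarrow> ('i \<Rightarrow> nat) \<Rightarrow> 'x) set" where
  "NT X = cstar_generated (fock X) (range (pi_rep X) \<union> {t_op X n \<xi> |n \<xi>. \<xi> \<in> carrier (fib X n)})"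

definition P_proj :: "('i, 'a::unital_cstar_algebra, 'x::complex_vector) prod_sys \<Rightarrow> ('i \<Rightarrow> 'x list) \<Rightarrow> 'i \<Rightarrow> (('i \<Rightarrow> nat) \<Rightarrow> 'x) \<Rightarrow> ('i \<Rightarrow> nat) \<Rightarrow> 'x" where
  "P_proj X x i = (\<Sum>j<length (x i). tt X (unit_vec i) (x i ! j) (unit_vec i) (x i ! j))"

definition Q_proj :: "('i, 'a::unital_cstar_algebra, 'x::complex_vector) prod_sys \<Rightarrow> ('i \<Rightarrow> 'x list) \<Rightarrow> 'i \<Rightarrow> (('i \<Rightarrow> nat) \<Rightarrow> 'x) \<Rightarrow> ('i \<Rightarrow> nat) \<Rightarrow> 'x" where
  "Q_proj X x i = id_op (fock X) - P_proj X x i"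

text \<open>The factors commute, so the chosen order of composition is immaterial.\<close>

definition Q_set :: "('i::{finite,linorder}, 'a::unital_cstar_algebra, 'x::complex_vector) prod_sys \<Rightarrow> ('i \<Rightarrow> 'x list) \<Rightarrow> 'i set \<Rightarrow> (('i \<Rightarrow> nat) \<Rightarrow> 'x) \<Rightarrow> ('i \<Rightarrow> nat) \<Rightarrow> 'x" where
  "Q_set X x F = foldr (\<lambda>i T. Q_proj X x i \<circ> T) (sorted_list_of_set F) (id_op (fock X))"

definition Q_level :: "('i::{finite,linorder}, 'a::unital_cstar_algebra, 'x::complex_vector) prod_sys \<Rightarrow> ('i \<Rightarrow> 'x list) \<Rightarrow> 'i set \<Rightarrow> ('i \<Rightarrow> nat) \<Rightarrow> (('i \<Rightarrow> nat) \<Rightarrow> 'x) \<Rightarrow> ('i \<Rightarrow> nat) \<Rightarrow> 'x" where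
  "Q_level X x F n = (\<Sum>\<mu> | \<mu> \<in> words x UNIV \<and> wlen \<mu> = n.
     t_op X n (word_elt X x \<mu>) \<circ> Q_set X x F \<circ> adj (fock X) (t_op X n (word_elt X x \<mu>)))"

text \<open>
  The gauge action is implemented by the unitaries \<open>\<eta>\<^sub>m \<mapsto> z\<^sup>m \<eta>\<^sub>m\<close>, and the conditional expectation
  onto its fixed point algebra is the average over the torus, \<open>E(T) = \<integral> \<gamma>\<^sub>z(T) dz\<close>, with the
  integral taken weakly with respect to the inner product of the Fock module.
\<close>

definition gauge_unitary :: "('i::finite, 'a::unital_cstar_algebra, 'x::complex_vector) prod_sys \<Rightarrow> ('i \<Rightarrow> complex) \<Rightarrow> (('i \<Rightarrow> nat) \<Rightarrow> 'x) \<Rightarrow> ('i \<Rightarrow> nat) \<Rightarrow> 'x" where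
  "gauge_unitary X z = restr (fock X) (\<lambda>\<eta> m. (\<Prod>i\<in>UNIV. z i ^ m i) *\<^sub>C \<eta> m)"

definition gauge :: "('i::finite, 'a::unital_cstar_algebra, 'x::complex_vector) prod_sys \<Rightarrow> ('i \<Rightarrow> complex)
    \<Rightarrow> ((('i \<Rightarrow> nat) \<Rightarrow> 'x) \<Rightarrow> ('i \<Rightarrow> nat) \<Rightarrow> 'x) \<Rightarrow> (('i \<Rightarrow> nat) \<Rightarrow> 'x) \<Rightarrow> ('i \<Rightarrow> nat) \<Rightarrow> 'x" where
  "gauge X z T = gauge_unitary X z \<circ> T \<circ> gauge_unitary X (\<lambda>i. cnj (z i))"

definition cond_exp :: "('i::finite, 'a::unital_cstar_algebra, 'x::complex_vector) prod_sys
    \<Rightarrow> ((('i \<Rightarrow> nat) \<Rightarrow> 'x) \<Rightarrow> ('i \<Rightarrow> nat) \<Rightarrow> 'x) \<Rightarrow> (('i \<Rightarrow> nat) \<Rightarrow> 'x) \<Rightarrow> ('i \<Rightarrow> nat) \<Rightarrow> 'x" where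
  "cond_exp X T = (THE S. S \<in> \<L> (fock X) \<and>
     (\<forall>\<zeta>\<in>carrier (fock X). \<forall>\<eta>\<in>carrier (fock X).
        ((\<lambda>s::real^'i. ip (fock X) \<zeta> (gauge X (\<lambda>i. cis (2 * pi * s $ i)) T \<eta>))
          has_integral ip (fock X) \<zeta> (S \<eta>)) (cbox 0 1)))"

section \<open>KMS states, traces and ideals\<close>

definition KMS :: "('i::finite, 'a::unital_cstar_algebra, 'x::complex_vector) prod_sys \<Rightarrow> real
    \<Rightarrow> (((('i \<Rightarrow> nat) \<Rightarrow> 'x) \<Rightarrow> ('i \<Rightarrow> nat) \<Rightarrow> 'x) \<Rightarrow> complex) set" where
  "KMS X \<beta> = {\<phi> \<in> states (fock X) (NT X). \<forall>n m k w.
     \<forall>\<xi>\<in>carrier (fib X n). \<forall>\<eta>\<in>carrier (fib X m). \<forall>\<zeta>\<in>carrier (fib X k). \<forall>\<omega>\<in>carrier (fib X w).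
       \<phi> (tt X n \<xi> m \<eta> \<circ> tt X k \<zeta> w \<omega>) =
         complex_of_real (exp (- (real (tdeg n) - real (tdeg m)) * \<beta>)) * \<phi> (tt X k \<zeta> w \<omega> \<circ> tt X n \<xi> m \<eta>)}"

definition KMS_F :: "('i::{finite,linorder}, 'a::unital_cstar_algebra, 'x::complex_vector) prod_sys \<Rightarrow> ('i \<Rightarrow> 'x list) \<Rightarrow> 'i set \<Rightarrow> real
    \<Rightarrow> (((('i \<Rightarrow> nat) \<Rightarrow> 'x) \<Rightarrow> ('i \<Rightarrow> nat) \<Rightarrow> 'x) \<Rightarrow> complex) set" where
  "KMS_F X x F \<beta> = {\<phi> \<in> KMS X \<beta>.
     ((\<lambda>n. \<phi> (Q_level X x F n)) has_sum 1) {n. supp n \<subseteq> F} \<and> (\<forall>i. i \<notin> F \<longrightarrow> \<phi> (Q_proj X x i) = 0)}"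

definition GKMS_F :: "('i::{finite,linorder}, 'a::unital_cstar_algebra, 'x::complex_vector) prod_sys \<Rightarrow> ('i \<Rightarrow> 'x list) \<Rightarrow> 'i set \<Rightarrow> real
    \<Rightarrow> (((('i \<Rightarrow> nat) \<Rightarrow> 'x) \<Rightarrow> ('i \<Rightarrow> nat) \<Rightarrow> 'x) \<Rightarrow> complex) set" where
  "GKMS_F X x F \<beta> = {\<phi> \<in> KMS_F X x F \<beta>. \<forall>T\<in>NT X. \<phi> T = \<phi> (cond_exp X T)}"

definition c_term :: "('i::{finite,linorder}, 'a::unital_cstar_algebra, 'x::complex_vector) prod_sys \<Rightarrow> ('i \<Rightarrow> 'x list) \<Rightarrow> ('a \<Rightarrow> complex) \<Rightarrow> real
    \<Rightarrow> ('i \<Rightarrow> nat list) \<Rightarrow> complex" where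
  "c_term X x \<tau> \<beta> \<mu> = complex_of_real (exp (- real (tdeg (wlen \<mu>)) * \<beta>)) *
     \<tau> (ip (fib X (wlen \<mu>)) (word_elt X x \<mu>) (word_elt X x \<mu>))"

text \<open>
  For a tracial state all terms are nonnegative reals, so \<open>c < \<infinity>\<close> is summability.
\<close>

definition c_const :: "('i::{finite,linorder}, 'a::unital_cstar_algebra, 'x::complex_vector) prod_sys \<Rightarrow> ('i \<Rightarrow> 'x list) \<Rightarrow> 'i set \<Rightarrow> ('a \<Rightarrow> complex) \<Rightarrow> real \<Rightarrow> complex" where
  "c_const X x F \<tau> \<beta> = (\<Sum>\<^sub>\<infinity>\<mu>\<in>words x F. c_term X x \<tau> \<beta> \<mu>)"

definition trace_scaling :: "('i, 'a::unital_cstar_algebra, 'x::complex_vector) prod_sys \<Rightarrow> ('i \<Rightarrow> 'x list) \<Rightarrow> ('a \<Rightarrow> complex) \<Rightarrow> real \<Rightarrow> 'i \<Rightarrow> bool" where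
  "trace_scaling X x \<tau> \<beta> i \<longleftrightarrow> (\<forall>a. complex_of_real (exp \<beta>) * \<tau> a =
     (\<Sum>j<length (x i). \<tau> (ip (fib X (unit_vec i)) (x i ! j) (lact (fib X (unit_vec i)) a (x i ! j)))))"

definition T_F :: "('i::{finite,linorder}, 'a::unital_cstar_algebra, 'x::complex_vector) prod_sys \<Rightarrow> ('i \<Rightarrow> 'x list) \<Rightarrow> 'i set \<Rightarrow> real \<Rightarrow> ('a \<Rightarrow> complex) set" where
  "T_F X x F \<beta> = {\<tau> \<in> tracial_states. c_term X x \<tau> \<beta> summable_on words x F \<and>
     (\<forall>i. i \<notin> F \<longrightarrow> trace_scaling X x \<tau> \<beta> i)}"

definition AVT :: "('i, 'a::unital_cstar_algebra, 'x::complex_vector) prod_sys \<Rightarrow> ('i \<Rightarrow> 'x list) \<Rightarrow> real \<Rightarrow> ('a \<Rightarrow> complex) set" where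
  "AVT X x \<beta> = {\<tau> \<in> tracial_states. \<forall>i. trace_scaling X x \<tau> \<beta> i}"

text \<open>The kernel of \<open>A \<rightarrow> NT(X) / \<langle>Q\<^sub>i | i \<in> F\<rangle>\<close> induced by \<open>\<pi>\<close>.\<close>

definition ker_ideal :: "('i, 'a::unital_cstar_algebra, 'x::complex_vector) prod_sys \<Rightarrow> ('i \<Rightarrow> 'x list) \<Rightarrow> 'i set \<Rightarrow> 'a set" where
  "ker_ideal X x F = {a. pi_rep X a \<in> ideal_generated (fock X) (NT X) (Q_proj X x ` F)}"

end

theory Submission
  imports Defs
begin

text \<open>
  For a tracial state \<open>\<tau>\<close> of \<open>A\<close> and a multi-degree \<open>p\<close> the sum \<open>Tr\<^sub>p(T) = \<Sum>\<^sub>\<mu> \<tau> \<langle>x\<^sub>\<mu>, T x\<^sub>\<mu>\<rangle>\<close> over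
  \<open>\<ell>(\<mu>) = p\<close> is a trace on the operators of the fibre \<open>X\<^sub>p\<close>, independent of the decomposition, and
  satisfies \<open>Tr\<^sub>q(t(\<xi>) T) = Tr\<^sub>q\<^sub>-\<^sub>n(T t(\<xi>))\<close> for \<open>\<xi> \<in> X\<^sub>n\<close>. Hence the Gibbs sum of
  \<open>e\<^sup>-\<^sup>|\<^sup>p\<^sup>|\<^sup>\<beta> Tr\<^sub>p\<close> over \<open>p \<in> F\<close> has the KMS property in the directions of \<open>F\<close>. In a direction
  \<open>i \<notin> F\<close> the scaling of \<open>\<tau>\<close> makes \<open>e\<^sup>-\<^sup>k\<^sup>\<beta> Tr\<^sub>p\<^sub>+\<^sub>k\<^sub>i\<close> constant on \<open>\<pi>(A)\<close>, so that its values on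
  the span of the \<open>t(\<xi>) t(\<eta>)\<^sup>*\<close> stabilise as \<open>k \<rightarrow> \<infinity>\<close>; the limit is a KMS state that vanishes on
  \<open>Q\<^sub>i\<close>.
  Conversely, a state \<open>\<phi>\<close> in the class of \<open>F\<close> is concentrated on the projections \<open>Q\<^sub>F\<^sup>n\<close>, and the KMS
  condition expresses \<open>\<phi>(Q\<^sub>F\<^sup>n \<pi>(a))\<close> through the trace \<open>a \<mapsto> \<phi>(Q\<^sub>F \<pi>(a) Q\<^sub>F)\<close>, which therefore
  determines \<open>\<phi>\<close>. Since the left kernel of a KMS state is a two-sided ideal, it contains the ideal
  generated by the \<open>Q\<^sub>i\<close> with \<open>i \<notin> F\<close>. The conditional expectation is the block diagonal part of an
  operator on the Fock module.
\<close>

section \<open>Positivity in unital C*-algebras\<close>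

text \<open>The class of C*-algebras supplies only the norm identity, whereas Fock vectors are
  defined by convergent sums of positive elements. So order comes first: the cone is described by a
  norm criterion, and positivity of \<open>star b * b\<close> is proved without spectra. Elements of
  \<open>\<L> (fock X)\<close> are functions rather than members of that class, so roots and bounds
  are built for them again; adjointables are not assumed bounded either. Finite rank gives every
  fibre a finite frame of words. It makes creation operators adjointable, turns every Q_i, Q_F and
  Q_F^n into the projection onto a set of degrees, and keeps each Tr_p a finite sum. Moving a
  creation operator through a Gibbs sum lowers the offset outside F, so the sums must be eventually
  constant for all large offsets and not only along one ray. The inverse map is explicit, the
  compression to the corner of Q_F, so bijectivity amounts to two identities. Both maps are linear
  before normalisation, and normalising produces the weights in the convexity formulas.\<close>

instance unital_cstar_algebra \<subseteq> banach ..

section \<open>Cauchy criterion for unordered sums in a Banach space\<close>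

lemma summable_on_CauchyI:
  fixes f :: "'i \<Rightarrow> 'b::banach"
  assumes small: "\<And>e. e > 0 \<Longrightarrow> \<exists>K. finite K \<and> K \<subseteq> I \<and> (\<forall>J. finite J \<and> J \<subseteq> I - K \<longrightarrow> norm (sum f J) < e)"
  shows "f summable_on I"
proof -
  have "cauchy_filter (filtermap (sum f) (finite_subsets_at_top I))"
    unfolding cauchy_filter_metric_filtermap
  proof (intro allI impI)
    fix e :: real assume "e > 0"
    then obtain K where K: "finite K" "K \<subseteq> I" "\<And>J. finite J \<Longrightarrow> J \<subseteq> I - K \<Longrightarrow> norm (sum f J) < e / 2"
      using small[of "e/2"] by (auto simp: field_simps)
    have near: "dist (sum f F) (sum f K) < e / 2" if "finite F" "K \<subseteq> F" "F \<subseteq> I" for F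
    proof -
      have "sum f F - sum f K = sum f (F - K)" using that by (simp add: sum_diff)
      then show ?thesis using K(3)[of "F - K"] that by (auto simp: dist_norm)
    qed
    show "\<exists>P. eventually P (finite_subsets_at_top I) \<and> (\<forall>x y. P x \<and> P y \<longrightarrow> dist (sum f x) (sum f y) < e)"
    proof (intro exI conjI allI impI)
      show "\<forall>\<^sub>F F in finite_subsets_at_top I. finite F \<and> K \<subseteq> F \<and> F \<subseteq> I"
        using K by (auto simp: eventually_finite_subsets_at_top)
      show "dist (sum f F) (sum f F') < e" if "(finite F \<and> K \<subseteq> F \<and> F \<subseteq> I) \<and> (finite F' \<and> K \<subseteq> F' \<and> F' \<subseteq> I)" for F F'
        using near[of F] near[of F'] that dist_triangle_half_l[of "sum f F" "sum f K" e "sum f F'"] by blast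
    qed
  qed
  moreover have "complete (UNIV::'b set)"
    by (meson Cauchy_convergent UNIV_I complete_def convergent_def)
  ultimately obtain L where "(sum f \<longlongrightarrow> L) (finite_subsets_at_top I)"
    using complete_uniform[where S="UNIV::'b set"] by (force simp add: filterlim_def)
  then show ?thesis using summable_on_def has_sum_def by blast
qed

text \<open>Converse of the criterion: once all finite sums over sets containing \<open>K\<close>
  are within \<open>e / 2\<close> of the limit, a sum over \<open>J\<close> disjoint from
  \<open>K\<close> is the difference of the sums over \<open>K \<union> J\<close> and
  \<open>K\<close>.\<close>

lemma summable_on_tail:
  fixes f :: "'i \<Rightarrow> 'b::banach"
  assumes g: "f summable_on I" and "e > 0"
  shows "\<exists>K. finite K \<and> K \<subseteq> I \<and> (\<forall>J. finite J \<and> J \<subseteq> I - K \<longrightarrow> norm (sum f J) < e)"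
proof -
  obtain G where G: "(f has_sum G) I" using g by (auto simp: summable_on_def)
  have "\<forall>\<^sub>F F in finite_subsets_at_top I. dist (sum f F) G < e / 2"
    using G assms(2) unfolding has_sum_def by (intro tendstoD) auto
  then obtain K where K: "finite K" "K \<subseteq> I"
    "\<And>F. finite F \<Longrightarrow> K \<subseteq> F \<Longrightarrow> F \<subseteq> I \<Longrightarrow> dist (sum f F) G < e / 2"
    by (auto simp: eventually_finite_subsets_at_top)
  show ?thesis
  proof (intro exI conjI allI impI)
    fix J assume J: "finite J \<and> J \<subseteq> I - K"
    have "sum f J = (sum f (K \<union> J) - G) - (sum f K - G)"
      using J K by (subst sum.union_disjoint) auto
    also have "norm \<dots> \<le> dist (sum f (K \<union> J)) G + dist (sum f K) G"
      unfolding dist_norm by (rule norm_triangle_ineq4)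
    also have "\<dots> < e" using K(3)[of "K \<union> J"] K(3)[of K] J K(1,2) by force
    finally show "norm (sum f J) < e" .
  qed (use K in auto)
qed

section \<open>Complex scalars and the involution\<close>

lemma scaleC_one [simp]: "1 *\<^sub>C (a::'a::complex_vector) = a"
  using scaleC_of_real[of 1 a] by simp

lemma scaleC_zero_left [simp]: "0 *\<^sub>C (a::'a::complex_vector) = 0"
  using scaleC_of_real[of 0 a] by simp

lemma scaleC_zero_right [simp]: "c *\<^sub>C (0::'a::complex_vector) = 0"
  using scaleC_add_right[of c 0 "0::'a"] by simp

lemma scaleC_minus_right [simp]: "c *\<^sub>C (- (a::'a::complex_vector)) = - (c *\<^sub>C a)"
  using scaleC_add_right[of c a "-a"] by (simp add: eq_neg_iff_add_eq_0 add.commute)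

lemma scaleC_minus_left [simp]: "(- c) *\<^sub>C (a::'a::complex_vector) = - (c *\<^sub>C a)"
  using scaleC_add_left[of c "-c" a] by (simp add: eq_neg_iff_add_eq_0 add.commute)

lemma scaleC_diff_right: "c *\<^sub>C (a - b::'a::complex_vector) = c *\<^sub>C a - c *\<^sub>C b"
  using scaleC_add_right[of c a "-b"] by simp

lemma scaleC_sum_right: "c *\<^sub>C (\<Sum>i\<in>I. f i :: 'a::complex_vector) = (\<Sum>i\<in>I. c *\<^sub>C f i)"
  by (induction I rule: infinite_finite_induct) (auto simp: scaleC_add_right)

lemma scaleC_complex_eq [simp]: "c *\<^sub>C (d::complex) = c * d"
  by (simp add: scaleC_complex_def)

context
  fixes dummy :: "'a::unital_cstar_algebra itself"
begin

lemma star_zero [simp]: "star (0::'a) = 0"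
  using star_add[of 0 "0::'a"] by simp

lemma star_one [simp]: "star (1::'a) = 1"
  by (metis mult.right_neutral mult_1 star_mult star_star)

lemma star_uminus: "star (- (a::'a)) = - star a"
  using star_add[of a "-a"] by (simp add: eq_neg_iff_add_eq_0 add.commute)

lemma star_diff: "star (a - b::'a) = star a - star b"
  using star_add[of a "-b"] star_uminus[of b] by simp

lemma star_scaleR: "star (r *\<^sub>R a::'a) = r *\<^sub>R star a"
  by (metis complex_cnj_complex_of_real scaleC_of_real star_scaleC)

lemmas star_simps = star_add star_diff star_uminus star_scaleR star_scaleC star_mult star_star

lemma norm_star [simp]: "norm (star (a::'a)) = norm a"
proof -
  have le: "norm b \<le> norm (star b)" for b :: 'a
  proof (cases "b = 0")
    case False
    have "(norm b)\<^sup>2 \<le> norm (star b) * norm b"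
      by (metis norm_mult_ineq norm_star_mult_self)
    then show ?thesis using False by (simp add: power2_eq_square)
  qed simp
  show ?thesis using le[of a] le[of "star a"] by (simp add: star_star)
qed

text \<open>The class fixes the norm of real multiples only; the complex case follows from the
  C*-identity for the element \<open>c *\<^sub>C a\<close>.\<close>

lemma norm_scaleC: "norm (c *\<^sub>C (a::'a)) = cmod c * norm a"
proof -
  have "star (c *\<^sub>C a) * (c *\<^sub>C a) = complex_of_real ((cmod c)\<^sup>2) *\<^sub>C (star a * a)"
    by (simp add: star_scaleC scaleC_mult_left scaleC_mult_right scaleC_scaleC complex_norm_square mult.commute
        del: of_real_power)
  then have "(norm (c *\<^sub>C a))\<^sup>2 = (cmod c * norm a)\<^sup>2"
    by (metis abs_of_nonneg norm_scaleR norm_star_mult_self power_mult_distrib scaleC_of_real zero_le_power2)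
  then show ?thesis by simp
qed

text \<open>Only an inequality, because the unit of the zero algebra has norm 0.\<close>

lemma norm_one_le: "norm (1::'a) \<le> 1"
proof -
  have "norm (1::'a) * norm (1::'a) = norm (1::'a)"
    using norm_star_mult_self[of "1::'a"] by (simp add: power2_eq_square)
  then show ?thesis by (metis mult_cancel_right1 order_refl zero_le_one)
qed

end

text \<open>The Banach iteration for \<open>y = (x + y\<^sup>2) / 2\<close>, which \<open>1 - sqrt (1 - x)\<close> solves,
  is dominated by the same iteration for \<open>x = 1\<close>.\<close>

primrec sqrt_iter :: "nat \<Rightarrow> real" where
  "sqrt_iter 0 = 0"
| "sqrt_iter (Suc n) = (1 + (sqrt_iter n)\<^sup>2) / 2"

lemma sqrt_iter_bounds: "0 \<le> sqrt_iter n \<and> sqrt_iter n \<le> 1"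
  by (induction n) (auto simp: power_le_one add_nonneg_nonneg)

lemma sqrt_iter_incseq: "incseq sqrt_iter"
proof (rule incseq_SucI)
  fix n
  have "(sqrt_iter n - 1)\<^sup>2 \<ge> 0" by simp
  then show "sqrt_iter n \<le> sqrt_iter (Suc n)" by (simp add: power2_eq_square algebra_simps)
qed

lemma sqrt_iter_Cauchy: "Cauchy sqrt_iter"
proof -
  have "Bseq sqrt_iter" using sqrt_iter_bounds by (intro BseqI'[of _ 1]) auto
  then have "convergent sqrt_iter" using sqrt_iter_incseq Bseq_mono_convergent incseqD by blast
  then show ?thesis by (rule convergent_Cauchy)
qed

lemma telescope_norm_le:
  fixes y :: "nat \<Rightarrow> 'b::real_normed_vector"
  assumes "\<And>n. norm (y (Suc n) - y n) \<le> r (Suc n) - r n" and "m \<le> n"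
  shows "norm (y n - y m) \<le> r n - (r m :: real)"
  using assms(2)
proof (induction n rule: dec_induct)
  case (step n)
  have "norm (y (Suc n) - y m) \<le> norm (y (Suc n) - y n) + norm (y n - y m)"
    using norm_triangle_ineq[of "y (Suc n) - y n" "y n - y m"] by simp
  then show ?case using step assms(1)[of n] by linarith
qed simp

text \<open>The iterates are real polynomials in \<open>x\<close>, so they are selfadjoint and
  commute with whatever commutes with \<open>x\<close>; both properties pass to the limit. The fixed
  point equation 2 y = x + y^2 is the assertion that 1 - y is a square root of 1 - x.\<close>

lemma cstar_sqrt_one_minus:
  fixes x :: "'a::unital_cstar_algebra"
  assumes x: "star x = x" "norm x \<le> 1"
  obtains y where "star y = y" "norm y \<le> 1" "(1 - y) * (1 - y) = 1 - x"
    "\<And>z. z * x = x * z \<Longrightarrow> z * y = y * z"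
proof -
  define Y where "Y = rec_nat (0::'a) (\<lambda>_ y. (1/2) *\<^sub>R (x + y * y))"
  have Y0: "Y 0 = 0" and YS: "Y (Suc n) = (1/2) *\<^sub>R (x + Y n * Y n)" for n
    by (simp_all add: Y_def)
  have nY: "norm (Y n) \<le> sqrt_iter n" for n
  proof (induction n)
    case (Suc n)
    have "norm (Y n * Y n) \<le> (sqrt_iter n)\<^sup>2"
      by (metis Suc mult_mono' norm_ge_zero norm_mult_ineq order_trans power2_eq_square)
    then have "norm (x + Y n * Y n) \<le> 1 + (sqrt_iter n)\<^sup>2"
      using x(2) norm_triangle_ineq[of x "Y n * Y n"] by linarith
    then show ?case by (simp add: YS)
  qed (simp add: Y0)
  have dY: "norm (Y (Suc n) - Y n) \<le> sqrt_iter (Suc n) - sqrt_iter n" for n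
  proof (induction n)
    case 0
    then show ?case using x(2) by (simp add: YS Y0)
  next
    case (Suc n)
    let ?a = "Y (Suc n)" and ?b = "Y n" and ?r = "sqrt_iter (Suc n)" and ?s = "sqrt_iter n"
    have rs: "?s \<le> ?r" "0 \<le> ?s" "0 \<le> ?r" using incseq_SucD[OF sqrt_iter_incseq, of n] sqrt_iter_bounds by (auto simp del: sqrt_iter.simps)
    have "Y (Suc (Suc n)) - Y (Suc n) = (1/2) *\<^sub>R (?a * ?a - ?b * ?b)"
      by (subst YS, subst YS[of n]) (simp add: scaleR_diff_right[symmetric] del: scaleR_diff_right add: algebra_simps YS)
    \<comment> \<open>A form of a^2 - b^2 that does not need commutativity; its two summands are
      matched by r (r - s) and (r - s) s in the dominating real iteration.\<close>
    also have "?a * ?a - ?b * ?b = ?a * (?a - ?b) + (?a - ?b) * ?b" by (simp add: algebra_simps)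
    also have "norm ((1/2) *\<^sub>R \<dots>) \<le> 1/2 * (?r * (?r - ?s) + (?r - ?s) * ?s)"
    proof -
      have "norm (?a * (?a - ?b)) \<le> ?r * (?r - ?s)"
        by (rule order_trans[OF norm_mult_ineq]) (intro mult_mono nY Suc, use rs in auto)
      moreover have "norm ((?a - ?b) * ?b) \<le> (?r - ?s) * ?s"
        by (rule order_trans[OF norm_mult_ineq]) (intro mult_mono nY Suc, use rs in auto)
      ultimately have "norm (?a * (?a - ?b) + (?a - ?b) * ?b) \<le> ?r * (?r - ?s) + (?r - ?s) * ?s"
        by (meson add_mono norm_triangle_le order_trans)
      then show ?thesis by simp
    qed
    also have "\<dots> = sqrt_iter (Suc (Suc n)) - sqrt_iter (Suc n)"
      by (simp add: power2_eq_square algebra_simps diff_divide_distrib add_divide_distrib)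
    finally show ?case .
  qed
  have le: "norm (Y n - Y m) \<le> \<bar>sqrt_iter n - sqrt_iter m\<bar>" for m n
  proof (cases "m \<le> n")
    case True
    then show ?thesis using telescope_norm_le[of Y sqrt_iter m n] dY by fastforce
  next
    case False
    then show ?thesis using telescope_norm_le[of Y sqrt_iter n m] dY by (smt (verit) nat_le_linear norm_minus_commute)
  qed
  have "Cauchy Y"
  proof (rule metric_CauchyI)
    fix e :: real assume "e > 0"
    then obtain M where "\<forall>m\<ge>M. \<forall>n\<ge>M. dist (sqrt_iter m) (sqrt_iter n) < e"
      using metric_CauchyD[OF sqrt_iter_Cauchy] by blast
    then show "\<exists>M. \<forall>m\<ge>M. \<forall>n\<ge>M. dist (Y m) (Y n) < e"
      by (auto simp: dist_norm intro!: exI[of _ M] le_less_trans[OF le])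
  qed
  then obtain y where y: "Y \<longlonglongrightarrow> y" using Cauchy_convergent convergent_def by blast
  have "(\<lambda>n. Y (Suc n)) \<longlonglongrightarrow> (1/2) *\<^sub>R (x + y * y)"
    unfolding YS by (intro tendsto_intros y)
  then have fixpt: "y = (1/2) *\<^sub>R (x + y * y)"
    using y LIMSEQ_Suc LIMSEQ_unique by blast
  have "star y = y"
  proof -
    have s: "star (Y n) = Y n" for n
      by (induction n) (auto simp: Y0 YS star_simps x)
    have "norm (star y - y) \<le> 2 * norm (Y n - y)" for n
    proof -
      have "star y - y = star (y - Y n) + (Y n - y)" by (simp add: star_diff s)
      then have "norm (star y - y) \<le> norm (y - Y n) + norm (Y n - y)"
        by (metis norm_star norm_triangle_ineq)
      then show ?thesis by (simp add: norm_minus_commute)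
    qed
    moreover have "(\<lambda>n. 2 * norm (Y n - y)) \<longlonglongrightarrow> 0"
      using tendsto_mult_right_zero[OF tendsto_norm_zero[OF LIM_zero[OF y]]] by simp
    ultimately have "norm (star y - y) \<le> 0"
      by (meson LIMSEQ_le_const)
    then show ?thesis by simp
  qed
  moreover have "norm y \<le> 1"
    using LIMSEQ_le_const2[OF tendsto_norm[OF y]] nY sqrt_iter_bounds by (meson order_trans)
  moreover have "(1 - y) * (1 - y) = 1 - x"
  proof -
    have "y + y = x + y * y" using arg_cong[OF fixpt, of "\<lambda>t. 2 *\<^sub>R t"] by (simp add: scaleR_2)
    then show ?thesis by (simp add: algebra_simps)
  qed
  moreover have "z * y = y * z" if z: "z * x = x * z" for z
  proof -
    have c: "z * Y n = Y n * z" for n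
    proof (induction n)
      case (Suc n)
      have "z * (Y n * Y n) = Y n * Y n * z" by (metis Suc mult.assoc)
      then show ?case by (simp add: YS distrib_left distrib_right z)
    qed (simp add: Y0)
    have "(\<lambda>n. z * Y n) \<longlonglongrightarrow> z * y" "(\<lambda>n. Y n * z) \<longlonglongrightarrow> y * z" by (intro tendsto_intros y)+
    then show ?thesis using c LIMSEQ_unique by simp
  qed
  ultimately show ?thesis using that by blast
qed

text \<open>Positivity as a norm condition: a selfadjoint element has spectrum in the interval from
  0 to 2t exactly if its distance from \<open>t *\<^sub>R 1\<close> is at most \<open>t\<close>. In
  this form sums and positive multiples of positive elements are positive before anything is known
  about \<open>star b * b\<close>.\<close>

definition cpos :: "'a::unital_cstar_algebra \<Rightarrow> bool" where
  "cpos a \<longleftrightarrow> star a = a \<and> (\<exists>t\<ge>0. norm (t *\<^sub>R 1 - a) \<le> t)"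

section \<open>Calculus of the positive cone, up to positivity of star b * b\<close>

context
  fixes dummy :: "'a::unital_cstar_algebra itself"
begin

lemma cposI: "star a = a \<Longrightarrow> norm (t *\<^sub>R 1 - a) \<le> t \<Longrightarrow> cpos (a::'a)"
  unfolding cpos_def using norm_ge_zero order_trans by blast

lemma cpos_star: "cpos (a::'a) \<Longrightarrow> star a = a"
  by (simp add: cpos_def)

lemma cpos_bound:
  assumes "norm (t *\<^sub>R 1 - (a::'a)) \<le> t" "t \<le> s"
  shows "norm (s *\<^sub>R 1 - a) \<le> s"
proof -
  have "s *\<^sub>R 1 - a = (s - t) *\<^sub>R 1 + (t *\<^sub>R 1 - a)" by (simp add: algebra_simps)
  then have "norm (s *\<^sub>R 1 - a) \<le> norm ((s - t) *\<^sub>R (1::'a)) + norm (t *\<^sub>R 1 - a)"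
    by (metis norm_triangle_ineq)
  also have "norm ((s - t) *\<^sub>R (1::'a)) \<le> s - t"
    using assms(2) norm_one_le[where 'a='a] mult_left_mono[of "norm (1::'a)" 1 "s - t"] by simp
  finally show ?thesis using assms(1) by simp
qed

lemma cpos_zero [simp]: "cpos (0::'a)"
  by (rule cposI[of _ 0]) auto

lemma cpos_add:
  assumes "cpos (a::'a)" "cpos b" shows "cpos (a + b)"
proof -
  obtain t s where t: "norm (t *\<^sub>R 1 - a) \<le> t" "norm (s *\<^sub>R 1 - b) \<le> s"
    using assms by (auto simp: cpos_def)
  have "norm ((t + s) *\<^sub>R 1 - (a + b)) \<le> norm (t *\<^sub>R 1 - a) + norm (s *\<^sub>R 1 - b)"
    by (rule order_trans[OF _ norm_triangle_ineq]) (simp add: algebra_simps)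
  then show ?thesis using assms t by (intro cposI[of _ "t + s"]) (auto simp: star_add cpos_star)
qed

lemma cpos_scaleR:
  assumes "cpos (a::'a)" "r \<ge> 0" shows "cpos (r *\<^sub>R a)"
proof -
  obtain t where t: "norm (t *\<^sub>R 1 - a) \<le> t" using assms by (auto simp: cpos_def)
  have "(r * t) *\<^sub>R 1 - r *\<^sub>R a = r *\<^sub>R (t *\<^sub>R 1 - a)" by (simp add: scaleR_diff_right)
  then have "norm ((r * t) *\<^sub>R 1 - r *\<^sub>R a) \<le> r * t" using t assms by (simp add: mult_left_mono)
  then show ?thesis using assms by (intro cposI[of _ "r * t"]) (auto simp: star_scaleR cpos_star)
qed

lemma cpos_norm_minus: "star (a::'a) = a \<Longrightarrow> cpos (norm a *\<^sub>R 1 - a)"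
  by (rule cposI[of _ "norm a"]) (auto simp: star_simps)

text \<open>The criterion says that a = t (1 - x) for the selfadjoint contraction x = 1 - a/t, so
  the root of 1 - x, multiplied by the root of \<open>t\<close>, is a root of \<open>a\<close>. For
  t = 0 the criterion forces a = 0.\<close>

lemma cpos_sqrt:
  assumes "cpos (a::'a)"
  obtains s where "star s = s" "s * s = a" "cpos s" "\<And>z. z * a = a * z \<Longrightarrow> z * s = s * z"
proof -
  obtain t where t: "t \<ge> 0" "norm (t *\<^sub>R 1 - a) \<le> t" and sa: "star a = a"
    using assms by (auto simp: cpos_def)
  show ?thesis
  proof (cases "t = 0")
    case True
    then have "a = 0" using t by simp
    then show ?thesis using that[of 0] by simp
  next
    case False
    then have tp: "t > 0" using t by simp
    define x where "x = 1 - (1 / t) *\<^sub>R a"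
    have "x = (1 / t) *\<^sub>R (t *\<^sub>R 1 - a)" using tp by (simp add: x_def scaleR_diff_right)
    then have "norm x \<le> 1" using t tp by (simp add: divide_simps)
    moreover have "star x = x" by (simp add: x_def star_simps sa)
    ultimately obtain y where y: "star y = y" "norm y \<le> 1" "(1 - y) * (1 - y) = 1 - x"
      "\<And>z. z * x = x * z \<Longrightarrow> z * y = y * z" using cstar_sqrt_one_minus by blast
    let ?s = "sqrt t *\<^sub>R (1 - y)"
    show ?thesis
    proof (rule that[of ?s])
      show "star ?s = ?s" by (simp add: star_simps y)
      show "?s * ?s = a" using y(3) tp by (simp add: x_def)
      show "cpos ?s" by (intro cpos_scaleR cposI[of _ 1]) (use y tp in \<open>auto simp: star_simps\<close>)
      show "z * ?s = ?s * z" if z: "z * a = a * z" for z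
      proof -
        have "z * x = x * z" by (simp add: x_def algebra_simps z)
        then show ?thesis using y(4)[of z] by (simp add: algebra_simps)
      qed
    qed
  qed
qed

text \<open>For selfadjoint \<open>h\<close> of norm at most \<open>1\<close>, \<open>h + i sqrt (1 - h\<^sup>2)\<close> is unitary.\<close>

lemma norm_one_minus_square:
  assumes h: "star (h::'a) = h" "norm h \<le> 1"
  shows "norm (1 - h * h) \<le> 1"
proof -
  have "norm (h * h) \<le> 1"
    using h(2) norm_mult_ineq[of h h] mult_le_one[of "norm h" "norm h"] by (meson norm_ge_zero order_trans)
  moreover have "star (h * h) = h * h" by (simp add: star_mult h)
  ultimately obtain y where y: "star y = y" "(1 - y) * (1 - y) = 1 - h * h"
      "\<And>z. z * (h * h) = (h * h) * z \<Longrightarrow> z * y = y * z" using cstar_sqrt_one_minus by metis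
  define s where "s = 1 - y"
  have s: "star s = s" "s * s = 1 - h * h" "h * s = s * h"
    using y(2) y(3)[of h] by (auto simp: s_def star_simps y(1) mult.assoc left_diff_distrib right_diff_distrib)
  define u where "u = h + \<i> *\<^sub>C s"
  have su: "star u = h - \<i> *\<^sub>C s" by (simp add: u_def star_simps h s)
  have "star u * u = h * h + h * (\<i> *\<^sub>C s) - (\<i> *\<^sub>C s) * h - (\<i> *\<^sub>C s) * (\<i> *\<^sub>C s)"
    unfolding su unfolding u_def by (simp add: algebra_simps)
  also have "\<dots> = 1" by (simp add: scaleC_mult_left scaleC_mult_right scaleC_scaleC s)
  finally have "(norm u)\<^sup>2 \<le> 1" using norm_one_le[where 'a='a] norm_star_mult_self[of u] by simp
  then have nu: "norm u \<le> 1" by (simp add: power_le_one_iff abs_le_square_iff[of _ 1, simplified])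
  have "u - star u = (2 * \<i>) *\<^sub>C s"
    unfolding su unfolding u_def using scaleC_add_left[of \<i> \<i> s] by simp
  \<comment> \<open>\<open>s\<close> is the imaginary part of the contraction \<open>u\<close>,
    hence a contraction itself.\<close>
  then have "2 * norm s = norm (u - star u)" by (simp add: norm_scaleC norm_mult)
  also have "\<dots> \<le> 2" using nu norm_triangle_ineq4[of u "star u"] by simp
  finally have "norm s \<le> 1" by simp
  then have "norm (s * s) \<le> 1"
    using norm_mult_ineq[of s s] mult_le_one[of "norm s" "norm s"] by (meson norm_ge_zero order_trans)
  then show ?thesis by (simp add: s)
qed

lemma norm_square_bound:
  assumes h: "star (h::'a) = h"
  shows "norm ((norm h)\<^sup>2 *\<^sub>R 1 - h * h) \<le> (norm h)\<^sup>2"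
proof (cases "h = 0")
  case False
  let ?k = "(1 / norm h) *\<^sub>R h"
  have "norm (1 - ?k * ?k) \<le> 1"
    using False by (intro norm_one_minus_square) (auto simp: star_scaleR h)
  moreover have "(norm h)\<^sup>2 *\<^sub>R 1 - h * h = (norm h)\<^sup>2 *\<^sub>R (1 - ?k * ?k)"
    using False by (simp add: scaleR_diff_right power2_eq_square)
  ultimately show ?thesis by (simp add: mult_left_le)
qed simp

lemma cpos_square: "star (h::'a) = h \<Longrightarrow> cpos (h * h)"
  by (rule cposI[of _ "(norm h)\<^sup>2"]) (auto simp: star_mult norm_square_bound)

text \<open>Removes the existential quantifier from \<open>cpos\<close>: for a = s^2 the bound for
  squares has the constant (norm s)^2 = norm a. This is what makes the cone closed.\<close>

lemma cpos_norm_bound: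
  assumes "cpos (a::'a)" shows "norm (norm a *\<^sub>R 1 - a) \<le> norm a"
proof -
  obtain s where s: "star s = s" "s * s = a" using cpos_sqrt[OF assms] by metis
  then have "(norm s)\<^sup>2 = norm a" using norm_star_mult_self[of s] by simp
  then show ?thesis using norm_square_bound[OF s(1)] s(2) by simp
qed

text \<open>Square roots s and r of commuting positive elements commute with each other, so the
  product is the square of the selfadjoint element s r.\<close>

lemma cpos_mult:
  assumes "cpos (a::'a)" "cpos b" "a * b = b * a"
  shows "cpos (a * b)"
proof -
  obtain s where s: "star s = s" "s * s = a" "\<And>z. z * a = a * z \<Longrightarrow> z * s = s * z"
    using cpos_sqrt[OF assms(1)] by metis
  obtain r where r: "star r = r" "r * r = b" "\<And>z. z * b = b * z \<Longrightarrow> z * r = r * z"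
    using cpos_sqrt[OF assms(2)] by metis
  have "b * s = s * b" using s(3)[of b] assms(3) by simp
  then have sr: "s * r = r * s" using r(3)[of s] by simp
  have "a * b = s * r * (s * r)" by (metis s(2) r(2) sr mult.assoc)
  moreover have "star (s * r) = s * r" by (simp add: star_mult s r sr)
  ultimately show ?thesis using cpos_square by metis
qed

text \<open>The product (l - q)(l + q) = l^2 - q^2 is positive with a root \<open>w\<close>
  commuting with \<open>q\<close>. Then u = q + i w satisfies u* u = l^2, so \<open>q\<close> is the
  real part of an element of norm at most \<open>l\<close>.\<close>

lemma norm_le_of_cpos_pos:
  assumes q: "cpos (l *\<^sub>R 1 - (q::'a))" "cpos (l *\<^sub>R 1 + q)" and l: "l > 0"
  shows "norm q \<le> l"
proof -
  have sq: "star q = q" using cpos_star[OF q(1)] by (simp add: star_simps)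
  have pos: "cpos ((l *\<^sub>R 1 - q) * (l *\<^sub>R 1 + q))"
    by (rule cpos_mult[OF q]) (simp add: algebra_simps)
  have eq: "(l *\<^sub>R 1 - q) * (l *\<^sub>R 1 + q) = (l * l) *\<^sub>R 1 - q * q" by (simp add: algebra_simps)
  obtain w where w: "star w = w" "w * w = (l * l) *\<^sub>R 1 - q * q"
      "\<And>z. z * ((l * l) *\<^sub>R 1 - q * q) = ((l * l) *\<^sub>R 1 - q * q) * z \<Longrightarrow> z * w = w * z"
    using cpos_sqrt[OF pos[unfolded eq]] by metis
  have qw: "q * w = w * q" by (rule w(3)) (simp add: algebra_simps)
  define u where "u = q + \<i> *\<^sub>C w"
  have su: "star u = q - \<i> *\<^sub>C w" by (simp add: u_def star_simps sq w)
  have "star u * u = q * q + q * (\<i> *\<^sub>C w) - (\<i> *\<^sub>C w) * q - (\<i> *\<^sub>C w) * (\<i> *\<^sub>C w)"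
    unfolding su unfolding u_def by (simp add: algebra_simps)
  also have "\<dots> = (l * l) *\<^sub>R 1" by (simp add: scaleC_mult_left scaleC_mult_right scaleC_scaleC w qw)
  finally have "(norm u)\<^sup>2 \<le> l\<^sup>2"
    using norm_star_mult_self[of u] mult_left_mono[OF norm_one_le[where 'a='a], of "l * l"] l
    by (simp add: power2_eq_square)
  then have nu: "norm u \<le> l" using l by (simp add: power2_le_iff_abs_le)
  have "2 *\<^sub>R q = u + star u" unfolding su by (simp add: u_def scaleR_2)
  then have "2 * norm q \<le> norm u + norm (star u)" by (metis norm_triangle_ineq norm_scaleR abs_numeral)
  then show ?thesis using nu by simp
qed

text \<open>Adding \<open>e *\<^sub>R 1\<close> to both inequalities reduces the case
  \<open>l = 0\<close> to the previous one.\<close>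

lemma norm_le_of_cpos:
  assumes q: "cpos (l *\<^sub>R 1 - (q::'a))" "cpos (l *\<^sub>R 1 + q)" and l: "l \<ge> 0"
  shows "norm q \<le> l"
proof (rule field_le_epsilon)
  fix e :: real assume "e > 0"
  have "cpos (e *\<^sub>R (1::'a))" using \<open>e > 0\<close> by (intro cposI[of _ e]) (auto simp: star_scaleR)
  from cpos_add[OF q(1) this] cpos_add[OF q(2) this]
  have "cpos ((l + e) *\<^sub>R 1 - q)" "cpos ((l + e) *\<^sub>R 1 + q)" by (simp_all add: algebra_simps)
  then show "norm q \<le> l + e" using l \<open>e > 0\<close> by (intro norm_le_of_cpos_pos) auto
qed

text \<open>For 0 \<le> a \<le> b the element \<open>a\<close> lies between minus and plus
  \<open>norm b\<close>.\<close>

lemma cpos_norm_mono: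
  assumes "cpos (a::'a)" "cpos (b - a)" shows "norm a \<le> norm b"
proof (rule norm_le_of_cpos)
  have sb: "star b = b" using cpos_star[OF assms(1)] cpos_star[OF assms(2)] by (simp add: star_diff)
  show "cpos (norm b *\<^sub>R 1 - a)" using cpos_add[OF cpos_norm_minus[OF sb] assms(2)] by simp
  have "cpos (norm b *\<^sub>R (1::'a))" by (intro cposI[of _ "norm b"]) (auto simp: star_scaleR)
  then show "cpos (norm b *\<^sub>R 1 + a)" using cpos_add assms(1) by blast
qed simp

text \<open>If \<open>c\<close> intertwines -g with q, it intertwines polynomials in them; only
  these powers are required below.\<close>

lemma star_intertwine_pow:
  assumes "(g::'a) * c = - (c * q)"
  shows "(1 - r *\<^sub>R g) ^ n * c = c * (1 + r *\<^sub>R q) ^ n"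
proof (induction n)
  case (Suc n)
  have "(1 - r *\<^sub>R g) ^ Suc n * c = (1 - r *\<^sub>R g) * (c * (1 + r *\<^sub>R q) ^ n)"
    by (simp add: Suc mult.assoc)
  also have "\<dots> = (1 - r *\<^sub>R g) * c * (1 + r *\<^sub>R q) ^ n" by (simp add: mult.assoc)
  also have "(1 - r *\<^sub>R g) * c = c * (1 + r *\<^sub>R q)" by (simp add: algebra_simps assms)
  finally show ?case by (simp add: mult.assoc)
qed simp

text \<open>Bernoulli's inequality in the order of the algebra. The commutation clause makes the
  product of the remainder \<open>w\<close> with another positive element commuting with
  \<open>r\<close> positive.\<close>

lemma cpos_bernoulli:
  assumes "cpos (r::'a)"
  shows "\<exists>w. (1 + r) ^ m = 1 + real m *\<^sub>R r + w \<and> cpos w \<and> (\<forall>z. z * r = r * z \<longrightarrow> z * w = w * z)"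
proof (induction m)
  case 0
  then show ?case by (intro exI[of _ 0]) auto
next
  case (Suc m)
  then obtain w where w: "(1 + r) ^ m = 1 + real m *\<^sub>R r + w" "cpos w"
    "\<And>z. z * r = r * z \<Longrightarrow> z * w = w * z" by blast
  have wr: "r * w = w * r" using w(3)[of r] by simp
  let ?w = "w + real m *\<^sub>R (r * r) + w * r"
  have "(1 + r) ^ Suc m = (1 + r) ^ m * (1 + r)" by (simp add: power_commutes)
  also have "\<dots> = 1 + real (Suc m) *\<^sub>R r + ?w" by (simp add: w algebra_simps)
  finally have 1: "(1 + r) ^ Suc m = 1 + real (Suc m) *\<^sub>R r + ?w" .
  have 2: "cpos ?w" using assms w wr by (intro cpos_add cpos_scaleR cpos_mult) auto
  have 3: "z * ?w = ?w * z" if z: "z * r = r * z" for z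
  proof -
    have "z * (r * r) = r * r * z" by (metis z mult.assoc)
    moreover have "z * (w * r) = w * r * z" by (metis w(3) z mult.assoc)
    ultimately show ?thesis by (simp add: distrib_left distrib_right w(3)[OF z])
  qed
  show ?case using 1 2 3 by blast
qed

lemma norm_pow_one_minus_le: "norm ((x::'a)) \<le> 1 \<Longrightarrow> norm (x ^ n) \<le> 1"
proof (induction n)
  case 0
  then show ?case using norm_one_le by simp
next
  case (Suc n)
  then show ?case
    using norm_mult_ineq[of x "x ^ n"] mult_le_one[of "norm x" "norm (x ^ n)"]
    unfolding power_Suc by (meson norm_ge_zero order_trans)
qed

text \<open>Takes the place of comparing the spectra of \<open>star c * c\<close> and
  \<open>c * star c\<close>. Both q = - \<open>star c * c\<close> and g = \<open>c * star c\<close>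
  are positive and g c = - c q, so powers of 1 - g/l times \<open>c\<close> equal \<open>c\<close>
  times powers of 1 + q/l. The former stay bounded because 1 - g/l is a contraction; the latter grow
  linearly by Bernoulli's inequality unless q^2 = 0.\<close>

lemma kelley_vaught_aux:
  assumes "cpos (- (star c * (c::'a)))"
  shows "star c * c = 0"
proof -
  define q where "q = - (star c * c)"
  define g where "g = c * star c"
  have q: "cpos q" using assms by (simp add: q_def)
  \<comment> \<open>\<open>x\<close> and \<open>y\<close> are the real and imaginary part of
    \<open>c\<close>; the identity c c* + c* c = 2 (x^2 + y^2) exhibits \<open>g\<close> as a sum of
    positive elements.\<close>
  define x where "x = (1/2) *\<^sub>R (c + star c)"
  define y where "y = (1/2) *\<^sub>R (\<i> *\<^sub>C (star c - c))"
  have sx: "star x = x" by (simp add: x_def star_simps add.commute)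
  have sy: "star y = y" by (simp add: y_def star_simps scaleC_diff_right)
  have "x * x = (1/4) *\<^sub>R (c * c + c * star c + star c * c + star c * star c)"
    by (simp add: x_def algebra_simps)
  moreover have "y * y = (1/4) *\<^sub>R (c * star c + star c * c - c * c - star c * star c)"
  proof -
    have "(\<i> *\<^sub>C (star c - c)) * (\<i> *\<^sub>C (star c - c)) = - ((star c - c) * (star c - c))"
      by (simp only: scaleC_mult_left scaleC_mult_right scaleC_scaleC) simp
    then show ?thesis by (simp add: y_def) (simp add: algebra_simps)
  qed
  ultimately have "x * x + y * y = (1/4) *\<^sub>R (2 *\<^sub>R (c * star c + star c * c))"
    by (simp only: scaleR_add_right[symmetric] scaleR_2) (simp add: algebra_simps)
  then have "2 *\<^sub>R (x * x + y * y) = c * star c + star c * c" by simp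
  then have "g = 2 *\<^sub>R (x * x + y * y) + q" by (simp add: g_def q_def)
  then have g: "cpos g" using q sx sy by (auto intro!: cpos_add cpos_scaleR cpos_square)
  have gc: "g * c = - (c * q)" by (simp add: g_def q_def mult.assoc)
  \<comment> \<open>At least \<open>norm g\<close>, and positive even if \<open>g\<close> vanishes,
    so that 1 - g/l is defined and is a contraction.\<close>
  define l where "l = norm g + 1"
  have l: "l > 0" "norm g \<le> l" by (auto simp: l_def add_nonneg_pos)
  define r where "r = (1 / l) *\<^sub>R q"
  have r: "cpos r" "star r = r" unfolding r_def using q l by (auto intro!: cpos_scaleR cpos_star)
  have "norm (l *\<^sub>R 1 - g) \<le> l" using cpos_bound[OF cpos_norm_bound[OF g] l(2)] .
  moreover have "1 - (1 / l) *\<^sub>R g = (1 / l) *\<^sub>R (l *\<^sub>R 1 - g)" using l by (simp add: scaleR_diff_right)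
  ultimately have ng: "norm (1 - (1 / l) *\<^sub>R g) \<le> 1" using l by (simp add: divide_simps)
  have bd: "real (2 * n) * norm (q * r) \<le> (norm c)\<^sup>2" for n
  proof -
    have eq: "(1 - (1 / l) *\<^sub>R g) ^ n * c = c * (1 + r) ^ n"
      unfolding r_def by (rule star_intertwine_pow[OF gc])
    have sp: "star ((1 + r) ^ n) = (1 + r) ^ n"
      by (induction n) (auto simp: star_simps r power_commutes)
    have "norm (c * (1 + r) ^ n) \<le> 1 * norm c"
      unfolding eq[symmetric] by (rule order_trans[OF norm_mult_ineq])
        (intro mult_right_mono norm_pow_one_minus_le ng norm_ge_zero)
    then have "(norm (c * (1 + r) ^ n))\<^sup>2 \<le> (norm c)\<^sup>2" by (simp add: power_mono)
    also have "(norm (c * (1 + r) ^ n))\<^sup>2 = norm (star (c * (1 + r) ^ n) * (c * (1 + r) ^ n))"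
      by (simp add: norm_star_mult_self)
    also have "star (c * (1 + r) ^ n) * (c * (1 + r) ^ n) = - ((1 + r) ^ n * q * (1 + r) ^ n)"
      by (simp add: star_mult sp q_def mult.assoc)
    also have "(1 + r) ^ n * q * (1 + r) ^ n = q * (1 + r) ^ (2 * n)"
    proof -
      have "(1 + r) ^ n * q = q * (1 + r) ^ n"
      proof (induction n)
        case (Suc n)
        have "(1 + r) * q = q * (1 + r)" by (simp add: r_def algebra_simps)
        then show ?case by (simp add: mult.assoc Suc) (simp add: mult.assoc[symmetric])
      qed simp
      then show ?thesis by (simp add: mult.assoc mult_2 power_add)
    qed
    finally have le: "norm (q * (1 + r) ^ (2 * n)) \<le> (norm c)\<^sup>2" by simp
    obtain w where w: "(1 + r) ^ (2 * n) = 1 + real (2 * n) *\<^sub>R r + w" "cpos w"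
      "\<And>z. z * r = r * z \<Longrightarrow> z * w = w * z" using cpos_bernoulli[OF r(1)] by blast
    have qr: "q * r = r * q" by (simp add: r_def)
    have 1: "cpos (real (2 * n) *\<^sub>R (q * r))" using q r qr by (intro cpos_scaleR cpos_mult) auto
    have "q * (1 + r) ^ (2 * n) - real (2 * n) *\<^sub>R (q * r) = q + q * w"
      unfolding w(1) by (simp add: algebra_simps)
    moreover have "cpos (q + q * w)" using q w(2) w(3)[OF qr] by (intro cpos_add cpos_mult)
    ultimately have "norm (real (2 * n) *\<^sub>R (q * r)) \<le> norm (q * (1 + r) ^ (2 * n))"
      using cpos_norm_mono[OF 1] by simp
    then show ?thesis using le by simp
  qed
  have "norm (q * r) = 0"
  proof (rule ccontr)
    assume "norm (q * r) \<noteq> 0"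
    then have p: "norm (q * r) > 0" by simp
    obtain n :: nat where "(norm c)\<^sup>2 < real n * norm (q * r)" using reals_Archimedean3[OF p] by blast
    also have "\<dots> \<le> real (2 * n) * norm (q * r)" by (simp add: mult_right_mono)
    finally show False using bd[of n] by simp
  qed
  then have "q * q = 0" using l by (simp add: r_def)
  then have "norm q = 0" using norm_star_mult_self[of q] cpos_star[OF q] by simp
  then show ?thesis by (simp add: q_def)
qed

text \<open>With \<open>f = \<bar>h\<bar> - h\<close> one has \<open>- f h f = (f \<bar>h\<bar>\<^sup>1\<^sup>/\<^sup>2)\<^sup>2\<close>, so the previous lemma applies to \<open>b f\<close>.\<close>

lemma cpos_star_mult_self: "cpos (star b * (b::'a))"
proof -
  define h where "h = star b * b"
  have sh: "star h = h" by (simp add: h_def star_simps)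
  obtain k where k: "star k = k" "k * k = h * h" "cpos k" "\<And>z. z * (h * h) = (h * h) * z \<Longrightarrow> z * k = k * z"
    using cpos_sqrt[OF cpos_square[OF sh]] by metis
  have hk: "h * k = k * h" by (rule k(4)) (simp add: mult.assoc)
  obtain s where s: "star s = s" "s * s = k" "\<And>z. z * k = k * z \<Longrightarrow> z * s = s * z"
    using cpos_sqrt[OF k(3)] by metis
  define f where "f = k - h"
  have sf: "star f = f" by (simp add: f_def star_simps k sh)
  have hf: "h * f = - (k * f)" by (simp add: f_def algebra_simps hk k(2))
  have fk: "f * k = k * f" by (simp add: f_def algebra_simps hk)
  have fs: "f * s = s * f" using s(3)[OF fk] .
  have "star (b * f) * (b * f) = f * (h * f)" by (simp add: star_mult sf h_def mult.assoc)
  also have "\<dots> = - (f * (s * (s * f)))" by (simp add: hf s(2)[symmetric] mult.assoc)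
  also have "\<dots> = - (star (f * s) * (f * s))" by (simp add: star_mult sf s fs) (metis fs mult.assoc)
  finally have eq: "star (b * f) * (b * f) = - (star (f * s) * (f * s))" .
  have sfs: "star (f * s) = f * s" by (simp add: star_mult sf s fs)
  have "cpos (- (star (b * f) * (b * f)))" using eq cpos_square[OF sfs] sfs by simp
  then have "star (f * s) * (f * s) = 0" using kelley_vaught_aux[of "b * f"] eq by simp
  then have "norm (f * s) = 0" using norm_star_mult_self[of "f * s"] by simp
  then have "f * k = 0" by (metis s(2) mult.assoc mult_zero_left norm_eq_zero)
  moreover have "f * f = (k - h) * f" by (simp add: f_def)
  ultimately have "f * f = 0" using hf fk by (simp add: left_diff_distrib)
  then have "norm f = 0" using norm_star_mult_self[of f] sf by simp
  then have "h = k" by (simp add: f_def)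
  then show ?thesis using k(3) by (simp add: h_def)
qed

lemma positive_element_iff_cpos: "positive_element (a::'a) \<longleftrightarrow> cpos a"
  unfolding positive_element_def by (metis cpos_star_mult_self cpos_sqrt)

text \<open>With the constant \<open>t = norm a\<close> both conditions in \<open>cpos\<close> are
  closed in \<open>a\<close>.\<close>

lemma closed_cpos: "closed {a::'a. cpos a}"
proof -
  have "{a::'a. cpos a} = {a. star a = a} \<inter> {a. norm (norm a *\<^sub>R 1 - a) \<le> norm a}"
    using cpos_norm_bound cpos_star by (auto intro: cposI)
  moreover have "closed {a::'a. norm (norm a *\<^sub>R 1 - a) \<le> norm a}"
    by (intro closed_Collect_le continuous_intros)
  moreover have "continuous_on UNIV (star :: 'a \<Rightarrow> 'a)"
  proof -
    have "bounded_linear (star :: 'a \<Rightarrow> 'a)"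
      by (rule bounded_linear_intro[where K=1]) (auto simp: star_simps)
    then show ?thesis by (simp add: linear_continuous_on)
  qed
  then have "closed {a::'a. star a = a}" by (intro closed_Collect_eq continuous_intros)
  ultimately show ?thesis by auto
qed

lemma bounded_linear_star: "bounded_linear (star :: 'a \<Rightarrow> 'a)"
  by (rule bounded_linear_intro[where K=1]) (auto simp: star_simps)

lemma bounded_linear_scaleC: "bounded_linear (\<lambda>a::'a. c *\<^sub>C a)"
proof (rule bounded_linear_intro[where K="cmod c"])
  fix r :: real and a :: 'a
  show "c *\<^sub>C (r *\<^sub>R a) = r *\<^sub>R (c *\<^sub>C a)"
    by (metis mult.commute scaleC_of_real scaleC_scaleC)
qed (auto simp: scaleC_add_right norm_scaleC mult.commute)

lemma bounded_linear_scaleC_left: "bounded_linear (\<lambda>c. c *\<^sub>C (a::'a))"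
proof (rule bounded_linear_intro[where K="norm a"])
  fix r :: real and c :: complex
  show "(r *\<^sub>R c) *\<^sub>C a = r *\<^sub>R (c *\<^sub>C a)"
    by (metis scaleC_of_real scaleC_scaleC scaleR_conv_of_real)
qed (auto simp: scaleC_add_left norm_scaleC)

lemma cpos_sum: "(\<And>i. i \<in> I \<Longrightarrow> cpos (f i :: 'a)) \<Longrightarrow> cpos (sum f I)"
  by (induction I rule: infinite_finite_induct) (auto intro: cpos_add)

lemma cpos_has_sum:
  assumes "(f has_sum s) I" "\<And>i. i \<in> I \<Longrightarrow> cpos (f i :: 'a)"
  shows "cpos s"
proof -
  have ev: "\<forall>\<^sub>F F in finite_subsets_at_top I. sum f F \<in> {a. cpos a}"
    using assms(2) by (auto intro!: eventually_finite_subsets_at_top_weakI cpos_sum)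
  have "s \<in> {a. cpos a}"
    by (rule Lim_in_closed_set[OF closed_cpos ev _ assms(1)[unfolded has_sum_def]]) simp
  then show ?thesis by simp
qed

lemma cpos_trans: "cpos (b - a) \<Longrightarrow> cpos (c - b) \<Longrightarrow> cpos (c - (a::'a))"
  using cpos_add[of "b - a" "c - b"] by simp

text \<open>Since the norm is monotone on positive elements, the tails of \<open>f\<close> are
  bounded by the tails of \<open>g\<close>. Absolute convergence would be too strong a requirement
  here; this comparison is the main tool for membership in the Fock module.\<close>

lemma cpos_summable_comparison:
  fixes f g :: "'i \<Rightarrow> 'a"
  assumes g: "g summable_on I" and f: "\<And>i. i \<in> I \<Longrightarrow> cpos (f i)" "\<And>i. i \<in> I \<Longrightarrow> cpos (g i - f i)"
  shows "f summable_on I"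
proof (rule summable_on_CauchyI)
  fix e :: real assume e: "e > 0"
  obtain K where K: "finite K" "K \<subseteq> I" "\<forall>J. finite J \<and> J \<subseteq> I - K \<longrightarrow> norm (sum g J) < e"
    using summable_on_tail[OF g e] by (elim exE conjE)
  have "norm (sum f J) < e" if J: "finite J \<and> J \<subseteq> I - K" for J
  proof -
    have "norm (sum f J) \<le> norm (sum g J)"
    proof (rule cpos_norm_mono)
      show "cpos (sum f J)" using J f by (intro cpos_sum) auto
      show "cpos (sum g J - sum f J)" unfolding sum_subtractf[symmetric] using J f by (intro cpos_sum) auto
    qed
    also have "\<dots> < e" using K(3) J by blast
    finally show ?thesis .
  qed
  then show "\<exists>K. finite K \<and> K \<subseteq> I \<and> (\<forall>J. finite J \<and> J \<subseteq> I - K \<longrightarrow> norm (sum f J) < e)" using K by blast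
qed

text \<open>Written with a factor \<open>b\<close> so that a left action by the difference turns
  into an inner product of a vector with itself.\<close>

lemma cpos_norm_square_minus:
  obtains b where "(norm (a::'a))\<^sup>2 *\<^sub>R 1 - star a * a = star b * b"
proof -
  have "star (star a * a) = star a * a" by (simp add: star_simps)
  from cpos_norm_minus[OF this] have "cpos ((norm a)\<^sup>2 *\<^sub>R 1 - star a * a)"
    by (simp add: norm_star_mult_self)
  then show ?thesis using that positive_element_iff_cpos unfolding positive_element_def by blast
qed

end

section \<open>Hilbert modules and their adjointable operators\<close>

text \<open>The expression is a positive functional at (x + c y)* (x + c y). The values at c = 1 and
  c = i give hermitian symmetry; c = - t \<open>cnj q\<close> leaves a real quadratic in
  \<open>t\<close>, minimal at t = 1 / \<open>Re s\<close>, which is the Cauchy-Schwarz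
  inequality.\<close>

lemma complex_quadratic_nonneg:
  fixes p q r s :: complex
  assumes nn: "\<And>c. p + c * q + cnj c * r + cnj c * c * s \<in> \<real>\<^sub>\<ge>\<^sub>0" and s: "s \<in> \<real>\<^sub>\<ge>\<^sub>0"
  shows "r = cnj q" "(cmod q)\<^sup>2 \<le> Re p * Re s"
proof -
  have p: "Re p \<ge> 0" "Im p = 0" using nn[of 0] by (auto simp: complex_nonneg_Reals_iff)
  have s': "Re s \<ge> 0" "Im s = 0" using s by (auto simp: complex_nonneg_Reals_iff)
  have 1: "Im q + Im r = 0" using nn[of 1] p s' by (auto simp: complex_nonneg_Reals_iff)
  have 2: "Re q = Re r" using nn[of \<i>] p s' by (auto simp: complex_nonneg_Reals_iff)
  show r: "r = cnj q" using 1 2 by (auto simp: complex_eq_iff)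
  have ge: "Re p - 2 * t * (cmod q)\<^sup>2 + t\<^sup>2 * (cmod q)\<^sup>2 * Re s \<ge> 0" for t :: real
  proof -
    let ?c = "- complex_of_real t * cnj q"
    have "p + ?c * q + cnj ?c * r + cnj ?c * ?c * s =
        p - complex_of_real (2 * t * (cmod q)\<^sup>2) + complex_of_real (t\<^sup>2 * (cmod q)\<^sup>2) * s"
      unfolding r of_real_mult complex_norm_square by (simp add: algebra_simps power2_eq_square)
    then have "p - complex_of_real (2 * t * (cmod q)\<^sup>2) + complex_of_real (t\<^sup>2 * (cmod q)\<^sup>2) * s \<in> \<real>\<^sub>\<ge>\<^sub>0"
      using nn[of ?c] by argo
    then have "Re (p - complex_of_real (2 * t * (cmod q)\<^sup>2) + complex_of_real (t\<^sup>2 * (cmod q)\<^sup>2) * s) \<ge> 0"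
      by (simp only: complex_nonneg_Reals_iff)
    then show ?thesis unfolding plus_complex.sel minus_complex.sel Re_complex_of_real
      by (simp add: Re_complex_of_real del: of_real_mult of_real_power)
  qed
  show "(cmod q)\<^sup>2 \<le> Re p * Re s"
  proof (cases "Re s = 0")
    case True
    have "(cmod q)\<^sup>2 = 0"
    proof (rule ccontr)
      assume "(cmod q)\<^sup>2 \<noteq> 0"
      \<comment> \<open>For \<open>Re s = 0\<close> the expression is affine in \<open>t\<close>,
        and this \<open>t\<close> gives it the value -1.\<close>
      then show False using ge[of "(Re p + 1) / (2 * (cmod q)\<^sup>2)"] True by (simp add: field_simps)
    qed
    then show ?thesis using True by simp
  next
    case False
    then have "Re s > 0" using s' by simp
    then show ?thesis using ge[of "1 / Re s"] by (simp add: field_simps power2_eq_square)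
  qed
qed

definition pos_functional :: "('a::unital_cstar_algebra \<Rightarrow> complex) \<Rightarrow> bool" where
  "pos_functional \<tau> \<longleftrightarrow> (\<forall>a b. \<tau> (a + b) = \<tau> a + \<tau> b) \<and> (\<forall>c a. \<tau> (c *\<^sub>C a) = c * \<tau> a) \<and>
     (\<forall>a. \<tau> (star a * a) \<in> \<real>\<^sub>\<ge>\<^sub>0)"

lemma tracial_pos_functional: "\<tau> \<in> tracial_states \<Longrightarrow> pos_functional \<tau>"
  by (auto simp: tracial_states_def pos_functional_def)

lemma pos_functional_simps:
  assumes "pos_functional \<tau>"
  shows "\<tau> (a + b) = \<tau> a + \<tau> b" "\<tau> (c *\<^sub>C a) = c * \<tau> a" "\<tau> 0 = 0" "\<tau> (- a) = - \<tau> a" "\<tau> (a - b) = \<tau> a - \<tau> b"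
    "\<tau> (r *\<^sub>R a) = of_real r * \<tau> a"
proof -
  show add: "\<tau> (a + b) = \<tau> a + \<tau> b" for a b using assms by (simp add: pos_functional_def)
  show sc: "\<tau> (c *\<^sub>C a) = c * \<tau> a" for c a using assms by (simp add: pos_functional_def)
  show "\<tau> 0 = 0" using sc[of 0 0] by simp
  show m: "\<tau> (- a) = - \<tau> a" for a using sc[of "-1" a] by simp
  show "\<tau> (a - b) = \<tau> a - \<tau> b" using add[of a "-b"] m by simp
  show "\<tau> (r *\<^sub>R a) = of_real r * \<tau> a" by (metis sc scaleC_of_real)
qed

lemma pos_functional_sum: "pos_functional \<tau> \<Longrightarrow> \<tau> (sum f I) = (\<Sum>i\<in>I. \<tau> (f i))"
  by (induction I rule: infinite_finite_induct) (auto simp: pos_functional_simps)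

lemma pos_functional_cpos: "pos_functional \<tau> \<Longrightarrow> cpos a \<Longrightarrow> \<tau> a \<in> \<real>\<^sub>\<ge>\<^sub>0"
  using positive_element_iff_cpos[of a] unfolding positive_element_def by (auto simp: pos_functional_def)

lemma is_adjoint_maps: "is_adjoint Y T S \<Longrightarrow> T \<in> maps Y" "is_adjoint Y T S \<Longrightarrow> S \<in> maps Y"
  by (auto simp: is_adjoint_def)

lemma maps_eqI: "T \<in> maps Y \<Longrightarrow> S \<in> maps Y \<Longrightarrow> (\<And>\<xi>. \<xi> \<in> carrier Y \<Longrightarrow> T \<xi> = S \<xi>) \<Longrightarrow> T = S"
  unfolding maps_def by (auto simp: fun_eq_iff) metis

lemma maps_closed: "T \<in> maps Y \<Longrightarrow> \<xi> \<in> carrier Y \<Longrightarrow> T \<xi> \<in> carrier Y"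
  by (auto simp: maps_def)

lemma restr_apply [simp]: "\<xi> \<in> carrier Y \<Longrightarrow> restr Y f \<xi> = f \<xi>"
  by (simp add: restr_def)

lemma restr_maps: "(\<And>\<xi>. \<xi> \<in> carrier Y \<Longrightarrow> f \<xi> \<in> carrier Y) \<Longrightarrow> restr Y f \<in> maps Y"
  by (auto simp: restr_def maps_def)

lemma id_op_apply [simp]: "\<xi> \<in> carrier Y \<Longrightarrow> id_op Y \<xi> = \<xi>"
  by (simp add: id_op_def)

lemma id_op_maps: "id_op Y \<in> maps Y"
  unfolding id_op_def by (rule restr_maps)

section \<open>Inner products and the Cauchy-Schwarz inequality\<close>

context hilbert_module
begin

lemma uminus_closed: "\<xi> \<in> carrier Y \<Longrightarrow> - \<xi> \<in> carrier Y"
  using scaleC_closed[of \<xi> "-1"] by simp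

lemma diff_closed: "\<xi> \<in> carrier Y \<Longrightarrow> \<eta> \<in> carrier Y \<Longrightarrow> \<xi> - \<eta> \<in> carrier Y"
  using add_closed[of \<xi> "-\<eta>"] uminus_closed by simp

lemma scaleR_closed: "\<xi> \<in> carrier Y \<Longrightarrow> r *\<^sub>R \<xi> \<in> carrier Y"
  using scaleC_closed[of \<xi> "of_real r"] by (simp add: scaleC_of_real)

lemma sum_closed: "(\<And>i. i \<in> I \<Longrightarrow> f i \<in> carrier Y) \<Longrightarrow> sum f I \<in> carrier Y"
  by (induction I rule: infinite_finite_induct) (auto simp: zero_closed add_closed)

lemmas closed_simps = zero_closed add_closed scaleC_closed ract_closed uminus_closed diff_closed scaleR_closed

lemma ip_zero_right [simp]: "\<xi> \<in> carrier Y \<Longrightarrow> ip Y \<xi> 0 = 0"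
  using ip_scaleC_right[of \<xi> 0 0] zero_closed by simp

lemma ip_uminus_right: "\<xi> \<in> carrier Y \<Longrightarrow> \<eta> \<in> carrier Y \<Longrightarrow> ip Y \<xi> (- \<eta>) = - ip Y \<xi> \<eta>"
  using ip_scaleC_right[of \<xi> \<eta> "-1"] by simp

lemma ip_diff_right: "\<xi> \<in> carrier Y \<Longrightarrow> \<eta> \<in> carrier Y \<Longrightarrow> \<zeta> \<in> carrier Y \<Longrightarrow> ip Y \<xi> (\<eta> - \<zeta>) = ip Y \<xi> \<eta> - ip Y \<xi> \<zeta>"
  using ip_add_right[of \<xi> \<eta> "-\<zeta>"] by (simp add: uminus_closed ip_uminus_right)

lemma ip_scaleR_right: "\<xi> \<in> carrier Y \<Longrightarrow> \<eta> \<in> carrier Y \<Longrightarrow> ip Y \<xi> (r *\<^sub>R \<eta>) = r *\<^sub>R ip Y \<xi> \<eta>"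
  using ip_scaleC_right[of \<xi> \<eta> "of_real r"] by (simp add: scaleC_of_real)

lemma ip_sum_right: "\<xi> \<in> carrier Y \<Longrightarrow> (\<And>i. i \<in> I \<Longrightarrow> f i \<in> carrier Y) \<Longrightarrow> ip Y \<xi> (sum f I) = (\<Sum>i\<in>I. ip Y \<xi> (f i))"
  by (induction I rule: infinite_finite_induct) (auto simp: ip_add_right sum_closed)

lemma ip_add_left: "\<xi> \<in> carrier Y \<Longrightarrow> \<eta> \<in> carrier Y \<Longrightarrow> \<zeta> \<in> carrier Y \<Longrightarrow> ip Y (\<eta> + \<zeta>) \<xi> = ip Y \<eta> \<xi> + ip Y \<zeta> \<xi>"
  using ip_star[of \<xi> "\<eta> + \<zeta>"] by (simp add: add_closed ip_add_right star_add ip_star)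

lemma ip_scaleC_left: "\<xi> \<in> carrier Y \<Longrightarrow> \<eta> \<in> carrier Y \<Longrightarrow> ip Y (c *\<^sub>C \<xi>) \<eta> = cnj c *\<^sub>C ip Y \<xi> \<eta>"
  using ip_star[of \<eta> "c *\<^sub>C \<xi>"] by (simp add: scaleC_closed ip_scaleC_right star_scaleC ip_star)

lemma ip_scaleR_left: "\<xi> \<in> carrier Y \<Longrightarrow> \<eta> \<in> carrier Y \<Longrightarrow> ip Y (r *\<^sub>R \<xi>) \<eta> = r *\<^sub>R ip Y \<xi> \<eta>"
  using ip_star[of \<eta> "r *\<^sub>R \<xi>"] by (simp add: scaleR_closed ip_scaleR_right star_scaleR ip_star)

lemma ip_uminus_left: "\<xi> \<in> carrier Y \<Longrightarrow> \<eta> \<in> carrier Y \<Longrightarrow> ip Y (- \<xi>) \<eta> = - ip Y \<xi> \<eta>"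
  using ip_star[of \<eta> "- \<xi>"] by (simp add: uminus_closed ip_uminus_right star_uminus ip_star)

lemma ip_diff_left: "\<xi> \<in> carrier Y \<Longrightarrow> \<eta> \<in> carrier Y \<Longrightarrow> \<zeta> \<in> carrier Y \<Longrightarrow> ip Y (\<eta> - \<zeta>) \<xi> = ip Y \<eta> \<xi> - ip Y \<zeta> \<xi>"
  using ip_star[of \<xi> "\<eta> - \<zeta>"] by (simp add: diff_closed ip_diff_right star_diff ip_star)

lemma ip_zero_left [simp]: "\<xi> \<in> carrier Y \<Longrightarrow> ip Y 0 \<xi> = 0"
  using ip_star[of \<xi> 0] by (simp add: zero_closed)

lemma ip_sum_left: "\<xi> \<in> carrier Y \<Longrightarrow> (\<And>i. i \<in> I \<Longrightarrow> f i \<in> carrier Y) \<Longrightarrow> ip Y (sum f I) \<xi> = (\<Sum>i\<in>I. ip Y (f i) \<xi>)"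
  by (induction I rule: infinite_finite_induct) (auto simp: ip_add_left sum_closed)

lemma ip_ract_left: "\<xi> \<in> carrier Y \<Longrightarrow> \<eta> \<in> carrier Y \<Longrightarrow> ip Y (ract Y \<xi> a) \<eta> = star a * ip Y \<xi> \<eta>"
  using ip_star[of \<eta> "ract Y \<xi> a"] by (simp add: ract_closed ip_ract star_mult ip_star)

lemmas ip_simps = ip_add_right ip_add_left ip_diff_right ip_diff_left ip_scaleC_right ip_scaleC_left
  ip_scaleR_right ip_scaleR_left ip_ract ip_ract_left ip_uminus_left ip_uminus_right

lemma ip_eqI:
  assumes "\<xi> \<in> carrier Y" "\<eta> \<in> carrier Y" "\<And>\<zeta>. \<zeta> \<in> carrier Y \<Longrightarrow> ip Y \<zeta> \<xi> = ip Y \<zeta> \<eta>"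
  shows "\<xi> = \<eta>"
proof -
  have "ip Y (\<xi> - \<eta>) (\<xi> - \<eta>) = 0" using assms by (simp add: ip_diff_right diff_closed)
  then show ?thesis using ip_definite[of "\<xi> - \<eta>"] assms by (simp add: diff_closed)
qed

lemma cpos_ip: "\<xi> \<in> carrier Y \<Longrightarrow> cpos (ip Y \<xi> \<xi>)"
  using ip_positive positive_element_iff_cpos by blast

text \<open>Expand the inner product of z = \<xi> a - N \<eta> with itself, where a is the inner
  product of \<xi> and \<eta>, and N the norm of that of \<xi> with itself. The bound of the
  quadratic term by N a* a leaves N a* a \<le> N^2 times the inner product of \<eta> with itself,
  and norms are monotone.\<close>

lemma ip_CS_square:
  assumes x: "\<xi> \<in> carrier Y" and y: "\<eta> \<in> carrier Y"
  shows "(norm (ip Y \<xi> \<eta>))\<^sup>2 \<le> norm (ip Y \<xi> \<xi>) * norm (ip Y \<eta> \<eta>)"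
proof (cases "ip Y \<xi> \<xi> = 0")
  case True
  then have "\<xi> = 0" using ip_definite x by blast
  then show ?thesis using y by simp
next
  case False
  define N where "N = norm (ip Y \<xi> \<xi>)"
  have N: "N > 0" using False by (simp add: N_def)
  define a where "a = ip Y \<xi> \<eta>"
  have sa: "ip Y \<eta> \<xi> = star a" using ip_star x y by (simp add: a_def)
  have c1: "cpos (N *\<^sub>R (star a * a) - star a * ip Y \<xi> \<xi> * a)"
  proof -
    have "positive_element (N *\<^sub>R 1 - ip Y \<xi> \<xi>)"
      unfolding positive_element_iff_cpos N_def by (rule cpos_norm_minus) (simp add: ip_star x)
    then obtain b where b: "N *\<^sub>R 1 - ip Y \<xi> \<xi> = star b * b" unfolding positive_element_def by blast
    have "N *\<^sub>R (star a * a) - star a * ip Y \<xi> \<xi> * a = star a * (N *\<^sub>R 1 - ip Y \<xi> \<xi>) * a"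
      by (simp add: algebra_simps)
    also have "\<dots> = star (b * a) * (b * a)" by (simp add: b star_mult mult.assoc)
    finally show ?thesis using cpos_star_mult_self by metis
  qed
  let ?z = "ract Y \<xi> a - N *\<^sub>R \<eta>"
  have zz: "ip Y ?z ?z = star a * ip Y \<xi> \<xi> * a - N *\<^sub>R (star a * a) - N *\<^sub>R (star a * a) + (N * N) *\<^sub>R ip Y \<eta> \<eta>"
    using x y by (simp add: ip_simps closed_simps sa a_def[symmetric] algebra_simps)
  have c2: "cpos (ip Y ?z ?z)" using x y by (intro cpos_ip closed_simps)
  have "cpos ((N * N) *\<^sub>R ip Y \<eta> \<eta> - N *\<^sub>R (star a * a))"
    using cpos_add[OF c1 c2] by (simp add: zz)
  from cpos_norm_mono[OF _ this] have "norm (N *\<^sub>R (star a * a)) \<le> norm ((N * N) *\<^sub>R ip Y \<eta> \<eta>)"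
    using N by (simp add: cpos_scaleR cpos_star_mult_self)
  then show ?thesis using N by (simp add: norm_star_mult_self a_def N_def[symmetric])
qed

lemma mnorm_nonneg: "mnorm Y \<xi> \<ge> 0"
  by (simp add: mnorm_def)

lemma mnorm_square: "(mnorm Y \<xi>)\<^sup>2 = norm (ip Y \<xi> \<xi>)"
  by (simp add: mnorm_def)

lemma ip_CS: "\<xi> \<in> carrier Y \<Longrightarrow> \<eta> \<in> carrier Y \<Longrightarrow> norm (ip Y \<xi> \<eta>) \<le> mnorm Y \<xi> * mnorm Y \<eta>"
  unfolding mnorm_def real_sqrt_mult[symmetric] by (rule real_le_rsqrt) (rule ip_CS_square)

lemma mnorm_triangle:
  assumes "\<xi> \<in> carrier Y" "\<eta> \<in> carrier Y"
  shows "mnorm Y (\<xi> + \<eta>) \<le> mnorm Y \<xi> + mnorm Y \<eta>"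
proof (rule power2_le_imp_le)
  have "(mnorm Y (\<xi> + \<eta>))\<^sup>2 = norm (ip Y \<xi> \<xi> + ip Y \<xi> \<eta> + (ip Y \<eta> \<xi> + ip Y \<eta> \<eta>))"
    using assms by (simp add: mnorm_square ip_simps closed_simps algebra_simps)
  also have "\<dots> \<le> norm (ip Y \<xi> \<xi>) + norm (ip Y \<xi> \<eta>) + (norm (ip Y \<eta> \<xi>) + norm (ip Y \<eta> \<eta>))"
    by (meson add_mono norm_triangle_ineq order_trans)
  also have "\<dots> \<le> (mnorm Y \<xi>)\<^sup>2 + mnorm Y \<xi> * mnorm Y \<eta> + (mnorm Y \<eta> * mnorm Y \<xi> + (mnorm Y \<eta>)\<^sup>2)"
    unfolding mnorm_square using ip_CS assms by (intro add_mono) auto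
  finally show "(mnorm Y (\<xi> + \<eta>))\<^sup>2 \<le> (mnorm Y \<xi> + mnorm Y \<eta>)\<^sup>2"
    by (simp add: power2_eq_square algebra_simps)
qed (simp add: mnorm_nonneg)

lemma mnorm_scaleC: "\<xi> \<in> carrier Y \<Longrightarrow> mnorm Y (c *\<^sub>C \<xi>) = cmod c * mnorm Y \<xi>"
  by (simp add: mnorm_def ip_simps closed_simps norm_scaleC real_sqrt_mult)

lemma mnorm_scaleR: "\<xi> \<in> carrier Y \<Longrightarrow> mnorm Y (r *\<^sub>R \<xi>) = \<bar>r\<bar> * mnorm Y \<xi>"
  using mnorm_scaleC[of \<xi> "of_real r"] by (simp add: scaleC_of_real)

lemma mnorm_uminus: "\<xi> \<in> carrier Y \<Longrightarrow> mnorm Y (- \<xi>) = mnorm Y \<xi>"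
  using mnorm_scaleC[of \<xi> "-1"] by simp

lemma mnorm_minus_commute: "\<xi> \<in> carrier Y \<Longrightarrow> \<eta> \<in> carrier Y \<Longrightarrow> mnorm Y (\<xi> - \<eta>) = mnorm Y (\<eta> - \<xi>)"
  using mnorm_uminus[of "\<xi> - \<eta>"] by (simp add: diff_closed)

lemma mnorm_triangle_diff:
  assumes "\<xi> \<in> carrier Y" "\<eta> \<in> carrier Y" "\<zeta> \<in> carrier Y"
  shows "mnorm Y (\<xi> - \<zeta>) \<le> mnorm Y (\<xi> - \<eta>) + mnorm Y (\<eta> - \<zeta>)"
  using mnorm_triangle[of "\<xi> - \<eta>" "\<eta> - \<zeta>"] assms by (simp add: diff_closed)

lemma mnorm_zero [simp]: "mnorm Y 0 = 0"
  by (simp add: mnorm_def zero_closed)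

lemma mnorm_eq_0: "\<xi> \<in> carrier Y \<Longrightarrow> mnorm Y \<xi> = 0 \<longleftrightarrow> \<xi> = 0"
  using ip_definite by (auto simp: mnorm_def zero_closed)

section \<open>The algebra of adjointable operators\<close>

lemma is_adjoint_sym: "is_adjoint Y T S \<Longrightarrow> is_adjoint Y S T"
  unfolding is_adjoint_def by (metis ip_star maps_closed)

lemma is_adjoint_unique: "is_adjoint Y T S \<Longrightarrow> is_adjoint Y T S' \<Longrightarrow> S = S'"
  unfolding is_adjoint_def by (metis ip_eqI maps_closed maps_eqI)

lemma adj_eq: "is_adjoint Y T S \<Longrightarrow> adj Y T = S"
  unfolding adj_def using is_adjoint_unique by blast

lemma adj_is_adjoint: "T \<in> \<L> Y \<Longrightarrow> is_adjoint Y T (adj Y T)"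
  unfolding adjointables_def using adj_eq by auto

lemma adjointablesI: "is_adjoint Y T S \<Longrightarrow> T \<in> \<L> Y"
  by (auto simp: adjointables_def)

lemma adj_closed: "T \<in> \<L> Y \<Longrightarrow> adj Y T \<in> \<L> Y"
  using adj_is_adjoint is_adjoint_sym adjointablesI by blast

lemma adj_adj: "T \<in> \<L> Y \<Longrightarrow> adj Y (adj Y T) = T"
  using adj_is_adjoint is_adjoint_sym adj_eq by blast

lemma adj_ip: "T \<in> \<L> Y \<Longrightarrow> \<xi> \<in> carrier Y \<Longrightarrow> \<eta> \<in> carrier Y \<Longrightarrow> ip Y \<xi> (adj Y T \<eta>) = ip Y (T \<xi>) \<eta>"
  using adj_is_adjoint unfolding is_adjoint_def by metis

lemma adj_ip_left: "T \<in> \<L> Y \<Longrightarrow> \<xi> \<in> carrier Y \<Longrightarrow> \<eta> \<in> carrier Y \<Longrightarrow> ip Y (adj Y T \<xi>) \<eta> = ip Y \<xi> (T \<eta>)"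
  using adj_ip[of "adj Y T"] adj_closed adj_adj by metis

lemma L_maps: "T \<in> \<L> Y \<Longrightarrow> T \<in> maps Y"
  using adj_is_adjoint is_adjoint_maps by blast

lemma L_closed: "T \<in> \<L> Y \<Longrightarrow> \<xi> \<in> carrier Y \<Longrightarrow> T \<xi> \<in> carrier Y"
  using L_maps maps_closed by blast

lemma L_eqI: "T \<in> \<L> Y \<Longrightarrow> S \<in> \<L> Y \<Longrightarrow> (\<And>\<xi>. \<xi> \<in> carrier Y \<Longrightarrow> T \<xi> = S \<xi>) \<Longrightarrow> T = S"
  using L_maps maps_eqI by blast

text \<open>Linearity is not part of the definition of \<open>adjointables\<close>; it follows by
  moving the operator to the other side of the inner product.\<close>

lemma L_add: "T \<in> \<L> Y \<Longrightarrow> \<xi> \<in> carrier Y \<Longrightarrow> \<eta> \<in> carrier Y \<Longrightarrow> T (\<xi> + \<eta>) = T \<xi> + T \<eta>"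
  by (rule ip_eqI) (auto simp: L_closed closed_simps ip_simps adj_ip_left[symmetric] adj_closed)

lemma L_scaleC: "T \<in> \<L> Y \<Longrightarrow> \<xi> \<in> carrier Y \<Longrightarrow> T (c *\<^sub>C \<xi>) = c *\<^sub>C T \<xi>"
  by (rule ip_eqI) (auto simp: L_closed closed_simps ip_simps adj_ip_left[symmetric] adj_closed)

lemma L_zero [simp]: "T \<in> \<L> Y \<Longrightarrow> T 0 = 0"
  using L_scaleC[of T 0 0] zero_closed by simp

lemma L_diff: "T \<in> \<L> Y \<Longrightarrow> \<xi> \<in> carrier Y \<Longrightarrow> \<eta> \<in> carrier Y \<Longrightarrow> T (\<xi> - \<eta>) = T \<xi> - T \<eta>"
  by (rule ip_eqI) (auto simp: L_closed closed_simps ip_simps adj_ip_left[symmetric] adj_closed)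

lemma L_scaleR: "T \<in> \<L> Y \<Longrightarrow> \<xi> \<in> carrier Y \<Longrightarrow> T (r *\<^sub>R \<xi>) = r *\<^sub>R T \<xi>"
  by (rule ip_eqI) (auto simp: L_closed closed_simps ip_simps adj_ip_left[symmetric] adj_closed)

lemma L_sum: "T \<in> \<L> Y \<Longrightarrow> (\<And>i. i \<in> I \<Longrightarrow> f i \<in> carrier Y) \<Longrightarrow> T (sum f I) = (\<Sum>i\<in>I. T (f i))"
  by (induction I rule: infinite_finite_induct) (auto simp: L_add sum_closed)

lemma is_adjoint_zero: "is_adjoint Y 0 0"
  by (auto simp: is_adjoint_def maps_def zero_closed)

lemma is_adjoint_id: "is_adjoint Y (id_op Y) (id_op Y)"
  by (auto simp: is_adjoint_def id_op_maps)

lemma is_adjoint_add: "is_adjoint Y T T' \<Longrightarrow> is_adjoint Y S S' \<Longrightarrow> is_adjoint Y (T + S) (T' + S')"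
  unfolding is_adjoint_def maps_def by (auto simp: closed_simps ip_simps)

lemma is_adjoint_diff: "is_adjoint Y T T' \<Longrightarrow> is_adjoint Y S S' \<Longrightarrow> is_adjoint Y (T - S) (T' - S')"
  unfolding is_adjoint_def maps_def by (auto simp: closed_simps ip_simps)

lemma is_adjoint_scaleC: "is_adjoint Y T T' \<Longrightarrow> is_adjoint Y (c *\<^sub>C T) (cnj c *\<^sub>C T')"
  unfolding is_adjoint_def maps_def by (auto simp: closed_simps ip_simps scaleC_fun_def)

lemma is_adjoint_comp: "is_adjoint Y T T' \<Longrightarrow> is_adjoint Y S S' \<Longrightarrow> is_adjoint Y (T \<circ> S) (S' \<circ> T')"
proof -
  assume T: "is_adjoint Y T T'" and S: "is_adjoint Y S S'"
  have "T 0 = 0" "S' 0 = 0" using T S is_adjoint_sym adjointablesI L_zero by blast+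
  then show ?thesis using T S unfolding is_adjoint_def maps_def by auto
qed

lemma L_zero_op: "0 \<in> \<L> Y" and L_id_op: "id_op Y \<in> \<L> Y"
  using is_adjoint_zero is_adjoint_id adjointablesI by blast+

lemma L_plus: "T \<in> \<L> Y \<Longrightarrow> S \<in> \<L> Y \<Longrightarrow> T + S \<in> \<L> Y"
  using adj_is_adjoint is_adjoint_add adjointablesI by blast

lemma L_minus: "T \<in> \<L> Y \<Longrightarrow> S \<in> \<L> Y \<Longrightarrow> T - S \<in> \<L> Y"
  using adj_is_adjoint is_adjoint_diff adjointablesI by blast

lemma L_comp: "T \<in> \<L> Y \<Longrightarrow> S \<in> \<L> Y \<Longrightarrow> T \<circ> S \<in> \<L> Y"
  using adj_is_adjoint is_adjoint_comp adjointablesI by blast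

lemma L_scale: "T \<in> \<L> Y \<Longrightarrow> c *\<^sub>C T \<in> \<L> Y"
  using adj_is_adjoint is_adjoint_scaleC adjointablesI by blast

lemma L_sum_op: "(\<And>i. i \<in> I \<Longrightarrow> f i \<in> \<L> Y) \<Longrightarrow> sum f I \<in> \<L> Y"
  by (induction I rule: infinite_finite_induct) (auto simp: L_zero_op L_plus)

lemmas L_simps = L_zero_op L_id_op L_plus L_minus L_comp L_scale adj_closed

lemma adj_plus: "T \<in> \<L> Y \<Longrightarrow> S \<in> \<L> Y \<Longrightarrow> adj Y (T + S) = adj Y T + adj Y S"
  and adj_minus: "T \<in> \<L> Y \<Longrightarrow> S \<in> \<L> Y \<Longrightarrow> adj Y (T - S) = adj Y T - adj Y S"
  and adj_comp: "T \<in> \<L> Y \<Longrightarrow> S \<in> \<L> Y \<Longrightarrow> adj Y (T \<circ> S) = adj Y S \<circ> adj Y T"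
  and adj_scaleC: "T \<in> \<L> Y \<Longrightarrow> adj Y (c *\<^sub>C T) = cnj c *\<^sub>C adj Y T"
  using adj_is_adjoint is_adjoint_add is_adjoint_diff is_adjoint_comp is_adjoint_scaleC adj_eq by meson+

lemma adj_id: "adj Y (id_op Y) = id_op Y" and adj_zero: "adj Y 0 = 0"
  using is_adjoint_id is_adjoint_zero adj_eq by blast+

lemmas adj_simps = adj_plus adj_minus adj_comp adj_scaleC adj_id adj_zero adj_adj

lemma comp_id_left: "T \<in> \<L> Y \<Longrightarrow> id_op Y \<circ> T = T"
  by (rule L_eqI) (auto simp: L_simps L_closed)

lemma comp_id_right: "T \<in> \<L> Y \<Longrightarrow> T \<circ> id_op Y = T"
  by (rule L_eqI) (auto simp: L_simps L_closed)

lemma comp_plus_right: "T \<in> \<L> Y \<Longrightarrow> S \<in> \<L> Y \<Longrightarrow> R \<in> \<L> Y \<Longrightarrow> T \<circ> (S + R) = (T \<circ> S) + (T \<circ> R)"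
  by (rule L_eqI) (auto simp: L_simps L_closed L_add)

lemma comp_minus_right: "T \<in> \<L> Y \<Longrightarrow> S \<in> \<L> Y \<Longrightarrow> R \<in> \<L> Y \<Longrightarrow> T \<circ> (S - R) = (T \<circ> S) - (T \<circ> R)"
  by (rule L_eqI) (auto simp: L_simps L_closed L_diff)

lemma comp_plus_left: "(S + R) \<circ> T = (S \<circ> T) + (R \<circ> (T :: 'x \<Rightarrow> 'x))"
  by (auto simp: fun_eq_iff)

lemma comp_minus_left: "(S - R) \<circ> T = (S \<circ> T) - (R \<circ> (T :: 'x \<Rightarrow> 'x))"
  by (auto simp: fun_eq_iff)

lemma comp_scale_left: "(c *\<^sub>C S) \<circ> T = c *\<^sub>C (S \<circ> (T :: 'x \<Rightarrow> 'x))"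
  by (auto simp: fun_eq_iff scaleC_fun_def)

lemma comp_scale_right: "T \<in> \<L> Y \<Longrightarrow> S \<in> \<L> Y \<Longrightarrow> T \<circ> (c *\<^sub>C S) = c *\<^sub>C (T \<circ> S)"
  by (rule L_eqI) (auto simp: L_simps L_closed L_scaleC, auto simp: scaleC_fun_def L_scaleC L_closed)

lemma comp_zero_right [simp]: "T \<in> \<L> Y \<Longrightarrow> T \<circ> 0 = 0"
  by (auto simp: fun_eq_iff)

lemma comp_zero_left [simp]: "0 \<circ> T = (0 :: 'x \<Rightarrow> 'x)"
  by (auto simp: fun_eq_iff)

lemma comp_sum_left: "sum f I \<circ> T = (\<Sum>i\<in>I. f i \<circ> (T :: 'x \<Rightarrow> 'x))"
  by (induction I rule: infinite_finite_induct) (auto simp: fun_eq_iff)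

lemma comp_sum_right: "T \<in> \<L> Y \<Longrightarrow> (\<And>i. i \<in> I \<Longrightarrow> f i \<in> \<L> Y) \<Longrightarrow> T \<circ> sum f I = (\<Sum>i\<in>I. T \<circ> f i)"
  by (induction I rule: infinite_finite_induct) (auto simp: comp_plus_right L_sum_op)

text \<open>Uniform boundedness by Sokal's argument: every ball of radius \<open>r\<close> contains a point where
  the functional \<open>\<langle>T \<xi>, \<sqdot>\<rangle>\<close> has norm at least \<open>r \<parallel>T \<xi>\<parallel>\<close>.\<close>

lemma L_bounded:
  assumes T: "T \<in> \<L> Y"
  shows "\<exists>M\<ge>0. \<forall>\<xi>\<in>carrier Y. mnorm Y (T \<xi>) \<le> M * mnorm Y \<xi>"
proof -
  define S where "S = adj Y T"
  have S: "S \<in> \<L> Y" "\<And>\<xi> \<eta>. \<xi> \<in> carrier Y \<Longrightarrow> \<eta> \<in> carrier Y \<Longrightarrow> ip Y (T \<xi>) \<eta> = ip Y \<xi> (S \<eta>)"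
    using T adj_ip by (auto simp: S_def adj_closed)
  have "\<exists>M. \<forall>\<xi>\<in>carrier Y. mnorm Y \<xi> \<le> 1 \<longrightarrow> mnorm Y (T \<xi>) \<le> M"
  proof (rule ccontr)
    assume "\<not> ?thesis"
    then have "\<forall>M. \<exists>\<xi>. \<xi> \<in> carrier Y \<and> mnorm Y \<xi> \<le> 1 \<and> mnorm Y (T \<xi>) > M" by (meson not_le)
    then obtain X where X: "\<And>M. X M \<in> carrier Y" "\<And>M. mnorm Y (X M) \<le> 1" "\<And>M. mnorm Y (T (X M)) > M" by metis
    \<comment> \<open>The factor 3^n compensates the radii 3^-n of the moves below; the factor n is
      what remains and becomes unbounded.\<close>
    define x where "x n = X (3 ^ n * real n)" for n :: nat
    have x: "x n \<in> carrier Y" "mnorm Y (x n) \<le> 1" "mnorm Y (T (x n)) > 3 ^ n * real n" for n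
      using X by (auto simp: x_def)
    \<comment> \<open>One move: from \<eta> by at most 3^-n to a point where the functional of
      \<open>T (x n)\<close> is at least 3^-n times the norm of \<open>T (x n)\<close>.\<close>
    define P where "P n \<eta> \<eta>' \<longleftrightarrow> \<eta>' \<in> carrier Y \<and> mnorm Y (\<eta>' - \<eta>) \<le> (1/3) ^ n \<and>
        norm (ip Y (T (x n)) \<eta>') \<ge> (1/3) ^ n * mnorm Y (T (x n))" for n \<eta> \<eta>'
    have ex: "\<exists>\<eta>'. P n \<eta> \<eta>'" if y: "\<eta> \<in> carrier Y" for n \<eta>
    proof -
      let ?t = "T (x n)"
      have t: "?t \<in> carrier Y" using T x by (simp add: L_closed)
      have tp: "mnorm Y ?t > 0" using x(3)[of n] by (meson le_less_trans mult_nonneg_nonneg of_nat_0_le_iff zero_le_numeral zero_le_power)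
      define r where "r = (1/3) ^ n / mnorm Y ?t"
      define z where "z = r *\<^sub>R ?t"
      have z: "z \<in> carrier Y" using t by (simp add: z_def scaleR_closed)
      have r: "r > 0" using tp by (simp add: r_def)
      have nz: "mnorm Y z = (1/3) ^ n" using t tp by (simp add: z_def mnorm_scaleR r_def)
      have "norm (ip Y ?t z) = r * (mnorm Y ?t)\<^sup>2" using t r by (simp add: z_def ip_simps mnorm_square)
      also have "\<dots> = (1/3) ^ n * mnorm Y ?t" using tp by (simp add: r_def power2_eq_square)
      finally have fz: "norm (ip Y ?t z) = (1/3) ^ n * mnorm Y ?t" .
      \<comment> \<open>The value at \<open>z\<close> is half the difference of the values at \<eta>
        + z and \<eta> - z, so one of these is at least as large.\<close>
      have "2 *\<^sub>R ip Y ?t z = ip Y ?t (\<eta> + z) - ip Y ?t (\<eta> - z)"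
        using t z y by (simp add: ip_simps scaleR_2)
      then have "2 * norm (ip Y ?t z) \<le> norm (ip Y ?t (\<eta> + z)) + norm (ip Y ?t (\<eta> - z))"
        by (metis norm_triangle_ineq4 norm_scaleR abs_numeral)
      then consider "norm (ip Y ?t (\<eta> + z)) \<ge> norm (ip Y ?t z)" | "norm (ip Y ?t (\<eta> - z)) \<ge> norm (ip Y ?t z)"
        by linarith
      then show ?thesis
      proof cases
        case 1
        then show ?thesis using y z nz fz by (intro exI[of _ "\<eta> + z"]) (auto simp: P_def closed_simps)
      next
        case 2
        then show ?thesis using y z nz fz by (intro exI[of _ "\<eta> - z"]) (auto simp: P_def closed_simps mnorm_uminus)
      qed
    qed
    define H where "H = rec_nat (0::'x) (\<lambda>n \<eta>. SOME \<eta>'. P (Suc n) \<eta> \<eta>')"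
    have H0: "H 0 = 0" and HS: "H (Suc n) = (SOME \<eta>'. P (Suc n) (H n) \<eta>')" for n by (simp_all add: H_def)
    have Hc: "H n \<in> carrier Y" for n
    proof (induction n)
      case (Suc n)
      then show ?case using someI_ex[OF ex[OF Suc], of "Suc n"] unfolding HS P_def by blast
    qed (simp add: H0 zero_closed)
    have HP: "P (Suc n) (H n) (H (Suc n))" for n
      using someI_ex[OF ex[OF Hc]] by (simp add: HS)
    \<comment> \<open>The right-hand side is the geometric sum of the moves 3^-k for n < k \<le>
      m.\<close>
    have dist: "mnorm Y (H m - H n) \<le> ((1/3) ^ n - (1/3) ^ m) / 2" if "n \<le> m" for m n
      using that
    proof (induction m rule: dec_induct)
      case (step m)
      have "mnorm Y (H (Suc m) - H n) \<le> mnorm Y (H (Suc m) - H m) + mnorm Y (H m - H n)"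
        by (intro mnorm_triangle_diff Hc)
      also have "\<dots> \<le> (1/3) ^ Suc m + ((1/3) ^ n - (1/3) ^ m) / 2"
        using HP[of m] step.IH by (intro add_mono) (simp_all add: P_def)
      also have "\<dots> = ((1/3) ^ n - (1/3) ^ Suc m) / 2" by (simp add: field_simps)
      finally show ?case .
    qed simp
    have dist': "mnorm Y (H m - H n) \<le> (1/3) ^ n / 2" if "n \<le> m" for m n
      using dist[OF that] by (rule order_trans) simp
    have "\<exists>\<eta>\<in>carrier Y. (\<lambda>k. mnorm Y (H k - \<eta>)) \<longlonglongrightarrow> 0"
    proof (rule complete[OF Hc], intro allI impI)
      fix e :: real assume "e > 0"
      then obtain K where K: "(1/3::real) ^ K < e" using real_arch_pow_inv[of e "1/3"] by auto
      show "\<exists>K. \<forall>p\<ge>K. \<forall>q\<ge>K. mnorm Y (H p - H q) < e"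
      proof (intro exI allI impI)
        fix p q assume "K \<le> p" "K \<le> q"
        then have "mnorm Y (H p - H K) \<le> (1/3) ^ K / 2" "mnorm Y (H K - H q) \<le> (1/3) ^ K / 2"
          using dist' mnorm_minus_commute[OF Hc Hc] by metis+
        then show "mnorm Y (H p - H q) < e" using mnorm_triangle_diff[OF Hc Hc Hc, of p q K] K by linarith
      qed
    qed
    then obtain \<eta> where e: "\<eta> \<in> carrier Y" "(\<lambda>k. mnorm Y (H k - \<eta>)) \<longlonglongrightarrow> 0" by blast
    have near: "mnorm Y (\<eta> - H n) \<le> (1/3) ^ n / 2" for n
    proof (rule LIMSEQ_le_const)
      show "(\<lambda>k. mnorm Y (H k - \<eta>) + (1/3) ^ n / 2) \<longlonglongrightarrow> (1/3) ^ n / 2"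
        using tendsto_add[OF e(2) tendsto_const] by simp
      show "\<exists>N. \<forall>k\<ge>N. mnorm Y (\<eta> - H n) \<le> mnorm Y (H k - \<eta>) + (1/3) ^ n / 2"
      proof (intro exI[of _ n] allI impI)
        fix k assume "n \<le> k"
        have "mnorm Y (\<eta> - H n) \<le> mnorm Y (\<eta> - H k) + mnorm Y (H k - H n)"
          by (intro mnorm_triangle_diff Hc e)
        then show "mnorm Y (\<eta> - H n) \<le> mnorm Y (H k - \<eta>) + (1/3) ^ n / 2"
          using dist'[OF \<open>n \<le> k\<close>] mnorm_minus_commute[OF e(1) Hc[of k]] by linarith
      qed
    qed
    \<comment> \<open>The limit stays within 3^-n / 2 of the n-th point, so half of the lower bound
      at that point survives; it is at least n/2 by the choice of \<open>x\<close>, and the norm of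
      \<open>S \<eta>\<close> dominates it because the \<open>x n\<close> lie in the unit
      ball.\<close>
    have big: "mnorm Y (S \<eta>) \<ge> real (Suc n) / 2" for n
    proof -
      let ?n = "Suc n" let ?t = "T (x ?n)"
      have t: "?t \<in> carrier Y" using T x by (simp add: L_closed)
      have "(1/3) ^ ?n * mnorm Y ?t \<le> norm (ip Y ?t (H ?n))" using HP[of n] by (simp add: P_def)
      also have "ip Y ?t (H ?n) = ip Y ?t \<eta> - ip Y ?t (\<eta> - H ?n)" using t e Hc by (simp add: ip_simps closed_simps)
      also have "norm \<dots> \<le> norm (ip Y ?t \<eta>) + norm (ip Y ?t (\<eta> - H ?n))" by (rule norm_triangle_ineq4)
      also have "norm (ip Y ?t (\<eta> - H ?n)) \<le> mnorm Y ?t * mnorm Y (\<eta> - H ?n)"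
        using t e Hc by (intro ip_CS closed_simps)
      also have "\<dots> \<le> mnorm Y ?t * ((1/3) ^ ?n / 2)"
        using near[of ?n] by (intro mult_left_mono mnorm_nonneg)
      also have "norm (ip Y ?t \<eta>) \<le> mnorm Y (S \<eta>)"
      proof -
        have "norm (ip Y ?t \<eta>) \<le> mnorm Y (x ?n) * mnorm Y (S \<eta>)"
          using S(2)[OF x(1) e(1)] ip_CS[OF x(1) L_closed[OF S(1) e(1)]] by simp
        also have "\<dots> \<le> mnorm Y (S \<eta>)" using x(2)[of ?n] mnorm_nonneg by (simp add: mult_left_le_one_le)
        finally show ?thesis .
      qed
      finally have 1: "(1/3) ^ ?n * mnorm Y ?t / 2 \<le> mnorm Y (S \<eta>)" by (simp add: algebra_simps)
      have "(1/3) ^ ?n * (3 ^ ?n * real ?n) \<le> (1/3) ^ ?n * mnorm Y ?t"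
        using x(3)[of ?n] by (intro mult_left_mono) auto
      also have "(1/3) ^ ?n * (3 ^ ?n * real ?n) = ((1/3) * 3) ^ ?n * real ?n"
        unfolding power_mult_distrib by simp
      finally have "real ?n \<le> (1/3) ^ ?n * mnorm Y ?t" by simp
      then have "real ?n / 2 \<le> (1/3) ^ ?n * mnorm Y ?t / 2" by (rule divide_right_mono) simp
      then show ?thesis using 1 by (rule order_trans)
    qed
    obtain n where "2 * mnorm Y (S \<eta>) < real n" using reals_Archimedean2 by blast
    then show False using big[of n] by simp
  qed
  then obtain M where M: "\<And>\<xi>. \<xi> \<in> carrier Y \<Longrightarrow> mnorm Y \<xi> \<le> 1 \<Longrightarrow> mnorm Y (T \<xi>) \<le> M" by blast
  have M0: "M \<ge> 0" using M[of 0] zero_closed T by simp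
  have "mnorm Y (T \<xi>) \<le> M * mnorm Y \<xi>" if x: "\<xi> \<in> carrier Y" for \<xi>
  proof (cases "mnorm Y \<xi> = 0")
    case True
    then show ?thesis using T x mnorm_eq_0 by simp
  next
    case False
    then have p: "mnorm Y \<xi> > 0" using mnorm_nonneg[of \<xi>] by linarith
    have "mnorm Y (T ((1 / mnorm Y \<xi>) *\<^sub>R \<xi>)) \<le> M"
      using x p by (intro M) (auto simp: scaleR_closed mnorm_scaleR)
    then show ?thesis using T x p by (simp add: L_scaleR mnorm_scaleR L_closed divide_simps mult.commute)
  qed
  then show ?thesis using M0 by blast
qed

section \<open>The operator norm\<close>

lemma opnorm_le:
  assumes "\<And>\<xi>. \<xi> \<in> carrier Y \<Longrightarrow> mnorm Y (T \<xi>) \<le> M * mnorm Y \<xi>" "M \<ge> 0"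
  shows "opnorm Y T \<le> M"
  unfolding opnorm_def
proof (rule cSup_least)
  show "{mnorm Y (T \<xi>) |\<xi>. \<xi> \<in> carrier Y \<and> mnorm Y \<xi> \<le> 1} \<noteq> {}" using zero_closed by force
  fix r assume "r \<in> {mnorm Y (T \<xi>) |\<xi>. \<xi> \<in> carrier Y \<and> mnorm Y \<xi> \<le> 1}"
  then obtain \<xi> where "r = mnorm Y (T \<xi>)" "\<xi> \<in> carrier Y" "mnorm Y \<xi> \<le> 1" by blast
  then show "r \<le> M" using assms(1)[of \<xi>] mult_left_le[of "mnorm Y \<xi>" M] assms(2) by linarith
qed

text \<open>The supremum in \<open>opnorm\<close> is an upper bound only because adjointable
  operators are bounded by \<open>L_bounded\<close>.\<close>

lemma opnorm_bound:
  assumes T: "T \<in> \<L> Y" and x: "\<xi> \<in> carrier Y"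
  shows "mnorm Y (T \<xi>) \<le> opnorm Y T * mnorm Y \<xi>"
proof (cases "mnorm Y \<xi> = 0")
  case True
  then show ?thesis using T x mnorm_eq_0 by simp
next
  case False
  then have p: "mnorm Y \<xi> > 0" using mnorm_nonneg[of \<xi>] by linarith
  obtain M where M: "M \<ge> 0" "\<And>\<xi>. \<xi> \<in> carrier Y \<Longrightarrow> mnorm Y (T \<xi>) \<le> M * mnorm Y \<xi>"
    using L_bounded[OF T] by blast
  have "mnorm Y (T \<eta>) \<le> opnorm Y T" if "\<eta> \<in> carrier Y" "mnorm Y \<eta> \<le> 1" for \<eta>
    unfolding opnorm_def
  proof (rule cSup_upper)
    show "bdd_above {mnorm Y (T \<xi>) |\<xi>. \<xi> \<in> carrier Y \<and> mnorm Y \<xi> \<le> 1}"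
    proof (rule bdd_aboveI[of _ M])
      fix r assume "r \<in> {mnorm Y (T \<xi>) |\<xi>. \<xi> \<in> carrier Y \<and> mnorm Y \<xi> \<le> 1}"
      then obtain \<xi> where "r = mnorm Y (T \<xi>)" "\<xi> \<in> carrier Y" "mnorm Y \<xi> \<le> 1" by blast
      then show "r \<le> M" using M(2)[of \<xi>] mult_left_le[of "mnorm Y \<xi>" M] M(1) by linarith
    qed
  qed (use that in blast)
  from this[of "(1 / mnorm Y \<xi>) *\<^sub>R \<xi>"] show ?thesis
    using T x p by (simp add: L_scaleR mnorm_scaleR L_closed scaleR_closed divide_simps mult.commute)
qed

lemma opnorm_nonneg:
  assumes "T \<in> \<L> Y" shows "opnorm Y T \<ge> 0"
proof -
  obtain M where M: "M \<ge> 0" "\<And>\<xi>. \<xi> \<in> carrier Y \<Longrightarrow> mnorm Y (T \<xi>) \<le> M * mnorm Y \<xi>"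
    using L_bounded[OF assms] by blast
  have "mnorm Y (T 0) \<le> opnorm Y T" unfolding opnorm_def
  proof (rule cSup_upper)
    show "bdd_above {mnorm Y (T \<xi>) |\<xi>. \<xi> \<in> carrier Y \<and> mnorm Y \<xi> \<le> 1}"
    proof (rule bdd_aboveI[of _ M])
      fix r assume "r \<in> {mnorm Y (T \<xi>) |\<xi>. \<xi> \<in> carrier Y \<and> mnorm Y \<xi> \<le> 1}"
      then obtain \<xi> where "r = mnorm Y (T \<xi>)" "\<xi> \<in> carrier Y" "mnorm Y \<xi> \<le> 1" by blast
      then show "r \<le> M" using M(2)[of \<xi>] mult_left_le[of "mnorm Y \<xi>" M] M(1) by linarith
    qed
  qed (use zero_closed in force)
  then show ?thesis using assms by simp
qed

lemma opnorm_triangle: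
  assumes "T \<in> \<L> Y" "S \<in> \<L> Y" shows "opnorm Y (T + S) \<le> opnorm Y T + opnorm Y S"
proof (rule opnorm_le)
  fix \<xi> assume x: "\<xi> \<in> carrier Y"
  have "mnorm Y ((T + S) \<xi>) \<le> mnorm Y (T \<xi>) + mnorm Y (S \<xi>)" using assms x by (simp add: mnorm_triangle L_closed)
  also have "\<dots> \<le> (opnorm Y T + opnorm Y S) * mnorm Y \<xi>"
    using opnorm_bound[OF assms(1) x] opnorm_bound[OF assms(2) x] by (simp add: distrib_right)
  finally show "mnorm Y ((T + S) \<xi>) \<le> (opnorm Y T + opnorm Y S) * mnorm Y \<xi>" .
qed (use assms opnorm_nonneg in simp)

lemma opnorm_comp:
  assumes "T \<in> \<L> Y" "S \<in> \<L> Y" shows "opnorm Y (T \<circ> S) \<le> opnorm Y T * opnorm Y S"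
proof (rule opnorm_le)
  fix \<xi> assume x: "\<xi> \<in> carrier Y"
  have "mnorm Y ((T \<circ> S) \<xi>) \<le> opnorm Y T * mnorm Y (S \<xi>)" using assms x by (simp add: opnorm_bound L_closed)
  also have "\<dots> \<le> opnorm Y T * (opnorm Y S * mnorm Y \<xi>)"
    using opnorm_bound[OF assms(2) x] assms opnorm_nonneg by (intro mult_left_mono) auto
  finally show "mnorm Y ((T \<circ> S) \<xi>) \<le> opnorm Y T * opnorm Y S * mnorm Y \<xi>" by (simp add: mult.assoc)
qed (use assms opnorm_nonneg in simp)

lemma opnorm_scaleC_le:
  assumes "T \<in> \<L> Y" shows "opnorm Y (c *\<^sub>C T) \<le> cmod c * opnorm Y T"
proof (rule opnorm_le)
  fix \<xi> assume x: "\<xi> \<in> carrier Y"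
  have "mnorm Y ((c *\<^sub>C T) \<xi>) = cmod c * mnorm Y (T \<xi>)" using assms x by (simp add: mnorm_scaleC L_closed scaleC_fun_def)
  also have "\<dots> \<le> cmod c * (opnorm Y T * mnorm Y \<xi>)" using opnorm_bound[OF assms x] by (intro mult_left_mono) auto
  finally show "mnorm Y ((c *\<^sub>C T) \<xi>) \<le> cmod c * opnorm Y T * mnorm Y \<xi>" by (simp add: mult.assoc)
qed (use assms opnorm_nonneg in simp)

lemma opnorm_minus_commute:
  assumes "T \<in> \<L> Y" "S \<in> \<L> Y" shows "opnorm Y (T - S) = opnorm Y (S - T)"
proof -
  have "mnorm Y ((T - S) \<xi>) = mnorm Y ((S - T) \<xi>)" if "\<xi> \<in> carrier Y" for \<xi>
    using mnorm_minus_commute that assms by (simp add: L_closed)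
  then have "{mnorm Y ((T - S) \<xi>) |\<xi>. \<xi> \<in> carrier Y \<and> mnorm Y \<xi> \<le> 1} = {mnorm Y ((S - T) \<xi>) |\<xi>. \<xi> \<in> carrier Y \<and> mnorm Y \<xi> \<le> 1}"
    by metis
  then show ?thesis by (simp add: opnorm_def)
qed

lemma opnorm_triangle_diff:
  assumes "T \<in> \<L> Y" "S \<in> \<L> Y" "R \<in> \<L> Y" shows "opnorm Y (T - R) \<le> opnorm Y (T - S) + opnorm Y (S - R)"
  using opnorm_triangle[of "T - S" "S - R"] assms by (simp add: L_minus)

lemma opnorm_adj_le:
  assumes T: "T \<in> \<L> Y" shows "opnorm Y (adj Y T) \<le> opnorm Y T"
proof (rule opnorm_le)
  fix \<xi> assume x: "\<xi> \<in> carrier Y"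
  let ?z = "adj Y T \<xi>"
  have z: "?z \<in> carrier Y" using T x by (simp add: L_closed adj_closed)
  have "(mnorm Y ?z)\<^sup>2 = norm (ip Y (T ?z) \<xi>)" using T x z by (simp add: mnorm_square adj_ip)
  also have "\<dots> \<le> mnorm Y (T ?z) * mnorm Y \<xi>" using ip_CS[OF L_closed[OF T z] x] .
  also have "\<dots> \<le> opnorm Y T * mnorm Y ?z * mnorm Y \<xi>"
    using opnorm_bound[OF T z] mnorm_nonneg by (intro mult_right_mono) auto
  finally have le: "mnorm Y ?z * mnorm Y ?z \<le> opnorm Y T * mnorm Y \<xi> * mnorm Y ?z"
    by (simp add: power2_eq_square mult.commute mult.left_commute)
  show "mnorm Y ?z \<le> opnorm Y T * mnorm Y \<xi>"
  proof (cases "mnorm Y ?z = 0")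
    case True
    then show ?thesis using opnorm_nonneg[OF T] mnorm_nonneg by simp
  next
    case False
    then show ?thesis using le mnorm_nonneg[of ?z] by (simp add: mult_le_cancel_right)
  qed
qed (use assms opnorm_nonneg in simp)

lemma opnorm_zero_iff: "T \<in> \<L> Y \<Longrightarrow> opnorm Y T \<le> 0 \<Longrightarrow> T = 0"
proof (rule L_eqI[OF _ L_zero_op])
  fix \<xi> assume T: "T \<in> \<L> Y" "opnorm Y T \<le> 0" and x: "\<xi> \<in> carrier Y"
  have "mnorm Y (T \<xi>) \<le> 0" using opnorm_bound[OF T(1) x] T opnorm_nonneg[OF T(1)] by simp
  then show "T \<xi> = 0 \<xi>" using mnorm_eq_0[of "T \<xi>"] mnorm_nonneg[of "T \<xi>"] L_closed[OF T(1) x] by simp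
qed

lemma ip_tendsto_left:
  assumes "\<And>n. s n \<in> carrier Y" "\<xi> \<in> carrier Y" "\<eta> \<in> carrier Y" "(\<lambda>n. mnorm Y (s n - \<xi>)) \<longlonglongrightarrow> 0"
  shows "(\<lambda>n::nat. ip Y (s n) \<eta>) \<longlonglongrightarrow> ip Y \<xi> \<eta>"
proof (rule LIM_zero_cancel, rule tendsto_norm_zero_cancel, rule Lim_null_comparison)
  show "\<forall>\<^sub>F n in sequentially. norm (norm (ip Y (s n) \<eta> - ip Y \<xi> \<eta>)) \<le> mnorm Y (s n - \<xi>) * mnorm Y \<eta>"
    using assms ip_CS[of "s _ - \<xi>" \<eta>] by (auto simp: ip_diff_left[symmetric] diff_closed)
  show "(\<lambda>n. mnorm Y (s n - \<xi>) * mnorm Y \<eta>) \<longlonglongrightarrow> 0"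
    using tendsto_mult_left_zero[OF assms(4)] by simp
qed

lemma ip_tendsto_right:
  assumes "\<And>n. s n \<in> carrier Y" "\<xi> \<in> carrier Y" "\<eta> \<in> carrier Y" "(\<lambda>n. mnorm Y (s n - \<xi>)) \<longlonglongrightarrow> 0"
  shows "(\<lambda>n::nat. ip Y \<eta> (s n)) \<longlonglongrightarrow> ip Y \<eta> \<xi>"
  using bounded_linear.tendsto[OF bounded_linear_star ip_tendsto_left[OF assms]] assms by (simp add: ip_star)

text \<open>Taking adjoints is contractive, so the adjoints form a Cauchy sequence as well. Both
  sequences converge pointwise, and the two limits are adjoint to each other because inner products
  are continuous.\<close>

lemma L_complete:
  assumes T: "\<And>n::nat. T n \<in> \<L> Y" and C: "\<And>e. e > 0 \<Longrightarrow> \<exists>K. \<forall>p\<ge>K. \<forall>q\<ge>K. opnorm Y (T p - T q) < e"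
  shows "\<exists>R\<in>\<L> Y. (\<lambda>n. opnorm Y (T n - R)) \<longlonglongrightarrow> 0"
proof -
  have lim: "\<exists>\<eta>\<in>carrier Y. (\<lambda>k. mnorm Y (S k \<xi> - \<eta>)) \<longlonglongrightarrow> 0"
    if S: "\<And>n::nat. S n \<in> \<L> Y" and C: "\<And>e. e > 0 \<Longrightarrow> \<exists>K. \<forall>p\<ge>K. \<forall>q\<ge>K. opnorm Y (S p - S q) < e" and x: "\<xi> \<in> carrier Y" for S \<xi>
  proof (rule complete[OF L_closed[OF S x]], intro allI impI)
    fix e :: real assume e: "e > 0"
    have m: "mnorm Y \<xi> + 1 > 0" using mnorm_nonneg[of \<xi>] by linarith
    then obtain K where K: "\<forall>p\<ge>K. \<forall>q\<ge>K. opnorm Y (S p - S q) < e / (mnorm Y \<xi> + 1)"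
      using C[of "e / (mnorm Y \<xi> + 1)"] e by auto
    show "\<exists>K. \<forall>p\<ge>K. \<forall>q\<ge>K. mnorm Y (S p \<xi> - S q \<xi>) < e"
    proof (intro exI allI impI)
      fix p q assume pq: "K \<le> p" "K \<le> q"
      have "mnorm Y (S p \<xi> - S q \<xi>) \<le> opnorm Y (S p - S q) * mnorm Y \<xi>"
        using opnorm_bound[OF L_minus[OF S S] x, of p q] by simp
      also have "\<dots> \<le> opnorm Y (S p - S q) * (mnorm Y \<xi> + 1)"
        using opnorm_nonneg[OF L_minus[OF S S]] by (intro mult_left_mono) auto
      also have "\<dots> < e" using K pq m by (simp add: less_divide_eq)
      finally show "mnorm Y (S p \<xi> - S q \<xi>) < e" .
    qed
  qed
  have Ca: "\<exists>K. \<forall>p\<ge>K. \<forall>q\<ge>K. opnorm Y (adj Y (T p) - adj Y (T q)) < e" if "e > 0" for e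
  proof -
    have "opnorm Y (adj Y (T p) - adj Y (T q)) \<le> opnorm Y (T p - T q)" for p q
      using opnorm_adj_le[OF L_minus[OF T T], of p q] T by (simp add: adj_minus)
    then show ?thesis using C[OF that] by (meson le_less_trans)
  qed
  obtain f where f: "\<And>\<xi>. \<xi> \<in> carrier Y \<Longrightarrow> f \<xi> \<in> carrier Y" "\<And>\<xi>. \<xi> \<in> carrier Y \<Longrightarrow> (\<lambda>k. mnorm Y (T k \<xi> - f \<xi>)) \<longlonglongrightarrow> 0"
    using lim[OF T C] by metis
  obtain g where g: "\<And>\<xi>. \<xi> \<in> carrier Y \<Longrightarrow> g \<xi> \<in> carrier Y" "\<And>\<xi>. \<xi> \<in> carrier Y \<Longrightarrow> (\<lambda>k. mnorm Y (adj Y (T k) \<xi> - g \<xi>)) \<longlonglongrightarrow> 0"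
    using lim[OF adj_closed[OF T] Ca] by metis
  define R where "R = restr Y f"
  have "is_adjoint Y R (restr Y g)"
    unfolding is_adjoint_def R_def
  proof (intro conjI ballI restr_maps f g)
    fix \<xi> \<eta> assume x: "\<xi> \<in> carrier Y" "\<eta> \<in> carrier Y"
    have "(\<lambda>k. ip Y (T k \<xi>) \<eta>) \<longlonglongrightarrow> ip Y (f \<xi>) \<eta>" using x f T by (intro ip_tendsto_left) (auto simp: L_closed)
    moreover have "(\<lambda>k. ip Y \<xi> (adj Y (T k) \<eta>)) \<longlonglongrightarrow> ip Y \<xi> (g \<eta>)"
      using x g T by (intro ip_tendsto_right) (auto simp: L_closed adj_closed)
    ultimately show "ip Y (restr Y f \<xi>) \<eta> = ip Y \<xi> (restr Y g \<eta>)"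
      using x T by (simp add: adj_ip LIMSEQ_unique)
  qed
  then have R: "R \<in> \<L> Y" by (rule adjointablesI)
  have "(\<lambda>n. opnorm Y (T n - R)) \<longlonglongrightarrow> 0"
  proof (rule LIMSEQ_I)
    fix e :: real assume e: "e > 0"
    then obtain K where K: "\<forall>p\<ge>K. \<forall>q\<ge>K. opnorm Y (T p - T q) < e / 2" using C[of "e/2"] by auto
    show "\<exists>N. \<forall>n\<ge>N. norm (opnorm Y (T n - R) - 0) < e"
    proof (intro exI allI impI)
      fix n assume n: "n \<ge> K"
      have "opnorm Y (T n - R) \<le> e / 2"
      proof (rule opnorm_le)
        fix \<xi> assume x: "\<xi> \<in> carrier Y"
        show "mnorm Y ((T n - R) \<xi>) \<le> e / 2 * mnorm Y \<xi>"
        proof (rule LIMSEQ_le_const)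
          show "(\<lambda>k. mnorm Y (T k \<xi> - f \<xi>) + e / 2 * mnorm Y \<xi>) \<longlonglongrightarrow> e / 2 * mnorm Y \<xi>"
            using tendsto_add[OF f(2)[OF x] tendsto_const] by simp
          show "\<exists>N. \<forall>k\<ge>N. mnorm Y ((T n - R) \<xi>) \<le> mnorm Y (T k \<xi> - f \<xi>) + e / 2 * mnorm Y \<xi>"
          proof (intro exI allI impI)
            fix k assume k: "k \<ge> K"
            have "mnorm Y ((T n - R) \<xi>) \<le> mnorm Y (T n \<xi> - T k \<xi>) + mnorm Y (T k \<xi> - f \<xi>)"
              using mnorm_triangle_diff[of "T n \<xi>" "T k \<xi>" "f \<xi>"] x f T by (simp add: R_def L_closed)
            moreover have "mnorm Y (T n \<xi> - T k \<xi>) \<le> opnorm Y (T n - T k) * mnorm Y \<xi>"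
              using opnorm_bound[OF L_minus[OF T T] x, of n k] by simp
            moreover have "\<dots> \<le> e / 2 * mnorm Y \<xi>" using K n k mnorm_nonneg[of \<xi>] by (intro mult_right_mono) (auto simp: less_imp_le)
            ultimately show "mnorm Y ((T n - R) \<xi>) \<le> mnorm Y (T k \<xi> - f \<xi>) + e / 2 * mnorm Y \<xi>" by linarith
          qed
        qed
      qed (use e in simp)
      then show "norm (opnorm Y (T n - R) - 0) < e" using e opnorm_nonneg[OF L_minus[OF T R]] by simp
    qed
  qed
  then show ?thesis using R by blast
qed

end

section \<open>Square roots of operators and Paschke's inequality\<close>

context hilbert_module
begin

lemma opnorm_comp_le:
  assumes "T \<in> \<L> Y" "S \<in> \<L> Y" "opnorm Y T \<le> a" "opnorm Y S \<le> b"
  shows "opnorm Y (T \<circ> S) \<le> a * b"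
  using opnorm_comp[OF assms(1,2)] mult_mono[OF assms(3,4)] opnorm_nonneg[OF assms(1)] opnorm_nonneg[OF assms(2)]
    assms(3) by linarith

lemma opnorm_plus_le:
  assumes "T \<in> \<L> Y" "S \<in> \<L> Y" "opnorm Y T \<le> a" "opnorm Y S \<le> b"
  shows "opnorm Y (T + S) \<le> a + b"
  using opnorm_triangle[OF assms(1,2)] assms(3,4) by linarith

text \<open>The square root iteration once more, now for operators with \<open>opnorm\<close>. The
  root is kept inside the closed subalgebra \<open>B\<close>, since a state is positive only on
  elements of \<open>B\<close>.\<close>

lemma operator_sqrt_one_minus:
  assumes B: "cstar_subalgebra Y B" and x: "x \<in> B" "adj Y x = x" "opnorm Y x \<le> 1" and id: "id_op Y \<in> B"
  obtains S where "S \<in> B" "adj Y S = S" "S \<circ> S = id_op Y - x"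
proof -
  have BL: "T \<in> \<L> Y" if "T \<in> B" for T using B that by (auto simp: cstar_subalgebra_def)
  have Bs: "T + S \<in> B" "T \<circ> S \<in> B" "c *\<^sub>C T \<in> B" "0 \<in> B" if "T \<in> B" "S \<in> B" for T S c
    using B that by (auto simp: cstar_subalgebra_def)
  have xL: "x \<in> \<L> Y" using BL x by blast
  define W where "W = rec_nat (0::'x \<Rightarrow> 'x) (\<lambda>_ y. (1/2) *\<^sub>C (x + (y \<circ> y)))"
  have W0: "W 0 = 0" and WS: "W (Suc n) = (1/2) *\<^sub>C (x + (W n \<circ> W n))" for n
    by (simp_all add: W_def)
  have WB: "W n \<in> B" for n using x Bs by (induction n) (auto simp: W0 WS)
  have WL: "W n \<in> \<L> Y" for n using BL WB by blast
  have half: "opnorm Y ((1/2) *\<^sub>C T) \<le> a / 2" if "T \<in> \<L> Y" "opnorm Y T \<le> a" for T a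
    using opnorm_scaleC_le[OF that(1), of "1/2"] that(2) by (simp add: norm_divide)
  have nW: "opnorm Y (W n) \<le> sqrt_iter n" for n
  proof (induction n)
    case 0
    have "opnorm Y 0 \<le> 0" by (rule opnorm_le) auto
    then show ?case by (simp only: W0 sqrt_iter.simps)
  next
    case (Suc n)
    have "opnorm Y (x + (W n \<circ> W n)) \<le> 1 + sqrt_iter n * sqrt_iter n"
      by (intro opnorm_plus_le opnorm_comp_le x xL WL L_comp Suc)
    from half[OF _ this] show ?case by (simp add: WS L_plus L_comp xL WL power2_eq_square)
  qed
  have dW: "opnorm Y (W (Suc n) - W n) \<le> sqrt_iter (Suc n) - sqrt_iter n" for n
  proof (induction n)
    case 0
    then show ?case using half[OF xL x(3)] by (simp add: WS W0)
  next
    case (Suc n)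
    let ?a = "W (Suc n)" and ?b = "W n" and ?r = "sqrt_iter (Suc n)" and ?s = "sqrt_iter n"
    have "W (Suc (Suc n)) - W (Suc n) = (1/2) *\<^sub>C (x + (?a \<circ> ?a)) - (1/2) *\<^sub>C (x + (?b \<circ> ?b))"
      by (simp only: WS)
    also have "\<dots> = (1/2) *\<^sub>C ((?a \<circ> (?a - ?b)) + ((?a - ?b) \<circ> ?b))"
      unfolding comp_minus_right[OF WL WL WL] comp_minus_left scaleC_diff_right[symmetric] by simp
    finally have eq: "W (Suc (Suc n)) - W (Suc n) = (1/2) *\<^sub>C ((?a \<circ> (?a - ?b)) + ((?a - ?b) \<circ> ?b))" .
    have "opnorm Y ((?a \<circ> (?a - ?b)) + ((?a - ?b) \<circ> ?b)) \<le> ?r * (?r - ?s) + (?r - ?s) * ?s"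
      by (intro opnorm_plus_le opnorm_comp_le L_comp L_minus WL nW Suc)
    from half[OF _ this] have "opnorm Y (W (Suc (Suc n)) - W (Suc n)) \<le> (?r * (?r - ?s) + (?r - ?s) * ?s) / 2"
      unfolding eq by (simp add: L_plus L_comp L_minus WL)
    also have "\<dots> = sqrt_iter (Suc (Suc n)) - sqrt_iter (Suc n)"
      by (simp add: power2_eq_square algebra_simps diff_divide_distrib add_divide_distrib)
    finally show ?case .
  qed
  have tele: "opnorm Y (W n - W m) \<le> sqrt_iter n - sqrt_iter m" if "m \<le> n" for m n
    using that
  proof (induction n rule: dec_induct)
    case base
    have "opnorm Y 0 \<le> 0" by (rule opnorm_le) auto
    then show ?case by (simp only: diff_self)
  next
    case (step n)
    then show ?case using opnorm_triangle_diff[OF WL WL WL, of "Suc n" m n] dW[of n] by linarith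
  qed
  have le: "opnorm Y (W n - W m) \<le> \<bar>sqrt_iter n - sqrt_iter m\<bar>" for m n
    using tele[of m n] tele[of n m] opnorm_minus_commute[OF WL WL, of m n] by (cases "m \<le> n") auto
  have "\<exists>K. \<forall>p\<ge>K. \<forall>q\<ge>K. opnorm Y (W p - W q) < e" if e: "e > 0" for e
  proof -
    obtain M where "\<forall>m\<ge>M. \<forall>n\<ge>M. dist (sqrt_iter m) (sqrt_iter n) < e"
      using metric_CauchyD[OF sqrt_iter_Cauchy e] by blast
    then show ?thesis by (auto simp: dist_norm intro!: exI[of _ M] le_less_trans[OF le])
  qed
  from L_complete[OF WL this] obtain y where y: "y \<in> \<L> Y" "(\<lambda>n. opnorm Y (W n - y)) \<longlonglongrightarrow> 0" by blast
  have yB: "y \<in> B"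
  proof -
    have "\<exists>S\<in>B. opnorm Y (y - S) < e" if e: "e > 0" for e
    proof -
      obtain n where "norm (opnorm Y (W n - y) - 0) < e" using LIMSEQ_D[OF y(2) e] by blast
      then show ?thesis using WB[of n] opnorm_minus_commute[OF WL y(1), of n] by (auto intro!: bexI[of _ "W n"])
    qed
    then show ?thesis using B y(1) by (auto simp: cstar_subalgebra_def closed_in_def)
  qed
  have selfadj: "adj Y (W n) = W n" for n
  proof (induction n)
    case 0
    show ?case by (simp only: W0 adj_zero)
  next
    case (Suc n)
    then show ?case by (simp add: WS adj_simps x xL WL L_simps)
  qed
  have zero: "T = 0" if "T \<in> \<L> Y" "\<And>n. opnorm Y T \<le> f n" "f \<longlonglongrightarrow> 0" for T and f :: "nat \<Rightarrow> real"
    using that opnorm_zero_iff LIMSEQ_le_const by metis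
  have ay: "adj Y y = y"
  proof -
    have "opnorm Y (adj Y y - y) \<le> opnorm Y (W n - y) + opnorm Y (W n - y)" for n
    proof -
      have "adj Y y - y = adj Y (y - W n) + (W n - y)" using y WL by (simp add: adj_simps selfadj)
      moreover have "opnorm Y (adj Y (y - W n)) \<le> opnorm Y (W n - y)"
        using opnorm_adj_le[OF L_minus[OF y(1) WL]] opnorm_minus_commute[OF WL y(1)] by simp
      ultimately show ?thesis
        using opnorm_plus_le[OF adj_closed[OF L_minus[OF y(1) WL]] L_minus[OF WL y(1)] _ order_refl] by metis
    qed
    moreover have "(\<lambda>n. opnorm Y (W n - y) + opnorm Y (W n - y)) \<longlonglongrightarrow> 0"
      using tendsto_add[OF y(2) y(2)] by simp
    ultimately have "adj Y y - y = 0" by (rule zero[OF L_minus[OF adj_closed[OF y(1)] y(1)]])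
    then show ?thesis by simp
  qed
  have ny: "opnorm Y y \<le> 1"
  proof (rule LIMSEQ_le_const)
    show "(\<lambda>n. opnorm Y (W n - y) + 1) \<longlonglongrightarrow> 1" using tendsto_add[OF y(2) tendsto_const] by simp
    show "\<exists>N. \<forall>n\<ge>N. opnorm Y y \<le> opnorm Y (W n - y) + 1"
    proof (intro exI allI impI)
      fix n
      have "opnorm Y ((y - W n) + W n) \<le> opnorm Y (W n - y) + 1"
        using opnorm_minus_commute[OF WL y(1), of n] nW[of n] sqrt_iter_bounds[of n] y WL
        by (intro opnorm_plus_le) (auto intro: L_simps order_trans)
      then show "opnorm Y y \<le> opnorm Y (W n - y) + 1" by simp
    qed
  qed
  have fixpt: "y - (1/2) *\<^sub>C (x + (y \<circ> y)) = 0"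
  proof (rule zero)
    show "y - (1/2) *\<^sub>C (x + (y \<circ> y)) \<in> \<L> Y" by (intro L_simps y xL)
    fix n
    let ?w = "W n"
    \<comment> \<open>Writes the defect of \<open>y\<close> in the fixed point equation through
      distances of iterates from \<open>y\<close>, so that it is bounded by a null sequence.\<close>
    have eq: "y - (1/2) *\<^sub>C (x + (y \<circ> y)) = (y - W (Suc n)) + (1/2) *\<^sub>C ((?w \<circ> (?w - y)) + ((?w - y) \<circ> y))"
      unfolding WS comp_minus_right[OF WL WL y(1)] comp_minus_left
      by (simp add: algebra_simps scaleC_diff_right scaleC_add_right)
    have "opnorm Y ((1/2) *\<^sub>C ((?w \<circ> (?w - y)) + ((?w - y) \<circ> y))) \<le> (1 * opnorm Y (?w - y) + opnorm Y (?w - y) * 1) / 2"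
      using nW[of n] sqrt_iter_bounds[of n] y WL ny
      by (intro half opnorm_plus_le opnorm_comp_le L_simps) (auto intro: order_trans)
    moreover have "opnorm Y (y - W (Suc n)) \<le> opnorm Y (W (Suc n) - y)"
      using opnorm_minus_commute[OF WL y(1), of "Suc n"] by simp
    ultimately show "opnorm Y (y - (1/2) *\<^sub>C (x + (y \<circ> y))) \<le>
        opnorm Y (W (Suc n) - y) + (1 * opnorm Y (?w - y) + opnorm Y (?w - y) * 1) / 2"
      unfolding eq by (intro opnorm_plus_le L_simps y WL)
  next
    have "(\<lambda>n. opnorm Y (W (Suc n) - y) + (1 * opnorm Y (W n - y) + opnorm Y (W n - y) * 1) / 2) \<longlonglongrightarrow> 0 + (1 * 0 + 0 * 1) / 2"
      by (intro tendsto_intros y LIMSEQ_Suc[OF y(2)]) auto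
    then show "(\<lambda>n. opnorm Y (W (Suc n) - y) + (1 * opnorm Y (W n - y) + opnorm Y (W n - y) * 1) / 2) \<longlonglongrightarrow> 0" by simp
  qed
  have two: "y + y = x + (y \<circ> y)"
  proof -
    have "y = (1/2) *\<^sub>C (x + (y \<circ> y))" using fixpt by simp
    then have "y + y = (1/2) *\<^sub>C (x + (y \<circ> y)) + (1/2) *\<^sub>C (x + (y \<circ> y))" by simp
    also have "\<dots> = (1/2 + 1/2) *\<^sub>C (x + (y \<circ> y))" by (rule scaleC_add_left[symmetric])
    finally show ?thesis by simp
  qed
  let ?S = "id_op Y - y"
  show ?thesis
  proof (rule that[of ?S])
    have "?S = id_op Y + (-1) *\<^sub>C y" by simp
    then show "?S \<in> B" using id yB Bs by metis
    show "adj Y ?S = ?S" using y ay by (simp add: adj_simps L_id_op)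
    have "?S \<circ> ?S = id_op Y - y - (y - (y \<circ> y))"
      using y(1) by (simp add: comp_minus_left comp_minus_right comp_id_left comp_id_right L_id_op)
    also have "\<dots> = id_op Y - (y + y) + (y \<circ> y)" by simp
    finally show "?S \<circ> ?S = id_op Y - x" by (simp add: two)
  qed
qed

lemma cstar_subalgebra_L: "cstar_subalgebra Y (\<L> Y)"
  by (auto simp: cstar_subalgebra_def closed_in_def L_simps)

text \<open>The operator form of T* T \<le> N^2: dividing by N^2 gives a selfadjoint contraction in
  \<open>B\<close>, and the root of its complement witnesses positivity inside
  \<open>B\<close>.\<close>

lemma cstar_subalgebra_contraction:
  assumes B: "cstar_subalgebra Y B" and id: "id_op Y \<in> B" and T: "T \<in> B" and N: "opnorm Y T \<le> N" "N > 0"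
  obtains S where "S \<in> B" "adj Y S \<circ> S = id_op Y - complex_of_real (1 / N\<^sup>2) *\<^sub>C (adj Y T \<circ> T)"
proof -
  have TL: "T \<in> \<L> Y" using B T by (auto simp: cstar_subalgebra_def)
  let ?x = "complex_of_real (1 / N\<^sup>2) *\<^sub>C (adj Y T \<circ> T)"
  have "?x \<in> B" using B T unfolding cstar_subalgebra_def by blast
  moreover have "adj Y ?x = ?x" using TL by (simp add: adj_simps L_simps)
  moreover have "opnorm Y ?x \<le> 1"
  proof -
    have "opnorm Y ?x \<le> cmod (complex_of_real (1 / N\<^sup>2)) * opnorm Y (adj Y T \<circ> T)"
      using TL by (intro opnorm_scaleC_le L_simps)
    also have "\<dots> \<le> (1 / N\<^sup>2) * (N * N)"
      unfolding norm_of_real using N TL opnorm_adj_le[OF TL]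
      by (intro mult_mono opnorm_comp_le L_simps) (auto intro!: opnorm_nonneg L_simps)
    also have "\<dots> = 1" using N by (simp add: power2_eq_square)
    finally show ?thesis .
  qed
  ultimately obtain S where "S \<in> B" "adj Y S = S" "S \<circ> S = id_op Y - ?x"
    using operator_sqrt_one_minus[OF B _ _ _ id] by metis
  then show ?thesis using that by metis
qed

text \<open>Paschke's inequality.\<close>

lemma L_ip_le:
  assumes T: "T \<in> \<L> Y" and N: "opnorm Y T \<le> N" "N > 0" and x: "\<xi> \<in> carrier Y"
  shows "cpos (N\<^sup>2 *\<^sub>R ip Y \<xi> \<xi> - ip Y (T \<xi>) (T \<xi>))"
proof -
  obtain S where S: "S \<in> \<L> Y" "adj Y S \<circ> S = id_op Y - complex_of_real (1 / N\<^sup>2) *\<^sub>C (adj Y T \<circ> T)"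
    using cstar_subalgebra_contraction[OF cstar_subalgebra_L L_id_op T N] by blast
  have "ip Y (S \<xi>) (S \<xi>) = ip Y \<xi> ((adj Y S \<circ> S) \<xi>)" using S(1) x by (simp add: adj_ip L_closed)
  also have "\<dots> = ip Y \<xi> \<xi> - (1 / N\<^sup>2) *\<^sub>R ip Y (T \<xi>) (T \<xi>)"
    unfolding S(2) using T x
    by (simp add: ip_simps L_closed adj_closed closed_simps scaleC_fun_def adj_ip scaleC_of_real del: of_real_divide of_real_power)
  finally have "cpos (ip Y \<xi> \<xi> - (1 / N\<^sup>2) *\<^sub>R ip Y (T \<xi>) (T \<xi>))" using S x by (metis L_closed cpos_ip)
  then have "cpos (N\<^sup>2 *\<^sub>R (ip Y \<xi> \<xi> - (1 / N\<^sup>2) *\<^sub>R ip Y (T \<xi>) (T \<xi>)))" by (rule cpos_scaleR) simp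
  then show ?thesis using N by (simp add: scaleR_diff_right)
qed

lemma pos_functional_ip_sym:
  assumes \<tau>: "pos_functional \<tau>" and x: "\<xi> \<in> carrier Y" "\<eta> \<in> carrier Y"
  shows "\<tau> (ip Y \<eta> \<xi>) = cnj (\<tau> (ip Y \<xi> \<eta>))"
    and "(cmod (\<tau> (ip Y \<xi> \<eta>)))\<^sup>2 \<le> Re (\<tau> (ip Y \<xi> \<xi>)) * Re (\<tau> (ip Y \<eta> \<eta>))"
proof -
  have "\<tau> (ip Y \<xi> \<xi>) + c * \<tau> (ip Y \<xi> \<eta>) + cnj c * \<tau> (ip Y \<eta> \<xi>) + cnj c * c * \<tau> (ip Y \<eta> \<eta>) \<in> \<real>\<^sub>\<ge>\<^sub>0" for c
  proof -
    have "\<tau> (ip Y (\<xi> + c *\<^sub>C \<eta>) (\<xi> + c *\<^sub>C \<eta>)) \<in> \<real>\<^sub>\<ge>\<^sub>0"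
      using \<tau> x by (intro pos_functional_cpos cpos_ip closed_simps)
    then show ?thesis using \<tau> x by (simp add: ip_simps closed_simps pos_functional_simps algebra_simps)
  qed
  moreover have "\<tau> (ip Y \<eta> \<eta>) \<in> \<real>\<^sub>\<ge>\<^sub>0" using \<tau> x by (intro pos_functional_cpos cpos_ip)
  ultimately show "\<tau> (ip Y \<eta> \<xi>) = cnj (\<tau> (ip Y \<xi> \<eta>))"
    and "(cmod (\<tau> (ip Y \<xi> \<eta>)))\<^sup>2 \<le> Re (\<tau> (ip Y \<xi> \<xi>)) * Re (\<tau> (ip Y \<eta> \<eta>))"
    by (rule complex_quadratic_nonneg)+
qed

text \<open>Cauchy-Schwarz for the scalar form given by \<tau>, followed by Paschke's inequality for
  \<open>T \<xi>\<close>. The bound involves the value of \<tau> on the inner product instead of a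
  norm, so it can be summed over frames and over degrees.\<close>

lemma pos_functional_L_bound:
  assumes \<tau>: "pos_functional \<tau>" and T: "T \<in> \<L> Y" and x: "\<xi> \<in> carrier Y"
  shows "cmod (\<tau> (ip Y \<xi> (T \<xi>))) \<le> opnorm Y T * Re (\<tau> (ip Y \<xi> \<xi>))"
proof (cases "opnorm Y T \<le> 0")
  case True
  then have "T = 0" using T opnorm_zero_iff by blast
  moreover have "opnorm Y 0 = 0" using opnorm_nonneg[OF L_zero_op] True \<open>T = 0\<close> by simp
  ultimately show ?thesis using \<tau> x by (simp add: pos_functional_simps)
next
  case False
  define N where "N = opnorm Y T"
  have N: "N > 0" using False by (simp add: N_def)
  have Tx: "T \<xi> \<in> carrier Y" using T x by (simp add: L_closed)
  have r0: "Re (\<tau> (ip Y \<xi> \<xi>)) \<ge> 0"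
    using pos_functional_cpos[OF \<tau> cpos_ip[OF x]] by (simp add: complex_nonneg_Reals_iff)
  have "\<tau> (N\<^sup>2 *\<^sub>R ip Y \<xi> \<xi> - ip Y (T \<xi>) (T \<xi>)) \<in> \<real>\<^sub>\<ge>\<^sub>0"
    by (intro pos_functional_cpos[OF \<tau>] L_ip_le T x N) (simp add: N_def)
  then have "Re (\<tau> (ip Y (T \<xi>) (T \<xi>))) \<le> N\<^sup>2 * Re (\<tau> (ip Y \<xi> \<xi>))"
    using \<tau> by (simp add: pos_functional_simps complex_nonneg_Reals_iff Re_complex_of_real del: of_real_power)
  then have "Re (\<tau> (ip Y \<xi> \<xi>)) * Re (\<tau> (ip Y (T \<xi>) (T \<xi>))) \<le> Re (\<tau> (ip Y \<xi> \<xi>)) * (N\<^sup>2 * Re (\<tau> (ip Y \<xi> \<xi>)))"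
    using r0 by (rule mult_left_mono)
  with pos_functional_ip_sym(2)[OF \<tau> x Tx] have "(cmod (\<tau> (ip Y \<xi> (T \<xi>))))\<^sup>2 \<le> (N * Re (\<tau> (ip Y \<xi> \<xi>)))\<^sup>2"
    by (simp add: power2_eq_square mult.assoc mult.left_commute)
  then have "cmod (\<tau> (ip Y \<xi> (T \<xi>))) \<le> N * Re (\<tau> (ip Y \<xi> \<xi>))"
    by (rule power2_le_imp_le) (use N r0 in simp)
  then show ?thesis by (simp only: N_def)
qed

end

section \<open>States on C*-algebras of operators\<close>

locale operator_state = hilbert_module +
  fixes B \<phi>
  assumes B: "cstar_subalgebra Y B" and id_B: "id_op Y \<in> B" and state: "\<phi> \<in> states Y B"
begin

lemma B_L: "T \<in> B \<Longrightarrow> T \<in> \<L> Y"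
  using B by (auto simp: cstar_subalgebra_def)

lemma B_zero: "0 \<in> B" and B_plus: "T \<in> B \<Longrightarrow> S \<in> B \<Longrightarrow> T + S \<in> B" and B_comp: "T \<in> B \<Longrightarrow> S \<in> B \<Longrightarrow> T \<circ> S \<in> B"
  and B_scale: "T \<in> B \<Longrightarrow> c *\<^sub>C T \<in> B" and B_adj: "T \<in> B \<Longrightarrow> adj Y T \<in> B"
  using B by (auto simp: cstar_subalgebra_def)

lemma B_minus: "T \<in> B \<Longrightarrow> S \<in> B \<Longrightarrow> T - S \<in> B"
  using B_plus[OF _ B_scale[of S "-1"], of T] by simp

lemma B_sum: "(\<And>i. i \<in> I \<Longrightarrow> f i \<in> B) \<Longrightarrow> sum f I \<in> B"
  by (induction I rule: infinite_finite_induct) (auto simp: B_zero B_plus)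

lemmas B_simps = B_zero B_plus B_comp B_scale B_adj B_minus id_B

lemma st_add: "T \<in> B \<Longrightarrow> S \<in> B \<Longrightarrow> \<phi> (T + S) = \<phi> T + \<phi> S"
  and st_scaleC: "T \<in> B \<Longrightarrow> \<phi> (c *\<^sub>C T) = c * \<phi> T"
  and st_pos: "T \<in> B \<Longrightarrow> \<phi> (adj Y T \<circ> T) \<in> \<real>\<^sub>\<ge>\<^sub>0"
  and st_id: "\<phi> (id_op Y) = 1"
  and st_off: "T \<notin> B \<Longrightarrow> \<phi> T = 0"
  using state by (auto simp: states_def)

lemma st_zero: "\<phi> 0 = 0"
  using st_scaleC[of 0 0] B_zero by simp

lemma st_minus: "T \<in> B \<Longrightarrow> S \<in> B \<Longrightarrow> \<phi> (T - S) = \<phi> T - \<phi> S"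
  using st_add[of T "(-1) *\<^sub>C S"] st_scaleC[of S "-1"] B_scale[of S "-1"] by simp

lemma st_sum: "(\<And>i. i \<in> I \<Longrightarrow> f i \<in> B) \<Longrightarrow> \<phi> (sum f I) = (\<Sum>i\<in>I. \<phi> (f i))"
  by (induction I rule: infinite_finite_induct) (auto simp: st_zero st_add B_sum)

lemma st_CS:
  assumes S: "S \<in> B" and T: "T \<in> B"
  shows "\<phi> (adj Y S \<circ> T) = cnj (\<phi> (adj Y T \<circ> S))"
    and "(cmod (\<phi> (adj Y S \<circ> T)))\<^sup>2 \<le> Re (\<phi> (adj Y S \<circ> S)) * Re (\<phi> (adj Y T \<circ> T))"
proof -
  have "\<phi> (adj Y P \<circ> P) + c * \<phi> (adj Y P \<circ> R) + cnj c * \<phi> (adj Y R \<circ> P) + cnj c * c * \<phi> (adj Y R \<circ> R) \<in> \<real>\<^sub>\<ge>\<^sub>0"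
    if "P \<in> B" "R \<in> B" for c P R
  proof -
    have "\<phi> (adj Y (P + c *\<^sub>C R) \<circ> (P + c *\<^sub>C R)) \<in> \<real>\<^sub>\<ge>\<^sub>0" using that by (intro st_pos B_simps)
    also have "adj Y (P + c *\<^sub>C R) \<circ> (P + c *\<^sub>C R) =
      (adj Y P \<circ> P) + c *\<^sub>C (adj Y P \<circ> R) + (cnj c *\<^sub>C (adj Y R \<circ> P) + (cnj c * c) *\<^sub>C (adj Y R \<circ> R))"
      using that by (simp add: adj_simps B_L L_simps comp_plus_left comp_plus_right comp_scale_left comp_scale_right
          scaleC_scaleC scaleC_add_right mult.commute)
    also have "\<phi> ((adj Y P \<circ> P) + c *\<^sub>C (adj Y P \<circ> R) + (cnj c *\<^sub>C (adj Y R \<circ> P) + (cnj c * c) *\<^sub>C (adj Y R \<circ> R)))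
      = \<phi> (adj Y P \<circ> P) + c * \<phi> (adj Y P \<circ> R) + (cnj c * \<phi> (adj Y R \<circ> P) + (cnj c * c) * \<phi> (adj Y R \<circ> R))"
      using that by (simp only: st_add st_scaleC B_simps)
    finally show ?thesis by (simp only: add.assoc)
  qed
  note * = complex_quadratic_nonneg[OF this st_pos]
  show "\<phi> (adj Y S \<circ> T) = cnj (\<phi> (adj Y T \<circ> S))" using *(1)[OF T S S] .
  show "(cmod (\<phi> (adj Y S \<circ> T)))\<^sup>2 \<le> Re (\<phi> (adj Y S \<circ> S)) * Re (\<phi> (adj Y T \<circ> T))" using *(2)[OF S T T] .
qed

lemma st_adj: "T \<in> B \<Longrightarrow> \<phi> (adj Y T) = cnj (\<phi> T)"
  using st_CS(1)[of T "id_op Y"] id_B by (simp add: comp_id_left comp_id_right adj_simps B_L L_simps)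

text \<open>By Cauchy-Schwarz the elements \<open>T\<close> annihilated in this sense form a left
  ideal on which the state vanishes.\<close>

lemma st_null:
  assumes T: "T \<in> B" and S: "S \<in> B" and z: "\<phi> (adj Y T \<circ> T) = 0"
  shows "\<phi> (S \<circ> T) = 0" "\<phi> (adj Y T \<circ> S) = 0"
proof -
  have "(cmod (\<phi> (adj Y (adj Y S) \<circ> T)))\<^sup>2 \<le> 0" using st_CS(2)[OF B_adj[OF S] T] z by simp
  then show "\<phi> (S \<circ> T) = 0" using S by (simp add: adj_simps B_L)
  have "(cmod (\<phi> (adj Y T \<circ> S)))\<^sup>2 \<le> 0" using st_CS(2)[OF T S] z by simp
  then show "\<phi> (adj Y T \<circ> S) = 0" by simp
qed

text \<open>States are defined by positivity; contractivity comes from the witness \<open>S\<close>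
  in \<open>B\<close> for T* T \<le> N^2 together with Cauchy-Schwarz against the identity.\<close>

lemma st_bound:
  assumes T: "T \<in> B" shows "cmod (\<phi> T) \<le> opnorm Y T"
proof (cases "opnorm Y T \<le> 0")
  case True
  then have "T = 0" using T B_L opnorm_zero_iff by blast
  then show ?thesis using opnorm_nonneg[OF B_L[OF T]] by (simp add: st_zero)
next
  case False
  define N where "N = opnorm Y T"
  have N: "N > 0" using False by (simp add: N_def)
  obtain S where S: "S \<in> B" "adj Y S \<circ> S = id_op Y - complex_of_real (1 / N\<^sup>2) *\<^sub>C (adj Y T \<circ> T)"
    using cstar_subalgebra_contraction[OF B id_B T _ N] N_def by blast
  have "\<phi> (adj Y S \<circ> S) = 1 - complex_of_real (1 / N\<^sup>2) * \<phi> (adj Y T \<circ> T)"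
    unfolding S(2) using T by (simp only: st_minus st_scaleC st_id B_simps)
  then have "1 - (1 / N\<^sup>2) * Re (\<phi> (adj Y T \<circ> T)) \<ge> 0"
    using st_pos[OF S(1)] unfolding complex_nonneg_Reals_iff by simp
  then have le: "Re (\<phi> (adj Y T \<circ> T)) \<le> N\<^sup>2" using N by (simp add: field_simps)
  have "(cmod (\<phi> (adj Y (id_op Y) \<circ> T)))\<^sup>2 \<le> Re (\<phi> (adj Y (id_op Y) \<circ> id_op Y)) * Re (\<phi> (adj Y T \<circ> T))"
    by (rule st_CS(2)[OF id_B T])
  then have "(cmod (\<phi> T))\<^sup>2 \<le> N\<^sup>2" using le T by (simp add: adj_id comp_id_left B_L L_id_op st_id)
  then have "cmod (\<phi> T) \<le> N" by (rule power2_le_imp_le) (use N in simp)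
  then show ?thesis by (simp only: N_def)
qed

end

section \<open>Interior tensor products and finite decompositions\<close>

context correspondence
begin

lemma left_op_L: "left_op Y a \<in> \<L> Y"
  using left_op_star adjointablesI by blast

lemma lact_eq: "\<xi> \<in> carrier Y \<Longrightarrow> lact Y a \<xi> = left_op Y a \<xi>"
  by (simp add: left_op_def)

lemma lact_closed: "\<xi> \<in> carrier Y \<Longrightarrow> lact Y a \<xi> \<in> carrier Y"
  using L_closed[OF left_op_L] by (simp add: lact_eq)

lemma lact_zero [simp]: "lact Y a 0 = 0"
  by (simp add: lact_eq zero_closed L_zero[OF left_op_L])

lemma lact_plus: "\<xi> \<in> carrier Y \<Longrightarrow> lact Y (a + b) \<xi> = lact Y a \<xi> + lact Y b \<xi>"
  by (simp add: lact_eq left_op_add)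

lemma lact_scaleC_left: "\<xi> \<in> carrier Y \<Longrightarrow> lact Y (c *\<^sub>C a) \<xi> = c *\<^sub>C lact Y a \<xi>"
  by (simp add: lact_eq left_op_scaleC scaleC_fun_def)

lemma lact_zero_left [simp]: "\<xi> \<in> carrier Y \<Longrightarrow> lact Y 0 \<xi> = 0"
  using lact_scaleC_left[of \<xi> 0 0] by simp

lemma lact_minus: "\<xi> \<in> carrier Y \<Longrightarrow> lact Y (a - b) \<xi> = lact Y a \<xi> - lact Y b \<xi>"
  using lact_plus[of \<xi> a "- b"] lact_scaleC_left[of \<xi> "-1" b] by simp

lemma lact_mult: "\<xi> \<in> carrier Y \<Longrightarrow> lact Y (a * b) \<xi> = lact Y a (lact Y b \<xi>)"
  using lact_closed[of \<xi> b] by (simp add: lact_eq left_op_mult)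

lemma ip_lact_left: "\<xi> \<in> carrier Y \<Longrightarrow> \<eta> \<in> carrier Y \<Longrightarrow> ip Y (lact Y a \<xi>) \<eta> = ip Y \<xi> (lact Y (star a) \<eta>)"
  using left_op_star by (simp add: lact_eq is_adjoint_def)

text \<open>The difference is the left action of \<open>norm a\<close> squared minus a* a = b* b,
  hence an inner product of a vector with itself. The action of 1 appears because in a general
  correspondence it is only a projection.\<close>

lemma cpos_lact:
  assumes "\<xi> \<in> carrier Y"
  shows "cpos ((norm a)\<^sup>2 *\<^sub>R ip Y (lact Y 1 \<xi>) (lact Y 1 \<xi>) - ip Y (lact Y a \<xi>) (lact Y a \<xi>))"
proof -
  obtain b where b: "(norm a)\<^sup>2 *\<^sub>R 1 - star a * a = star b * b" using cpos_norm_square_minus by metis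
  have "(norm a)\<^sup>2 *\<^sub>R ip Y (lact Y 1 \<xi>) (lact Y 1 \<xi>) - ip Y (lact Y a \<xi>) (lact Y a \<xi>)
     = ip Y \<xi> (lact Y ((norm a)\<^sup>2 *\<^sub>R 1 - star a * a) \<xi>)"
  proof -
    have "lact Y (of_real ((norm a)\<^sup>2) *\<^sub>C 1) \<xi> = of_real ((norm a)\<^sup>2) *\<^sub>C lact Y 1 \<xi>"
      by (rule lact_scaleC_left[OF assms])
    then have "lact Y ((norm a)\<^sup>2 *\<^sub>R 1) \<xi> = (norm a)\<^sup>2 *\<^sub>R lact Y 1 \<xi>" unfolding scaleC_of_real .
    moreover have "ip Y (lact Y 1 \<xi>) (lact Y 1 \<xi>) = ip Y \<xi> (lact Y 1 \<xi>)"
      using assms by (simp add: ip_lact_left lact_closed lact_mult[symmetric])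
    ultimately show ?thesis
      using assms by (simp add: lact_minus lact_mult ip_simps closed_simps lact_closed ip_lact_left)
  qed
  also have "\<dots> = ip Y (lact Y b \<xi>) (lact Y b \<xi>)" unfolding b
    using assms by (simp add: lact_mult ip_lact_left lact_closed)
  finally show ?thesis using assms by (simp add: cpos_ip lact_closed)
qed

end

locale unital_correspondence = correspondence +
  assumes lact_one: "\<xi> \<in> carrier Y \<Longrightarrow> lact Y 1 \<xi> = \<xi>"
begin

lemma cpos_lact': "\<xi> \<in> carrier Y \<Longrightarrow> cpos ((norm a)\<^sup>2 *\<^sub>R ip Y \<xi> \<xi> - ip Y (lact Y a \<xi>) (lact Y a \<xi>))"
  using cpos_lact[of \<xi> a] by (simp add: lact_one)

lemma mnorm_lact:
  assumes "\<xi> \<in> carrier Y" shows "mnorm Y (lact Y a \<xi>) \<le> norm a * mnorm Y \<xi>"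
proof (rule power2_le_imp_le)
  have "norm (ip Y (lact Y a \<xi>) (lact Y a \<xi>)) \<le> norm ((norm a)\<^sup>2 *\<^sub>R ip Y \<xi> \<xi>)"
    using assms by (intro cpos_norm_mono cpos_ip cpos_lact' lact_closed)
  then show "(mnorm Y (lact Y a \<xi>))\<^sup>2 \<le> (norm a * mnorm Y \<xi>)\<^sup>2"
    by (simp add: power_mult_distrib mnorm_square)
qed (simp add: mnorm_nonneg)

end

text \<open>A finite Parseval frame of the module with an arbitrary index set, so that products and
  reindexed families are again of this kind.\<close>

definition is_dec :: "('a::unital_cstar_algebra, 'x::complex_vector) corr \<Rightarrow> 'j set \<Rightarrow> ('j \<Rightarrow> 'x) \<Rightarrow> bool" where
  "is_dec Y J y \<longleftrightarrow> finite J \<and> (\<forall>j\<in>J. y j \<in> carrier Y) \<and>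
     (\<forall>\<xi>\<in>carrier Y. \<xi> = (\<Sum>j\<in>J. ract Y (y j) (ip Y (y j) \<xi>)))"

lemma is_dec_finite: "is_dec Y J y \<Longrightarrow> finite J"
  and is_dec_closed: "is_dec Y J y \<Longrightarrow> j \<in> J \<Longrightarrow> y j \<in> carrier Y"
  and is_dec_sum: "is_dec Y J y \<Longrightarrow> \<xi> \<in> carrier Y \<Longrightarrow> (\<Sum>j\<in>J. ract Y (y j) (ip Y (y j) \<xi>)) = \<xi>"
  unfolding is_dec_def by auto

lemma is_decI: "finite J \<Longrightarrow> (\<And>j. j \<in> J \<Longrightarrow> y j \<in> carrier Y) \<Longrightarrow>
    (\<And>\<xi>. \<xi> \<in> carrier Y \<Longrightarrow> (\<Sum>j\<in>J. ract Y (y j) (ip Y (y j) \<xi>)) = \<xi>) \<Longrightarrow> is_dec Y J y"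
  unfolding is_dec_def by (intro conjI ballI) simp_all

lemma is_dec_cong: "(\<And>j. j \<in> J \<Longrightarrow> y j = z j) \<Longrightarrow> is_dec Y J y \<longleftrightarrow> is_dec Y J z"
  unfolding is_dec_def by (auto cong: sum.cong)

lemma is_dec_reindex:
  assumes "is_dec Y J y" "bij_betw f K J"
  shows "is_dec Y K (y \<circ> f)"
proof (rule is_decI)
  show "finite K" using assms is_dec_finite bij_betw_finite by blast
  show "(y \<circ> f) k \<in> carrier Y" if "k \<in> K" for k
    using is_dec_closed[OF assms(1), of "f k"] assms(2) that by (auto simp: bij_betw_def)
  show "(\<Sum>k\<in>K. ract Y ((y \<circ> f) k) (ip Y ((y \<circ> f) k) \<xi>)) = \<xi>" if "\<xi> \<in> carrier Y" for \<xi>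
    using sum.reindex_bij_betw[OF assms(2), of "\<lambda>j. ract Y (y j) (ip Y (y j) \<xi>)"] is_dec_sum[OF assms(1) that]
    by (simp only: comp_apply)
qed

context hilbert_module
begin

lemma is_dec_expand:
  assumes d: "is_dec Y J y" and x: "\<xi> \<in> carrier Y" "\<eta> \<in> carrier Y"
  shows "ip Y \<xi> \<eta> = (\<Sum>j\<in>J. ip Y \<xi> (y j) * ip Y (y j) \<eta>)"
proof -
  have "ip Y \<xi> \<eta> = ip Y \<xi> (\<Sum>j\<in>J. ract Y (y j) (ip Y (y j) \<eta>))" by (simp only: is_dec_sum[OF d x(2)])
  also have "\<dots> = (\<Sum>j\<in>J. ip Y \<xi> (y j) * ip Y (y j) \<eta>)"
    using is_dec_closed[OF d] x by (simp add: ip_sum_right ip_ract ract_closed)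
  finally show ?thesis .
qed

end

locale corr_tensor = interior_tensor Y Z W p + Y: unital_correspondence Y + Z: unital_correspondence Z + W: unital_correspondence W
  for Y Z W :: "('a::unital_cstar_algebra, 'x::complex_vector) corr" and p
begin

lemma p_zero_left [simp]: "\<eta> \<in> carrier Z \<Longrightarrow> p 0 \<eta> = 0"
  using p_scaleC_left[of 0 \<eta> 0] Y.zero_closed by simp

lemma p_zero_right [simp]: "\<xi> \<in> carrier Y \<Longrightarrow> p \<xi> 0 = 0"
  using p_scaleC_right[of \<xi> 0 0] Z.zero_closed by simp

lemma p_sum_left: "\<eta> \<in> carrier Z \<Longrightarrow> (\<And>i. i \<in> I \<Longrightarrow> f i \<in> carrier Y) \<Longrightarrow> p (sum f I) \<eta> = (\<Sum>i\<in>I. p (f i) \<eta>)"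
  by (induction I rule: infinite_finite_induct) (auto simp: p_add_left Y.sum_closed)

lemma p_sum_right: "\<xi> \<in> carrier Y \<Longrightarrow> (\<And>i. i \<in> I \<Longrightarrow> f i \<in> carrier Z) \<Longrightarrow> p \<xi> (sum f I) = (\<Sum>i\<in>I. p \<xi> (f i))"
  by (induction I rule: infinite_finite_induct) (auto simp: p_add_right Z.sum_closed)

text \<open>The difference \<open>d\<close> is orthogonal to all elementary tensors, hence to the
  finite sums \<open>?u\<close> approximating it; therefore its squared norm is at most the
  approximation error times the norm of \<open>d\<close>.\<close>

lemma tensor_eqI:
  assumes z: "\<zeta> \<in> carrier W" "\<zeta>' \<in> carrier W"
    and eq: "\<And>\<xi> \<eta>. \<xi> \<in> carrier Y \<Longrightarrow> \<eta> \<in> carrier Z \<Longrightarrow> ip W (p \<xi> \<eta>) \<zeta> = ip W (p \<xi> \<eta>) \<zeta>'"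
  shows "\<zeta> = \<zeta>'"
proof -
  define d where "d = \<zeta> - \<zeta>'"
  have d: "d \<in> carrier W" using z by (simp add: d_def W.diff_closed)
  have "mnorm W d \<le> e" if e: "e > 0" for e
  proof -
    obtain k :: nat and s s' where s: "\<And>j. j < k \<Longrightarrow> s j \<in> carrier Y \<and> s' j \<in> carrier Z"
      and near: "mnorm W (d - (\<Sum>j<k. p (s j) (s' j))) < e" using p_total[OF d e] by metis
    let ?u = "\<Sum>j<k. p (s j) (s' j)"
    have u: "?u \<in> carrier W" using s by (intro W.sum_closed p_closed) auto
    have "ip W ?u d = (\<Sum>j<k. ip W (p (s j) (s' j)) d)" using d s by (intro W.ip_sum_left p_closed) auto
    also have "\<dots> = 0" using s z by (intro sum.neutral) (auto simp: d_def W.ip_diff_right p_closed eq)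
    finally have "(mnorm W d)\<^sup>2 = norm (ip W (d - ?u) d)"
      using d u by (simp add: W.mnorm_square W.ip_diff_left)
    also have "\<dots> \<le> mnorm W (d - ?u) * mnorm W d" using d u by (intro W.ip_CS W.diff_closed)
    also have "\<dots> \<le> e * mnorm W d" using near W.mnorm_nonneg by (intro mult_right_mono) auto
    finally have "mnorm W d * mnorm W d \<le> e * mnorm W d" by (simp add: power2_eq_square)
    then show ?thesis using W.mnorm_nonneg[of d] e by (cases "mnorm W d = 0") (auto simp: mult_le_cancel_right)
  qed
  then have "mnorm W d \<le> 0" by (meson dense_le not_le order_less_le_trans field_le_epsilon add.left_neutral)
  then have "d = 0" using W.mnorm_eq_0[OF d] W.mnorm_nonneg[of d] by simp
  then show ?thesis by (simp add: d_def)
qed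

lemma mnorm_p:
  assumes "\<xi> \<in> carrier Y" "\<eta> \<in> carrier Z"
  shows "mnorm W (p \<xi> \<eta>) \<le> mnorm Y \<xi> * mnorm Z \<eta>"
proof (rule power2_le_imp_le)
  have "(mnorm W (p \<xi> \<eta>))\<^sup>2 = norm (ip Z \<eta> (lact Z (ip Y \<xi> \<xi>) \<eta>))"
    using assms by (simp add: W.mnorm_square p_ip)
  also have "\<dots> \<le> mnorm Z \<eta> * mnorm Z (lact Z (ip Y \<xi> \<xi>) \<eta>)"
    using assms by (intro Z.ip_CS Z.lact_closed)
  also have "\<dots> \<le> mnorm Z \<eta> * (norm (ip Y \<xi> \<xi>) * mnorm Z \<eta>)"
    using assms by (intro mult_left_mono Z.mnorm_lact Z.mnorm_nonneg)
  also have "\<dots> = (mnorm Y \<xi> * mnorm Z \<eta>)\<^sup>2"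
    unfolding Y.mnorm_square[symmetric] by (simp add: power2_eq_square)
  finally show "(mnorm W (p \<xi> \<eta>))\<^sup>2 \<le> (mnorm Y \<xi> * mnorm Z \<eta>)\<^sup>2" .
qed (simp add: Y.mnorm_nonneg Z.mnorm_nonneg)

text \<open>\<open>w\<close> is the vector obtained from \<zeta> by annihilating \<xi>: the value at
  \<zeta> of the adjoint of multiplication by \<xi> from the left. It is a relation because
  existence still has to be proved.\<close>

definition creates :: "'x \<Rightarrow> 'x \<Rightarrow> 'x \<Rightarrow> bool" where
  "creates \<xi> \<zeta> w \<longleftrightarrow> w \<in> carrier Z \<and> (\<forall>\<omega>\<in>carrier Z. ip Z \<omega> w = ip W (p \<xi> \<omega>) \<zeta>)"

lemma creates_norm:
  assumes x: "\<xi> \<in> carrier Y" and z: "\<zeta> \<in> carrier W" and w: "creates \<xi> \<zeta> w"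
  shows "mnorm Z w \<le> mnorm Y \<xi> * mnorm W \<zeta>"
proof -
  have wZ: "w \<in> carrier Z" using w by (simp add: creates_def)
  have "(mnorm Z w)\<^sup>2 = norm (ip W (p \<xi> w) \<zeta>)" using w wZ by (simp add: Z.mnorm_square creates_def)
  also have "\<dots> \<le> mnorm W (p \<xi> w) * mnorm W \<zeta>" using x z wZ by (intro W.ip_CS p_closed)
  also have "\<dots> \<le> mnorm Y \<xi> * mnorm Z w * mnorm W \<zeta>" using x wZ by (intro mult_right_mono mnorm_p W.mnorm_nonneg)
  finally have "mnorm Z w * mnorm Z w \<le> (mnorm Y \<xi> * mnorm W \<zeta>) * mnorm Z w"
    by (simp add: power2_eq_square mult.commute mult.left_commute)
  then show ?thesis using Z.mnorm_nonneg[of w] Y.mnorm_nonneg[of \<xi>] W.mnorm_nonneg[of \<zeta>]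
    by (cases "mnorm Z w = 0") (auto simp: mult_le_cancel_right)
qed

text \<open>No Riesz representation is available in a Hilbert module. On finite sums of elementary
  tensors the vector is explicit, and by \<open>creates_norm\<close> it depends continuously on
  \<zeta>, so approximants of \<zeta> give a Cauchy sequence.\<close>

lemma creates_exists:
  assumes x: "\<xi> \<in> carrier Y" and z: "\<zeta> \<in> carrier W"
  shows "\<exists>w. creates \<xi> \<zeta> w"
proof -
  have elem: "creates \<xi> (\<Sum>j<k. p (s j) (s' j)) (\<Sum>j<k. lact Z (ip Y \<xi> (s j)) (s' j))"
    if s: "\<And>j. j < k \<Longrightarrow> s j \<in> carrier Y \<and> s' j \<in> carrier Z" for k :: nat and s s'
    unfolding creates_def
  proof (intro conjI ballI)
    show "(\<Sum>j<k. lact Z (ip Y \<xi> (s j)) (s' j)) \<in> carrier Z" using s by (intro Z.sum_closed Z.lact_closed) auto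
    fix \<omega> assume o: "\<omega> \<in> carrier Z"
    have "ip Z \<omega> (\<Sum>j<k. lact Z (ip Y \<xi> (s j)) (s' j)) = (\<Sum>j<k. ip Z \<omega> (lact Z (ip Y \<xi> (s j)) (s' j)))"
      using s o by (intro Z.ip_sum_right Z.lact_closed) auto
    also have "\<dots> = (\<Sum>j<k. ip W (p \<xi> \<omega>) (p (s j) (s' j)))" using s o x by (intro sum.cong) (auto simp: p_ip)
    also have "\<dots> = ip W (p \<xi> \<omega>) (\<Sum>j<k. p (s j) (s' j))"
      using s o x by (intro W.ip_sum_right[symmetric] p_closed) auto
    finally show "ip Z \<omega> (\<Sum>j<k. lact Z (ip Y \<xi> (s j)) (s' j)) = ip W (p \<xi> \<omega>) (\<Sum>j<k. p (s j) (s' j))" .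
  qed
  have "\<exists>u w. u \<in> carrier W \<and> creates \<xi> u w \<and> mnorm W (\<zeta> - u) < 1 / real (Suc n)" for n
  proof -
    obtain k :: nat and s s' where s: "\<And>j. j < k \<Longrightarrow> s j \<in> carrier Y \<and> s' j \<in> carrier Z"
      and near: "mnorm W (\<zeta> - (\<Sum>j<k. p (s j) (s' j))) < 1 / real (Suc n)"
      using p_total[OF z, of "1 / real (Suc n)"] by force
    have "(\<Sum>j<k. p (s j) (s' j)) \<in> carrier W" using s by (intro W.sum_closed p_closed) auto
    then show ?thesis using elem[of k s s'] s near by blast
  qed
  then obtain u w where u: "\<And>n. u n \<in> carrier W" and w: "\<And>n. creates \<xi> (u n) (w n)"
    and near: "\<And>n. mnorm W (\<zeta> - u n) < 1 / real (Suc n)" by metis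
  have wZ: "w n \<in> carrier Z" for n using w by (simp add: creates_def)
  have cr_diff: "creates \<xi> (u m - u n) (w m - w n)" for m n
    using w u x unfolding creates_def by (auto simp: Z.ip_diff_right W.ip_diff_right Z.diff_closed p_closed)
  have udiff: "mnorm W (u m - u n) < 1 / real (Suc m) + 1 / real (Suc n)" for m n
    using W.mnorm_triangle_diff[OF u z u, of m n] near[of m] near[of n] W.mnorm_minus_commute[OF u z, of m] by linarith
  have wdiff: "mnorm Z (w m - w n) \<le> mnorm Y \<xi> * (1 / real (Suc m) + 1 / real (Suc n))" for m n
    using creates_norm[OF x W.diff_closed[OF u u] cr_diff, of m n] udiff[of m n] Y.mnorm_nonneg[of \<xi>]
    by (meson less_imp_le mult_left_mono order_trans)
  have "\<exists>v\<in>carrier Z. (\<lambda>k. mnorm Z (w k - v)) \<longlonglongrightarrow> 0"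
  proof (rule Z.complete[OF wZ], intro allI impI)
    fix e :: real assume e: "e > 0"
    obtain K :: nat where K: "real K > 2 * mnorm Y \<xi> / e" using reals_Archimedean2 by blast
    show "\<exists>K. \<forall>p\<ge>K. \<forall>q\<ge>K. mnorm Z (w p - w q) < e"
    proof (intro exI allI impI)
      fix p q assume pq: "K \<le> p" "K \<le> q"
      have "1 / real (Suc p) \<le> 1 / real (Suc K)" "1 / real (Suc q) \<le> 1 / real (Suc K)"
        using pq by (simp_all add: frac_le)
      then have "1 / real (Suc p) + 1 / real (Suc q) \<le> 2 / real (Suc K)" by simp
      then have "mnorm Y \<xi> * (1 / real (Suc p) + 1 / real (Suc q)) \<le> mnorm Y \<xi> * (2 / real (Suc K))"
        by (intro mult_left_mono Y.mnorm_nonneg)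
      also have "\<dots> < e" using K e by (simp add: field_simps)
      finally show "mnorm Z (w p - w q) < e" using wdiff[of p q] by linarith
    qed
  qed
  then obtain v where v: "v \<in> carrier Z" "(\<lambda>k. mnorm Z (w k - v)) \<longlonglongrightarrow> 0" by blast
  have ulim: "(\<lambda>k. mnorm W (u k - \<zeta>)) \<longlonglongrightarrow> 0"
  proof (rule Lim_null_comparison)
    show "\<forall>\<^sub>F n in sequentially. norm (mnorm W (u n - \<zeta>)) \<le> 1 / real (Suc n)"
      using near u z by (auto simp: W.mnorm_minus_commute W.mnorm_nonneg less_imp_le intro!: always_eventually)
    show "(\<lambda>n. 1 / real (Suc n)) \<longlonglongrightarrow> 0"
      using LIMSEQ_inverse_real_of_nat by (simp add: inverse_eq_divide)
  qed
  have "creates \<xi> \<zeta> v" unfolding creates_def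
  proof (intro conjI ballI v)
    fix \<omega> assume o: "\<omega> \<in> carrier Z"
    have "(\<lambda>k. ip Z \<omega> (w k)) \<longlonglongrightarrow> ip Z \<omega> v" by (intro Z.ip_tendsto_right wZ v o)
    moreover have "(\<lambda>k. ip W (p \<xi> \<omega>) (u k)) \<longlonglongrightarrow> ip W (p \<xi> \<omega>) \<zeta>"
      by (intro W.ip_tendsto_right u z ulim p_closed x o)
    moreover have "ip Z \<omega> (w k) = ip W (p \<xi> \<omega>) (u k)" for k using w o by (simp add: creates_def)
    ultimately show "ip Z \<omega> v = ip W (p \<xi> \<omega>) \<zeta>" using LIMSEQ_unique by simp
  qed
  then show ?thesis by blast
qed

definition tstar :: "'x \<Rightarrow> 'x \<Rightarrow> 'x" where
  "tstar \<xi> \<zeta> = (SOME w. creates \<xi> \<zeta> w)"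

lemma tstar_closed: "\<xi> \<in> carrier Y \<Longrightarrow> \<zeta> \<in> carrier W \<Longrightarrow> tstar \<xi> \<zeta> \<in> carrier Z"
  and tstar_ip: "\<xi> \<in> carrier Y \<Longrightarrow> \<zeta> \<in> carrier W \<Longrightarrow> \<omega> \<in> carrier Z \<Longrightarrow> ip Z \<omega> (tstar \<xi> \<zeta>) = ip W (p \<xi> \<omega>) \<zeta>"
  using someI_ex[OF creates_exists, of \<xi> \<zeta>] by (auto simp: tstar_def creates_def)

lemma tstar_ip_left:
  assumes "\<xi> \<in> carrier Y" "\<zeta> \<in> carrier W" "\<omega> \<in> carrier Z"
  shows "ip Z (tstar \<xi> \<zeta>) \<omega> = ip W \<zeta> (p \<xi> \<omega>)"
  using tstar_ip[OF assms] assms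
  by (metis W.ip_star Z.ip_star p_closed tstar_closed)

lemma tstar_p: "\<xi> \<in> carrier Y \<Longrightarrow> \<xi>' \<in> carrier Y \<Longrightarrow> \<eta> \<in> carrier Z \<Longrightarrow> tstar \<xi> (p \<xi>' \<eta>) = lact Z (ip Y \<xi> \<xi>') \<eta>"
  by (rule Z.ip_eqI) (auto simp: tstar_closed p_closed Z.lact_closed tstar_ip p_ip)

text \<open>Creating after annihilating, summed over a frame, is the identity of the tensor product.
  Tested against an elementary tensor, the sum reassembles its left factor from the frame.\<close>

lemma tstar_dec:
  assumes d: "is_dec Y J y" and z: "\<zeta> \<in> carrier W"
  shows "\<zeta> = (\<Sum>j\<in>J. p (y j) (tstar (y j) \<zeta>))"
proof (rule tensor_eqI)
  have y: "y j \<in> carrier Y" if "j \<in> J" for j using is_dec_closed[OF d that] .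
  show "(\<Sum>j\<in>J. p (y j) (tstar (y j) \<zeta>)) \<in> carrier W"
    using y z by (intro W.sum_closed p_closed tstar_closed) auto
  fix \<xi> \<eta> assume s: "\<xi> \<in> carrier Y" "\<eta> \<in> carrier Z"
  have "ip W (p \<xi> \<eta>) (\<Sum>j\<in>J. p (y j) (tstar (y j) \<zeta>)) = (\<Sum>j\<in>J. ip W (p \<xi> \<eta>) (p (y j) (tstar (y j) \<zeta>)))"
    using y z s by (intro W.ip_sum_right p_closed tstar_closed) auto
  also have "\<dots> = (\<Sum>j\<in>J. ip W (p (ract Y (y j) (ip Y (y j) \<xi>)) \<eta>) \<zeta>)"
  proof (rule sum.cong[OF refl])
    fix j assume "j \<in> J"
    then have yj: "y j \<in> carrier Y" by (rule y)
    have "ip W (p \<xi> \<eta>) (p (y j) (tstar (y j) \<zeta>)) = ip Z (lact Z (ip Y (y j) \<xi>) \<eta>) (tstar (y j) \<zeta>)"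
      using yj s z by (simp add: p_ip tstar_closed Z.ip_lact_left Y.ip_star)
    also have "\<dots> = ip W (p (y j) (lact Z (ip Y (y j) \<xi>) \<eta>)) \<zeta>"
      using yj s z by (simp add: tstar_ip Z.lact_closed)
    finally show "ip W (p \<xi> \<eta>) (p (y j) (tstar (y j) \<zeta>)) = ip W (p (ract Y (y j) (ip Y (y j) \<xi>)) \<eta>) \<zeta>"
      using yj s by (simp add: p_balanced)
  qed
  also have "\<dots> = ip W (\<Sum>j\<in>J. p (ract Y (y j) (ip Y (y j) \<xi>)) \<eta>) \<zeta>"
    using y s z by (intro W.ip_sum_left[symmetric] p_closed Y.ract_closed) auto
  also have "(\<Sum>j\<in>J. p (ract Y (y j) (ip Y (y j) \<xi>)) \<eta>) = p (\<Sum>j\<in>J. ract Y (y j) (ip Y (y j) \<xi>)) \<eta>"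
    using y s by (intro p_sum_left[symmetric] Y.ract_closed) auto
  also have "(\<Sum>j\<in>J. ract Y (y j) (ip Y (y j) \<xi>)) = \<xi>" by (rule is_dec_sum[OF d s(1)])
  finally show "ip W (p \<xi> \<eta>) \<zeta> = ip W (p \<xi> \<eta>) (\<Sum>j\<in>J. p (y j) (tstar (y j) \<zeta>))" by simp
qed (rule z)

lemma tstar_parseval:
  assumes d: "is_dec Y J y" and z: "\<zeta> \<in> carrier W"
  shows "ip W \<zeta> \<zeta> = (\<Sum>j\<in>J. ip Z (tstar (y j) \<zeta>) (tstar (y j) \<zeta>))"
proof -
  have y: "y j \<in> carrier Y" if "j \<in> J" for j using is_dec_closed[OF d that] .
  have "ip W \<zeta> \<zeta> = ip W \<zeta> (\<Sum>j\<in>J. p (y j) (tstar (y j) \<zeta>))" by (simp only: tstar_dec[OF d z, symmetric])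
  also have "\<dots> = (\<Sum>j\<in>J. ip W \<zeta> (p (y j) (tstar (y j) \<zeta>)))"
    using y z by (intro W.ip_sum_right p_closed tstar_closed) auto
  also have "\<dots> = (\<Sum>j\<in>J. ip Z (tstar (y j) \<zeta>) (tstar (y j) \<zeta>))"
    using y z by (intro sum.cong) (auto simp: tstar_ip_left tstar_closed)
  finally show ?thesis .
qed

text \<open>Reduces annihilation by an arbitrary vector to annihilation by frame vectors, where
  Parseval's identity gives bounds.\<close>

lemma tstar_dec_left:
  assumes d: "is_dec Y J y" and x: "\<xi> \<in> carrier Y" and z: "\<zeta> \<in> carrier W"
  shows "tstar \<xi> \<zeta> = (\<Sum>j\<in>J. lact Z (ip Y \<xi> (y j)) (tstar (y j) \<zeta>))"
proof (rule Z.ip_eqI)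
  have y: "y j \<in> carrier Y" if "j \<in> J" for j using is_dec_closed[OF d that] .
  show "tstar \<xi> \<zeta> \<in> carrier Z" using x z by (rule tstar_closed)
  show "(\<Sum>j\<in>J. lact Z (ip Y \<xi> (y j)) (tstar (y j) \<zeta>)) \<in> carrier Z"
    using y z by (intro Z.sum_closed Z.lact_closed tstar_closed) auto
  fix \<omega> assume o: "\<omega> \<in> carrier Z"
  have "ip Z \<omega> (tstar \<xi> \<zeta>) = ip W (p \<xi> \<omega>) (\<Sum>j\<in>J. p (y j) (tstar (y j) \<zeta>))"
    using x z o by (simp only: tstar_ip tstar_dec[OF d z, symmetric])
  also have "\<dots> = (\<Sum>j\<in>J. ip W (p \<xi> \<omega>) (p (y j) (tstar (y j) \<zeta>)))"
    using y z x o by (intro W.ip_sum_right p_closed tstar_closed) auto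
  also have "\<dots> = (\<Sum>j\<in>J. ip Z \<omega> (lact Z (ip Y \<xi> (y j)) (tstar (y j) \<zeta>)))"
    using y z x o by (intro sum.cong) (auto simp: p_ip tstar_closed)
  also have "\<dots> = ip Z \<omega> (\<Sum>j\<in>J. lact Z (ip Y \<xi> (y j)) (tstar (y j) \<zeta>))"
    using y z o by (intro Z.ip_sum_right[symmetric] Z.lact_closed tstar_closed) auto
  finally show "ip Z \<omega> (tstar \<xi> \<zeta>) = ip Z \<omega> (\<Sum>j\<in>J. lact Z (ip Y \<xi> (y j)) (tstar (y j) \<zeta>))" .
qed

text \<open>Expand along the left frame by \<open>tstar_dec\<close>, then each annihilated vector
  along the right frame. Iterating this from the fibres over unit vectors produces the
  words.\<close>

lemma is_dec_tensor:
  assumes d: "is_dec Y J y" and e: "is_dec Z K z"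
  shows "is_dec W (J \<times> K) (\<lambda>(j, k). p (y j) (z k))"
  unfolding is_dec_def
proof (intro conjI ballI)
  have y: "y j \<in> carrier Y" if "j \<in> J" for j using is_dec_closed[OF d that] .
  have zk: "z k \<in> carrier Z" if "k \<in> K" for k using is_dec_closed[OF e that] .
  show "finite (J \<times> K)" using is_dec_finite[OF d] is_dec_finite[OF e] by simp
  show "\<And>jk. jk \<in> J \<times> K \<Longrightarrow> (case jk of (j, k) \<Rightarrow> p (y j) (z k)) \<in> carrier W"
    using y zk by (auto simp: p_closed)
  fix \<zeta> assume z: "\<zeta> \<in> carrier W"
  have "\<zeta> = (\<Sum>j\<in>J. p (y j) (tstar (y j) \<zeta>))" by (rule tstar_dec[OF d z])
  also have "\<dots> = (\<Sum>j\<in>J. \<Sum>k\<in>K. ract W (p (y j) (z k)) (ip W (p (y j) (z k)) \<zeta>))"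
  proof (rule sum.cong[OF refl])
    fix j assume j: "j \<in> J"
    have "p (y j) (tstar (y j) \<zeta>) = p (y j) (\<Sum>k\<in>K. ract Z (z k) (ip Z (z k) (tstar (y j) \<zeta>)))"
      by (simp only: is_dec_sum[OF e tstar_closed[OF y[OF j] z]])
    also have "\<dots> = (\<Sum>k\<in>K. p (y j) (ract Z (z k) (ip Z (z k) (tstar (y j) \<zeta>))))"
      using y[OF j] zk by (intro p_sum_right Z.ract_closed) auto
    also have "\<dots> = (\<Sum>k\<in>K. ract W (p (y j) (z k)) (ip W (p (y j) (z k)) \<zeta>))"
      using y[OF j] zk z by (intro sum.cong) (auto simp: p_ract tstar_ip)
    finally show "p (y j) (tstar (y j) \<zeta>) = (\<Sum>k\<in>K. ract W (p (y j) (z k)) (ip W (p (y j) (z k)) \<zeta>))" .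
  qed
  also have "\<dots> = (\<Sum>jk\<in>J \<times> K. ract W (case jk of (j, k) \<Rightarrow> p (y j) (z k)) (ip W (case jk of (j, k) \<Rightarrow> p (y j) (z k)) \<zeta>))"
    by (simp add: sum.cartesian_product split_def)
  finally show "\<zeta> = (\<Sum>jk\<in>J \<times> K. ract W (case jk of (j, k) \<Rightarrow> p (y j) (z k)) (ip W (case jk of (j, k) \<Rightarrow> p (y j) (z k)) \<zeta>))" .
qed

end

section \<open>Product systems: words and the Fock module\<close>

lemma (in hilbert_module) ip_tendsto_self:
  assumes s: "\<And>n. s n \<in> carrier Y" and x: "\<xi> \<in> carrier Y" and lim: "(\<lambda>n. mnorm Y (s n - \<xi>)) \<longlonglongrightarrow> 0"
  shows "(\<lambda>n::nat. ip Y (s n) (s n)) \<longlonglongrightarrow> ip Y \<xi> \<xi>"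
proof -
  have "(\<lambda>n. ip Y (s n - \<xi>) (s n - \<xi>)) \<longlonglongrightarrow> 0"
  proof (rule tendsto_norm_zero_cancel)
    have "(\<lambda>n. (mnorm Y (s n - \<xi>))\<^sup>2) \<longlonglongrightarrow> 0\<^sup>2" by (intro tendsto_intros lim)
    then show "(\<lambda>n. norm (ip Y (s n - \<xi>) (s n - \<xi>))) \<longlonglongrightarrow> 0" by (simp add: mnorm_square)
  qed
  moreover have "(\<lambda>n. ip Y (s n) \<xi>) \<longlonglongrightarrow> ip Y \<xi> \<xi>" "(\<lambda>n. ip Y \<xi> (s n)) \<longlonglongrightarrow> ip Y \<xi> \<xi>"
    by (intro ip_tendsto_left ip_tendsto_right s x lim)+
  ultimately have "(\<lambda>n. ip Y (s n - \<xi>) (s n - \<xi>) + ip Y (s n) \<xi> + ip Y \<xi> (s n) - ip Y \<xi> \<xi>) \<longlonglongrightarrow> 0 + ip Y \<xi> \<xi> + ip Y \<xi> \<xi> - ip Y \<xi> \<xi>"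
    by (intro tendsto_intros)
  moreover have "ip Y (s n - \<xi>) (s n - \<xi>) + ip Y (s n) \<xi> + ip Y \<xi> (s n) - ip Y \<xi> \<xi> = ip Y (s n) (s n)" for n
    using s x by (simp add: ip_simps closed_simps)
  ultimately show ?thesis by simp
qed

section \<open>Shifts of multi-indices in unordered sums\<close>

lemma nat_fun_add_diff: "n \<le> k \<Longrightarrow> n + (k - n) = (k :: 'k \<Rightarrow> nat)"
  by (auto simp: le_fun_def fun_eq_iff)

lemma nat_fun_diff_add: "(n + m) - n = (m :: 'k \<Rightarrow> nat)"
  by (auto simp: fun_eq_iff)

lemma nat_fun_le_add: "n \<le> n + (m :: 'k \<Rightarrow> nat)"
  by (auto simp: le_fun_def)

lemma nat_fun_leE: "n \<le> k \<Longrightarrow> \<exists>m. k = n + (m :: 'k \<Rightarrow> nat)"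
  using nat_fun_add_diff by metis

lemma inj_nat_fun_add: "inj (\<lambda>m. n + (m :: 'k \<Rightarrow> nat))"
  by (rule inj_on_inverseI[of _ "\<lambda>k. k - n"]) (rule nat_fun_diff_add)

lemma has_sum_shift:
  fixes g :: "('k \<Rightarrow> nat) \<Rightarrow> 'b::{comm_monoid_add,topological_space}"
  assumes "(g has_sum S) UNIV"
  shows "((\<lambda>k. if n \<le> k then g (k - n) else 0) has_sum S) UNIV"
proof -
  let ?f = "\<lambda>k. if n \<le> k then g (k - n) else 0"
  have "g = ?f \<circ> (\<lambda>m. n + m)" by (auto simp: fun_eq_iff nat_fun_diff_add[unfolded fun_eq_iff] nat_fun_le_add nat_fun_diff_add)
  then have "(?f has_sum S) (range (\<lambda>m. n + m))"
    using assms has_sum_reindex[OF inj_nat_fun_add, of ?f n S] by metis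
  moreover have "(?f has_sum S) (range (\<lambda>m. n + m)) \<longleftrightarrow> (?f has_sum S) UNIV"
    by (rule has_sum_cong_neutral) (auto dest!: nat_fun_leE)
  ultimately show ?thesis by simp
qed

lemma summable_on_shift:
  fixes g :: "('k \<Rightarrow> nat) \<Rightarrow> 'b::{comm_monoid_add,topological_space}"
  assumes "g summable_on UNIV"
  shows "(\<lambda>k. if n \<le> k then g (k - n) else 0) summable_on UNIV"
  using assms has_sum_shift unfolding summable_on_def by blast

lemma summable_on_unshift:
  fixes g :: "('k \<Rightarrow> nat) \<Rightarrow> 'b::banach"
  assumes "g summable_on UNIV"
  shows "(\<lambda>m. g (n + m)) summable_on UNIV"
proof -
  have "g summable_on range (\<lambda>m. n + m)" using summable_on_subset_banach[OF assms] by blast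
  then show ?thesis using summable_on_reindex[OF inj_nat_fun_add, of g n] by (simp add: o_def)
qed

lemma infsum_shift:
  fixes g :: "('k \<Rightarrow> nat) \<Rightarrow> 'b::{comm_monoid_add,t2_space}"
  assumes "\<And>k. \<not> n \<le> k \<Longrightarrow> f k = 0" "\<And>m. f (n + m) = g m"
  shows "infsum f UNIV = infsum g UNIV"
proof -
  have "infsum f UNIV = infsum f (range (\<lambda>m. n + m))"
    using nat_fun_leE assms(1) by (intro infsum_cong_neutral) (blast, blast, simp)
  also have "\<dots> = infsum (f \<circ> (\<lambda>m. n + m)) UNIV" by (rule infsum_reindex[OF inj_nat_fun_add])
  also have "f \<circ> (\<lambda>m. n + m) = g" using assms(2) by (simp add: fun_eq_iff)
  finally show ?thesis .
qed

text \<open>A copy of the locale of unital product systems in which the type variables have readable names.\<close>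

locale product_system_unital = unital_product_system X
  for X :: "('i::{finite,linorder}, 'a::unital_cstar_algebra, 'x::complex_vector) prod_sys"
begin

sublocale F: unital_correspondence "fib X n" for n
proof -
  interpret correspondence "fib X n" by (rule fibre)
  show "unital_correspondence (fib X n)"
    by unfold_locales (simp add: lact_eq left_op_one)
qed

sublocale T: corr_tensor "fib X n" "fib X m" "fib X (n + m)" "pmul X n m" for n m
proof -
  interpret interior_tensor "fib X n" "fib X m" "fib X (n + m)" "pmul X n m" by (rule tensor)
  show "corr_tensor (fib X n) (fib X m) (fib X (n + m)) (pmul X n m)" by unfold_locales
qed

lemma emb_closed: "emb X a \<in> carrier (fib X 0)"
  using emb_bij by (auto simp: bij_betw_def)

lemma emb_cases: "\<xi> \<in> carrier (fib X 0) \<Longrightarrow> \<exists>a. \<xi> = emb X a"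
  using emb_bij by (auto simp: bij_betw_def)

text \<open>Letter sequences whose directions are prescribed by the list \<open>ts\<close>, a form
  in which \<open>letter_prod\<close> can be treated by induction on the list.\<close>

definition valid_letters :: "('i \<Rightarrow> 'x list) \<Rightarrow> 'i list \<Rightarrow> ('i \<times> nat) list set" where
  "valid_letters x ts = {w. map fst w = ts \<and> (\<forall>q\<in>set w. snd q < length (x (fst q)))}"

text \<open>Splitting off the first letter identifies these sequences with pairs, so the frame is
  the product of the frame of one direction with the frame of the remaining directions.\<close>

lemma is_dec_letter_prod:
  assumes ud: "unit_decomposition X x"
  shows "is_dec (fib X (\<Sum>i\<leftarrow>ts. unit_vec i)) (valid_letters x ts) (letter_prod X x)"
proof (induction ts)
  case Nil
  have "ract (fib X 0) (emb X 1) (ip (fib X 0) (emb X 1) \<xi>) = \<xi>" if xi: "\<xi> \<in> carrier (fib X 0)" for \<xi>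
    using emb_cases[OF xi] by (auto simp: emb_ip emb_ract)
  moreover have "valid_letters x [] = {[]}" by (auto simp: valid_letters_def)
  ultimately have "is_dec (fib X 0) (valid_letters x []) (letter_prod X x)"
    by (intro is_decI) (auto simp: emb_closed)
  then show ?case by (simp only: list.map sum_list.Nil)
next
  case (Cons i ts)
  let ?Y = "fib X (unit_vec i)"
  have "set (x i) \<subseteq> carrier ?Y \<and> (\<forall>\<xi>\<in>carrier ?Y. \<xi> = (\<Sum>j<length (x i). ract ?Y (x i ! j) (ip ?Y (x i ! j) \<xi>)))"
    using ud unfolding unit_decomposition_def Let_def by blast
  then have 1: "is_dec ?Y {..<length (x i)} (\<lambda>j. x i ! j)"
    unfolding is_dec_def by auto
  let ?f = "\<lambda>w. (snd (hd w), tl w) :: nat \<times> ('i \<times> nat) list"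
  have bij: "bij_betw ?f (valid_letters x (i # ts)) ({..<length (x i)} \<times> valid_letters x ts)"
  proof (rule bij_betwI[where g="\<lambda>(j, w). (i, j) # w"])
    show "?f \<in> valid_letters x (i # ts) \<rightarrow> {..<length (x i)} \<times> valid_letters x ts"
      by (auto simp: valid_letters_def)
    show "(\<lambda>(j, w). (i, j) # w) \<in> {..<length (x i)} \<times> valid_letters x ts \<rightarrow> valid_letters x (i # ts)"
      by (auto simp: valid_letters_def)
    show "(case ?f w of (j, w) \<Rightarrow> (i, j) # w) = w" if "w \<in> valid_letters x (i # ts)" for w
      using that by (auto simp: valid_letters_def)
    show "?f (case jw of (j, w) \<Rightarrow> (i, j) # w) = jw" for jw by (cases jw) auto
  qed
  let ?m = "\<Sum>i\<leftarrow>ts. unit_vec i"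
  have 2: "is_dec (fib X (unit_vec i + ?m)) (valid_letters x (i # ts))
      ((\<lambda>(j, w). pmul X (unit_vec i) ?m (x i ! j) (letter_prod X x w)) \<circ> ?f)"
    by (rule is_dec_reindex[OF T.is_dec_tensor[OF 1 Cons.IH] bij])
  have "letter_prod X x w = ((\<lambda>(j, w). pmul X (unit_vec i) ?m (x i ! j) (letter_prod X x w)) \<circ> ?f) w"
    if "w \<in> valid_letters x (i # ts)" for w
  proof -
    from that have "\<exists>j v. w = (i, j) # v \<and> map fst v = ts" by (cases w) (auto simp: valid_letters_def)
    then obtain j v where w: "w = (i, j) # v" and v: "map fst v = ts" by blast
    have "(\<Sum>q\<leftarrow>v. unit_vec (fst q)) = ?m" unfolding v[symmetric] by (simp add: o_def)
    then show ?thesis by (simp add: w)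
  qed
  then have "is_dec (fib X (unit_vec i + ?m)) (valid_letters x (i # ts)) (letter_prod X x)"
    by (rule iffD2[OF is_dec_cong 2])
  then show ?case by (simp only: list.map sum_list.Cons)
qed

section \<open>Encoding of multi-words as letter sequences\<close>

lemma filter_concat_replicate:
  "distinct L \<Longrightarrow> filter (\<lambda>t. t = i) (concat (map (\<lambda>i. replicate (n i) i) L)) = (if i \<in> set L then replicate (n i) i else [])"
  by (induction L) (auto simp: filter_replicate)

lemma filter_enc:
  "distinct L \<Longrightarrow> map snd (filter (\<lambda>q. fst q = i) (concat (map (\<lambda>i. map (Pair i) (\<mu> i)) L))) = (if i \<in> set L then \<mu> i else [])"
proof (induction L)
  case (Cons k L)
  have "filter (\<lambda>q. fst q = i) (map (Pair k) (\<mu> k)) = (if i = k then map (Pair k) (\<mu> k) else [])"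
    by (auto simp: filter_map o_def)
  then show ?case using Cons by (auto simp: o_def)
qed simp

text \<open>Since the directions of \<open>w\<close> come in blocks ordered by \<open>L\<close>,
  each block is recovered by filtering for its direction, and concatenating the blocks gives
  \<open>w\<close> back.\<close>

lemma enc_filter:
  "distinct L \<Longrightarrow> map fst w = concat (map (\<lambda>i. replicate (n i) i) L) \<Longrightarrow>
    concat (map (\<lambda>i. map (Pair i) (map snd (filter (\<lambda>q. fst q = i) w))) L) = w"
proof (induction L arbitrary: w)
  case (Cons k L)
  obtain w1 w2 where w: "w = w1 @ w2" "map fst w1 = replicate (n k) k" "map fst w2 = concat (map (\<lambda>i. replicate (n i) i) L)"
    using Cons.prems(2) by (auto simp: map_eq_append_conv)
  have f1: "fst q = k" if "q \<in> set w1" for q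
    using arg_cong[OF w(2), of set] that by auto
  have f2: "fst q \<in> set L" if "q \<in> set w2" for q
  proof -
    have "fst q \<in> set (map fst w2)" using that by simp
    then show ?thesis unfolding w(3) by auto
  qed
  have "filter (\<lambda>q. fst q = k) w2 = []" using f2 Cons.prems(1) by (auto simp: filter_empty_conv)
  moreover have "filter (\<lambda>q. fst q = k) w1 = w1" using f1 by (simp add: filter_id_conv)
  moreover have "map (Pair k) (map snd w1) = w1" using f1 by (intro nth_equalityI) (auto simp: prod_eq_iff)
  moreover have "filter (\<lambda>q. fst q = i) w1 = []" if "i \<in> set L" for i
    using f1 that Cons.prems(1) by (auto simp: filter_empty_conv)
  then have "concat (map (\<lambda>i. map (Pair i) (map snd (filter (\<lambda>q. fst q = i) w))) L)
      = concat (map (\<lambda>i. map (Pair i) (map snd (filter (\<lambda>q. fst q = i) w2))) L)"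
    unfolding w(1) by (intro arg_cong[where f=concat] map_cong) auto
  ultimately show ?case using Cons.IH[OF _ w(3)] Cons.prems(1) by (simp add: w(1))
qed simp

lemma sum_list_unit_vec:
  "distinct L \<Longrightarrow> (\<Sum>i\<leftarrow>concat (map (\<lambda>i. replicate (n i) i) L). unit_vec i) k = (if k \<in> set L then n k else 0)"
proof (induction L)
  case (Cons i L)
  have "(\<Sum>i\<leftarrow>replicate m i. unit_vec i) k = (if k = i then m else 0)" for m
    by (induction m) (auto simp: unit_vec_def)
  then show ?case using Cons by auto
qed simp

definition words_of :: "('i \<Rightarrow> 'x list) \<Rightarrow> ('i \<Rightarrow> nat) \<Rightarrow> ('i \<Rightarrow> nat list) set" where
  "words_of x n = {\<mu>. \<mu> \<in> words x UNIV \<and> wlen \<mu> = n}"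

text \<open>A multi-word of degree \<open>n\<close> is the same as a letter sequence with
  \<open>n i\<close> letters of direction \<open>i\<close>, arranged in increasing order of
  \<open>i\<close>; the frame of letter sequences is transported along this bijection.\<close>

lemma is_dec_words:
  assumes ud: "unit_decomposition X x"
  shows "is_dec (fib X n) (words_of x n) (word_elt X x)"
proof -
  define L where "L = sorted_list_of_set (UNIV :: 'i set)"
  have L: "distinct L" "set L = UNIV" by (simp_all add: L_def)
  let ?ts = "concat (map (\<lambda>i. replicate (n i) i) L)"
  let ?e = "\<lambda>\<mu>. concat (map (\<lambda>i. map (Pair i) (\<mu> i)) L) :: ('i \<times> nat) list"
  let ?g = "\<lambda>w i. map snd (filter (\<lambda>q. fst q = i) w) :: nat list"
  have bij: "bij_betw ?e (words_of x n) (valid_letters x ?ts)"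
  proof (rule bij_betwI[where g="?g"])
    show "?e \<in> words_of x n \<rightarrow> valid_letters x ?ts"
    proof
      fix \<mu> assume m: "\<mu> \<in> words_of x n"
      have len: "length (\<mu> i) = n i" for i using m by (auto simp: words_of_def)
      have "map fst (?e \<mu>) = ?ts" by (simp add: map_concat o_def map_replicate_const len)
      moreover have "snd q < length (x (fst q))" if "q \<in> set (?e \<mu>)" for q
        using that m by (force simp: words_of_def words_def)
      ultimately show "?e \<mu> \<in> valid_letters x ?ts" by (simp add: valid_letters_def)
    qed
    show "?g \<in> valid_letters x ?ts \<rightarrow> words_of x n"
    proof
      fix w assume w: "w \<in> valid_letters x ?ts"
      have "length (?g w i) = n i" for i
      proof -
        have "length (?g w i) = length (filter (\<lambda>t. t = i) (map fst w))" by (simp add: filter_map o_def)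
        also have "map fst w = ?ts" using w by (simp add: valid_letters_def)
        finally show ?thesis using filter_concat_replicate[OF L(1), of i n] L(2) by simp
      qed
      moreover have "set (?g w i) \<subseteq> {..<length (x i)}" for i
        using w by (auto simp: valid_letters_def)
      ultimately show "?g w \<in> words_of x n" by (simp add: words_of_def words_def)
    qed
    show "?g (?e \<mu>) = \<mu>" for \<mu> :: "'i \<Rightarrow> nat list" using filter_enc[OF L(1), of _ \<mu>] L(2) by (simp add: fun_eq_iff)
    show "?e (?g w) = w" if "w \<in> valid_letters x ?ts" for w
      using enc_filter[OF L(1), of w n] that by (simp add: valid_letters_def)
  qed
  have "(\<Sum>i\<leftarrow>?ts. unit_vec i) = n"
    using sum_list_unit_vec[OF L(1), of n] L(2) by (simp add: fun_eq_iff)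
  then have "is_dec (fib X n) (words_of x n) (letter_prod X x \<circ> ?e)"
    using is_dec_reindex[OF is_dec_letter_prod[OF ud] bij] by metis
  moreover have "letter_prod X x \<circ> ?e = word_elt X x"
    by (simp add: fun_eq_iff word_elt_def L_def)
  ultimately show ?thesis by simp
qed

section \<open>The Fock module is a Hilbert module\<close>

lemma fock_simps: "carrier (fock X) = {\<eta>. (\<forall>m. \<eta> m \<in> carrier (fib X m)) \<and> (\<lambda>m. ip (fib X m) (\<eta> m) (\<eta> m)) summable_on UNIV}"
  "ip (fock X) \<eta> \<zeta> = (\<Sum>\<^sub>\<infinity>m. ip (fib X m) (\<eta> m) (\<zeta> m))"
  "ract (fock X) \<eta> a = (\<lambda>m. ract (fib X m) (\<eta> m) a)"
  "lact (fock X) a \<eta> = (\<lambda>m. lact (fib X m) a (\<eta> m))"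
  by (simp_all add: fock_def)

lemma fockI: "(\<And>m. \<eta> m \<in> carrier (fib X m)) \<Longrightarrow> (\<lambda>m. ip (fib X m) (\<eta> m) (\<eta> m)) summable_on UNIV \<Longrightarrow> \<eta> \<in> carrier (fock X)"
  and fock_comp: "\<eta> \<in> carrier (fock X) \<Longrightarrow> \<eta> m \<in> carrier (fib X m)"
  and fock_summable: "\<eta> \<in> carrier (fock X) \<Longrightarrow> (\<lambda>m. ip (fib X m) (\<eta> m) (\<eta> m)) summable_on UNIV"
  by (auto simp: fock_simps)

text \<open>By the parallelogram law the summands are dominated by twice the sum of those of \<eta>
  and \<zeta>, with an inner square as difference.\<close>

lemma fock_add:
  assumes "\<eta> \<in> carrier (fock X)" "\<zeta> \<in> carrier (fock X)"
  shows "\<eta> + \<zeta> \<in> carrier (fock X)"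
proof (rule fockI)
  note c = fock_comp[OF assms(1)] fock_comp[OF assms(2)]
  show "(\<eta> + \<zeta>) m \<in> carrier (fib X m)" for m using c by (simp add: F.add_closed)
  show "(\<lambda>m. ip (fib X m) ((\<eta> + \<zeta>) m) ((\<eta> + \<zeta>) m)) summable_on UNIV"
  proof (rule cpos_summable_comparison)
    show "(\<lambda>m. 2 *\<^sub>R (ip (fib X m) (\<eta> m) (\<eta> m) + ip (fib X m) (\<zeta> m) (\<zeta> m))) summable_on UNIV"
      by (intro summable_on_scaleR_right summable_on_add fock_summable assms)
    fix m
    show "cpos (ip (fib X m) ((\<eta> + \<zeta>) m) ((\<eta> + \<zeta>) m))" using c by (simp add: F.cpos_ip F.add_closed)
    have "2 *\<^sub>R (ip (fib X m) (\<eta> m) (\<eta> m) + ip (fib X m) (\<zeta> m) (\<zeta> m)) - ip (fib X m) ((\<eta> + \<zeta>) m) ((\<eta> + \<zeta>) m)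
      = ip (fib X m) (\<eta> m - \<zeta> m) (\<eta> m - \<zeta> m)" using c by (simp add: F.ip_simps F.closed_simps scaleR_2)
    then show "cpos (2 *\<^sub>R (ip (fib X m) (\<eta> m) (\<eta> m) + ip (fib X m) (\<zeta> m) (\<zeta> m)) - ip (fib X m) ((\<eta> + \<zeta>) m) ((\<eta> + \<zeta>) m))"
      using c by (simp add: F.cpos_ip F.diff_closed)
  qed
qed

lemma fock_scaleC:
  assumes "\<eta> \<in> carrier (fock X)" shows "c *\<^sub>C \<eta> \<in> carrier (fock X)"
proof (rule fockI)
  note k = fock_comp[OF assms]
  show "(c *\<^sub>C \<eta>) m \<in> carrier (fib X m)" for m using k by (simp add: F.scaleC_closed scaleC_fun_def)
  have "(\<lambda>m. (cnj c * c) *\<^sub>C ip (fib X m) (\<eta> m) (\<eta> m)) summable_on UNIV"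
    by (intro summable_on_bounded_linear[OF bounded_linear_scaleC] fock_summable assms)
  then show "(\<lambda>m. ip (fib X m) ((c *\<^sub>C \<eta>) m) ((c *\<^sub>C \<eta>) m)) summable_on UNIV"
    using k by (simp add: scaleC_fun_def F.ip_simps F.scaleC_closed scaleC_scaleC mult.commute)
qed

text \<open>Polarisation: with a and b the inner product and its adjoint, (a + b) - i (i a - i b) =
  2 a, and both brackets come from inner squares of vectors in the Fock module.\<close>

lemma fock_ip_summable:
  assumes "\<eta> \<in> carrier (fock X)" "\<zeta> \<in> carrier (fock X)"
  shows "(\<lambda>m. ip (fib X m) (\<eta> m) (\<zeta> m)) summable_on UNIV"
proof -
  note c = fock_comp[OF assms(1)] fock_comp[OF assms(2)]
  let ?q = "\<lambda>\<xi> m. ip (fib X m) (\<xi> m) (\<xi> m)"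
  let ?h = "\<lambda>m. (?q (\<eta> + \<zeta>) m - (?q \<eta> m + ?q \<zeta> m)) - \<i> *\<^sub>C (?q (\<eta> + \<i> *\<^sub>C \<zeta>) m - (?q \<eta> m + ?q \<zeta> m))"
  have diff: "(\<lambda>m. f m - g m) summable_on UNIV" if "f summable_on UNIV" "g summable_on UNIV" for f g :: "('i \<Rightarrow> nat) \<Rightarrow> 'a"
    using summable_on_add[OF that(1) iffD2[OF summable_on_uminus that(2)]] by simp
  have "?h summable_on UNIV"
    by (intro diff summable_on_add summable_on_bounded_linear[OF bounded_linear_scaleC] fock_summable fock_add fock_scaleC assms)
  then have "(\<lambda>m. (1/2) *\<^sub>R ?h m) summable_on UNIV" by (rule summable_on_scaleR_right)
  moreover have "(1/2) *\<^sub>R ?h m = ip (fib X m) (\<eta> m) (\<zeta> m)" for m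
  proof -
    let ?a = "ip (fib X m) (\<eta> m) (\<zeta> m)" and ?b = "ip (fib X m) (\<zeta> m) (\<eta> m)"
    have "?q (\<eta> + \<zeta>) m - (?q \<eta> m + ?q \<zeta> m) = ?a + ?b" using c by (simp add: F.ip_simps F.closed_simps)
    moreover have "?q (\<eta> + \<i> *\<^sub>C \<zeta>) m - (?q \<eta> m + ?q \<zeta> m) = \<i> *\<^sub>C ?a - \<i> *\<^sub>C ?b"
      using c by (simp add: F.ip_simps F.closed_simps scaleC_fun_def scaleC_diff_right scaleC_scaleC)
    moreover have "\<i> *\<^sub>C (\<i> *\<^sub>C ?a - \<i> *\<^sub>C ?b) = ?b - ?a" by (simp add: scaleC_diff_right scaleC_scaleC)
    ultimately have "?h m = 2 *\<^sub>R ?a" by (simp add: scaleR_2)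
    then show ?thesis by simp
  qed
  ultimately show ?thesis by simp
qed

lemma fock_has_sum: "\<eta> \<in> carrier (fock X) \<Longrightarrow> \<zeta> \<in> carrier (fock X) \<Longrightarrow>
    ((\<lambda>m. ip (fib X m) (\<eta> m) (\<zeta> m)) has_sum ip (fock X) \<eta> \<zeta>) UNIV"
  unfolding fock_simps(2) by (intro has_sum_infsum fock_ip_summable)

lemma fock_ipI: "((\<lambda>m. ip (fib X m) (\<eta> m) (\<zeta> m)) has_sum S) UNIV \<Longrightarrow> ip (fock X) \<eta> \<zeta> = S"
  unfolding fock_simps(2) by (rule infsumI)

lemma fock_ract:
  assumes "\<eta> \<in> carrier (fock X)" shows "ract (fock X) \<eta> a \<in> carrier (fock X)"
proof (rule fockI)
  note k = fock_comp[OF assms]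
  show "ract (fock X) \<eta> a m \<in> carrier (fib X m)" for m using k by (simp add: F.ract_closed fock_simps)
  have "bounded_linear (\<lambda>b. star a * (b * a))"
    by (intro bounded_linear_mult_right[THEN bounded_linear_compose] bounded_linear_mult_left)
  then have "(\<lambda>m. star a * (ip (fib X m) (\<eta> m) (\<eta> m) * a)) summable_on UNIV"
    by (rule summable_on_bounded_linear) (intro fock_summable assms)
  then show "(\<lambda>m. ip (fib X m) (ract (fock X) \<eta> a m) (ract (fock X) \<eta> a m)) summable_on UNIV"
    using k by (simp add: fock_simps F.ip_simps F.ract_closed mult.assoc)
qed

lemma fock_partial:
  assumes "\<eta> \<in> carrier (fock X)" "finite J"
  shows "cpos (ip (fock X) \<eta> \<eta> - (\<Sum>m\<in>J. ip (fib X m) (\<eta> m) (\<eta> m)))"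
proof -
  have "((\<lambda>m. ip (fib X m) (\<eta> m) (\<eta> m)) has_sum (ip (fock X) \<eta> \<eta> - (\<Sum>m\<in>J. ip (fib X m) (\<eta> m) (\<eta> m)))) (UNIV - J)"
    using fock_has_sum[OF assms(1,1)] assms(2) by (intro has_sum_Diff) auto
  then show ?thesis by (rule cpos_has_sum) (intro F.cpos_ip fock_comp assms)
qed

lemma fock_cpos: "\<eta> \<in> carrier (fock X) \<Longrightarrow> cpos (ip (fock X) \<eta> \<eta>)"
  using fock_partial[of \<eta> "{}"] by simp

lemma fock_component:
  assumes "\<eta> \<in> carrier (fock X)"
  shows "mnorm (fib X m) (\<eta> m) \<le> mnorm (fock X) \<eta>"
proof -
  have "norm (ip (fib X m) (\<eta> m) (\<eta> m)) \<le> norm (ip (fock X) \<eta> \<eta>)"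
    using fock_partial[OF assms, of "{m}"] by (intro cpos_norm_mono F.cpos_ip fock_comp assms) simp
  then show ?thesis by (simp add: mnorm_def)
qed

lemma fock_diff: "\<eta> \<in> carrier (fock X) \<Longrightarrow> \<zeta> \<in> carrier (fock X) \<Longrightarrow> \<eta> - \<zeta> \<in> carrier (fock X)"
  using fock_add[of \<eta> "(-1) *\<^sub>C \<zeta>"] fock_scaleC[of \<zeta> "-1"] by simp

text \<open>Components converge since they are dominated by the Fock norm. The finite partial sums
  of the inner squares of \<open>s p - \<xi>\<close> stay below e^2 uniformly in the finite set,
  which yields first the membership of \<xi> and then convergence in norm.\<close>

lemma fock_complete:
  assumes s: "\<And>k::nat. s k \<in> carrier (fock X)"
    and C: "\<forall>e>0. \<exists>K. \<forall>p\<ge>K. \<forall>q\<ge>K. mnorm (fock X) (s p - s q) < e"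
  shows "\<exists>\<xi>\<in>carrier (fock X). (\<lambda>k. mnorm (fock X) (s k - \<xi>)) \<longlonglongrightarrow> 0"
proof -
  have sm: "s k m \<in> carrier (fib X m)" for k m using s fock_comp by blast
  have "\<exists>\<xi>\<in>carrier (fib X m). (\<lambda>k. mnorm (fib X m) (s k m - \<xi>)) \<longlonglongrightarrow> 0" for m
  proof (rule F.complete[OF sm], intro allI impI)
    fix e :: real assume "e > 0"
    then obtain K where "\<forall>p\<ge>K. \<forall>q\<ge>K. mnorm (fock X) (s p - s q) < e" using C by blast
    moreover have "mnorm (fib X m) (s p m - s q m) \<le> mnorm (fock X) (s p - s q)" for p q
      using fock_component[OF fock_diff[OF s s], of m p q] by simp
    ultimately show "\<exists>K. \<forall>p\<ge>K. \<forall>q\<ge>K. mnorm (fib X m) (s p m - s q m) < e"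
      by (meson le_less_trans)
  qed
  then obtain \<xi> where xi: "\<And>m. \<xi> m \<in> carrier (fib X m)" "\<And>m. (\<lambda>k. mnorm (fib X m) (s k m - \<xi> m)) \<longlonglongrightarrow> 0"
    by metis
  let ?q = "\<lambda>\<eta> m. ip (fib X m) (\<eta> m) (\<eta> m)"
  have part: "\<exists>K. \<forall>p\<ge>K. \<forall>J. finite J \<longrightarrow> norm (\<Sum>m\<in>J. ?q (s p - \<xi>) m) \<le> e\<^sup>2" if e: "e > 0" for e
  proof -
    obtain K where K: "\<forall>p\<ge>K. \<forall>q\<ge>K. mnorm (fock X) (s p - s q) < e" using C e by blast
    show ?thesis
    proof (intro exI[of _ K] allI impI)
      fix p and J :: "('i \<Rightarrow> nat) set" assume p: "p \<ge> K" and J: "finite J"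
      have "(\<lambda>k. \<Sum>m\<in>J. ?q (s p - s k) m) \<longlonglongrightarrow> (\<Sum>m\<in>J. ?q (s p - \<xi>) m)"
      proof (rule tendsto_sum)
        fix m assume "m \<in> J"
        have "(\<lambda>k. mnorm (fib X m) ((s p m - s k m) - (s p m - \<xi> m))) \<longlonglongrightarrow> 0"
          using xi(2)[of m] F.mnorm_minus_commute[OF sm xi(1)] by simp
        then show "(\<lambda>k. ?q (s p - s k) m) \<longlonglongrightarrow> ?q (s p - \<xi>) m"
          using sm xi(1) by (simp add: F.ip_tendsto_self F.diff_closed)
      qed
      then have lim: "(\<lambda>k. norm (\<Sum>m\<in>J. ?q (s p - s k) m)) \<longlonglongrightarrow> norm (\<Sum>m\<in>J. ?q (s p - \<xi>) m)"
        by (rule tendsto_norm)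
      have "norm (\<Sum>m\<in>J. ?q (s p - s k) m) \<le> e\<^sup>2" if "k \<ge> K" for k
      proof -
        have d: "s p - s k \<in> carrier (fock X)" by (intro fock_diff s)
        have "norm (\<Sum>m\<in>J. ?q (s p - s k) m) \<le> norm (ip (fock X) (s p - s k) (s p - s k))"
          using fock_comp[OF d] by (intro cpos_norm_mono cpos_sum F.cpos_ip fock_partial d J)
        also have "\<dots> = (mnorm (fock X) (s p - s k))\<^sup>2" by (simp add: mnorm_def)
        also have "\<dots> \<le> e\<^sup>2" using K p that by (intro power_mono) (auto simp: less_imp_le mnorm_def)
        finally show ?thesis .
      qed
      then show "norm (\<Sum>m\<in>J. ?q (s p - \<xi>) m) \<le> e\<^sup>2" by (intro LIMSEQ_le_const2[OF lim]) blast
    qed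
  qed
  have "?q \<xi> summable_on UNIV"
  proof (rule summable_on_CauchyI)
    fix e :: real assume e: "e > 0"
    \<comment> \<open>The bounds e/8 here and e/4 for the tail of \<open>s K\<close> give 2 (e/4 +
      e/8) < e after the parallelogram law.\<close>
    obtain K where K: "\<forall>p\<ge>K. \<forall>J. finite J \<longrightarrow> norm (\<Sum>m\<in>J. ?q (s p - \<xi>) m) \<le> (sqrt (e / 8))\<^sup>2"
      using part[of "sqrt (e / 8)"] e by auto
    obtain J0 where J0: "finite J0" "\<forall>J. finite J \<and> J \<subseteq> UNIV - J0 \<longrightarrow> norm (sum (?q (s K)) J) < e / 4"
      using summable_on_tail[OF fock_summable[OF s[of K]], of "e / 4"] e by auto
    show "\<exists>K. finite K \<and> K \<subseteq> UNIV \<and> (\<forall>J. finite J \<and> J \<subseteq> UNIV - K \<longrightarrow> norm (sum (?q \<xi>) J) < e)"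
    proof (intro exI[of _ J0] conjI allI impI)
      fix J assume J: "finite J \<and> J \<subseteq> UNIV - J0"
      have "norm (sum (?q \<xi>) J) \<le> norm (2 *\<^sub>R ((\<Sum>m\<in>J. ?q (s K) m) + (\<Sum>m\<in>J. ?q (s K - \<xi>) m)))"
      proof (rule cpos_norm_mono)
        show "cpos (sum (?q \<xi>) J)" by (intro cpos_sum F.cpos_ip xi)
        \<comment> \<open>Parallelogram law for \<xi> as the difference of \<open>s K\<close> and
          \<open>s K - \<xi>\<close>; the remaining inner square is that of their sum.\<close>
        have "2 *\<^sub>R ((\<Sum>m\<in>J. ?q (s K) m) + (\<Sum>m\<in>J. ?q (s K - \<xi>) m)) - sum (?q \<xi>) J
          = (\<Sum>m\<in>J. 2 *\<^sub>R (?q (s K) m + ?q (s K - \<xi>) m) - ?q \<xi> m)"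
          by (simp only: sum_subtractf sum.distrib scaleR_sum_right[symmetric])
        also have "\<dots> = (\<Sum>m\<in>J. ip (fib X m) (s K m + s K m - \<xi> m) (s K m + s K m - \<xi> m))"
          using sm xi(1) by (intro sum.cong refl) (simp add: F.ip_simps F.closed_simps scaleR_2)
        finally show "cpos (2 *\<^sub>R ((\<Sum>m\<in>J. ?q (s K) m) + (\<Sum>m\<in>J. ?q (s K - \<xi>) m)) - sum (?q \<xi>) J)"
          using sm xi(1) by (simp only:) (intro cpos_sum F.cpos_ip F.closed_simps)
      qed
      also have "\<dots> \<le> 2 * (norm (\<Sum>m\<in>J. ?q (s K) m) + norm (\<Sum>m\<in>J. ?q (s K - \<xi>) m))"
        unfolding norm_scaleR by (intro mult_mono norm_triangle_ineq) auto
      also have "\<dots> < 2 * (e / 4 + e / 8)"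
      proof -
        have "norm (\<Sum>m\<in>J. ?q (s K) m) < e / 4" using J0(2) J by blast
        moreover have "norm (\<Sum>m\<in>J. ?q (s K - \<xi>) m) \<le> e / 8" using K J e by simp
        ultimately show ?thesis by (intro mult_strict_left_mono add_less_le_mono) auto
      qed
      also have "\<dots> < e" using e by simp
      finally show "norm (sum (?q \<xi>) J) < e" .
    qed (use J0 in auto)
  qed
  then have x: "\<xi> \<in> carrier (fock X)" using xi(1) by (intro fockI)
  have "(\<lambda>k. mnorm (fock X) (s k - \<xi>)) \<longlonglongrightarrow> 0"
  proof (rule LIMSEQ_I)
    fix e :: real assume e: "e > 0"
    then obtain K where K: "\<forall>p\<ge>K. \<forall>J. finite J \<longrightarrow> norm (\<Sum>m\<in>J. ?q (s p - \<xi>) m) \<le> (e / 2)\<^sup>2"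
      using part[of "e / 2"] by auto
    have "mnorm (fock X) (s p - \<xi>) < e" if "p \<ge> K" for p
    proof -
      have d: "s p - \<xi> \<in> carrier (fock X)" by (intro fock_diff s x)
      have "ip (fock X) (s p - \<xi>) (s p - \<xi>) \<in> cball 0 ((e / 2)\<^sup>2)"
        by (rule Lim_in_closed_set[OF closed_cball _ _ fock_has_sum[OF d d, unfolded has_sum_def]])
          (use K that in \<open>auto intro!: eventually_finite_subsets_at_top_weakI\<close>)
      then have "norm (ip (fock X) (s p - \<xi>) (s p - \<xi>)) \<le> (e / 2)\<^sup>2" by simp
      then have "mnorm (fock X) (s p - \<xi>) \<le> e / 2" unfolding mnorm_def using e by (intro real_le_lsqrt) auto
      then show ?thesis using e by linarith
    qed
    then show "\<exists>K. \<forall>p\<ge>K. norm (mnorm (fock X) (s p - \<xi>) - 0) < e" by (auto simp: mnorm_def)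
  qed
  then show ?thesis using x by blast
qed

sublocale K: hilbert_module "fock X"
proof
  show "0 \<in> carrier (fock X)" by (rule fockI) (simp_all add: F.zero_closed)
next
  fix \<xi> \<eta> assume "\<xi> \<in> carrier (fock X)" "\<eta> \<in> carrier (fock X)"
  then show "\<xi> + \<eta> \<in> carrier (fock X)" by (rule fock_add)
next
  fix \<xi> and c assume "\<xi> \<in> carrier (fock X)" then show "c *\<^sub>C \<xi> \<in> carrier (fock X)" by (rule fock_scaleC)
next
  fix \<xi> a assume "\<xi> \<in> carrier (fock X)" then show "ract (fock X) \<xi> a \<in> carrier (fock X)" by (rule fock_ract)
next
  fix \<xi> \<eta> a assume a: "\<xi> \<in> carrier (fock X)" "\<eta> \<in> carrier (fock X)"
  note c = fock_comp[OF a(1)] fock_comp[OF a(2)]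
  show "ract (fock X) (\<xi> + \<eta>) a = ract (fock X) \<xi> a + ract (fock X) \<eta> a"
    using c by (simp add: fock_simps fun_eq_iff F.ract_add_left)
  show "star (ip (fock X) \<xi> \<eta>) = ip (fock X) \<eta> \<xi>"
    using has_sum_bounded_linear[OF bounded_linear_star fock_has_sum[OF a]] c
    by (intro fock_ipI[symmetric]) (simp add: F.ip_star o_def)
  show "ip (fock X) \<xi> (ract (fock X) \<eta> a) = ip (fock X) \<xi> \<eta> * a"
    using has_sum_bounded_linear[OF bounded_linear_mult_left[of a] fock_has_sum[OF a]] c
    by (intro fock_ipI) (simp add: fock_simps F.ip_ract o_def)
next
  fix \<xi> and a b :: 'a and c assume a: "\<xi> \<in> carrier (fock X)"
  note k = fock_comp[OF a]
  show "ract (fock X) \<xi> (a + b) = ract (fock X) \<xi> a + ract (fock X) \<xi> b"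
    "ract (fock X) (c *\<^sub>C \<xi>) a = c *\<^sub>C ract (fock X) \<xi> a" "ract (fock X) \<xi> (c *\<^sub>C a) = c *\<^sub>C ract (fock X) \<xi> a"
    "ract (fock X) \<xi> (a * b) = ract (fock X) (ract (fock X) \<xi> a) b"
    using k by (simp_all add: fock_simps fun_eq_iff scaleC_fun_def F.ract_add_right F.ract_scaleC_left F.ract_scaleC_right F.ract_mult)
  show "positive_element (ip (fock X) \<xi> \<xi>)" using fock_cpos[OF a] positive_element_iff_cpos by blast
  assume z: "ip (fock X) \<xi> \<xi> = 0"
  show "\<xi> = 0"
  proof
    fix m
    have "mnorm (fib X m) (\<xi> m) \<le> 0" using fock_component[OF a, of m] z by (simp add: mnorm_def)
    then show "\<xi> m = 0 m" using F.mnorm_eq_0[OF k] F.mnorm_nonneg[of m "\<xi> m"] by simp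
  qed
next
  fix \<xi> \<eta> \<zeta> assume a: "\<xi> \<in> carrier (fock X)" "\<eta> \<in> carrier (fock X)" "\<zeta> \<in> carrier (fock X)"
  note c = fock_comp[OF a(1)] fock_comp[OF a(2)] fock_comp[OF a(3)]
  show "ip (fock X) \<xi> (\<eta> + \<zeta>) = ip (fock X) \<xi> \<eta> + ip (fock X) \<xi> \<zeta>"
    using has_sum_add[OF fock_has_sum[OF a(1,2)] fock_has_sum[OF a(1,3)]] c
    by (intro fock_ipI) (simp add: F.ip_add_right)
next
  fix \<xi> \<eta> and c assume a: "\<xi> \<in> carrier (fock X)" "\<eta> \<in> carrier (fock X)"
  note k = fock_comp[OF a(1)] fock_comp[OF a(2)]
  show "ip (fock X) \<xi> (c *\<^sub>C \<eta>) = c *\<^sub>C ip (fock X) \<xi> \<eta>"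
    using has_sum_bounded_linear[OF bounded_linear_scaleC[of c] fock_has_sum[OF a]] k
    by (intro fock_ipI) (simp add: F.ip_scaleC_right scaleC_fun_def o_def)
next
  fix s :: "nat \<Rightarrow> ('i \<Rightarrow> nat) \<Rightarrow> 'x" assume "\<And>k. s k \<in> carrier (fock X)" "\<forall>e>0. \<exists>K. \<forall>p\<ge>K. \<forall>q\<ge>K. mnorm (fock X) (s p - s q) < e"
  then show "\<exists>\<xi>\<in>carrier (fock X). (\<lambda>k::nat. mnorm (fock X) (s k - \<xi>)) \<longlonglongrightarrow> 0" by (rule fock_complete)
qed

end

section \<open>Creation operators and the Toeplitz-Nica-Pimsner algebra\<close>

context product_system_unital
begin

definition sgl :: "('i \<Rightarrow> nat) \<Rightarrow> 'x \<Rightarrow> ('i \<Rightarrow> nat) \<Rightarrow> 'x" where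
  "sgl m \<xi> = (\<lambda>k. if k = m then \<xi> else 0)"

lemma sgl_same [simp]: "sgl m \<xi> m = \<xi>"
  by (simp add: sgl_def)

lemma sgl_zero: "sgl m 0 = 0"
  by (auto simp: sgl_def)

lemma sgl_add: "sgl m (\<xi> + \<eta>) = sgl m \<xi> + sgl m \<eta>"
  by (auto simp: sgl_def)

lemma sgl_sum: "sgl m (\<Sum>i\<in>I. f i) = (\<Sum>i\<in>I. sgl m (f i))"
  by (induction I rule: infinite_finite_induct) (auto simp: sgl_zero sgl_add)

lemma sgl_closed:
  assumes "\<xi> \<in> carrier (fib X m)" shows "sgl m \<xi> \<in> carrier (fock X)"
proof (rule fockI)
  show "sgl m \<xi> k \<in> carrier (fib X k)" for k using assms by (simp add: sgl_def F.zero_closed)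
  show "(\<lambda>k. ip (fib X k) (sgl m \<xi> k) (sgl m \<xi> k)) summable_on UNIV"
    by (rule finite_nonzero_values_imp_summable_on, rule finite_subset[of _ "{m}"])
      (auto simp: sgl_def F.zero_closed split: if_splits)
qed

lemma ip_sgl_left:
  assumes "\<xi> \<in> carrier (fib X m)" "\<eta> \<in> carrier (fock X)"
  shows "ip (fock X) (sgl m \<xi>) \<eta> = ip (fib X m) \<xi> (\<eta> m)"
proof (rule fock_ipI)
  show "((\<lambda>k. ip (fib X k) (sgl m \<xi> k) (\<eta> k)) has_sum ip (fib X m) \<xi> (\<eta> m)) UNIV"
    by (rule has_sum_finite_neutralI[of "{m}"]) (use fock_comp[OF assms(2)] in \<open>auto simp: sgl_def\<close>)
qed

lemma ip_sgl_right:
  assumes "\<xi> \<in> carrier (fib X m)" "\<eta> \<in> carrier (fock X)"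
  shows "ip (fock X) \<eta> (sgl m \<xi>) = ip (fib X m) (\<eta> m) \<xi>"
  using ip_sgl_left[OF assms] K.ip_star[OF sgl_closed[OF assms(1)] assms(2)] F.ip_star[OF assms(1) fock_comp[OF assms(2)]]
  by simp

lemma fock_eqI_sgl:
  assumes "\<eta> \<in> carrier (fock X)" "\<zeta> \<in> carrier (fock X)"
    and "\<And>m \<xi>. \<xi> \<in> carrier (fib X m) \<Longrightarrow> ip (fock X) (sgl m \<xi>) \<eta> = ip (fock X) (sgl m \<xi>) \<zeta>"
  shows "\<eta> = \<zeta>"
proof
  fix m
  show "\<eta> m = \<zeta> m"
    by (rule F.ip_eqI) (use fock_comp assms ip_sgl_left in auto)
qed

text \<open>Operators need not be evaluated on infinite sums: if they agree on homogeneous vectors,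
  their adjoints have the same inner products with those vectors, which separate points.\<close>

lemma op_eqI:
  assumes T: "T \<in> \<L> (fock X)" and S: "S \<in> \<L> (fock X)"
    and eq: "\<And>m \<xi>. \<xi> \<in> carrier (fib X m) \<Longrightarrow> T (sgl m \<xi>) = S (sgl m \<xi>)"
  shows "T = S"
proof -
  have "adj (fock X) T = adj (fock X) S"
  proof (rule K.L_eqI[OF K.adj_closed[OF T] K.adj_closed[OF S]])
    fix \<eta> assume e: "\<eta> \<in> carrier (fock X)"
    show "adj (fock X) T \<eta> = adj (fock X) S \<eta>"
    proof (rule fock_eqI_sgl)
      fix m \<xi> assume x: "\<xi> \<in> carrier (fib X m)"
      show "ip (fock X) (sgl m \<xi>) (adj (fock X) T \<eta>) = ip (fock X) (sgl m \<xi>) (adj (fock X) S \<eta>)"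
        using K.adj_ip[OF T sgl_closed[OF x] e] K.adj_ip[OF S sgl_closed[OF x] e] eq[OF x] by simp
    qed (use K.L_closed[OF K.adj_closed[OF T] e] K.L_closed[OF K.adj_closed[OF S] e] in auto)
  qed
  then show ?thesis using K.adj_adj T S by metis
qed

lemma fock_lact:
  assumes "\<eta> \<in> carrier (fock X)" shows "(\<lambda>m. lact (fib X m) a (\<eta> m)) \<in> carrier (fock X)"
proof (rule fockI)
  note k = fock_comp[OF assms]
  show "lact (fib X m) a (\<eta> m) \<in> carrier (fib X m)" for m using k by (simp add: F.lact_closed)
  show "(\<lambda>m. ip (fib X m) (lact (fib X m) a (\<eta> m)) (lact (fib X m) a (\<eta> m))) summable_on UNIV"
  proof (rule cpos_summable_comparison)
    show "(\<lambda>m. (norm a)\<^sup>2 *\<^sub>R ip (fib X m) (\<eta> m) (\<eta> m)) summable_on UNIV"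
      by (intro summable_on_scaleR_right fock_summable assms)
  qed (use k in \<open>simp_all add: F.cpos_lact' F.cpos_ip F.lact_closed\<close>)
qed

text \<open>The projection onto the degrees in \<open>S\<close>. All the projections P_i, Q_i, Q_F
  and Q_F^n will be identified with operators of this kind.\<close>

definition dproj :: "('i \<Rightarrow> nat) set \<Rightarrow> (('i \<Rightarrow> nat) \<Rightarrow> 'x) \<Rightarrow> ('i \<Rightarrow> nat) \<Rightarrow> 'x" where
  "dproj S = restr (fock X) (\<lambda>\<eta> m. if m \<in> S then \<eta> m else 0)"

lemma fock_restrict:
  assumes "\<eta> \<in> carrier (fock X)" shows "(\<lambda>m. if m \<in> S then \<eta> m else 0) \<in> carrier (fock X)"
proof (rule fockI)
  note k = fock_comp[OF assms]
  show "(if m \<in> S then \<eta> m else 0) \<in> carrier (fib X m)" for m using k by (simp add: F.zero_closed)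
  show "(\<lambda>m. ip (fib X m) (if m \<in> S then \<eta> m else 0) (if m \<in> S then \<eta> m else 0)) summable_on UNIV"
    by (rule cpos_summable_comparison[OF fock_summable[OF assms]]) (use k in \<open>auto simp: F.cpos_ip F.zero_closed\<close>)
qed

lemma dproj_apply: "\<eta> \<in> carrier (fock X) \<Longrightarrow> dproj S \<eta> = (\<lambda>m. if m \<in> S then \<eta> m else 0)"
  by (simp add: dproj_def)

lemma is_adjoint_dproj: "is_adjoint (fock X) (dproj S) (dproj S)"
  unfolding is_adjoint_def
proof (intro conjI ballI)
  show "dproj S \<in> maps (fock X)" unfolding dproj_def by (intro restr_maps fock_restrict)
  then show "dproj S \<in> maps (fock X)" .
  fix \<xi> \<eta> assume a: "\<xi> \<in> carrier (fock X)" "\<eta> \<in> carrier (fock X)"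
  have "ip (fib X m) (if m \<in> S then \<xi> m else 0) (\<eta> m) = ip (fib X m) (\<xi> m) (if m \<in> S then \<eta> m else 0)" for m
    using fock_comp[OF a(1)] fock_comp[OF a(2)] by simp
  then show "ip (fock X) (dproj S \<xi>) \<eta> = ip (fock X) \<xi> (dproj S \<eta>)"
    unfolding dproj_apply[OF a(1)] dproj_apply[OF a(2)] fock_simps(2) by simp
qed

lemma dproj_L: "dproj S \<in> \<L> (fock X)"
  using is_adjoint_dproj K.adjointablesI by blast

lemma adj_dproj: "adj (fock X) (dproj S) = dproj S"
  using is_adjoint_dproj K.adj_eq by blast

lemma dproj_sgl: "\<xi> \<in> carrier (fib X m) \<Longrightarrow> dproj S (sgl m \<xi>) = (if m \<in> S then sgl m \<xi> else 0)"
  unfolding dproj_apply[OF sgl_closed] by (rule ext) (simp add: sgl_def)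

lemma dproj_comp: "dproj S \<circ> dproj S' = dproj (S \<inter> S')"
  by (rule op_eqI) (auto simp: dproj_L K.L_comp dproj_sgl sgl_closed K.L_zero[OF dproj_L])

lemma dproj_UNIV: "dproj UNIV = id_op (fock X)"
  by (rule op_eqI) (auto simp: dproj_L K.L_id_op dproj_sgl sgl_closed)

lemma dproj_compl: "id_op (fock X) - dproj S = dproj (- S)"
  by (rule op_eqI) (auto simp: dproj_L K.L_id_op K.L_minus dproj_sgl sgl_closed)

abbreviation ts :: "('i \<Rightarrow> nat) \<Rightarrow> ('i \<Rightarrow> nat) \<Rightarrow> 'x \<Rightarrow> 'x \<Rightarrow> 'x" where
  "ts n m \<equiv> corr_tensor.tstar (fib X m) (fib X (n + m)) (pmul X n m)"

end

locale finite_rank_system = product_system_unital X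
  for X :: "('i::{finite,linorder}, 'a::unital_cstar_algebra, 'x::complex_vector) prod_sys" +
  fixes x
  assumes ud: "unit_decomposition X x"
begin

abbreviation "xw \<equiv> word_elt X x"
abbreviation "wds \<equiv> words_of x"

lemma xw_dec: "is_dec (fib X n) (wds n) xw"
  using is_dec_words[OF ud] .

lemma xw_closed: "\<mu> \<in> wds n \<Longrightarrow> xw \<mu> \<in> carrier (fib X n)"
  using is_dec_closed[OF xw_dec] .

lemma finite_wds: "finite (wds n)"
  using is_dec_finite[OF xw_dec] .

text \<open>Writing the inner square of \<xi> as b* b turns that of a product with \<xi> into the
  inner square of the left action by \<open>b\<close>, shifted by \<open>n\<close>.\<close>

lemma t_fock:
  assumes x: "\<xi> \<in> carrier (fib X n)" and e: "\<eta> \<in> carrier (fock X)"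
  shows "(\<lambda>k. if n \<le> k then pmul X n (k - n) \<xi> (\<eta> (k - n)) else 0) \<in> carrier (fock X)" (is "?t \<in> _")
proof (rule fockI)
  note k = fock_comp[OF e]
  show "?t k \<in> carrier (fib X k)" for k
    using T.p_closed[OF x k, of "k - n"] by (cases "n \<le> k") (simp_all add: nat_fun_add_diff[of n k] F.zero_closed)
  obtain b where b: "ip (fib X n) \<xi> \<xi> = star b * b" using F.ip_positive[OF x] unfolding positive_element_def by blast
  have "ip (fib X k) (?t k) (?t k) = (if n \<le> k then
      ip (fib X (k - n)) (lact (fib X (k - n)) b (\<eta> (k - n))) (lact (fib X (k - n)) b (\<eta> (k - n))) else 0)" for k
  proof (cases "n \<le> k")
    case True
    have "ip (fib X (n + (k - n))) (?t k) (?t k) = ip (fib X (k - n)) (\<eta> (k - n)) (lact (fib X (k - n)) (star b * b) (\<eta> (k - n)))"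
      using True x k by (simp add: T.p_ip b)
    then show ?thesis using True k by (simp add: nat_fun_add_diff F.ip_lact_left F.lact_closed F.lact_mult)
  qed (simp add: F.zero_closed)
  then show "(\<lambda>k. ip (fib X k) (?t k) (?t k)) summable_on UNIV"
    using summable_on_shift[OF fock_summable[OF fock_lact[OF e, of b]], of n] by simp
qed

text \<open>Here finite rank enters: for a frame vector, Parseval's identity dominates the inner
  square of the annihilated component by that of \<zeta>, and a general \<xi> is a finite
  combination of these cases.\<close>

lemma ta_fock:
  assumes x: "\<xi> \<in> carrier (fib X n)" and z: "\<zeta> \<in> carrier (fock X)"
  shows "(\<lambda>m. ts n m \<xi> (\<zeta> (n + m))) \<in> carrier (fock X)"
proof -
  note k = fock_comp[OF z]
  have 1: "(\<lambda>m. ts n m (xw \<mu>) (\<zeta> (n + m))) \<in> carrier (fock X)" if m: "\<mu> \<in> wds n" for \<mu>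
  proof (rule fockI)
    show "ts n m (xw \<mu>) (\<zeta> (n + m)) \<in> carrier (fib X m)" for m using T.tstar_closed[OF xw_closed[OF m] k] .
    show "(\<lambda>m. ip (fib X m) (ts n m (xw \<mu>) (\<zeta> (n + m))) (ts n m (xw \<mu>) (\<zeta> (n + m)))) summable_on UNIV"
    proof (rule cpos_summable_comparison)
      show "(\<lambda>m. ip (fib X (n + m)) (\<zeta> (n + m)) (\<zeta> (n + m))) summable_on UNIV"
        using summable_on_unshift[OF fock_summable[OF z], of n] .
      fix m
      show "cpos (ip (fib X m) (ts n m (xw \<mu>) (\<zeta> (n + m))) (ts n m (xw \<mu>) (\<zeta> (n + m))))"
        by (intro F.cpos_ip T.tstar_closed xw_closed m k)
      let ?f = "\<lambda>\<nu>. ip (fib X m) (ts n m (xw \<nu>) (\<zeta> (n + m))) (ts n m (xw \<nu>) (\<zeta> (n + m)))"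
      have "ip (fib X (n + m)) (\<zeta> (n + m)) (\<zeta> (n + m)) - ?f \<mu> = sum ?f (wds n) - ?f \<mu>"
        by (simp add: T.tstar_parseval[OF xw_dec k])
      also have "\<dots> = sum ?f (wds n - {\<mu>})" using finite_wds m by (simp add: sum_diff1)
      finally show "cpos (ip (fib X (n + m)) (\<zeta> (n + m)) (\<zeta> (n + m)) - ?f \<mu>)"
        using xw_closed k by (auto intro!: cpos_sum F.cpos_ip T.tstar_closed)
    qed
  qed
  have "(\<lambda>m. ts n m \<xi> (\<zeta> (n + m))) = (\<Sum>\<mu>\<in>wds n. (\<lambda>m. lact (fib X m) (ip (fib X n) \<xi> (xw \<mu>)) (ts n m (xw \<mu>) (\<zeta> (n + m)))))"
  proof
    have s: "(\<Sum>\<mu>\<in>I. f \<mu>) m = (\<Sum>\<mu>\<in>I. f \<mu> m)" for I and f :: "('i \<Rightarrow> nat list) \<Rightarrow> ('i \<Rightarrow> nat) \<Rightarrow> 'x" and m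
      by (induction I rule: infinite_finite_induct) auto
    show "ts n m \<xi> (\<zeta> (n + m)) = (\<Sum>\<mu>\<in>wds n. (\<lambda>m. lact (fib X m) (ip (fib X n) \<xi> (xw \<mu>)) (ts n m (xw \<mu>) (\<zeta> (n + m))))) m" for m
      unfolding s by (rule T.tstar_dec_left[OF xw_dec x k])
  qed
  then show ?thesis using fock_lact[OF 1] by (auto intro!: K.sum_closed)
qed

lemma is_adjoint_t:
  assumes x: "\<xi> \<in> carrier (fib X n)"
  shows "is_adjoint (fock X) (t_op X n \<xi>) (restr (fock X) (\<lambda>\<zeta> m. ts n m \<xi> (\<zeta> (n + m))))"
  unfolding is_adjoint_def t_op_def
proof (intro conjI ballI restr_maps t_fock ta_fock x)
  fix \<eta> \<zeta> assume e: "\<eta> \<in> carrier (fock X)" and z: "\<zeta> \<in> carrier (fock X)"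
  let ?t = "\<lambda>k. if n \<le> k then pmul X n (k - n) \<xi> (\<eta> (k - n)) else 0"
  have "(\<Sum>\<^sub>\<infinity>k. ip (fib X k) (?t k) (\<zeta> k)) = (\<Sum>\<^sub>\<infinity>m. ip (fib X m) (\<eta> m) (ts n m \<xi> (\<zeta> (n + m))))"
  proof (rule infsum_shift)
    show "ip (fib X k) (?t k) (\<zeta> k) = 0" if "\<not> n \<le> k" for k using that fock_comp[OF z] by simp
    show "ip (fib X (n + m)) (?t (n + m)) (\<zeta> (n + m)) = ip (fib X m) (\<eta> m) (ts n m \<xi> (\<zeta> (n + m)))" for m
      using T.tstar_ip[OF x fock_comp[OF z] fock_comp[OF e], of m] by (simp add: nat_fun_le_add nat_fun_diff_add)
  qed
  then show "ip (fock X) (restr (fock X) (\<lambda>\<eta> k. if n \<le> k then pmul X n (k - n) \<xi> (\<eta> (k - n)) else 0) \<eta>) \<zeta>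
     = ip (fock X) \<eta> (restr (fock X) (\<lambda>\<zeta> m. ts n m \<xi> (\<zeta> (n + m))) \<zeta>)"
    using e z by (simp add: fock_simps(2))
qed

section \<open>Relations between creation and annihilation operators\<close>

abbreviation "t \<equiv> t_op X"
abbreviation "tA n \<xi> \<equiv> adj (fock X) (t_op X n \<xi>)"

lemma t_L: "\<xi> \<in> carrier (fib X n) \<Longrightarrow> t n \<xi> \<in> \<L> (fock X)"
  using is_adjoint_t K.adjointablesI by blast

lemma tA_L: "\<xi> \<in> carrier (fib X n) \<Longrightarrow> tA n \<xi> \<in> \<L> (fock X)"
  using t_L K.adj_closed by blast

lemma tA_apply: "\<xi> \<in> carrier (fib X n) \<Longrightarrow> \<zeta> \<in> carrier (fock X) \<Longrightarrow> tA n \<xi> \<zeta> = (\<lambda>m. ts n m \<xi> (\<zeta> (n + m)))"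
  using K.adj_eq[OF is_adjoint_t] by simp

lemma ts_zero: "\<xi> \<in> carrier (fib X n) \<Longrightarrow> ts n m \<xi> 0 = 0"
  using T.tstar_p[of \<xi> n \<xi> 0 m] F.zero_closed by simp

lemma t_sgl:
  assumes "\<xi> \<in> carrier (fib X n)" "\<eta> \<in> carrier (fib X m)"
  shows "t n \<xi> (sgl m \<eta>) = sgl (n + m) (pmul X n m \<xi> \<eta>)"
proof
  fix k
  show "t n \<xi> (sgl m \<eta>) k = sgl (n + m) (pmul X n m \<xi> \<eta>) k"
  proof (cases "n \<le> k")
    case True
    then obtain j where "k = n + j" using nat_fun_leE by blast
    then show ?thesis unfolding t_op_def restr_apply[OF sgl_closed[OF assms(2)]]
      using assms by (simp add: nat_fun_le_add nat_fun_diff_add) (simp add: sgl_def)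
  next
    case False
    then have "k \<noteq> n + m" using nat_fun_le_add by auto
    then show ?thesis using assms False by (simp add: t_op_def sgl_closed) (simp add: sgl_def)
  qed
qed

lemma tA_sgl:
  assumes "\<xi> \<in> carrier (fib X n)" "\<zeta> \<in> carrier (fib X (n + m))"
  shows "tA n \<xi> (sgl (n + m) \<zeta>) = sgl m (ts n m \<xi> \<zeta>)"
  unfolding tA_apply[OF assms(1) sgl_closed[OF assms(2)]]
  using ts_zero[OF assms(1)] by (intro ext) (simp add: sgl_def)

lemma tA_sgl_not:
  assumes "\<xi> \<in> carrier (fib X n)" "\<zeta> \<in> carrier (fib X k)" "\<not> n \<le> k"
  shows "tA n \<xi> (sgl k \<zeta>) = 0"
proof
  fix m
  have "n + m \<noteq> k" using assms(3) nat_fun_le_add by auto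
  then show "tA n \<xi> (sgl k \<zeta>) m = 0 m"
    unfolding tA_apply[OF assms(1) sgl_closed[OF assms(2)]] using ts_zero[OF assms(1)] by (simp add: sgl_def)
qed

lemma t_add: "\<xi> \<in> carrier (fib X n) \<Longrightarrow> \<eta> \<in> carrier (fib X n) \<Longrightarrow> t n (\<xi> + \<eta>) = t n \<xi> + t n \<eta>"
  by (rule op_eqI) (auto simp: t_L F.add_closed K.L_plus t_sgl T.p_add_left sgl_add)

lemma sgl_scaleC: "sgl m (c *\<^sub>C \<xi>) = c *\<^sub>C sgl m \<xi>"
  by (auto simp: sgl_def scaleC_fun_def)

lemma t_scaleC: "\<xi> \<in> carrier (fib X n) \<Longrightarrow> t n (c *\<^sub>C \<xi>) = c *\<^sub>C t n \<xi>"
  by (rule op_eqI[OF t_L[OF F.scaleC_closed] K.L_scale[OF t_L]])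
    (simp_all add: F.scaleC_closed t_sgl T.p_scaleC_left sgl_scaleC scaleC_fun_def[of c "t n \<xi>"])

lemma t_sum: "(\<And>i. i \<in> I \<Longrightarrow> f i \<in> carrier (fib X n)) \<Longrightarrow> t n (\<Sum>i\<in>I. f i) = (\<Sum>i\<in>I. t n (f i))"
proof (induction I rule: infinite_finite_induct)
  case (insert i I)
  then show ?case by (simp add: t_add F.sum_closed)
next
  have z: "t n 0 = 0" using t_scaleC[OF F.zero_closed, of n 0] by simp
  { case (infinite A) then show ?case using z by simp }
  { case empty then show ?case using z by simp }
qed

lemma t_emb: "t 0 (emb X a) = pi_rep X a"
proof -
  have "pmul X 0 k (emb X a) (\<eta> k) = lact (fib X k) a (\<eta> k)" if "\<eta> \<in> carrier (fock X)" for \<eta> k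
    by (rule pmul_emb_left[OF fock_comp[OF that]])
  then show ?thesis by (auto simp: t_op_def pi_rep_def left_op_def restr_def fun_eq_iff fock_simps(4) le_fun_def fun_diff_def)
qed

lemma pi_L: "pi_rep X a \<in> \<L> (fock X)"
  using t_L[OF emb_closed, of a] by (simp add: t_emb)

lemma pi_sgl: "\<xi> \<in> carrier (fib X m) \<Longrightarrow> pi_rep X a (sgl m \<xi>) = sgl m (lact (fib X m) a \<xi>)"
  using t_sgl[OF emb_closed, of \<xi> m a] by (simp add: t_emb pmul_emb_left)

lemma pi_one: "pi_rep X 1 = id_op (fock X)"
  by (rule op_eqI) (auto simp: pi_L K.L_id_op pi_sgl sgl_closed F.lact_one)

lemma pi_mult: "pi_rep X (a * b) = pi_rep X a \<circ> pi_rep X b"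
  by (rule op_eqI) (auto simp: pi_L K.L_comp pi_sgl F.lact_closed F.lact_mult)

lemma pi_add: "pi_rep X (a + b) = pi_rep X a + pi_rep X b"
  by (rule op_eqI) (auto simp: pi_L K.L_plus pi_sgl F.lact_plus sgl_add)

lemma pi_scaleC: "pi_rep X (c *\<^sub>C a) = c *\<^sub>C pi_rep X a"
  by (rule op_eqI[OF pi_L K.L_scale[OF pi_L]])
    (simp_all add: pi_sgl F.lact_scaleC_left sgl_scaleC scaleC_fun_def[of c "pi_rep X a"])

lemma t_mult:
  assumes "\<xi> \<in> carrier (fib X n)" "\<eta> \<in> carrier (fib X m)"
  shows "t n \<xi> \<circ> t m \<eta> = t (n + m) (pmul X n m \<xi> \<eta>)"
  by (rule op_eqI) (use assms in \<open>auto simp: t_L K.L_comp T.p_closed t_sgl assoc add.assoc\<close>)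

lemma tA_t:
  assumes "\<eta> \<in> carrier (fib X n)" "\<xi> \<in> carrier (fib X n)"
  shows "tA n \<eta> \<circ> t n \<xi> = pi_rep X (ip (fib X n) \<eta> \<xi>)"
  by (rule op_eqI) (use assms in \<open>auto simp: t_L tA_L pi_L K.L_comp T.p_closed t_sgl tA_sgl pi_sgl T.tstar_p\<close>)

lemma adj_pi: "adj (fock X) (pi_rep X a) = pi_rep X (star a)"
proof (rule op_eqI)
  fix m \<xi> assume x: "\<xi> \<in> carrier (fib X m)"
  have *: "adj (fock X) (pi_rep X a) (sgl m \<xi>) \<in> carrier (fock X)" using K.L_closed[OF K.adj_closed[OF pi_L] sgl_closed[OF x]] .
  show "adj (fock X) (pi_rep X a) (sgl m \<xi>) = pi_rep X (star a) (sgl m \<xi>)"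
  proof (rule fock_eqI_sgl)
    fix k \<eta> assume y: "\<eta> \<in> carrier (fib X k)"
    have "ip (fock X) (sgl k \<eta>) (adj (fock X) (pi_rep X a) (sgl m \<xi>)) = ip (fock X) (sgl k (lact (fib X k) a \<eta>)) (sgl m \<xi>)"
      using K.adj_ip[OF pi_L sgl_closed[OF y] sgl_closed[OF x]] y by (simp add: pi_sgl)
    also have "\<dots> = ip (fock X) (sgl k \<eta>) (sgl m (lact (fib X m) (star a) \<xi>))"
      using x y by (simp add: ip_sgl_left sgl_closed F.lact_closed) (auto simp: sgl_def F.ip_lact_left F.lact_closed)
    finally show "ip (fock X) (sgl k \<eta>) (adj (fock X) (pi_rep X a) (sgl m \<xi>)) = ip (fock X) (sgl k \<eta>) (pi_rep X (star a) (sgl m \<xi>))"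
      using x by (simp add: pi_sgl)
  qed (use * x in \<open>simp_all add: pi_sgl sgl_closed F.lact_closed\<close>)
qed (simp_all add: pi_L K.adj_closed)

lemma pi_t: "\<xi> \<in> carrier (fib X n) \<Longrightarrow> pi_rep X a \<circ> t n \<xi> = t n (lact (fib X n) a \<xi>)"
  by (rule op_eqI) (auto simp: t_L pi_L K.L_comp T.p_closed t_sgl pi_sgl F.lact_closed T.p_lact)

text \<open>Expanding \<zeta> along the frame of the fibre over \<open>m\<close> reduces the product
  to the relation \<open>tA_t\<close> in equal degrees.\<close>

lemma tA_t_le:
  assumes "\<eta> \<in> carrier (fib X m)" "\<zeta> \<in> carrier (fib X (m + j))"
  shows "tA m \<eta> \<circ> t (m + j) \<zeta> = t j (ts m j \<eta> \<zeta>)"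
proof -
  have c: "ts m j (xw \<mu>) \<zeta> \<in> carrier (fib X j)" if "\<mu> \<in> wds m" for \<mu>
    using T.tstar_closed[OF xw_closed[OF that] assms(2)] .
  have "t (m + j) \<zeta> = t (m + j) (\<Sum>\<mu>\<in>wds m. pmul X m j (xw \<mu>) (ts m j (xw \<mu>) \<zeta>))"
    by (simp only: T.tstar_dec[OF xw_dec assms(2), symmetric])
  also have "\<dots> = (\<Sum>\<mu>\<in>wds m. t m (xw \<mu>) \<circ> t j (ts m j (xw \<mu>) \<zeta>))"
    using c xw_closed by (subst t_sum) (auto simp: T.p_closed t_mult)
  finally have "tA m \<eta> \<circ> t (m + j) \<zeta> = (\<Sum>\<mu>\<in>wds m. tA m \<eta> \<circ> (t m (xw \<mu>) \<circ> t j (ts m j (xw \<mu>) \<zeta>)))"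
    using c xw_closed assms by (simp add: K.comp_sum_right tA_L t_L K.L_comp)
  also have "\<dots> = (\<Sum>\<mu>\<in>wds m. t j (lact (fib X j) (ip (fib X m) \<eta> (xw \<mu>)) (ts m j (xw \<mu>) \<zeta>)))"
    using c xw_closed assms by (intro sum.cong) (auto simp: comp_assoc[symmetric] tA_t pi_t)
  also have "\<dots> = t j (\<Sum>\<mu>\<in>wds m. lact (fib X j) (ip (fib X m) \<eta> (xw \<mu>)) (ts m j (xw \<mu>) \<zeta>))"
    using c by (intro t_sum[symmetric] F.lact_closed)
  also have "\<dots> = t j (ts m j \<eta> \<zeta>)" by (simp only: T.tstar_dec_left[OF xw_dec assms])
  finally show ?thesis .
qed

lemma adj_tt: "\<xi> \<in> carrier (fib X n) \<Longrightarrow> \<eta> \<in> carrier (fib X m) \<Longrightarrow> adj (fock X) (tt X n \<xi> m \<eta>) = tt X m \<eta> n \<xi>"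
  by (simp add: K.adj_comp t_L tA_L K.adj_adj)

text \<open>The sum does not depend on the frame: it is the identity on degrees above
  \<open>n\<close>, by \<open>tstar_dec\<close>, and zero elsewhere.\<close>

lemma sum_tt_dec:
  assumes d: "is_dec (fib X n) J y"
  shows "(\<Sum>\<mu>\<in>J. tt X n (y \<mu>) n (y \<mu>)) = dproj {k. n \<le> k}"
proof (rule op_eqI)
  show "(\<Sum>\<mu>\<in>J. tt X n (y \<mu>) n (y \<mu>)) \<in> \<L> (fock X)"
    using is_dec_closed[OF d] by (auto intro!: K.L_sum_op K.L_comp t_L tA_L)
  fix k \<zeta> assume z: "\<zeta> \<in> carrier (fib X k)"
  have s: "(\<Sum>\<mu>\<in>I. f \<mu>) \<omega> = (\<Sum>\<mu>\<in>I. f \<mu> \<omega>)" for I and f :: "_ \<Rightarrow> (('i \<Rightarrow> nat) \<Rightarrow> 'x) \<Rightarrow> (('i \<Rightarrow> nat) \<Rightarrow> 'x)" and \<omega>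
    by (induction I rule: infinite_finite_induct) auto
  show "(\<Sum>\<mu>\<in>J. tt X n (y \<mu>) n (y \<mu>)) (sgl k \<zeta>) = dproj {k. n \<le> k} (sgl k \<zeta>)"
  proof (cases "n \<le> k")
    case True
    then obtain m where k: "k = n + m" using nat_fun_leE by blast
    have "(\<Sum>\<mu>\<in>J. tt X n (y \<mu>) n (y \<mu>)) (sgl k \<zeta>) = (\<Sum>\<mu>\<in>J. sgl k (pmul X n m (y \<mu>) (ts n m (y \<mu>) \<zeta>)))"
      unfolding s using z is_dec_closed[OF d] by (intro sum.cong) (auto simp: k tA_sgl t_sgl T.tstar_closed)
    also have "\<dots> = sgl k \<zeta>" unfolding sgl_sum[symmetric] using T.tstar_dec[OF d, of \<zeta> m] z k by simp
    finally show ?thesis using True z by (simp add: dproj_sgl)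
  next
    case False
    have "(\<Sum>\<mu>\<in>J. tt X n (y \<mu>) n (y \<mu>)) (sgl k \<zeta>) = 0"
      unfolding s using False z is_dec_closed[OF d] by (intro sum.neutral) (auto simp: tA_sgl_not K.L_zero[OF t_L])
    then show ?thesis using False z by (simp add: dproj_sgl)
  qed
qed (rule dproj_L)

lemmas sum_tt_words = sum_tt_dec[OF xw_dec]

text \<open>Nica covariance. The range of t(\<xi>) lies in degrees above \<open>n\<close>, and the
  adjoint of t(\<eta>) kills degrees not above \<open>m\<close>; so the projection onto degrees
  above \<open>sup m n\<close> may be inserted between them. By finite rank it is a finite sum over
  words, and each summand simplifies on both sides.\<close>

lemma Nica:
  assumes e: "\<eta> \<in> carrier (fib X m)" and x: "\<xi> \<in> carrier (fib X n)"
  defines "l \<equiv> sup m n"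
  shows "tA m \<eta> \<circ> t n \<xi> = (\<Sum>\<mu>\<in>wds l. tt X (l - m) (ts m (l - m) \<eta> (xw \<mu>)) (l - n) (ts n (l - n) \<xi> (xw \<mu>)))"
proof -
  have lm: "m + (l - m) = l" and ln: "n + (l - n) = l"
    by (simp_all add: l_def nat_fun_add_diff)
  have w: "xw \<mu> \<in> carrier (fib X (m + (l - m)))" "xw \<mu> \<in> carrier (fib X (n + (l - n)))" if "\<mu> \<in> wds l" for \<mu>
    using xw_closed[OF that] lm ln by auto
  have "tA m \<eta> \<circ> t n \<xi> = tA m \<eta> \<circ> (dproj {k. l \<le> k} \<circ> t n \<xi>)"
  proof (rule op_eqI)
    fix k \<zeta> assume z: "\<zeta> \<in> carrier (fib X k)"
    show "(tA m \<eta> \<circ> t n \<xi>) (sgl k \<zeta>) = (tA m \<eta> \<circ> (dproj {k. l \<le> k} \<circ> t n \<xi>)) (sgl k \<zeta>)"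
    proof (cases "m \<le> n + k")
      case True
      then have "l \<le> n + k" unfolding l_def by (intro sup_least nat_fun_le_add)
      then show ?thesis using z x by (simp add: t_sgl dproj_sgl T.p_closed)
    next
      case False
      then have "\<not> l \<le> n + k" unfolding l_def by (meson le_supE)
      then show ?thesis using False z x e by (simp add: t_sgl dproj_sgl T.p_closed tA_sgl_not K.L_zero[OF tA_L])
    qed
  qed (auto intro!: K.L_comp tA_L t_L dproj_L e x)
  also have "\<dots> = (\<Sum>\<mu>\<in>wds l. tA m \<eta> \<circ> (tt X l (xw \<mu>) l (xw \<mu>) \<circ> t n \<xi>))"
    unfolding sum_tt_words[symmetric] K.comp_sum_left using xw_closed
    by (intro K.comp_sum_right K.L_comp tA_L t_L e x)
  also have "\<dots> = (\<Sum>\<mu>\<in>wds l. tt X (l - m) (ts m (l - m) \<eta> (xw \<mu>)) (l - n) (ts n (l - n) \<xi> (xw \<mu>)))"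
  proof (rule sum.cong[OF refl])
    fix \<mu> assume m: "\<mu> \<in> wds l"
    note c = T.tstar_closed[OF e w(1)[OF m]] T.tstar_closed[OF x w(2)[OF m]]
    have 1: "tA m \<eta> \<circ> t l (xw \<mu>) = t (l - m) (ts m (l - m) \<eta> (xw \<mu>))"
      using tA_t_le[OF e w(1)[OF m]] lm by simp
    have "tA n \<xi> \<circ> t l (xw \<mu>) = t (l - n) (ts n (l - n) \<xi> (xw \<mu>))"
      using tA_t_le[OF x w(2)[OF m]] ln by simp
    then have "adj (fock X) (tA n \<xi> \<circ> t l (xw \<mu>)) = tA (l - n) (ts n (l - n) \<xi> (xw \<mu>))" by simp
    then have 2: "tA l (xw \<mu>) \<circ> t n \<xi> = tA (l - n) (ts n (l - n) \<xi> (xw \<mu>))"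
      using x xw_closed[OF m] by (simp add: K.adj_comp tA_L t_L K.adj_adj)
    have "tA m \<eta> \<circ> (tt X l (xw \<mu>) l (xw \<mu>) \<circ> t n \<xi>) = (tA m \<eta> \<circ> t l (xw \<mu>)) \<circ> (tA l (xw \<mu>) \<circ> t n \<xi>)"
      by (simp add: comp_assoc)
    then show "tA m \<eta> \<circ> (tt X l (xw \<mu>) l (xw \<mu>) \<circ> t n \<xi>) = tt X (l - m) (ts m (l - m) \<eta> (xw \<mu>)) (l - n) (ts n (l - n) \<xi> (xw \<mu>))"
      by (simp only: 1 2)
  qed
  finally show ?thesis .
qed

text \<open>The linear span of the products of a creation and an annihilation operator. Scalars are
  absorbed into \<xi>, which leaves a single inductive step.\<close>

inductive_set Alg :: "((('i \<Rightarrow> nat) \<Rightarrow> 'x) \<Rightarrow> ('i \<Rightarrow> nat) \<Rightarrow> 'x) set" where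
  Alg_zero: "0 \<in> Alg"
| Alg_step: "T \<in> Alg \<Longrightarrow> \<xi> \<in> carrier (fib X n) \<Longrightarrow> \<eta> \<in> carrier (fib X m) \<Longrightarrow> tt X n \<xi> m \<eta> + T \<in> Alg"

lemma tt_L: "\<xi> \<in> carrier (fib X n) \<Longrightarrow> \<eta> \<in> carrier (fib X m) \<Longrightarrow> tt X n \<xi> m \<eta> \<in> \<L> (fock X)"
  by (intro K.L_comp t_L tA_L)

lemma Alg_L: "T \<in> Alg \<Longrightarrow> T \<in> \<L> (fock X)"
  by (induction rule: Alg.induct) (rule K.L_zero_op, intro K.L_plus tt_L)

lemma Alg_tt: "\<xi> \<in> carrier (fib X n) \<Longrightarrow> \<eta> \<in> carrier (fib X m) \<Longrightarrow> tt X n \<xi> m \<eta> \<in> Alg"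
  using Alg_step[OF Alg_zero] by simp

lemma Alg_plus: "T \<in> Alg \<Longrightarrow> S \<in> Alg \<Longrightarrow> T + S \<in> Alg"
  by (induction rule: Alg.induct) (simp_all only: add_0 add.assoc Alg_step)

lemma Alg_sum: "(\<And>i. i \<in> I \<Longrightarrow> f i \<in> Alg) \<Longrightarrow> sum f I \<in> Alg"
  by (induction I rule: infinite_finite_induct) (simp_all add: Alg_zero Alg_plus)

lemma Alg_scaleC: "T \<in> Alg \<Longrightarrow> c *\<^sub>C T \<in> Alg"
proof (induction rule: Alg.induct)
  case (Alg_step T \<xi> n \<eta> m)
  have "c *\<^sub>C (tt X n \<xi> m \<eta> + T) = tt X n (c *\<^sub>C \<xi>) m \<eta> + c *\<^sub>C T"
    using Alg_step by (simp add: scaleC_add_right t_scaleC K.comp_scale_left)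
  then show ?case using Alg.Alg_step[OF Alg_step.IH F.scaleC_closed] Alg_step by metis
qed (simp only: scaleC_zero_right Alg_zero)

lemma Alg_minus: "T \<in> Alg \<Longrightarrow> S \<in> Alg \<Longrightarrow> T - S \<in> Alg"
  using Alg_plus[OF _ Alg_scaleC[of S "-1"], of T] by simp

lemma Alg_adj: "T \<in> Alg \<Longrightarrow> adj (fock X) T \<in> Alg"
proof (induction rule: Alg.induct)
  case (Alg_step T \<xi> n \<eta> m)
  then show ?case using Alg.Alg_step[OF Alg_step.IH]
    by (subst K.adj_plus[OF tt_L Alg_L]) (simp_all only: adj_tt)
qed (simp only: K.adj_zero Alg_zero)

text \<open>Nica covariance replaces the inner pair of factors by products in the opposite order, so
  the span is closed under multiplication.\<close>

lemma Alg_tt_tt: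
  assumes "\<xi> \<in> carrier (fib X n)" "\<eta> \<in> carrier (fib X m)" "\<zeta> \<in> carrier (fib X k)" "\<omega> \<in> carrier (fib X w)"
  shows "tt X n \<xi> m \<eta> \<circ> tt X k \<zeta> w \<omega> \<in> Alg"
proof -
  define l where "l = sup m k"
  have lm: "m + (l - m) = l" and lk: "k + (l - k) = l"
    by (simp_all add: l_def nat_fun_add_diff)
  let ?a = "\<lambda>\<mu>. ts m (l - m) \<eta> (xw \<mu>)" and ?b = "\<lambda>\<mu>. ts k (l - k) \<zeta> (xw \<mu>)"
  have c: "?a \<mu> \<in> carrier (fib X (l - m))" "?b \<mu> \<in> carrier (fib X (l - k))" if "\<mu> \<in> wds l" for \<mu>
    using T.tstar_closed[OF assms(2), of "xw \<mu>" "l - m"] T.tstar_closed[OF assms(3), of "xw \<mu>" "l - k"] xw_closed[OF that] lm lk by auto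
  have "tt X n \<xi> m \<eta> \<circ> tt X k \<zeta> w \<omega> = t n \<xi> \<circ> ((tA m \<eta> \<circ> t k \<zeta>) \<circ> tA w \<omega>)" by (simp add: comp_assoc)
  also have "\<dots> = (\<Sum>\<mu>\<in>wds l. t n \<xi> \<circ> (tt X (l - m) (?a \<mu>) (l - k) (?b \<mu>) \<circ> tA w \<omega>))"
    unfolding Nica[OF assms(2,3)] l_def[symmetric] K.comp_sum_left
    using c assms by (intro K.comp_sum_right K.L_comp t_L tA_L)
  also have "\<dots> = (\<Sum>\<mu>\<in>wds l. tt X (n + (l - m)) (pmul X n (l - m) \<xi> (?a \<mu>)) (w + (l - k)) (pmul X w (l - k) \<omega> (?b \<mu>)))"
  proof (rule sum.cong[OF refl])
    fix \<mu> assume m: "\<mu> \<in> wds l"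
    have "adj (fock X) (t w \<omega> \<circ> t (l - k) (?b \<mu>)) = tA (w + (l - k)) (pmul X w (l - k) \<omega> (?b \<mu>))"
      using t_mult[OF assms(4) c(2)[OF m]] by simp
    then have "tA (l - k) (?b \<mu>) \<circ> tA w \<omega> = tA (w + (l - k)) (pmul X w (l - k) \<omega> (?b \<mu>))"
      using assms c[OF m] by (simp add: K.adj_comp t_L)
    moreover have "t n \<xi> \<circ> (tt X (l - m) (?a \<mu>) (l - k) (?b \<mu>) \<circ> tA w \<omega>) = (t n \<xi> \<circ> t (l - m) (?a \<mu>)) \<circ> (tA (l - k) (?b \<mu>) \<circ> tA w \<omega>)"
      by (simp add: comp_assoc)
    ultimately show "t n \<xi> \<circ> (tt X (l - m) (?a \<mu>) (l - k) (?b \<mu>) \<circ> tA w \<omega>)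
        = tt X (n + (l - m)) (pmul X n (l - m) \<xi> (?a \<mu>)) (w + (l - k)) (pmul X w (l - k) \<omega> (?b \<mu>))"
      using t_mult[OF assms(1) c(1)[OF m]] by simp
  qed
  finally show ?thesis using c assms by (simp only:) (intro Alg_sum Alg_tt T.p_closed)
qed

lemma Alg_tt_comp:
  assumes "S \<in> Alg" "\<xi> \<in> carrier (fib X n)" "\<eta> \<in> carrier (fib X m)"
  shows "tt X n \<xi> m \<eta> \<circ> S \<in> Alg"
  using assms(1)
proof (induction rule: Alg.induct)
  case Alg_zero
  show ?case unfolding K.comp_zero_right[OF tt_L[OF assms(2,3)]] by (rule Alg.Alg_zero)
next
  case (Alg_step T \<zeta> k \<omega> w)
  then show ?case
    using K.comp_plus_right[OF tt_L[OF assms(2,3)] tt_L[OF Alg_step(2,3)] Alg_L[OF Alg_step(1)]]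
      Alg_plus[OF Alg_tt_tt[OF assms(2,3) Alg_step(2,3)] Alg_step.IH] by (simp only:)
qed

lemma Alg_comp: "T \<in> Alg \<Longrightarrow> S \<in> Alg \<Longrightarrow> T \<circ> S \<in> Alg"
proof (induction rule: Alg.induct)
  case Alg_zero
  show ?case unfolding K.comp_zero_left by (rule Alg.Alg_zero)
next
  case (Alg_step T \<xi> n \<eta> m)
  then show ?case unfolding K.comp_plus_left using Alg_plus Alg_tt_comp by blast
qed

lemma Alg_t: "\<xi> \<in> carrier (fib X n) \<Longrightarrow> t n \<xi> \<in> Alg"
  using Alg_tt[OF _ emb_closed[of 1], of \<xi> n]
  by (simp add: t_emb pi_one K.adj_id K.comp_id_right t_L)

lemma Alg_pi: "pi_rep X a \<in> Alg"
  using Alg_t[OF emb_closed, of a] by (simp add: t_emb)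

lemma Alg_id: "id_op (fock X) \<in> Alg"
  using Alg_pi[of 1] by (simp add: pi_one)

section \<open>The Toeplitz-Nica-Pimsner algebra as the closure of Alg\<close>

lemma cstar_subalgebra_NT: "cstar_subalgebra (fock X) (NT X)"
proof -
  let ?G = "range (pi_rep X) \<union> {t_op X n \<xi> |n \<xi>. \<xi> \<in> carrier (fib X n)}"
  have "?G \<subseteq> \<L> (fock X)" using pi_L t_L by auto
  then have 1: "NT X \<subseteq> \<L> (fock X)" unfolding NT_def cstar_generated_def using K.cstar_subalgebra_L by blast
  have 2: "closed_in (fock X) (\<L> (fock X)) (NT X)"
    unfolding closed_in_def
  proof (intro ballI impI)
    fix T assume T: "T \<in> \<L> (fock X)" and h: "\<forall>\<epsilon>>0. \<exists>S\<in>NT X. opnorm (fock X) (T - S) < \<epsilon>"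
    show "T \<in> NT X" unfolding NT_def cstar_generated_def
    proof (rule InterI, clarify)
      fix B assume B: "?G \<subseteq> B" "cstar_subalgebra (fock X) B"
      then have "NT X \<subseteq> B" by (auto simp: NT_def cstar_generated_def)
      then have "\<forall>\<epsilon>>0. \<exists>S\<in>B. opnorm (fock X) (T - S) < \<epsilon>" using h by blast
      then show "T \<in> B" using B(2) T unfolding cstar_subalgebra_def closed_in_def by blast
    qed
  qed
  have 3: "0 \<in> NT X" "\<And>S T. S \<in> NT X \<Longrightarrow> T \<in> NT X \<Longrightarrow> S + T \<in> NT X" "\<And>S T. S \<in> NT X \<Longrightarrow> T \<in> NT X \<Longrightarrow> S \<circ> T \<in> NT X"
    "\<And>T. T \<in> NT X \<Longrightarrow> adj (fock X) T \<in> NT X" "\<And>T c. T \<in> NT X \<Longrightarrow> c *\<^sub>C T \<in> NT X"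
    unfolding NT_def cstar_generated_def cstar_subalgebra_def by blast+
  show ?thesis unfolding cstar_subalgebra_def by (intro conjI ballI allI 1 2 3)
qed

lemma NT_L: "T \<in> NT X \<Longrightarrow> T \<in> \<L> (fock X)"
  using cstar_subalgebra_NT by (auto simp: cstar_subalgebra_def)

lemma NT_simps: "0 \<in> NT X" "S \<in> NT X \<Longrightarrow> T \<in> NT X \<Longrightarrow> S + T \<in> NT X" "S \<in> NT X \<Longrightarrow> T \<in> NT X \<Longrightarrow> S \<circ> T \<in> NT X"
    "T \<in> NT X \<Longrightarrow> adj (fock X) T \<in> NT X" "T \<in> NT X \<Longrightarrow> c *\<^sub>C T \<in> NT X"
  using cstar_subalgebra_NT by (auto simp: cstar_subalgebra_def)

lemma Alg_NT: "T \<in> Alg \<Longrightarrow> T \<in> NT X"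
proof (induction rule: Alg.induct)
  case (Alg_step T \<xi> n \<eta> m)
  have "t n \<xi> \<in> NT X" "t m \<eta> \<in> NT X" using Alg_step unfolding NT_def cstar_generated_def by blast+
  then show ?case using Alg_step by (intro NT_simps)
qed (rule NT_simps)

lemma NT_closed: "T \<in> \<L> (fock X) \<Longrightarrow> (\<And>e. e > 0 \<Longrightarrow> \<exists>S\<in>NT X. opnorm (fock X) (T - S) < e) \<Longrightarrow> T \<in> NT X"
  using cstar_subalgebra_NT unfolding cstar_subalgebra_def closed_in_def by blast

text \<open>The norm closure of \<open>Alg\<close> is a C*-subalgebra containing the generators, so
  it contains the intersection that defines \<open>NT X\<close>.\<close>

lemma NT_approx:
  assumes "T \<in> NT X" "e > 0"
  shows "\<exists>S\<in>Alg. opnorm (fock X) (T - S) < e"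
proof -
  let ?N = "opnorm (fock X)"
  let ?C = "{T \<in> \<L> (fock X). \<forall>e>0. \<exists>S\<in>Alg. ?N (T - S) < e}"
  have C: "T \<in> ?C" if "T \<in> Alg" for T
  proof -
    have "?N (T - T) \<le> 0" using K.opnorm_le[of 0 0] by simp
    then show ?thesis using that Alg_L by force
  qed
  have "cstar_subalgebra (fock X) ?C"
    unfolding cstar_subalgebra_def
  proof (intro conjI ballI allI)
    show "?C \<subseteq> \<L> (fock X)" by blast
    show "0 \<in> ?C" by (intro C Alg_zero)
  next
    fix S T assume "S \<in> ?C" "T \<in> ?C"
    then have L: "S \<in> \<L> (fock X)" "T \<in> \<L> (fock X)"
      and ap: "\<And>e. e > 0 \<Longrightarrow> \<exists>S'\<in>Alg. ?N (S - S') < e" "\<And>e. e > 0 \<Longrightarrow> \<exists>S'\<in>Alg. ?N (T - S') < e" by auto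
    show "S + T \<in> ?C"
    proof (clarify, intro conjI allI impI K.L_plus L)
      fix e :: real assume "e > 0"
      then obtain S' T' where s: "S' \<in> Alg" "?N (S - S') < e / 2" "T' \<in> Alg" "?N (T - T') < e / 2"
        using ap[of "e/2"] by auto
      have "?N ((S + T) - (S' + T')) \<le> ?N (S - S') + ?N (T - T')"
        using K.opnorm_triangle[of "S - S'" "T - T'"] L s by (simp add: K.L_minus Alg_L algebra_simps)
      then show "\<exists>R\<in>Alg. ?N ((S + T) - R) < e" using s by (intro bexI[of _ "S' + T'"]) (auto intro: Alg_plus)
    qed
    show "S \<circ> T \<in> ?C"
    proof (clarify, intro conjI allI impI K.L_comp L)
      fix e :: real assume e: "e > 0"
      define a where "a = ?N S + ?N T + 1"
      have a: "a \<ge> 1" "?N S \<le> a" "?N T + 1 \<le> a" "?N T \<le> a" using K.opnorm_nonneg[OF L(1)] K.opnorm_nonneg[OF L(2)] by (auto simp: a_def)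
      \<comment> \<open>The bound 1 keeps the norm of the approximant of \<open>T\<close> below
        \<open>a\<close>; the bound e / (2 a) makes each part of the product error at most e /
        2.\<close>
      define d where "d = min 1 (e / (2 * a))"
      have d: "d > 0" "d \<le> 1" "d \<le> e / (2 * a)" using e a by (auto simp: d_def)
      obtain S' T' where s: "S' \<in> Alg" "?N (S - S') < d" "T' \<in> Alg" "?N (T - T') < d"
        using ap d(1) by metis
      have L': "S' \<in> \<L> (fock X)" "T' \<in> \<L> (fock X)" using s Alg_L by auto
      have "?N T' \<le> a"
        using K.opnorm_triangle_diff[OF L'(2) L(2) K.L_zero_op] K.opnorm_minus_commute[OF L(2) L'(2)] s(4) d a by simp
      have eq: "(S \<circ> T) - (S' \<circ> T') = (S \<circ> (T - T')) + ((S - S') \<circ> T')"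
        using L L' by (simp add: K.comp_minus_right K.comp_minus_left)
      have "?N (S \<circ> (T - T')) \<le> a * ?N (T - T')" using L L' a by (intro K.opnorm_comp_le K.L_minus) auto
      also have "\<dots> < a * d" using s a by simp
      also have "\<dots> \<le> e / 2" using d(3) a by (simp add: field_simps)
      finally have 1: "?N (S \<circ> (T - T')) < e / 2" .
      have "?N ((S - S') \<circ> T') \<le> ?N (S - S') * a" using L L' \<open>?N T' \<le> a\<close> by (intro K.opnorm_comp_le K.L_minus) auto
      also have "\<dots> \<le> d * a" using s a by (intro mult_right_mono) auto
      also have "\<dots> \<le> e / 2" using d(3) a by (simp add: field_simps)
      finally have 2: "?N ((S - S') \<circ> T') \<le> e / 2" .
      have "?N ((S \<circ> T) - (S' \<circ> T')) < e" unfolding eq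
        using 1 2 K.opnorm_triangle[of "S \<circ> (T - T')" "(S - S') \<circ> T'"] L L' by (simp add: K.L_comp K.L_minus)
      then show "\<exists>R\<in>Alg. ?N ((S \<circ> T) - R) < e" using s by (intro bexI[of _ "S' \<circ> T'"]) (auto intro: Alg_comp)
    qed
  next
    fix T assume "T \<in> ?C"
    then have L: "T \<in> \<L> (fock X)" and ap: "\<And>e. e > 0 \<Longrightarrow> \<exists>S'\<in>Alg. ?N (T - S') < e" by auto
    show "adj (fock X) T \<in> ?C"
    proof (clarify, intro conjI allI impI K.adj_closed L)
      fix e :: real assume "e > 0"
      then obtain S where s: "S \<in> Alg" "?N (T - S) < e" using ap by blast
      have "?N (adj (fock X) T - adj (fock X) S) \<le> ?N (T - S)"
        using K.opnorm_adj_le[OF K.L_minus[OF L Alg_L[OF s(1)]]] K.adj_minus[OF L Alg_L[OF s(1)]] by simp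
      then show "\<exists>R\<in>Alg. ?N (adj (fock X) T - R) < e" using s by (intro bexI[of _ "adj (fock X) S"]) (auto intro: Alg_adj)
    qed
    fix c
    show "c *\<^sub>C T \<in> ?C"
    proof (clarify, intro conjI allI impI K.L_scale L)
      fix e :: real assume e: "e > 0"
      have p: "cmod c + 1 > 0" using norm_ge_zero[of c] by linarith
      then obtain S where s: "S \<in> Alg" "?N (T - S) < e / (cmod c + 1)" using ap[of "e / (cmod c + 1)"] e by auto
      have "?N (c *\<^sub>C T - c *\<^sub>C S) \<le> cmod c * ?N (T - S)"
        using K.opnorm_scaleC_le[OF K.L_minus[OF L Alg_L[OF s(1)]], of c] by (simp add: scaleC_diff_right)
      also have "\<dots> \<le> (cmod c + 1) * ?N (T - S)" using K.opnorm_nonneg[OF K.L_minus[OF L Alg_L[OF s(1)]]] by (intro mult_right_mono) auto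
      also have "\<dots> < e" using s(2) p by (simp add: less_divide_eq mult.commute)
      finally show "\<exists>R\<in>Alg. ?N (c *\<^sub>C T - R) < e" using s by (intro bexI[of _ "c *\<^sub>C S"]) (auto intro: Alg_scaleC)
    qed
  next
    show "closed_in (fock X) (\<L> (fock X)) ?C"
      unfolding closed_in_def
    proof (intro ballI impI)
      fix T assume T: "T \<in> \<L> (fock X)" and h: "\<forall>\<epsilon>>0. \<exists>S\<in>?C. ?N (T - S) < \<epsilon>"
      have "\<exists>R\<in>Alg. ?N (T - R) < e" if e: "e > 0" for e
      proof -
        obtain S where S: "S \<in> ?C" "?N (T - S) < e / 2" using h e half_gt_zero by blast
        then obtain R where R: "R \<in> Alg" "?N (S - R) < e / 2" using e half_gt_zero by blast
        have "?N (T - R) \<le> ?N (T - S) + ?N (S - R)" using T S R Alg_L by (intro K.opnorm_triangle_diff) auto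
        then show ?thesis using S R by (intro bexI[of _ R]) auto
      qed
      then show "T \<in> ?C" using T by blast
    qed
  qed
  moreover have "range (pi_rep X) \<union> {t_op X n \<xi> |n \<xi>. \<xi> \<in> carrier (fib X n)} \<subseteq> ?C"
    using C Alg_pi Alg_t by blast
  ultimately have "NT X \<subseteq> ?C" unfolding NT_def cstar_generated_def by blast
  then show ?thesis using assms by blast
qed

end

section \<open>Degree projections and the traces on the fibres\<close>

context finite_rank_system
begin

lemma letters_dec: "is_dec (fib X (unit_vec i)) {..<length (x i)} (\<lambda>j. x i ! j)"
proof (rule is_decI)
  have *: "set (x i) \<subseteq> carrier (fib X (unit_vec i)) \<and> (\<forall>\<xi>\<in>carrier (fib X (unit_vec i)).
      \<xi> = (\<Sum>j<length (x i). ract (fib X (unit_vec i)) (x i ! j) (ip (fib X (unit_vec i)) (x i ! j) \<xi>)))"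
    using ud unfolding unit_decomposition_def Let_def by blast
  show "x i ! j \<in> carrier (fib X (unit_vec i))" if "j \<in> {..<length (x i)}" for j using * that by auto
  show "(\<Sum>j<length (x i). ract (fib X (unit_vec i)) (x i ! j) (ip (fib X (unit_vec i)) (x i ! j) \<xi>)) = \<xi>"
    if "\<xi> \<in> carrier (fib X (unit_vec i))" for \<xi> using * that by metis
qed simp

lemma unit_vec_le: "unit_vec i \<le> k \<longleftrightarrow> k i \<noteq> 0"
  by (auto simp: unit_vec_def le_fun_def)

text \<open>Together with the next lemmas this reduces relations between the projections to
  relations between sets of degrees.\<close>

lemma Q_proj_eq: "Q_proj X x i = dproj {k. k i = 0}"
proof -
  have "P_proj X x i = dproj {k. k i \<noteq> 0}"
    unfolding P_proj_def using sum_tt_dec[OF letters_dec, of i] by (simp only: unit_vec_le)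
  then have "Q_proj X x i = dproj (- {k. k i \<noteq> 0})" unfolding Q_proj_def by (simp only: dproj_compl)
  also have "- {k. k i \<noteq> 0} = {k. k i = 0}" by auto
  finally show ?thesis .
qed

lemma Q_set_eq: "Q_set X x F = dproj {k. \<forall>i\<in>F. k i = 0}"
proof -
  have "foldr (\<lambda>i T. Q_proj X x i \<circ> T) L (id_op (fock X)) = dproj {k. \<forall>i\<in>set L. k i = 0}" for L
  proof (induction L)
    case (Cons i L)
    have "{k. k i = 0} \<inter> {k. \<forall>i\<in>set L. k i = 0} = {k :: 'i \<Rightarrow> nat. \<forall>i\<in>set (i # L). k i = 0}" by auto
    moreover have "foldr (\<lambda>i T. Q_proj X x i \<circ> T) (i # L) (id_op (fock X))
        = Q_proj X x i \<circ> foldr (\<lambda>i T. Q_proj X x i \<circ> T) L (id_op (fock X))" by simp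
    ultimately show ?case by (simp only: Cons.IH) (simp only: Q_proj_eq dproj_comp)
  qed (simp add: dproj_UNIV)
  then show ?thesis unfolding Q_set_def by simp
qed

lemma sum_fun_apply: "(\<Sum>i\<in>I. (f i :: 'z \<Rightarrow> 'y::comm_monoid_add)) z = (\<Sum>i\<in>I. f i z)"
  by (induction I rule: infinite_finite_induct) auto

lemma Q_level_eq: "Q_level X x F n = dproj {k. n \<le> k \<and> (\<forall>i\<in>F. (k - n) i = 0)}"
proof -
  let ?S = "{k. \<forall>i\<in>F. k i = 0}"
  have "(\<Sum>\<mu>\<in>wds n. t n (xw \<mu>) \<circ> dproj ?S \<circ> tA n (xw \<mu>)) = dproj {k. n \<le> k \<and> k - n \<in> ?S}"
  proof (rule op_eqI)
    show "(\<Sum>\<mu>\<in>wds n. t n (xw \<mu>) \<circ> dproj ?S \<circ> tA n (xw \<mu>)) \<in> \<L> (fock X)"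
      using xw_closed by (intro K.L_sum_op K.L_comp t_L tA_L dproj_L) 
    fix k \<zeta> assume z: "\<zeta> \<in> carrier (fib X k)"
    show "(\<Sum>\<mu>\<in>wds n. t n (xw \<mu>) \<circ> dproj ?S \<circ> tA n (xw \<mu>)) (sgl k \<zeta>) = dproj {k. n \<le> k \<and> k - n \<in> ?S} (sgl k \<zeta>)"
    proof (cases "n \<le> k \<and> k - n \<in> ?S")
      case True
      then obtain m where k: "k = n + m" using nat_fun_leE by blast
      have m: "m \<in> ?S" using True by (simp add: k nat_fun_diff_add)
      have "(\<Sum>\<mu>\<in>wds n. t n (xw \<mu>) \<circ> dproj ?S \<circ> tA n (xw \<mu>)) (sgl k \<zeta>) = (\<Sum>\<mu>\<in>wds n. sgl k (pmul X n m (xw \<mu>) (ts n m (xw \<mu>) \<zeta>)))"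
        using z xw_closed m by (subst sum_fun_apply, intro sum.cong) (auto simp: k tA_sgl t_sgl T.tstar_closed dproj_sgl)
      also have "\<dots> = sgl k \<zeta>" unfolding sgl_sum[symmetric] using T.tstar_dec[OF xw_dec, of \<zeta> n m] z k by simp
      finally show ?thesis using True z by (simp add: dproj_sgl)
    next
      case False
      have "(\<Sum>\<mu>\<in>wds n. t n (xw \<mu>) \<circ> dproj ?S \<circ> tA n (xw \<mu>)) (sgl k \<zeta>) = 0"
      proof (subst sum_fun_apply, rule sum.neutral, rule ballI)
        fix \<mu> assume w: "\<mu> \<in> wds n"
        show "(t n (xw \<mu>) \<circ> dproj ?S \<circ> tA n (xw \<mu>)) (sgl k \<zeta>) = 0"
        proof (cases "n \<le> k")
          case True
          then obtain m where k: "k = n + m" using nat_fun_leE by blast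
          have "m \<notin> ?S" using False True by (simp add: k nat_fun_diff_add)
          then have "dproj ?S (tA n (xw \<mu>) (sgl k \<zeta>)) = 0"
            using z xw_closed[OF w] by (simp only: k tA_sgl T.tstar_closed dproj_sgl if_False)
          then show ?thesis by (simp add: K.L_zero[OF t_L] xw_closed[OF w])
        next
          case False
          then show ?thesis using z xw_closed[OF w] by (simp add: tA_sgl_not K.L_zero[OF t_L] K.L_zero[OF dproj_L])
        qed
      qed
      then show ?thesis using False by (simp only: dproj_sgl[OF z] mem_Collect_eq if_False)
    qed
  qed (rule dproj_L)
  then show ?thesis unfolding Q_level_def Q_set_eq words_of_def by simp
qed

text \<open>For \<open>n\<close> supported in \<open>F\<close> the level prescribes exactly the
  coordinates in \<open>F\<close>, so different levels are orthogonal.\<close>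

lemma Q_level_eq':
  assumes "supp n \<subseteq> F" shows "Q_level X x F n = dproj {k. \<forall>i\<in>F. k i = n i}"
proof -
  have "(n \<le> k \<and> (\<forall>i\<in>F. (k - n) i = 0)) \<longleftrightarrow> (\<forall>i\<in>F. k i = n i)" for k
  proof
    assume h: "n \<le> k \<and> (\<forall>i\<in>F. (k - n) i = 0)"
    then have "n i \<le> k i" for i by (simp add: le_fun_def)
    then show "\<forall>i\<in>F. k i = n i" using h by (simp add: fun_diff_def le_antisym)
  next
    assume h: "\<forall>i\<in>F. k i = n i"
    have "n i = 0" if "i \<notin> F" for i using assms that by (auto simp: supp_def)
    then have "n i \<le> k i" for i using h by (cases "i \<in> F") auto
    then show "n \<le> k \<and> (\<forall>i\<in>F. (k - n) i = 0)" using h by (simp add: le_fun_def fun_diff_def)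
  qed
  then show ?thesis unfolding Q_level_eq by simp
qed

lemma Alg_Q_proj: "Q_proj X x i \<in> Alg"
  unfolding Q_proj_def P_proj_def using is_dec_closed[OF letters_dec] by (intro Alg_minus Alg_id Alg_sum Alg_tt)

lemma Alg_Q_set: "Q_set X x F \<in> Alg"
proof -
  have "foldr (\<lambda>i T. Q_proj X x i \<circ> T) L (id_op (fock X)) \<in> Alg" for L
    by (induction L) (simp_all add: Alg_id Alg_comp[OF Alg_Q_proj, unfolded comp_def] comp_def)
  then show ?thesis unfolding Q_set_def .
qed

lemma Alg_tA: "\<xi> \<in> carrier (fib X n) \<Longrightarrow> tA n \<xi> \<in> Alg"
  by (intro Alg_adj Alg_t)

lemma Alg_Q_level: "Q_level X x F n \<in> Alg"
  unfolding Q_level_def words_of_def[symmetric] using xw_closed by (intro Alg_sum Alg_comp Alg_Q_set Alg_t Alg_tA)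

lemma tdeg_add: "tdeg (n + m) = tdeg n + tdeg m"
  by (simp add: tdeg_def sum.distrib)

lemma tdeg_unit_vec: "tdeg (unit_vec i) = 1"
  by (simp add: tdeg_def unit_vec_def)

lemma tdeg_eq_0: "tdeg n = 0 \<longleftrightarrow> n = 0"
  by (auto simp: tdeg_def fun_eq_iff)

lemma nonneg_Reals_sum: "(\<And>i. i \<in> I \<Longrightarrow> f i \<in> \<real>\<^sub>\<ge>\<^sub>0) \<Longrightarrow> sum f I \<in> (\<real>\<^sub>\<ge>\<^sub>0 :: complex set)"
  by (induction I rule: infinite_finite_induct) auto

section \<open>The traces on the fibres\<close>

definition Tr :: "('a \<Rightarrow> complex) \<Rightarrow> ('i \<Rightarrow> nat) \<Rightarrow> ((('i \<Rightarrow> nat) \<Rightarrow> 'x) \<Rightarrow> ('i \<Rightarrow> nat) \<Rightarrow> 'x) \<Rightarrow> complex" where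
  "Tr \<tau> p T = (\<Sum>\<mu>\<in>wds p. \<tau> (ip (fock X) (sgl p (xw \<mu>)) (T (sgl p (xw \<mu>)))))"

context
  fixes \<tau> :: "'a \<Rightarrow> complex" assumes tau: "\<tau> \<in> tracial_states"
begin

lemma pos_tau: "pos_functional \<tau>"
  using tracial_pos_functional[OF tau] .

lemma tau_comm: "\<tau> (a * b) = \<tau> (b * a)"
  using tau unfolding tracial_states_def by blast

text \<open>Both sides expand into products of matrix entries of \<open>S\<close> and
  \<open>T\<close> with respect to the two frames, which \<tau> allows to be exchanged. Only
  \<open>S\<close> must map one fibre to the other. With the identity as \<open>S\<close> this gives
  independence of the frame, with a creation operator the KMS relation in one degree.\<close>

lemma trace_swap:
  assumes y: "is_dec (fib X p) J y" and z: "is_dec (fib X q) L z" and S: "S \<in> \<L> (fock X)" and T: "T \<in> \<L> (fock X)"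
    and S1: "\<And>\<xi>. \<xi> \<in> carrier (fib X p) \<Longrightarrow> \<exists>\<zeta>\<in>carrier (fib X q). S (sgl p \<xi>) = sgl q \<zeta>"
    and S2: "\<And>\<zeta>. \<zeta> \<in> carrier (fib X q) \<Longrightarrow> \<exists>\<xi>\<in>carrier (fib X p). adj (fock X) S (sgl q \<zeta>) = sgl p \<xi>"
  shows "(\<Sum>j\<in>J. \<tau> (ip (fock X) (sgl p (y j)) ((T \<circ> S) (sgl p (y j))))) =
    (\<Sum>k\<in>L. \<tau> (ip (fock X) (sgl q (z k)) ((S \<circ> T) (sgl q (z k)))))"
proof -
  let ?i = "ip (fock X)"
  have yc: "sgl p (y j) \<in> carrier (fock X)" if "j \<in> J" for j using sgl_closed is_dec_closed[OF y that] by blast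
  have zc: "sgl q (z k) \<in> carrier (fock X)" if "k \<in> L" for k using sgl_closed is_dec_closed[OF z that] by blast
  have 1: "?i (sgl p (y j)) ((T \<circ> S) (sgl p (y j))) = (\<Sum>k\<in>L. ?i (sgl p (y j)) (T (sgl q (z k))) * ?i (sgl q (z k)) (S (sgl p (y j))))"
    if j: "j \<in> J" for j
  proof -
    obtain \<zeta> where \<zeta>: "\<zeta> \<in> carrier (fib X q)" "S (sgl p (y j)) = sgl q \<zeta>" using S1 is_dec_closed[OF y j] by blast
    let ?w = "adj (fock X) T (sgl p (y j))"
    have w: "?w \<in> carrier (fock X)" using K.L_closed[OF K.adj_closed[OF T] yc[OF j]] .
    have "?i (sgl p (y j)) ((T \<circ> S) (sgl p (y j))) = ?i ?w (sgl q \<zeta>)"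
      using K.adj_ip_left[OF T yc[OF j] sgl_closed[OF \<zeta>(1)]] \<zeta> by simp
    also have "\<dots> = ip (fib X q) (?w q) \<zeta>" by (rule ip_sgl_right[OF \<zeta>(1) w])
    also have "\<dots> = (\<Sum>k\<in>L. ip (fib X q) (?w q) (z k) * ip (fib X q) (z k) \<zeta>)"
      by (rule F.is_dec_expand[OF z fock_comp[OF w] \<zeta>(1)])
    also have "\<dots> = (\<Sum>k\<in>L. ?i (sgl p (y j)) (T (sgl q (z k))) * ?i (sgl q (z k)) (S (sgl p (y j))))"
    proof (rule sum.cong[OF refl])
      fix k assume k: "k \<in> L"
      have "ip (fib X q) (?w q) (z k) = ?i ?w (sgl q (z k))" using ip_sgl_right[OF is_dec_closed[OF z k] w] by simp
      then show "ip (fib X q) (?w q) (z k) * ip (fib X q) (z k) \<zeta> = ?i (sgl p (y j)) (T (sgl q (z k))) * ?i (sgl q (z k)) (S (sgl p (y j)))"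
        using K.adj_ip_left[OF T yc[OF j] zc[OF k]] ip_sgl_left[OF is_dec_closed[OF z k] sgl_closed[OF \<zeta>(1)]] \<zeta>(2) by simp
    qed
    finally show ?thesis .
  qed
  have 2: "?i (sgl q (z k)) ((S \<circ> T) (sgl q (z k))) = (\<Sum>j\<in>J. ?i (sgl q (z k)) (S (sgl p (y j))) * ?i (sgl p (y j)) (T (sgl q (z k))))"
    if k: "k \<in> L" for k
  proof -
    obtain \<xi> where \<xi>: "\<xi> \<in> carrier (fib X p)" "adj (fock X) S (sgl q (z k)) = sgl p \<xi>" using S2 is_dec_closed[OF z k] by blast
    let ?w = "T (sgl q (z k))"
    have w: "?w \<in> carrier (fock X)" using K.L_closed[OF T zc[OF k]] .
    have "?i (sgl q (z k)) ((S \<circ> T) (sgl q (z k))) = ?i (sgl p \<xi>) ?w"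
      using K.adj_ip_left[OF S zc[OF k] w] \<xi> by simp
    also have "\<dots> = ip (fib X p) \<xi> (?w p)" by (rule ip_sgl_left[OF \<xi>(1) w])
    also have "\<dots> = (\<Sum>j\<in>J. ip (fib X p) \<xi> (y j) * ip (fib X p) (y j) (?w p))"
      by (rule F.is_dec_expand[OF y \<xi>(1) fock_comp[OF w]])
    also have "\<dots> = (\<Sum>j\<in>J. ?i (sgl q (z k)) (S (sgl p (y j))) * ?i (sgl p (y j)) (T (sgl q (z k))))"
    proof (rule sum.cong[OF refl])
      fix j assume j: "j \<in> J"
      have "ip (fib X p) \<xi> (y j) = ?i (sgl p \<xi>) (sgl p (y j))"
        using ip_sgl_left[OF \<xi>(1) yc[OF j]] by simp
      also have "\<dots> = ?i (sgl q (z k)) (S (sgl p (y j)))" using K.adj_ip_left[OF S zc[OF k] yc[OF j]] \<xi>(2) by simp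
      finally show "ip (fib X p) \<xi> (y j) * ip (fib X p) (y j) (?w p) = ?i (sgl q (z k)) (S (sgl p (y j))) * ?i (sgl p (y j)) (T (sgl q (z k)))"
        using ip_sgl_left[OF is_dec_closed[OF y j] w] by simp
    qed
    finally show ?thesis .
  qed
  have "(\<Sum>j\<in>J. \<tau> (?i (sgl p (y j)) ((T \<circ> S) (sgl p (y j))))) =
     (\<Sum>j\<in>J. \<Sum>k\<in>L. \<tau> (?i (sgl p (y j)) (T (sgl q (z k))) * ?i (sgl q (z k)) (S (sgl p (y j)))))"
    using 1 by (intro sum.cong) (simp_all only: pos_functional_sum[OF pos_tau])
  also have "\<dots> = (\<Sum>k\<in>L. \<Sum>j\<in>J. \<tau> (?i (sgl q (z k)) (S (sgl p (y j))) * ?i (sgl p (y j)) (T (sgl q (z k)))))"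
    by (subst sum.swap) (simp only: tau_comm)
  also have "\<dots> = (\<Sum>k\<in>L. \<tau> (?i (sgl q (z k)) ((S \<circ> T) (sgl q (z k)))))"
    using 2 by (intro sum.cong) (simp_all only: pos_functional_sum[OF pos_tau])
  finally show ?thesis .
qed

lemma Tr_dec:
  assumes y: "is_dec (fib X p) J y" and T: "T \<in> \<L> (fock X)"
  shows "Tr \<tau> p T = (\<Sum>j\<in>J. \<tau> (ip (fock X) (sgl p (y j)) (T (sgl p (y j)))))"
proof -
  have "(\<Sum>\<mu>\<in>wds p. \<tau> (ip (fock X) (sgl p (xw \<mu>)) ((T \<circ> id_op (fock X)) (sgl p (xw \<mu>)))))
     = (\<Sum>j\<in>J. \<tau> (ip (fock X) (sgl p (y j)) ((id_op (fock X) \<circ> T) (sgl p (y j)))))"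
    by (rule trace_swap[OF xw_dec y K.L_id_op T]) (auto simp: K.adj_id sgl_closed)
  then show ?thesis unfolding Tr_def K.comp_id_left[OF T] K.comp_id_right[OF T] .
qed

lemma Tr_plus: "T \<in> \<L> (fock X) \<Longrightarrow> S \<in> \<L> (fock X) \<Longrightarrow> Tr \<tau> p (T + S) = Tr \<tau> p T + Tr \<tau> p S"
  unfolding Tr_def using sgl_closed[OF xw_closed]
  by (simp add: K.ip_add_right K.L_closed pos_functional_simps[OF pos_tau] sum.distrib)

lemma Tr_scaleC: "T \<in> \<L> (fock X) \<Longrightarrow> Tr \<tau> p (c *\<^sub>C T) = c * Tr \<tau> p T"
  unfolding Tr_def using sgl_closed[OF xw_closed]
  by (simp add: K.ip_scaleC_right K.L_closed pos_functional_simps[OF pos_tau] sum_distrib_left scaleC_fun_def[of c T])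

lemma Tr_nonneg:
  assumes T: "T \<in> \<L> (fock X)" shows "Tr \<tau> p (adj (fock X) T \<circ> T) \<in> \<real>\<^sub>\<ge>\<^sub>0"
  unfolding Tr_def
proof (rule nonneg_Reals_sum)
  fix \<mu> assume "\<mu> \<in> wds p"
  then have c: "sgl p (xw \<mu>) \<in> carrier (fock X)" using sgl_closed xw_closed by blast
  have "ip (fock X) (sgl p (xw \<mu>)) ((adj (fock X) T \<circ> T) (sgl p (xw \<mu>))) = ip (fock X) (T (sgl p (xw \<mu>))) (T (sgl p (xw \<mu>)))"
    using K.adj_ip[OF T c K.L_closed[OF T c]] by simp
  then show "\<tau> (ip (fock X) (sgl p (xw \<mu>)) ((adj (fock X) T \<circ> T) (sgl p (xw \<mu>)))) \<in> \<real>\<^sub>\<ge>\<^sub>0"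
    using pos_functional_cpos[OF pos_tau K.cpos_ip[OF K.L_closed[OF T c]]] by simp
qed

lemma Tr_id_nonneg: "Tr \<tau> p (id_op (fock X)) \<in> \<real>\<^sub>\<ge>\<^sub>0"
  using Tr_nonneg[OF K.L_id_op, of p] by (simp add: K.adj_id K.comp_id_left K.L_id_op)

lemma Tr_bound:
  assumes T: "T \<in> \<L> (fock X)"
  shows "cmod (Tr \<tau> p T) \<le> opnorm (fock X) T * Re (Tr \<tau> p (id_op (fock X)))"
proof -
  have "cmod (Tr \<tau> p T) \<le> (\<Sum>\<mu>\<in>wds p. cmod (\<tau> (ip (fock X) (sgl p (xw \<mu>)) (T (sgl p (xw \<mu>))))))"
    unfolding Tr_def by (rule norm_sum)
  also have "\<dots> \<le> (\<Sum>\<mu>\<in>wds p. opnorm (fock X) T * Re (\<tau> (ip (fock X) (sgl p (xw \<mu>)) (sgl p (xw \<mu>)))))"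
    by (intro sum_mono K.pos_functional_L_bound[OF pos_tau T] sgl_closed xw_closed)
  also have "\<dots> = opnorm (fock X) T * Re (Tr \<tau> p (id_op (fock X)))"
    unfolding Tr_def using sgl_closed[OF xw_closed] by (simp add: sum_distrib_left Re_sum)
  finally show ?thesis .
qed

lemma Tr_cong: "(\<And>\<xi>. \<xi> \<in> carrier (fib X p) \<Longrightarrow> ip (fock X) (sgl p \<xi>) (T (sgl p \<xi>)) = ip (fock X) (sgl p \<xi>) (S (sgl p \<xi>))) \<Longrightarrow> Tr \<tau> p T = Tr \<tau> p S"
  unfolding Tr_def using xw_closed by simp

lemma Tr_zeroI: "(\<And>\<xi>. \<xi> \<in> carrier (fib X p) \<Longrightarrow> ip (fock X) (sgl p \<xi>) (T (sgl p \<xi>)) = 0) \<Longrightarrow> Tr \<tau> p T = 0"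
  unfolding Tr_def using xw_closed by (simp add: pos_functional_simps(3)[OF pos_tau])

lemma Tr_dproj:
  assumes T: "T \<in> \<L> (fock X)"
  shows "Tr \<tau> p (dproj S \<circ> T \<circ> dproj S) = (if p \<in> S then Tr \<tau> p T else 0)"
proof -
  have "ip (fock X) (sgl p \<xi>) ((dproj S \<circ> T \<circ> dproj S) (sgl p \<xi>)) = (if p \<in> S then ip (fock X) (sgl p \<xi>) (T (sgl p \<xi>)) else 0)"
    if x: "\<xi> \<in> carrier (fib X p)" for \<xi>
  proof (cases "p \<in> S")
    case True
    have "ip (fock X) (sgl p \<xi>) (dproj S (T (sgl p \<xi>))) = ip (fock X) (dproj S (sgl p \<xi>)) (T (sgl p \<xi>))"
      using K.adj_ip_left[OF dproj_L sgl_closed[OF x] K.L_closed[OF T sgl_closed[OF x]]] by (simp add: adj_dproj)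
    then show ?thesis using True x by (simp add: dproj_sgl)
  next
    case False
    then show ?thesis using x by (simp add: dproj_sgl K.L_zero[OF T] K.L_zero[OF dproj_L] sgl_closed)
  qed
  then show ?thesis by (cases "p \<in> S") (auto intro!: Tr_cong Tr_zeroI)
qed

lemma Tr_dproj_id: "Tr \<tau> p (dproj S) = (if p \<in> S then Tr \<tau> p (id_op (fock X)) else 0)"
proof -
  have "dproj S \<circ> id_op (fock X) \<circ> dproj S = dproj S"
    by (simp only: K.comp_id_right[OF dproj_L] dproj_comp Int_absorb)
  then show ?thesis using Tr_dproj[OF K.L_id_op, of p S] by simp
qed

text \<open>If \<open>q\<close> is not above \<open>n\<close>, the range of the creation operator
  has no component in degree \<open>q\<close>; otherwise \<open>trace_swap\<close> applies between
  the degrees q - n and q.\<close>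

lemma Tr_t:
  assumes x: "\<xi> \<in> carrier (fib X n)" and T: "T \<in> \<L> (fock X)"
  shows "Tr \<tau> q (t n \<xi> \<circ> T) = (if n \<le> q then Tr \<tau> (q - n) (T \<circ> t n \<xi>) else 0)"
proof (cases "n \<le> q")
  case True
  then obtain p where q: "q = n + p" using nat_fun_leE by blast
  have "Tr \<tau> p (T \<circ> t n \<xi>) = Tr \<tau> q (t n \<xi> \<circ> T)"
    unfolding Tr_def
  proof (rule trace_swap[OF xw_dec xw_dec t_L[OF x] T])
    show "\<exists>\<zeta>\<in>carrier (fib X q). t n \<xi> (sgl p \<eta>) = sgl q \<zeta>" if "\<eta> \<in> carrier (fib X p)" for \<eta>
      using x that T.p_closed[OF x that] by (auto simp: q t_sgl)
    show "\<exists>\<eta>\<in>carrier (fib X p). tA n \<xi> (sgl q \<zeta>) = sgl p \<eta>" if "\<zeta> \<in> carrier (fib X q)" for \<zeta>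
      using that tA_sgl[OF x] T.tstar_closed[OF x] unfolding q by blast
  qed
  then show ?thesis using True by (simp add: q nat_fun_diff_add)
next
  case False
  have "ip (fock X) (sgl q \<zeta>) ((t n \<xi> \<circ> T) (sgl q \<zeta>)) = 0" if z: "\<zeta> \<in> carrier (fib X q)" for \<zeta>
    using K.adj_ip_left[OF t_L[OF x] sgl_closed[OF z] K.L_closed[OF T sgl_closed[OF z]]] tA_sgl_not[OF x z False]
      K.L_closed[OF T sgl_closed[OF z]] by simp
  then have "Tr \<tau> q (t n \<xi> \<circ> T) = 0" by (rule Tr_zeroI)
  then show ?thesis using False by simp
qed

lemma Tr_tt_off:
  assumes x: "\<xi> \<in> carrier (fib X n)" and e: "\<eta> \<in> carrier (fib X m)" and nm: "n \<noteq> m"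
  shows "Tr \<tau> q (tt X n \<xi> m \<eta>) = 0"
proof (rule Tr_zeroI)
  fix \<zeta> assume z: "\<zeta> \<in> carrier (fib X q)"
  show "ip (fock X) (sgl q \<zeta>) (tt X n \<xi> m \<eta> (sgl q \<zeta>)) = 0"
  proof (cases "m \<le> q")
    case True
    then obtain k where q: "q = m + k" using nat_fun_leE by blast
    have c: "ts m k \<eta> \<zeta> \<in> carrier (fib X k)" using T.tstar_closed[OF e] z q by blast
    have "q \<noteq> n + k" using nm q by simp
    then show ?thesis using z x e c T.p_closed[OF x c] unfolding comp_apply q
      by (simp add: tA_sgl t_sgl ip_sgl_left sgl_closed) (simp add: sgl_def)
  next
    case False
    then show ?thesis using z by (simp add: tA_sgl_not[OF e z] K.L_zero[OF t_L[OF x]] sgl_closed)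
  qed
qed

lemma Tr_pi: "Tr \<tau> p (pi_rep X a) = (\<Sum>\<mu>\<in>wds p. \<tau> (ip (fib X p) (xw \<mu>) (lact (fib X p) a (xw \<mu>))))"
  unfolding Tr_def using xw_closed by (intro sum.cong) (auto simp: pi_sgl ip_sgl_left sgl_closed F.lact_closed)

lemma Tr_zero_pi: "Tr \<tau> 0 (pi_rep X a) = \<tau> a"
proof -
  have "ract (fib X 0) (emb X 1) (ip (fib X 0) (emb X 1) \<xi>) = \<xi>" if xi: "\<xi> \<in> carrier (fib X 0)" for \<xi>
    using emb_cases[OF xi] by (auto simp: emb_ip emb_ract)
  then have "is_dec (fib X 0) {()} (\<lambda>_. emb X 1)"
    by (intro is_decI) (simp_all add: emb_closed)
  from Tr_dec[OF this pi_L] show ?thesis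
    by (simp add: pi_sgl emb_closed ip_sgl_left sgl_closed F.lact_closed emb_lact emb_ip)
qed

text \<open>Evaluated in the product frame of words and letters of direction \<open>i\<close>, the
  sum over the letters is the scaling relation for the inner product of the word with its image
  under \<open>a\<close>.\<close>

lemma Tr_scaling_step:
  assumes sc: "trace_scaling X x \<tau> \<beta> i"
  shows "Tr \<tau> (p + unit_vec i) (pi_rep X a) = complex_of_real (exp \<beta>) * Tr \<tau> p (pi_rep X a)"
proof -
  let ?e = "unit_vec i"
  have "Tr \<tau> (p + ?e) (pi_rep X a) = (\<Sum>mj\<in>wds p \<times> {..<length (x i)}.
      \<tau> (ip (fock X) (sgl (p + ?e) (case mj of (\<mu>, j) \<Rightarrow> pmul X p ?e (xw \<mu>) (x i ! j)))
        (pi_rep X a (sgl (p + ?e) (case mj of (\<mu>, j) \<Rightarrow> pmul X p ?e (xw \<mu>) (x i ! j))))))"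
    by (rule Tr_dec[OF T.is_dec_tensor[OF xw_dec letters_dec] pi_L])
  also have "\<dots> = (\<Sum>(\<mu>, j)\<in>wds p \<times> {..<length (x i)}.
      \<tau> (ip (fib X ?e) (x i ! j) (lact (fib X ?e) (ip (fib X p) (xw \<mu>) (lact (fib X p) a (xw \<mu>))) (x i ! j))))"
    using xw_closed is_dec_closed[OF letters_dec]
    by (intro sum.cong) (auto simp: pi_sgl T.p_closed ip_sgl_left sgl_closed F.lact_closed T.p_lact T.p_ip)
  also have "\<dots> = (\<Sum>\<mu>\<in>wds p. \<Sum>j<length (x i).
      \<tau> (ip (fib X ?e) (x i ! j) (lact (fib X ?e) (ip (fib X p) (xw \<mu>) (lact (fib X p) a (xw \<mu>))) (x i ! j))))"
    by (rule sum.cartesian_product[symmetric])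
  also have "\<dots> = (\<Sum>\<mu>\<in>wds p. complex_of_real (exp \<beta>) * \<tau> (ip (fib X p) (xw \<mu>) (lact (fib X p) a (xw \<mu>))))"
    using sc unfolding trace_scaling_def by (intro sum.cong) auto
  finally show ?thesis unfolding Tr_pi by (simp add: sum_distrib_left)
qed

lemma Tr_scaling:
  assumes sc: "\<And>i. i \<notin> F \<Longrightarrow> trace_scaling X x \<tau> \<beta> i" and k: "supp k \<subseteq> - F"
  shows "Tr \<tau> (p + k) (pi_rep X a) = complex_of_real (exp (real (tdeg k) * \<beta>)) * Tr \<tau> p (pi_rep X a)"
  using k
proof (induction "tdeg k" arbitrary: k)
  case 0
  then have "k = 0" by (simp add: tdeg_eq_0)
  then show ?case by (simp add: tdeg_def)
next
  case (Suc d)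
  then have "k \<noteq> 0" by (metis nat.simps(3) tdeg_eq_0)
  then obtain i where i: "k i \<noteq> 0" by (auto simp: fun_eq_iff)
  then obtain m where m: "k = m + unit_vec i"
    using nat_fun_leE unit_vec_le by (metis add.commute)
  have iF: "i \<notin> F" using i Suc(3) by (auto simp: supp_def)
  have sm: "supp m \<subseteq> - F" using Suc(3) by (auto simp: supp_def m)
  have d: "d = tdeg m" using Suc(2) by (simp add: m tdeg_add tdeg_unit_vec)
  have "Tr \<tau> (p + k) (pi_rep X a) = complex_of_real (exp \<beta>) * Tr \<tau> (p + m) (pi_rep X a)"
    using Tr_scaling_step[OF sc[OF iF], of "p + m" a] by (simp add: m add.assoc)
  also have "\<dots> = complex_of_real (exp \<beta>) * (complex_of_real (exp (real (tdeg m) * \<beta>)) * Tr \<tau> p (pi_rep X a))"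
    using Suc(1)[OF d sm] by simp
  also have "\<dots> = complex_of_real (exp (real (tdeg k) * \<beta>)) * Tr \<tau> p (pi_rep X a)"
    by (simp add: m tdeg_add tdeg_unit_vec distrib_left exp_add mult.commute)
  finally show ?case .
qed

end

end

section \<open>Gibbs sums and their limits\<close>

context finite_rank_system
begin

definition degs :: "'i set \<Rightarrow> ('i \<Rightarrow> nat) set" where
  "degs F = {p. supp p \<subseteq> F}"

text \<open>\<open>k\<close> is an offset of all degrees in directions outside \<open>F\<close>. Its
  weight is included so that it cancels the growth of the traces of \<pi>(a) under scaling.\<close>

definition W :: "'i set \<Rightarrow> real \<Rightarrow> ('a \<Rightarrow> complex) \<Rightarrow> ('i \<Rightarrow> nat) \<Rightarrow> ((('i \<Rightarrow> nat) \<Rightarrow> 'x) \<Rightarrow> ('i \<Rightarrow> nat) \<Rightarrow> 'x) \<Rightarrow> complex" where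
  "W F \<beta> \<tau> k T = (\<Sum>\<^sub>\<infinity>p\<in>degs F. complex_of_real (exp (- (real (tdeg p) + real (tdeg k)) * \<beta>)) * Tr \<tau> (p + k) T)"

definition ray :: "'i set \<Rightarrow> nat \<Rightarrow> 'i \<Rightarrow> nat" where
  "ray F j = (\<lambda>i. if i \<in> F then 0 else j)"

text \<open>The sum over the directions in \<open>F\<close> is a Gibbs state; in the remaining directions the limit
  \<open>j \<rightarrow> \<infinity>\<close> pushes the state off the projections \<open>Q\<^sub>i\<close>.\<close>

definition Phi :: "'i set \<Rightarrow> real \<Rightarrow> ('a \<Rightarrow> complex) \<Rightarrow> ((('i \<Rightarrow> nat) \<Rightarrow> 'x) \<Rightarrow> ('i \<Rightarrow> nat) \<Rightarrow> 'x) \<Rightarrow> complex" where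
  "Phi F \<beta> \<tau> T = (if \<tau> \<in> tracial_states \<and> T \<in> NT X
     then lim (\<lambda>j. W F \<beta> \<tau> (ray F j) T / W F \<beta> \<tau> 0 (id_op (fock X))) else 0)"

lemma supp_ray: "supp (ray F j) \<subseteq> - F"
  by (auto simp: supp_def ray_def)

lemma degs_add: "p \<in> degs F \<Longrightarrow> q \<in> degs F \<Longrightarrow> p + q \<in> degs F"
  by (auto simp: degs_def supp_def)

lemma words_has_sum:
  fixes f :: "('i \<Rightarrow> nat list) \<Rightarrow> complex"
  assumes "(f has_sum S) (words x F)"
  shows "((\<lambda>p. \<Sum>\<mu>\<in>wds p. f \<mu>) has_sum S) (degs F)"
proof -
  have bij: "bij_betw snd (Sigma (degs F) wds) (words x F)"
    by (rule bij_betwI[where g="\<lambda>\<mu>. (wlen \<mu>, \<mu>)"]) (force simp: degs_def words_of_def words_def)+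
  have "((\<lambda>y. f (snd y)) has_sum S) (Sigma (degs F) wds)"
    using has_sum_reindex_bij_betw[OF bij, of f S] assms by blast
  then show ?thesis
    by (rule has_sum_Sigma') (simp add: finite_wds)
qed

lemma words_summable_nonneg:
  fixes f :: "('i \<Rightarrow> nat list) \<Rightarrow> real"
  assumes "(\<lambda>p. \<Sum>\<mu>\<in>wds p. f \<mu>) summable_on degs F" "\<And>\<mu>. \<mu> \<in> words x F \<Longrightarrow> f \<mu> \<ge> 0"
  shows "f summable_on words x F"
proof -
  have bij: "bij_betw snd (Sigma (degs F) wds) (words x F)"
    by (rule bij_betwI[where g="\<lambda>\<mu>. (wlen \<mu>, \<mu>)"]) (force simp: degs_def words_of_def words_def)+
  have "(\<lambda>y. f (snd y)) summable_on (Sigma (degs F) wds)"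
  proof (rule summable_on_SigmaI)
    show "((\<lambda>\<mu>. f (snd (p, \<mu>))) has_sum (\<Sum>\<mu>\<in>wds p. f \<mu>)) (wds p)" for p by (simp add: finite_wds)
    show "f (snd (p, \<mu>)) \<ge> 0" if "p \<in> degs F" "\<mu> \<in> wds p" for p \<mu>
      using assms(2)[of \<mu>] that by (auto simp: degs_def words_of_def words_def)
  qed (rule assms(1))
  then show ?thesis using summable_on_reindex_bij_betw[OF bij, of f] by blast
qed

lemma c_term_eq:
  assumes "\<mu> \<in> wds p"
  shows "c_term X x \<tau> \<beta> \<mu> = complex_of_real (exp (- real (tdeg p) * \<beta>)) * \<tau> (ip (fock X) (sgl p (xw \<mu>)) (sgl p (xw \<mu>)))"
  using assms xw_closed[OF assms] by (simp add: c_term_def words_of_def ip_sgl_left sgl_closed)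

lemma c_term_nonneg:
  assumes tau: "\<tau> \<in> tracial_states" and m: "\<mu> \<in> words x F"
  shows "c_term X x \<tau> \<beta> \<mu> \<in> \<real>\<^sub>\<ge>\<^sub>0"
proof -
  have w: "\<mu> \<in> wds (wlen \<mu>)" using m by (auto simp: words_of_def words_def)
  have "\<tau> (ip (fock X) (sgl (wlen \<mu>) (xw \<mu>)) (sgl (wlen \<mu>) (xw \<mu>))) \<in> \<real>\<^sub>\<ge>\<^sub>0"
    using sgl_closed[OF xw_closed[OF w]] by (intro pos_functional_cpos[OF tracial_pos_functional[OF tau]] K.cpos_ip)
  then show ?thesis unfolding c_term_eq[OF w] by (intro nonneg_Reals_mult_I) auto
qed

lemma sum_c_term:
  "(\<Sum>\<mu>\<in>wds p. c_term X x \<tau> \<beta> \<mu>) = complex_of_real (exp (- real (tdeg p) * \<beta>)) * Tr \<tau> p (id_op (fock X))"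
  unfolding Tr_def sum_distrib_left using sgl_closed[OF xw_closed] by (intro sum.cong) (auto simp: c_term_eq)

text \<open>The vector written n_F in the usual notation.\<close>

definition cpart :: "'i set \<Rightarrow> ('i \<Rightarrow> nat) \<Rightarrow> 'i \<Rightarrow> nat" where
  "cpart F n = (\<lambda>i. if i \<in> F then n i else 0)"

lemma cpart_add: "cpart F n + cpart (- F) n = n"
  by (auto simp: cpart_def)

lemma cpart_degs: "cpart F n \<in> degs F"
  by (auto simp: cpart_def degs_def supp_def)

lemma supp_diff: "supp k \<subseteq> S \<Longrightarrow> supp (k - m) \<subseteq> S"
  by (force simp: supp_def fun_diff_def)

lemma tdeg_ge: "n i \<le> tdeg n"
  unfolding tdeg_def by (rule member_le_sum) auto

section \<open>Gibbs sums of a fixed trace\<close>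

context
  fixes F :: "'i set" and \<beta> :: real and \<tau> :: "'a \<Rightarrow> complex"
  assumes TF: "\<tau> \<in> T_F X x F \<beta>"
begin

lemma TF_tracial: "\<tau> \<in> tracial_states" and TF_scaling: "i \<notin> F \<Longrightarrow> trace_scaling X x \<tau> \<beta> i"
  and TF_summable: "c_term X x \<tau> \<beta> summable_on words x F"
  using TF by (auto simp: T_F_def)

definition wt :: "('i \<Rightarrow> nat) \<Rightarrow> real" where
  "wt p = exp (- real (tdeg p) * \<beta>) * Re (Tr \<tau> p (id_op (fock X)))"

lemma wt_nonneg: "wt p \<ge> 0"
  using Tr_id_nonneg[OF TF_tracial, of p] by (simp add: wt_def complex_nonneg_Reals_iff)

lemma Tr_id_real: "Tr \<tau> p (id_op (fock X)) = complex_of_real (Re (Tr \<tau> p (id_op (fock X))))"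
  using Tr_id_nonneg[OF TF_tracial, of p] by (simp add: complex_nonneg_Reals_iff complex_eq_iff)

lemma wt_complex: "complex_of_real (exp (- real (tdeg p) * \<beta>)) * Tr \<tau> p (id_op (fock X)) = complex_of_real (wt p)"
  unfolding wt_def of_real_mult Tr_id_real[symmetric] ..

definition cR :: real where "cR = (\<Sum>\<^sub>\<infinity>p\<in>degs F. wt p)"

lemma wt_has_sum_c: "((\<lambda>p. complex_of_real (wt p)) has_sum c_const X x F \<tau> \<beta>) (degs F)"
  using words_has_sum[OF has_sum_infsum[OF TF_summable]] unfolding sum_c_term wt_complex c_const_def .

lemma wt_summable: "wt summable_on degs F"
  using has_sum_Re[OF wt_has_sum_c] by (simp add: has_sum_imp_summable)

lemma wt_has_sum: "(wt has_sum cR) (degs F)"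
  unfolding cR_def by (rule has_sum_infsum[OF wt_summable])

lemma c_const_eq: "c_const X x F \<tau> \<beta> = complex_of_real cR"
  using has_sum_unique[OF wt_has_sum_c has_sum_of_real[OF wt_has_sum]] .

lemma Tr_scale: "supp k \<subseteq> - F \<Longrightarrow> Tr \<tau> (p + k) (pi_rep X a) = complex_of_real (exp (real (tdeg k) * \<beta>)) * Tr \<tau> p (pi_rep X a)"
  using Tr_scaling[OF TF_tracial TF_scaling, of F k p a] by blast

lemma Tr_scale_id: "supp k \<subseteq> - F \<Longrightarrow> Tr \<tau> (p + k) (id_op (fock X)) = complex_of_real (exp (real (tdeg k) * \<beta>)) * Tr \<tau> p (id_op (fock X))"
  using Tr_scale[of k p 1] by (simp add: pi_one)

text \<open>The term of degree 0 is \<tau>(1) = 1, so division by the normalising constant is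
  legitimate.\<close>

lemma cR_ge_1: "cR \<ge> 1"
proof -
  have "wt 0 = 1"
    using Tr_zero_pi[OF TF_tracial, of 1] TF_tracial by (simp add: wt_def pi_one tdeg_def tracial_states_def)
  moreover have "(\<Sum>p\<in>{0}. wt p) \<le> cR" unfolding cR_def
    by (rule finite_sum_le_infsum[OF wt_summable]) (auto simp: degs_def supp_def wt_nonneg)
  ultimately show ?thesis by simp
qed

text \<open>The bound does not depend on the offset because scaling cancels the factor for
  \<open>k\<close>. It gives summability and, at the same time, a Lipschitz constant of
  \<open>W\<close> that is uniform in \<open>k\<close>.\<close>

lemma W_term_bound:
  assumes T: "T \<in> \<L> (fock X)" and k: "supp k \<subseteq> - F"
  shows "cmod (complex_of_real (exp (- (real (tdeg p) + real (tdeg k)) * \<beta>)) * Tr \<tau> (p + k) T) \<le> opnorm (fock X) T * wt p"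
proof -
  have "cmod (complex_of_real (exp (- (real (tdeg p) + real (tdeg k)) * \<beta>)) * Tr \<tau> (p + k) T)
     = exp (- (real (tdeg p) + real (tdeg k)) * \<beta>) * cmod (Tr \<tau> (p + k) T)" by (simp only: norm_mult norm_of_real abs_exp_cancel)
  also have "\<dots> \<le> exp (- (real (tdeg p) + real (tdeg k)) * \<beta>) * (opnorm (fock X) T * Re (Tr \<tau> (p + k) (id_op (fock X))))"
    by (intro mult_left_mono Tr_bound[OF TF_tracial T]) simp
  also have "\<dots> = opnorm (fock X) T * (exp (- (real (tdeg p) + real (tdeg k)) * \<beta>) * exp (real (tdeg k) * \<beta>)) * Re (Tr \<tau> p (id_op (fock X)))"
    unfolding Tr_scale_id[OF k] by simp
  also have "exp (- (real (tdeg p) + real (tdeg k)) * \<beta>) * exp (real (tdeg k) * \<beta>) = exp (- real (tdeg p) * \<beta>)"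
    by (simp add: exp_add[symmetric] algebra_simps)
  finally show ?thesis by (simp only: wt_def mult.assoc)
qed

lemma W_abs_summable:
  assumes T: "T \<in> \<L> (fock X)" and k: "supp k \<subseteq> - F"
  shows "(\<lambda>p. cmod (complex_of_real (exp (- (real (tdeg p) + real (tdeg k)) * \<beta>)) * Tr \<tau> (p + k) T)) summable_on degs F"
proof (rule Infinite_Sum.abs_summable_on_comparison_test')
  show "(\<lambda>p. opnorm (fock X) T * wt p) summable_on degs F" by (rule summable_on_cmult_right[OF wt_summable])
qed (rule W_term_bound[OF assms])

lemmas W_summable = abs_summable_summable[OF W_abs_summable]

lemma W_bound:
  assumes T: "T \<in> \<L> (fock X)" and k: "supp k \<subseteq> - F"
  shows "cmod (W F \<beta> \<tau> k T) \<le> opnorm (fock X) T * cR"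
proof -
  have "cmod (W F \<beta> \<tau> k T) \<le> (\<Sum>\<^sub>\<infinity>p\<in>degs F. cmod (complex_of_real (exp (- (real (tdeg p) + real (tdeg k)) * \<beta>)) * Tr \<tau> (p + k) T))"
    unfolding W_def by (rule norm_infsum_bound[OF W_abs_summable[OF assms]])
  also have "\<dots> \<le> (\<Sum>\<^sub>\<infinity>p\<in>degs F. opnorm (fock X) T * wt p)"
    by (intro infsum_mono W_abs_summable assms summable_on_cmult_right wt_summable W_term_bound)
  also have "\<dots> = opnorm (fock X) T * cR"
    unfolding cR_def by (rule infsum_cmult_right) (simp add: wt_summable)
  finally show ?thesis .
qed

lemma W_plus: "T \<in> \<L> (fock X) \<Longrightarrow> S \<in> \<L> (fock X) \<Longrightarrow> supp k \<subseteq> - F \<Longrightarrow> W F \<beta> \<tau> k (T + S) = W F \<beta> \<tau> k T + W F \<beta> \<tau> k S"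
  unfolding W_def by (simp only: Tr_plus[OF TF_tracial] distrib_left infsum_add[OF W_summable W_summable])

lemma W_scaleC: "T \<in> \<L> (fock X) \<Longrightarrow> supp k \<subseteq> - F \<Longrightarrow> W F \<beta> \<tau> k (c *\<^sub>C T) = c * W F \<beta> \<tau> k T"
proof -
  assume a: "T \<in> \<L> (fock X)" "supp k \<subseteq> - F"
  have "W F \<beta> \<tau> k (c *\<^sub>C T) = (\<Sum>\<^sub>\<infinity>p\<in>degs F. c * (complex_of_real (exp (- (real (tdeg p) + real (tdeg k)) * \<beta>)) * Tr \<tau> (p + k) T))"
    unfolding W_def by (simp only: Tr_scaleC[OF TF_tracial a(1)] mult.left_commute)
  then show ?thesis unfolding W_def using infsum_cmult_right[OF W_summable[OF a]] by simp
qed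

lemma W_minus: "T \<in> \<L> (fock X) \<Longrightarrow> S \<in> \<L> (fock X) \<Longrightarrow> supp k \<subseteq> - F \<Longrightarrow> W F \<beta> \<tau> k (T - S) = W F \<beta> \<tau> k T - W F \<beta> \<tau> k S"
  using W_plus[of T "(-1) *\<^sub>C S" k] W_scaleC[of S k "-1"] by (simp add: K.L_scale[of _ "-1", simplified])

lemma W_pi: assumes k: "supp k \<subseteq> - F" shows "W F \<beta> \<tau> k (pi_rep X a) = W F \<beta> \<tau> 0 (pi_rep X a)"
  unfolding W_def
proof (rule infsum_cong)
  fix p :: "'i \<Rightarrow> nat"
  have "exp (- (real (tdeg p) + real (tdeg k)) * \<beta>) * exp (real (tdeg k) * \<beta>) = exp (- real (tdeg p) * \<beta>)"
    by (simp add: exp_add[symmetric] algebra_simps)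
  then have "complex_of_real (exp (- (real (tdeg p) + real (tdeg k)) * \<beta>)) * complex_of_real (exp (real (tdeg k) * \<beta>)) = complex_of_real (exp (- real (tdeg p) * \<beta>))"
    by (simp only: of_real_mult[symmetric])
  then show "complex_of_real (exp (- (real (tdeg p) + real (tdeg k)) * \<beta>)) * Tr \<tau> (p + k) (pi_rep X a)
      = complex_of_real (exp (- (real (tdeg p) + real (tdeg 0)) * \<beta>)) * Tr \<tau> (p + 0) (pi_rep X a)"
    by (simp only: Tr_scale[OF k] mult.assoc[symmetric]) (simp add: tdeg_def)
qed

lemma W_id: "supp k \<subseteq> - F \<Longrightarrow> W F \<beta> \<tau> k (id_op (fock X)) = complex_of_real cR"
proof -
  have "W F \<beta> \<tau> 0 (id_op (fock X)) = complex_of_real cR"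
    unfolding W_def using infsumI[OF wt_has_sum_c] c_const_eq by (simp add: wt_complex[symmetric] tdeg_def)
  then show "supp k \<subseteq> - F \<Longrightarrow> W F \<beta> \<tau> k (id_op (fock X)) = complex_of_real cR"
    using W_pi[of k 1] by (simp add: pi_one)
qed

text \<open>The KMS relation for Gibbs sums. The part of \<open>n\<close> inside \<open>F\<close> is
  absorbed by translating the summation index, the part outside \<open>F\<close> by lowering the
  offset; so both sides belong to different offsets, and a KMS functional arises only where
  \<open>W\<close> has become constant in \<open>k\<close>.\<close>

lemma W_t:
  assumes x: "\<xi> \<in> carrier (fib X n)" and T: "T \<in> \<L> (fock X)" and k: "supp k \<subseteq> - F" "cpart (- F) n \<le> k"
  shows "W F \<beta> \<tau> k (t n \<xi> \<circ> T) = complex_of_real (exp (- real (tdeg n) * \<beta>)) * W F \<beta> \<tau> (k - cpart (- F) n) (T \<circ> t n \<xi>)"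
proof -
  let ?nF = "cpart F n" and ?nG = "cpart (- F) n"
  let ?f = "\<lambda>p. complex_of_real (exp (- (real (tdeg p) + real (tdeg k)) * \<beta>)) * Tr \<tau> (p + k) (t n \<xi> \<circ> T)"
  obtain j where j: "k = ?nG + j" using nat_fun_leE[OF k(2)] by blast
  have kj: "k - ?nG = j" by (simp add: j nat_fun_diff_add)
  have sj: "supp j \<subseteq> - F" using k(1) by (auto simp: supp_def j)
  \<comment> \<open>Since \<open>k\<close> vanishes on \<open>F\<close>, the relation n \<le> p + k
    would make \<open>p\<close> a translate by the part of \<open>n\<close> in \<open>F\<close>;
    outside the image of the translation the trace is therefore zero.\<close>
  have zero: "?f p = 0" if p: "p \<in> degs F" "p \<notin> (+) ?nF ` degs F" for p
  proof -
    have "\<not> n \<le> p + k"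
    proof
      assume le: "n \<le> p + k"
      have "?nF i \<le> p i" for i
      proof (cases "i \<in> F")
        case True
        then have "k i = 0" using k(1) by (auto simp: supp_def)
        then show ?thesis using le True by (simp add: cpart_def le_fun_def) (metis add.right_neutral)
      qed (simp add: cpart_def)
      then have "?nF \<le> p" by (simp add: le_fun_def)
      then obtain q where q: "p = ?nF + q" using nat_fun_leE by blast
      then have "q \<in> degs F" using p(1) by (auto simp: degs_def supp_def)
      then show False using p(2) q by blast
    qed
    then show ?thesis using Tr_t[OF TF_tracial x T, of "p + k"] by simp
  qed
  have "W F \<beta> \<tau> k (t n \<xi> \<circ> T) = infsum ?f ((+) ?nF ` degs F)"
    unfolding W_def by (rule infsum_cong_neutral) (use zero cpart_degs degs_add in auto)
  also have "\<dots> = infsum (?f \<circ> (+) ?nF) (degs F)"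
    by (rule infsum_reindex[OF inj_on_subset[OF inj_nat_fun_add]]) simp
  also have "\<dots> = (\<Sum>\<^sub>\<infinity>p\<in>degs F. complex_of_real (exp (- real (tdeg n) * \<beta>)) *
      (complex_of_real (exp (- (real (tdeg p) + real (tdeg j)) * \<beta>)) * Tr \<tau> (p + j) (T \<circ> t n \<xi>)))"
  proof (rule infsum_cong)
    fix p :: "'i \<Rightarrow> nat"
    have "n + (p + j) = (?nF + ?nG) + (p + j)" by (simp only: cpart_add)
    also have "\<dots> = ?nF + p + k" unfolding j by (simp only: add_ac)
    finally have e: "?nF + p + k = n + (p + j)" by (rule sym)
    have "tdeg n = tdeg (?nF + ?nG)" by (simp only: cpart_add)
    then have dn: "tdeg n = tdeg ?nF + tdeg ?nG" by (simp only: tdeg_add)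
    have "Tr \<tau> (?nF + p + k) (t n \<xi> \<circ> T) = Tr \<tau> (p + j) (T \<circ> t n \<xi>)"
      unfolding e Tr_t[OF TF_tracial x T] by (simp add: nat_fun_le_add nat_fun_diff_add)
    moreover have "real (tdeg (?nF + p)) + real (tdeg k) = real (tdeg n) + (real (tdeg p) + real (tdeg j))"
      unfolding dn j tdeg_add by simp
    then have "exp (- (real (tdeg (?nF + p)) + real (tdeg k)) * \<beta>) = exp (- real (tdeg n) * \<beta>) * exp (- (real (tdeg p) + real (tdeg j)) * \<beta>)"
      by (simp add: exp_add[symmetric] algebra_simps)
    ultimately show "(?f \<circ> (+) ?nF) p = complex_of_real (exp (- real (tdeg n) * \<beta>)) *
      (complex_of_real (exp (- (real (tdeg p) + real (tdeg j)) * \<beta>)) * Tr \<tau> (p + j) (T \<circ> t n \<xi>))"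
      by (simp only: comp_apply of_real_mult mult.assoc)
  qed
  also have "\<dots> = complex_of_real (exp (- real (tdeg n) * \<beta>)) * W F \<beta> \<tau> j (T \<circ> t n \<xi>)"
    unfolding W_def using W_summable[OF K.L_comp[OF T t_L[OF x]] sj] by (intro infsum_cmult_right)
  finally show ?thesis unfolding kj .
qed

lemma W_tt_off:
  assumes "\<xi> \<in> carrier (fib X n)" "\<eta> \<in> carrier (fib X m)" "n \<noteq> m"
  shows "W F \<beta> \<tau> k (tt X n \<xi> m \<eta>) = 0"
  unfolding W_def Tr_tt_off[OF TF_tracial assms] by simp

text \<open>After one application of the KMS relation the two factors cancel to an element of
  \<pi>(A), on which \<open>W\<close> does not depend on the offset.\<close>

lemma W_tt:
  assumes x: "\<xi> \<in> carrier (fib X n)" and e: "\<eta> \<in> carrier (fib X n)" and k: "supp k \<subseteq> - F" "cpart (- F) n \<le> k"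
  shows "W F \<beta> \<tau> k (tt X n \<xi> n \<eta>) = complex_of_real (exp (- real (tdeg n) * \<beta>)) * W F \<beta> \<tau> 0 (pi_rep X (ip (fib X n) \<eta> \<xi>))"
proof -
  have "supp (k - cpart (- F) n) \<subseteq> - F" using k(1) by (rule supp_diff)
  then show ?thesis using W_t[OF x tA_L[OF e] k] tA_t[OF e x] W_pi by simp
qed

text \<open>Constancy is claimed for all sufficiently large offsets, because the KMS relation
  replaces \<open>k\<close> by k minus a part of \<open>n\<close>, which need not lie on a ray. The
  threshold \<open>tdeg n\<close> dominates every coordinate of \<open>n\<close>.\<close>

lemma Alg_event_ex:
  assumes "T \<in> Alg"
  shows "\<exists>J L. \<forall>k. supp k \<subseteq> - F \<and> (\<forall>i. i \<notin> F \<longrightarrow> J \<le> k i) \<longrightarrow> W F \<beta> \<tau> k T = L"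
  using assms
proof (induction rule: Alg.induct)
  case Alg_zero
  have "W F \<beta> \<tau> k 0 = 0" if "supp k \<subseteq> - F" for k using W_scaleC[OF K.L_zero_op that, of 0] by simp
  then show ?case by blast
next
  case (Alg_step T \<xi> n \<eta> m)
  then obtain J L where JL: "\<forall>k. supp k \<subseteq> - F \<and> (\<forall>i. i \<notin> F \<longrightarrow> J \<le> k i) \<longrightarrow> W F \<beta> \<tau> k T = L" by auto
  have add: "W F \<beta> \<tau> k (tt X n \<xi> m \<eta> + T) = W F \<beta> \<tau> k (tt X n \<xi> m \<eta>) + W F \<beta> \<tau> k T" if "supp k \<subseteq> - F" for k
    by (rule W_plus[OF tt_L[OF Alg_step(2,3)] Alg_L[OF Alg_step(1)] that])
  have "\<exists>L'. \<forall>k. supp k \<subseteq> - F \<and> (\<forall>i. i \<notin> F \<longrightarrow> tdeg n \<le> k i) \<longrightarrow> W F \<beta> \<tau> k (tt X n \<xi> m \<eta>) = L'"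
  proof (cases "n = m")
    case True
    have "cpart (- F) n \<le> k" if "\<forall>i. i \<notin> F \<longrightarrow> tdeg n \<le> k i" for k
      using that tdeg_ge[of n] order_trans by (fastforce simp: le_fun_def cpart_def)
    then show ?thesis using W_tt[OF Alg_step(2), of \<eta>] Alg_step(3) True by blast
  next
    case False
    then show ?thesis using W_tt_off[OF Alg_step(2,3)] by blast
  qed
  then obtain L' where L': "\<forall>k. supp k \<subseteq> - F \<and> (\<forall>i. i \<notin> F \<longrightarrow> tdeg n \<le> k i) \<longrightarrow> W F \<beta> \<tau> k (tt X n \<xi> m \<eta>) = L'" by auto
  show ?case
  proof (intro exI[of _ "J + tdeg n"] exI[of _ "L' + L"] allI impI)
    fix k assume k: "supp k \<subseteq> - F \<and> (\<forall>i. i \<notin> F \<longrightarrow> J + tdeg n \<le> k i)"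
    then have "\<forall>i. i \<notin> F \<longrightarrow> J \<le> k i" "\<forall>i. i \<notin> F \<longrightarrow> tdeg n \<le> k i" by (auto dest: add_leD1 add_leD2)
    then have "W F \<beta> \<tau> k T = L" "W F \<beta> \<tau> k (tt X n \<xi> m \<eta>) = L'" using JL L' k by blast+
    then show "W F \<beta> \<tau> k (tt X n \<xi> m \<eta> + T) = L' + L" using add k by (simp only:)
  qed
qed

lemma Phi_eq_lim: "T \<in> NT X \<Longrightarrow> Phi F \<beta> \<tau> T = lim (\<lambda>j. W F \<beta> \<tau> (ray F j) T / complex_of_real cR)"
  using TF_tracial W_id[of 0] by (simp add: Phi_def supp_def)

text \<open>On \<open>Alg\<close> the sequence is eventually constant, and the bound of
  \<open>W\<close> by the operator norm is uniform in \<open>j\<close>; approximation from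
  \<open>Alg\<close> makes it a Cauchy sequence on all of \<open>NT X\<close>.\<close>

lemma Phi_lim:
  assumes T: "T \<in> NT X"
  shows "(\<lambda>j. W F \<beta> \<tau> (ray F j) T / complex_of_real cR) \<longlonglongrightarrow> Phi F \<beta> \<tau> T"
proof -
  let ?w = "\<lambda>T j. W F \<beta> \<tau> (ray F j) T / complex_of_real cR"
  have bd: "cmod (?w S j - ?w T j) \<le> opnorm (fock X) (T - S)" if S: "S \<in> \<L> (fock X)" for S j
  proof -
    have "?w S j - ?w T j = - W F \<beta> \<tau> (ray F j) (T - S) / complex_of_real cR"
      using W_minus[OF NT_L[OF T] S supp_ray] by (simp add: diff_divide_distrib)
    then have "cmod (?w S j - ?w T j) = cmod (W F \<beta> \<tau> (ray F j) (T - S)) / cR"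
      using cR_ge_1 by (simp add: norm_divide)
    also have "\<dots> \<le> opnorm (fock X) (T - S)"
      using W_bound[OF K.L_minus[OF NT_L[OF T] S] supp_ray] cR_ge_1 by (simp add: divide_le_eq)
    finally show ?thesis .
  qed
  have "Cauchy (?w T)"
  proof (rule metric_CauchyI)
    fix e :: real assume e: "e > 0"
    obtain S where S: "S \<in> Alg" "opnorm (fock X) (T - S) < e / 2" using NT_approx[OF T] e half_gt_zero by blast
    obtain J L where JL: "\<forall>k. supp k \<subseteq> - F \<and> (\<forall>i. i \<notin> F \<longrightarrow> J \<le> k i) \<longrightarrow> W F \<beta> \<tau> k S = L"
      using Alg_event_ex[OF S(1)] by blast
    have ws: "?w S j = L / complex_of_real cR" if "j \<ge> J" for j
      using JL that supp_ray[of F j] by (simp add: ray_def)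
    have near: "dist (L / complex_of_real cR) (?w T j) < e / 2" if "j \<ge> J" for j
      using bd[OF Alg_L[OF S(1)], of j] ws[OF that] S(2) by (simp only: dist_norm)
    show "\<exists>M. \<forall>m\<ge>M. \<forall>n\<ge>M. dist (?w T m) (?w T n) < e"
      using near dist_triangle_half_r[of "L / complex_of_real cR"] by blast
  qed
  then show ?thesis using Cauchy_convergent convergent_LIMSEQ_iff Phi_eq_lim[OF T] by metis
qed

lemma Phi_eventually:
  assumes T: "T \<in> NT X" and W: "\<And>j. j \<ge> J \<Longrightarrow> W F \<beta> \<tau> (ray F j) T = L"
  shows "Phi F \<beta> \<tau> T = L / complex_of_real cR"
proof -
  have "(\<lambda>j. W F \<beta> \<tau> (ray F j) T / complex_of_real cR) \<longlonglongrightarrow> L / complex_of_real cR"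
    by (rule tendsto_eventually) (use W in \<open>auto simp: eventually_sequentially\<close>)
  then show ?thesis using Phi_lim[OF T] LIMSEQ_unique by blast
qed

lemma Phi_Alg:
  assumes T: "T \<in> Alg"
  shows "\<exists>J. \<forall>k. supp k \<subseteq> - F \<and> (\<forall>i. i \<notin> F \<longrightarrow> J \<le> k i) \<longrightarrow> W F \<beta> \<tau> k T = complex_of_real cR * Phi F \<beta> \<tau> T"
proof -
  obtain J L where JL: "\<forall>k. supp k \<subseteq> - F \<and> (\<forall>i. i \<notin> F \<longrightarrow> J \<le> k i) \<longrightarrow> W F \<beta> \<tau> k T = L"
    using Alg_event_ex[OF T] by blast
  have "Phi F \<beta> \<tau> T = L / complex_of_real cR"
    by (rule Phi_eventually[OF Alg_NT[OF T], of J]) (use JL supp_ray in \<open>auto simp: ray_def\<close>)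
  then have "L = complex_of_real cR * Phi F \<beta> \<tau> T" using cR_ge_1 by simp
  then show ?thesis using JL by blast
qed

text \<open>Each Gibbs sum is a positive functional term by term with value 1 at the identity after
  normalisation, and these properties survive the limit.\<close>

lemma Phi_state: "Phi F \<beta> \<tau> \<in> states (fock X) (NT X)"
  unfolding states_def
proof (intro CollectI conjI allI ballI impI)
  show "Phi F \<beta> \<tau> T = 0" if "T \<notin> NT X" for T using that by (simp add: Phi_def)
  fix S T assume S: "S \<in> NT X" and T: "T \<in> NT X"
  have "(\<lambda>j. W F \<beta> \<tau> (ray F j) (S + T) / complex_of_real cR) \<longlonglongrightarrow> Phi F \<beta> \<tau> S + Phi F \<beta> \<tau> T"
    using tendsto_add[OF Phi_lim[OF S] Phi_lim[OF T]] W_plus[OF NT_L[OF S] NT_L[OF T] supp_ray] by (simp add: add_divide_distrib)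
  then show "Phi F \<beta> \<tau> (S + T) = Phi F \<beta> \<tau> S + Phi F \<beta> \<tau> T"
    using Phi_lim[OF NT_simps(2)[OF S T]] LIMSEQ_unique by blast
next
  fix c T assume T: "T \<in> NT X"
  have "(\<lambda>j. W F \<beta> \<tau> (ray F j) (c *\<^sub>C T) / complex_of_real cR) \<longlonglongrightarrow> c * Phi F \<beta> \<tau> T"
    using tendsto_mult_left[OF Phi_lim[OF T], of c] W_scaleC[OF NT_L[OF T] supp_ray] by simp
  then show "Phi F \<beta> \<tau> (c *\<^sub>C T) = c * Phi F \<beta> \<tau> T"
    using Phi_lim[OF NT_simps(5)[OF T]] LIMSEQ_unique by blast
next
  fix T assume T: "T \<in> NT X"
  let ?S = "adj (fock X) T \<circ> T"
  have S: "?S \<in> NT X" using T by (intro NT_simps)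
  have "W F \<beta> \<tau> (ray F j) ?S / complex_of_real cR \<in> \<real>\<^sub>\<ge>\<^sub>0" for j
  proof -
    have t0: "complex_of_real (exp (- (real (tdeg p) + real (tdeg (ray F j))) * \<beta>)) * Tr \<tau> (p + ray F j) ?S \<ge> 0" for p
    proof -
      have "Tr \<tau> (p + ray F j) ?S \<in> \<real>\<^sub>\<ge>\<^sub>0" by (rule Tr_nonneg[OF TF_tracial NT_L[OF T]])
      then have "Tr \<tau> (p + ray F j) ?S \<ge> 0" by (simp add: complex_nonneg_Reals_iff less_eq_complex_def)
      then show ?thesis by (intro mult_nonneg_nonneg) (simp_all add: less_eq_complex_def)
    qed
    have "W F \<beta> \<tau> (ray F j) ?S \<ge> 0"
      unfolding W_def by (intro infsum_nonneg_complex W_summable NT_L[OF S] supp_ray t0)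
    then have "W F \<beta> \<tau> (ray F j) ?S / complex_of_real cR \<ge> 0" using cR_ge_1 by (simp add: less_eq_complex_def)
    then show ?thesis by (simp add: complex_nonneg_Reals_iff less_eq_complex_def)
  qed
  then show "Phi F \<beta> \<tau> ?S \<in> \<real>\<^sub>\<ge>\<^sub>0"
    using Lim_in_closed_set[OF closed_nonneg_Reals_complex _ _ Phi_lim[OF S]] by simp
next
  have "Phi F \<beta> \<tau> (id_op (fock X)) = complex_of_real cR / complex_of_real cR"
    by (rule Phi_eventually[OF Alg_NT[OF Alg_id], of 0]) (rule W_id[OF supp_ray])
  then show "Phi F \<beta> \<tau> (id_op (fock X)) = 1" using cR_ge_1 by simp
qed

lemma Phi_t:
  assumes x: "\<xi> \<in> carrier (fib X n)" and R: "R \<in> Alg"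
  shows "Phi F \<beta> \<tau> (t n \<xi> \<circ> R) = complex_of_real (exp (- real (tdeg n) * \<beta>)) * Phi F \<beta> \<tau> (R \<circ> t n \<xi>)"
proof -
  obtain J1 where J1: "\<forall>k. supp k \<subseteq> - F \<and> (\<forall>i. i \<notin> F \<longrightarrow> J1 \<le> k i) \<longrightarrow> W F \<beta> \<tau> k (t n \<xi> \<circ> R) = complex_of_real cR * Phi F \<beta> \<tau> (t n \<xi> \<circ> R)"
    using Phi_Alg[OF Alg_comp[OF Alg_t[OF x] R]] by blast
  obtain J2 where J2: "\<forall>k. supp k \<subseteq> - F \<and> (\<forall>i. i \<notin> F \<longrightarrow> J2 \<le> k i) \<longrightarrow> W F \<beta> \<tau> k (R \<circ> t n \<xi>) = complex_of_real cR * Phi F \<beta> \<tau> (R \<circ> t n \<xi>)"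
    using Phi_Alg[OF Alg_comp[OF R Alg_t[OF x]]] by blast
  \<comment> \<open>Large enough for both thresholds even after a part of \<open>n\<close>, with
    coordinates at most \<open>tdeg n\<close>, has been subtracted.\<close>
  define k where "k = ray F (J1 + J2 + tdeg n)"
  have k: "supp k \<subseteq> - F" unfolding k_def by (rule supp_ray)
  have le: "cpart (- F) n \<le> k" using tdeg_ge[of n] by (auto simp: le_fun_def cpart_def k_def ray_def intro: trans_le_add2)
  have 1: "W F \<beta> \<tau> k (t n \<xi> \<circ> R) = complex_of_real cR * Phi F \<beta> \<tau> (t n \<xi> \<circ> R)"
    using J1 k by (simp add: k_def ray_def)
  have 2: "W F \<beta> \<tau> (k - cpart (- F) n) (R \<circ> t n \<xi>) = complex_of_real cR * Phi F \<beta> \<tau> (R \<circ> t n \<xi>)"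
  proof (rule J2[rule_format], intro conjI allI impI)
    show "supp (k - cpart (- F) n) \<subseteq> - F" using k by (rule supp_diff)
    show "J2 \<le> (k - cpart (- F) n) i" if "i \<notin> F" for i
      using that tdeg_ge[of n i] by (simp add: k_def ray_def cpart_def fun_diff_def)
  qed
  show ?thesis using W_t[OF x Alg_L[OF R] k le] cR_ge_1 unfolding 1 2 by simp
qed

end

end

section \<open>The conditional expectation as the diagonal part\<close>

text \<open>Translation by half a period in a coordinate with nonzero exponent changes the sign of
  the character. Cutting the cube at \<open>h\<close> and at 1 - h and translating one pair of
  pieces by h, the other by h - 1, shows that the integral equals its negative.\<close>

lemma integral_torus_character:
  fixes d :: "'i::finite \<Rightarrow> int"
  shows "((\<lambda>s::(real, 'i::finite) vec. cis (2 * pi * (\<Sum>i\<in>UNIV. s $ i * of_int (d i)))) has_integral (if \<forall>i. d i = 0 then 1 else 0)) (cbox 0 1)"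
proof (cases "\<forall>i. d i = 0")
  case True
  have "((\<lambda>s::(real, 'i) vec. 1::complex) has_integral measure lborel (cbox 0 (1::(real, 'i) vec)) *\<^sub>R 1) (cbox 0 1)"
    by (rule has_integral_const)
  moreover have "measure lborel (cbox 0 (1::(real, 'i) vec)) = 1"
  proof -
    have "(0::(real, 'i) vec) \<in> cbox 0 1" by (simp add: mem_box_cart)
    then have "cbox 0 (1::(real, 'i) vec) \<noteq> {}" by blast
    then show ?thesis by (simp add: content_cbox_if_cart)
  qed
  ultimately show ?thesis using True by simp
next
  case False
  then obtain i where i: "d i \<noteq> 0" by blast
  define f where "f = (\<lambda>s::(real, 'i) vec. cis (2 * pi * (\<Sum>i\<in>UNIV. s $ i * of_int (d i))))"
  \<comment> \<open>Half a period in direction \<open>i\<close>; as a nonzero integer exponent has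
    modulus at least 1, it is less than 1.\<close>
  define h :: real where "h = 1 / (2 * \<bar>of_int (d i)\<bar>)"
  have "\<bar>of_int (d i)\<bar> \<ge> (1::real)" using i by linarith
  then have h: "0 < h" "h < 1" by (auto simp: h_def divide_simps)
  let ?e = "axis i 1 :: (real, 'i) vec"
  have sum_axis: "(\<Sum>k\<in>UNIV. (c *\<^sub>R ?e + s) $ k * of_int (d k)) = c * of_int (d i) + (\<Sum>k\<in>UNIV. s $ k * of_int (d k))" for c s
  proof -
    have "(c *\<^sub>R ?e + s) $ k * of_int (d k) = (if k = i then c * of_int (d k) else 0) + s $ k * of_int (d k)" for k
      by (simp add: axis_def distrib_right)
    then show ?thesis by (simp only: sum.distrib) simp
  qed
  have fh: "f (c *\<^sub>R ?e + s) = cis (2 * pi * (c * of_int (d i))) * f s" for c s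
    unfolding f_def sum_axis cis_mult by (simp add: distrib_left)
  have hd: "h * of_int (d i) = (if d i > 0 then 1/2 else -1/2)" using i by (auto simp: h_def field_simps)
  have c1: "cis (2 * pi * (h * of_int (d i))) = -1" unfolding hd by (auto simp: complex_eq_iff)
  have c2: "cis (2 * pi * ((h - 1) * of_int (d i))) = -1"
  proof -
    have "cis (2 * pi * ((h - 1) * of_int (d i))) = cis (2 * pi * (h * of_int (d i))) / cis (2 * pi * of_int (d i))"
      unfolding cis_divide by (simp add: algebra_simps)
    then show ?thesis using c1 by (simp add: cis_multiple_2pi)
  qed
  have cont: "continuous_on S f" for S unfolding f_def by (intro continuous_intros)
  have int: "f integrable_on cbox a b" for a b by (rule integrable_continuous[OF cont])
  have neg: "negligible {s::(real, 'i) vec. s $ i = c}" for c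
    using negligible_standard_hyperplane[of ?e c] by (simp add: cart_eq_inner_axis)
  have split: "integral (cbox 0 1) f = integral (cbox 0 (1 - (1 - c) *\<^sub>R ?e)) f + integral (cbox (c *\<^sub>R ?e) 1) f"
    if c: "0 \<le> c" "c \<le> 1" for c
  proof -
    have "cbox 0 1 = cbox 0 (1 - (1 - c) *\<^sub>R ?e) \<union> cbox (c *\<^sub>R ?e) (1::(real, 'i) vec)"
    proof
      show "cbox 0 1 \<subseteq> cbox 0 (1 - (1 - c) *\<^sub>R ?e) \<union> cbox (c *\<^sub>R ?e) (1::(real, 'i) vec)"
      proof
        fix s :: "(real, 'i) vec" assume s: "s \<in> cbox 0 1"
        show "s \<in> cbox 0 (1 - (1 - c) *\<^sub>R ?e) \<union> cbox (c *\<^sub>R ?e) 1"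
          using s by (cases "s $ i \<le> c") (auto simp: mem_box_cart axis_def)
      qed
      show "cbox 0 (1 - (1 - c) *\<^sub>R ?e) \<union> cbox (c *\<^sub>R ?e) 1 \<subseteq> (cbox 0 1 :: ((real, 'i) vec) set)"
      proof
        fix s :: "(real, 'i) vec" assume "s \<in> cbox 0 (1 - (1 - c) *\<^sub>R ?e) \<union> cbox (c *\<^sub>R ?e) 1"
        then show "s \<in> cbox 0 1"
        proof
          assume s: "s \<in> cbox 0 (1 - (1 - c) *\<^sub>R ?e)"
          have "0 \<le> s $ k \<and> s $ k \<le> 1" for k using s c unfolding mem_box_cart by (cases "k = i") (auto simp: axis_def dest!: spec[of _ k])
          then show ?thesis by (simp add: mem_box_cart)
        next
          assume s: "s \<in> cbox (c *\<^sub>R ?e) 1"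
          have "0 \<le> s $ k \<and> s $ k \<le> 1" for k using s c unfolding mem_box_cart by (cases "k = i") (auto simp: axis_def dest!: spec[of _ k])
          then show ?thesis by (simp add: mem_box_cart)
        qed
      qed
    qed
    moreover have "negligible (cbox 0 (1 - (1 - c) *\<^sub>R ?e) \<inter> cbox (c *\<^sub>R ?e) (1::(real, 'i) vec))"
    proof (rule negligible_subset[OF neg[of c]], rule subsetI)
      fix s :: "(real, 'i) vec" assume s: "s \<in> cbox 0 (1 - (1 - c) *\<^sub>R ?e) \<inter> cbox (c *\<^sub>R ?e) 1"
      then have "s $ i \<le> c" "c \<le> s $ i" unfolding Int_iff mem_box_cart by (auto simp: axis_def dest!: spec[of _ i])
      then show "s \<in> {s. s $ i = c}" by simp
    qed
    ultimately show ?thesis using integral_Un[OF int int, of 0 "1 - (1 - c) *\<^sub>R ?e" "c *\<^sub>R ?e" 1] by simp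
  qed
  have s1: "integral (cbox (h *\<^sub>R ?e) 1) f = - integral (cbox 0 (1 - h *\<^sub>R ?e)) f"
  proof -
    have "integral (cbox 0 (1 - h *\<^sub>R ?e)) (f \<circ> ((+) (h *\<^sub>R ?e))) = integral (cbox (h *\<^sub>R ?e) 1) f"
      using integral_shift_cbox_plus[of 0 "1 - h *\<^sub>R ?e" f "h *\<^sub>R ?e"] by simp
    moreover have "f \<circ> ((+) (h *\<^sub>R ?e)) = (\<lambda>s. - f s)" using fh c1 by (auto simp: fun_eq_iff)
    ultimately show ?thesis by simp
  qed
  have s2: "integral (cbox 0 (1 - (1 - h) *\<^sub>R ?e)) f = - integral (cbox ((1 - h) *\<^sub>R ?e) 1) f"
  proof -
    have "integral (cbox ((1 - h) *\<^sub>R ?e) 1) (f \<circ> ((+) ((h - 1) *\<^sub>R ?e))) = integral (cbox 0 (1 - (1 - h) *\<^sub>R ?e)) f"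
      using integral_shift_cbox_plus[of "(1 - h) *\<^sub>R ?e" 1 f "(h - 1) *\<^sub>R ?e"] by (simp add: algebra_simps)
    moreover have "f \<circ> ((+) ((h - 1) *\<^sub>R ?e)) = (\<lambda>s. - f s)" using fh c2 by (auto simp: fun_eq_iff)
    ultimately show ?thesis by simp
  qed
  have "integral (cbox 0 1) f = integral (cbox 0 (1 - (1 - h) *\<^sub>R ?e)) f + integral (cbox (h *\<^sub>R ?e) 1) f"
    using split[of h] h by simp
  also have "\<dots> = - (integral (cbox 0 (1 - h *\<^sub>R ?e)) f + integral (cbox ((1 - h) *\<^sub>R ?e) 1) f)"
    unfolding s1 s2 by simp
  also have "integral (cbox 0 (1 - h *\<^sub>R ?e)) f + integral (cbox ((1 - h) *\<^sub>R ?e) 1) f = integral (cbox 0 1) f"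
    using split[of "1 - h"] h by simp
  finally have "integral (cbox 0 1) f = 0" by simp
  then have "(f has_integral 0) (cbox 0 1)" using integrable_integral[OF int] by metis
  then show ?thesis using i unfolding f_def by auto
qed

section \<open>Characters of the torus\<close>

definition torus_pt :: "(real, 'i) vec \<Rightarrow> 'i::finite \<Rightarrow> complex" where
  "torus_pt s = (\<lambda>i. cis (2 * pi * s $ i))"

definition chr :: "(real, 'i) vec \<Rightarrow> ('i::finite \<Rightarrow> nat) \<Rightarrow> complex" where
  "chr s m = (\<Prod>i\<in>UNIV. torus_pt s i ^ m i)"

lemma chr_eq: "chr s m = cis (2 * pi * (\<Sum>i\<in>UNIV. s $ i * real (m i)))"
proof -
  have "cis (\<Sum>i\<in>I. g i) = (\<Prod>i\<in>I. cis (g i))" for g and I :: "'a set"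
    by (induction I rule: infinite_finite_induct) (auto simp: cis_mult[symmetric])
  then have "cis (\<Sum>i\<in>UNIV. real (m i) * (2 * pi * s $ i)) = chr s m"
    by (simp only: chr_def torus_pt_def Complex.DeMoivre)
  then show ?thesis by (simp add: sum_distrib_left mult_ac)
qed

lemma cnj_chr: "(\<Prod>i\<in>UNIV. cnj (torus_pt s i) ^ m i) = cnj (chr s m)"
  by (simp add: chr_def)

lemma norm_chr [simp]: "cmod (chr s m) = 1"
  by (simp add: chr_eq)

lemma has_integral_chr:
  "((\<lambda>s::(real, 'i::finite) vec. chr s k * cnj (chr s m)) has_integral (if k = m then 1 else 0)) (cbox 0 1)"
proof -
  have "chr s k * cnj (chr s m) = cis (2 * pi * (\<Sum>i\<in>UNIV. s $ i * of_int (int (k i) - int (m i))))" for s :: "(real, 'i) vec"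
    by (simp add: chr_eq cis_cnj cis_mult sum_subtractf right_diff_distrib)
  moreover have "(\<forall>i. int (k i) - int (m i) = 0) \<longleftrightarrow> k = m" by (auto simp: fun_eq_iff)
  ultimately show ?thesis using integral_torus_character[of "\<lambda>i. int (k i) - int (m i)"] by simp
qed

section \<open>The block diagonal part of an operator\<close>

context finite_rank_system
begin

definition diag :: "((('i \<Rightarrow> nat) \<Rightarrow> 'x) \<Rightarrow> ('i \<Rightarrow> nat) \<Rightarrow> 'x) \<Rightarrow> (('i \<Rightarrow> nat) \<Rightarrow> 'x) \<Rightarrow> ('i \<Rightarrow> nat) \<Rightarrow> 'x" where
  "diag T = restr (fock X) (\<lambda>\<eta> m. T (sgl m (\<eta> m)) m)"

text \<open>Paschke's inequality for a homogeneous vector, after discarding the components of its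
  image in other degrees. An estimate in the order of A can be summed over the degrees, which an
  estimate of norms could not.\<close>

lemma diag_ip_le:
  assumes T: "T \<in> \<L> (fock X)" and N: "opnorm (fock X) T \<le> N" "N > 0" and x: "\<xi> \<in> carrier (fib X m)"
  shows "cpos (N\<^sup>2 *\<^sub>R ip (fib X m) \<xi> \<xi> - ip (fib X m) (T (sgl m \<xi>) m) (T (sgl m \<xi>) m))"
proof -
  have c: "T (sgl m \<xi>) \<in> carrier (fock X)" using K.L_closed[OF T sgl_closed[OF x]] .
  have "cpos (N\<^sup>2 *\<^sub>R ip (fock X) (sgl m \<xi>) (sgl m \<xi>) - ip (fock X) (T (sgl m \<xi>)) (T (sgl m \<xi>)))"
    by (rule K.L_ip_le[OF T N sgl_closed[OF x]])
  moreover have "cpos (ip (fock X) (T (sgl m \<xi>)) (T (sgl m \<xi>)) - ip (fib X m) (T (sgl m \<xi>) m) (T (sgl m \<xi>) m))"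
    using fock_partial[OF c, of "{m}"] by simp
  ultimately show ?thesis using cpos_trans x by (simp add: ip_sgl_left sgl_closed)
qed

lemma diag_fock:
  assumes T: "T \<in> \<L> (fock X)" and e: "\<eta> \<in> carrier (fock X)"
  shows "(\<lambda>m. T (sgl m (\<eta> m)) m) \<in> carrier (fock X)"
proof (rule fockI)
  have c: "T (sgl m (\<eta> m)) m \<in> carrier (fib X m)" for m
    by (rule fock_comp[OF K.L_closed[OF T sgl_closed[OF fock_comp[OF e]]]])
  then show "T (sgl m (\<eta> m)) m \<in> carrier (fib X m)" for m .
  show "(\<lambda>m. ip (fib X m) (T (sgl m (\<eta> m)) m) (T (sgl m (\<eta> m)) m)) summable_on UNIV"
  proof (rule cpos_summable_comparison)
    show "(\<lambda>m. (opnorm (fock X) T + 1)\<^sup>2 *\<^sub>R ip (fib X m) (\<eta> m) (\<eta> m)) summable_on UNIV"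
      by (intro summable_on_scaleR_right fock_summable e)
    show "cpos (ip (fib X m) (T (sgl m (\<eta> m)) m) (T (sgl m (\<eta> m)) m))" for m by (intro F.cpos_ip c)
    show "cpos ((opnorm (fock X) T + 1)\<^sup>2 *\<^sub>R ip (fib X m) (\<eta> m) (\<eta> m) - ip (fib X m) (T (sgl m (\<eta> m)) m) (T (sgl m (\<eta> m)) m))" for m
      using K.opnorm_nonneg[OF T] by (intro diag_ip_le[OF T] fock_comp e) auto
  qed
qed

lemma is_adjoint_diag:
  assumes T: "T \<in> \<L> (fock X)" shows "is_adjoint (fock X) (diag T) (diag (adj (fock X) T))"
  unfolding is_adjoint_def diag_def
proof (intro conjI ballI)
  show "restr (fock X) (\<lambda>\<eta> m. T (sgl m (\<eta> m)) m) \<in> maps (fock X)"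
    by (rule restr_maps[OF diag_fock[OF T]])
  show "restr (fock X) (\<lambda>\<eta> m. adj (fock X) T (sgl m (\<eta> m)) m) \<in> maps (fock X)"
    by (rule restr_maps[OF diag_fock[OF K.adj_closed[OF T]]])
next
  fix \<xi> \<eta> assume x: "\<xi> \<in> carrier (fock X)" and e: "\<eta> \<in> carrier (fock X)"
  have "ip (fib X m) (T (sgl m (\<xi> m)) m) (\<eta> m) = ip (fib X m) (\<xi> m) (adj (fock X) T (sgl m (\<eta> m)) m)" for m
  proof -
    note cx = sgl_closed[OF fock_comp[OF x]] and ce = sgl_closed[OF fock_comp[OF e]]
    have "ip (fib X m) (T (sgl m (\<xi> m)) m) (\<eta> m) = ip (fock X) (T (sgl m (\<xi> m))) (sgl m (\<eta> m))"
      by (rule ip_sgl_right[OF fock_comp[OF e] K.L_closed[OF T cx], symmetric])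
    also have "\<dots> = ip (fock X) (sgl m (\<xi> m)) (adj (fock X) T (sgl m (\<eta> m)))" by (rule K.adj_ip[OF T cx ce, symmetric])
    also have "\<dots> = ip (fib X m) (\<xi> m) (adj (fock X) T (sgl m (\<eta> m)) m)"
      by (rule ip_sgl_left[OF fock_comp[OF x] K.L_closed[OF K.adj_closed[OF T] ce]])
    finally show ?thesis .
  qed
  then show "ip (fock X) (restr (fock X) (\<lambda>\<eta> m. T (sgl m (\<eta> m)) m) \<xi>) \<eta>
      = ip (fock X) \<xi> (restr (fock X) (\<lambda>\<eta> m. adj (fock X) T (sgl m (\<eta> m)) m) \<eta>)"
    using x e by (simp add: fock_simps(2))
qed

lemma diag_L: "T \<in> \<L> (fock X) \<Longrightarrow> diag T \<in> \<L> (fock X)"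
  using is_adjoint_diag K.adjointablesI by blast

lemma diag_apply: "\<eta> \<in> carrier (fock X) \<Longrightarrow> diag T \<eta> = (\<lambda>m. T (sgl m (\<eta> m)) m)"
  by (simp add: diag_def)

lemma diag_sgl: "T \<in> \<L> (fock X) \<Longrightarrow> \<xi> \<in> carrier (fib X m) \<Longrightarrow> diag T (sgl m \<xi>) = sgl m (T (sgl m \<xi>) m)"
proof
  fix k assume a: "T \<in> \<L> (fock X)" "\<xi> \<in> carrier (fib X m)"
  show "diag T (sgl m \<xi>) k = sgl m (T (sgl m \<xi>) m) k"
  proof (cases "k = m")
    case False
    then have "sgl m \<xi> k = 0" "sgl m (T (sgl m \<xi>) m) k = 0" by (simp_all add: sgl_def)
    then show ?thesis unfolding diag_apply[OF sgl_closed[OF a(2)]] by (simp add: sgl_zero K.L_zero[OF a(1)])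
  qed (simp add: diag_apply sgl_closed a)
qed

lemma diag_plus: "diag (T + S) = diag T + diag S"
  by (auto simp: diag_def restr_def fun_eq_iff)

lemma diag_minus: "diag (T - S) = diag T - diag S"
  by (auto simp: diag_def restr_def fun_eq_iff)

lemma opnorm_diag:
  assumes T: "T \<in> \<L> (fock X)" shows "opnorm (fock X) (diag T) \<le> opnorm (fock X) T"
proof (rule field_le_epsilon)
  fix e :: real assume e: "e > 0"
  \<comment> \<open>The excess \<open>e\<close> makes \<open>N\<close> positive, as Paschke's
    inequality is stated for positive constants.\<close>
  define N where "N = opnorm (fock X) T + e"
  have N: "N > 0" "opnorm (fock X) T \<le> N" using e K.opnorm_nonneg[OF T] by (auto simp: N_def)
  show "opnorm (fock X) (diag T) \<le> opnorm (fock X) T + e" unfolding N_def[symmetric]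
  proof (rule K.opnorm_le)
    fix \<eta> assume h: "\<eta> \<in> carrier (fock X)"
    have d: "diag T \<eta> \<in> carrier (fock X)" using K.L_closed[OF diag_L[OF T] h] .
    have neg: "((\<lambda>m. - ip (fib X m) (diag T \<eta> m) (diag T \<eta> m)) has_sum - ip (fock X) (diag T \<eta>) (diag T \<eta>)) UNIV"
      using fock_has_sum[OF d d] by (simp add: has_sum_uminus)
    have "((\<lambda>m. N\<^sup>2 *\<^sub>R ip (fib X m) (\<eta> m) (\<eta> m) - ip (fib X m) (diag T \<eta> m) (diag T \<eta> m)) has_sum
        (N\<^sup>2 *\<^sub>R ip (fock X) \<eta> \<eta> - ip (fock X) (diag T \<eta>) (diag T \<eta>))) UNIV"
      using has_sum_add[OF has_sum_bounded_linear[OF bounded_linear_scaleR_right[of "N\<^sup>2"] fock_has_sum[OF h h]] neg]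
      by (simp add: o_def)
    then have "cpos (N\<^sup>2 *\<^sub>R ip (fock X) \<eta> \<eta> - ip (fock X) (diag T \<eta>) (diag T \<eta>))"
      by (rule cpos_has_sum) (simp add: diag_apply[OF h] diag_ip_le[OF T N(2,1) fock_comp[OF h]])
    then have "norm (ip (fock X) (diag T \<eta>) (diag T \<eta>)) \<le> norm (N\<^sup>2 *\<^sub>R ip (fock X) \<eta> \<eta>)"
      by (intro cpos_norm_mono K.cpos_ip d)
    then have "(mnorm (fock X) (diag T \<eta>))\<^sup>2 \<le> (N * mnorm (fock X) \<eta>)\<^sup>2"
      by (simp add: K.mnorm_square power_mult_distrib)
    then show "mnorm (fock X) (diag T \<eta>) \<le> N * mnorm (fock X) \<eta>"
      by (rule power2_le_imp_le) (use N K.mnorm_nonneg in simp)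
  qed (use N in simp)
qed

lemma diag_tt:
  assumes x: "\<xi> \<in> carrier (fib X n)" and e: "\<eta> \<in> carrier (fib X m)"
  shows "diag (tt X n \<xi> m \<eta>) = (if n = m then tt X n \<xi> m \<eta> else 0)"
proof (rule op_eqI)
  show "diag (tt X n \<xi> m \<eta>) \<in> \<L> (fock X)" by (rule diag_L[OF tt_L[OF x e]])
  show "(if n = m then tt X n \<xi> m \<eta> else 0) \<in> \<L> (fock X)" using tt_L[OF x e] K.L_zero_op by (cases "n = m") (simp_all only: if_True if_False refl simp_thms)
  fix k \<zeta> assume z: "\<zeta> \<in> carrier (fib X k)"
  show "diag (tt X n \<xi> m \<eta>) (sgl k \<zeta>) = (if n = m then tt X n \<xi> m \<eta> else 0) (sgl k \<zeta>)"
  proof (cases "m \<le> k")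
    case True
    then obtain j where k: "k = m + j" using nat_fun_leE by blast
    have c: "ts m j \<eta> \<zeta> \<in> carrier (fib X j)" using T.tstar_closed[OF e] z k by blast
    have "tt X n \<xi> m \<eta> (sgl k \<zeta>) = sgl (n + j) (pmul X n j \<xi> (ts m j \<eta> \<zeta>))"
      using z x e c by (simp add: k tA_sgl t_sgl)
    moreover have "sgl k (sgl (n + j) \<omega> k) = (if n = m then sgl (n + j) \<omega> else 0)" for \<omega>
    proof (cases "n = m")
      case False
      then have "sgl (n + j) \<omega> k = 0" by (auto simp: sgl_def k)
      then show ?thesis using False sgl_zero[of k] by simp
    qed (simp add: k)
    ultimately show ?thesis unfolding diag_sgl[OF tt_L[OF x e] z] by (cases "n = m") simp_all
  next
    case False
    then have "tt X n \<xi> m \<eta> (sgl k \<zeta>) = 0" using z by (simp add: tA_sgl_not[OF e z] K.L_zero[OF t_L[OF x]])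
    then show ?thesis unfolding diag_sgl[OF tt_L[OF x e] z] by (cases "n = m") (simp_all add: sgl_zero)
  qed
qed

lemma diag_Alg: "T \<in> Alg \<Longrightarrow> diag T \<in> Alg"
proof (induction rule: Alg.induct)
  case Alg_zero
  have "diag 0 = diag (0 - 0)" by (simp only: diff_self)
  also have "\<dots> = 0" unfolding diag_minus by (rule diff_self)
  finally show ?case by (simp only: Alg.Alg_zero)
next
  case (Alg_step T \<xi> n \<eta> m)
  show ?case
  proof (cases "n = m")
    case True
    show ?thesis unfolding diag_plus diag_tt[OF Alg_step(2,3)] if_P[OF True]
      by (rule Alg.Alg_step[OF Alg_step.IH Alg_step(2,3)])
  next
    case False
    show ?thesis unfolding diag_plus diag_tt[OF Alg_step(2,3)] if_not_P[OF False] add_0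
      by (rule Alg_step.IH)
  qed
qed

lemma diag_NT:
  assumes T: "T \<in> NT X" shows "diag T \<in> NT X"
proof (rule NT_closed[OF diag_L[OF NT_L[OF T]]])
  fix e :: real assume "e > 0"
  then obtain S where S: "S \<in> Alg" "opnorm (fock X) (T - S) < e" using NT_approx[OF T] by blast
  have "opnorm (fock X) (diag T - diag S) \<le> opnorm (fock X) (T - S)"
    unfolding diag_minus[symmetric] by (rule opnorm_diag[OF K.L_minus[OF NT_L[OF T] Alg_L[OF S(1)]]])
  then show "\<exists>S\<in>NT X. opnorm (fock X) (diag T - S) < e"
    using S Alg_NT[OF diag_Alg[OF S(1)]] by (meson le_less_trans)
qed

lemma Tr_diag:
  assumes tau: "\<tau> \<in> tracial_states" and T: "T \<in> \<L> (fock X)"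
  shows "Tr \<tau> p (diag T) = Tr \<tau> p T"
proof (rule Tr_cong[OF tau])
  fix \<xi> assume x: "\<xi> \<in> carrier (fib X p)"
  note c = K.L_closed[OF T sgl_closed[OF x]]
  show "ip (fock X) (sgl p \<xi>) (diag T (sgl p \<xi>)) = ip (fock X) (sgl p \<xi>) (T (sgl p \<xi>))"
    using x fock_comp[OF c] c by (simp add: diag_sgl[OF T x] ip_sgl_left sgl_closed)
qed

text \<open>The squared distance is the norm of the tail of the series that defines the inner square
  of \<eta>.\<close>

lemma trunc_tendsto:
  assumes e: "\<eta> \<in> carrier (fock X)"
  shows "((\<lambda>J. mnorm (fock X) (\<eta> - dproj J \<eta>)) \<longlongrightarrow> 0) (finite_subsets_at_top UNIV)"
proof -
  let ?q = "\<lambda>m. ip (fib X m) (\<eta> m) (\<eta> m)"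
  have eq: "mnorm (fock X) (\<eta> - dproj J \<eta>) = sqrt (norm (ip (fock X) \<eta> \<eta> - sum ?q J))" if J: "finite J" for J
  proof -
    have d: "dproj J \<eta> \<in> carrier (fock X)" by (rule K.L_closed[OF dproj_L e])
    have "ip (fock X) (dproj J \<eta>) \<zeta> = ip (fock X) (dproj J \<eta>) (dproj J \<zeta>)" if z: "\<zeta> \<in> carrier (fock X)" for \<zeta>
      using K.adj_ip[OF dproj_L[of J] K.L_closed[OF dproj_L[of J] e] z]
      using fun_cong[OF dproj_comp[of J J], of \<eta>] by (simp add: adj_dproj)
    then have 1: "ip (fock X) (dproj J \<eta>) (dproj J \<eta>) = ip (fock X) (dproj J \<eta>) \<eta>" using e by simp
    have 2: "ip (fock X) \<eta> (dproj J \<eta>) = ip (fock X) (dproj J \<eta>) \<eta>"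
      using K.adj_ip[OF dproj_L[of J] e e] by (simp add: adj_dproj)
    have "ip (fock X) (dproj J \<eta>) \<eta> = sum ?q J"
    proof (rule fock_ipI)
      show "((\<lambda>m. ip (fib X m) (dproj J \<eta> m) (\<eta> m)) has_sum sum ?q J) UNIV"
        by (rule has_sum_finite_neutralI[OF J]) (use fock_comp[OF e] in \<open>auto simp: dproj_apply[OF e]\<close>)
    qed
    then have "ip (fock X) (\<eta> - dproj J \<eta>) (\<eta> - dproj J \<eta>) = ip (fock X) \<eta> \<eta> - sum ?q J"
      using e d 1 2 by (simp add: K.ip_simps K.diff_closed)
    then show ?thesis by (simp add: mnorm_def)
  qed
  have "((\<lambda>J. sqrt (norm (ip (fock X) \<eta> \<eta> - sum ?q J))) \<longlongrightarrow> sqrt (norm (ip (fock X) \<eta> \<eta> - ip (fock X) \<eta> \<eta>))) (finite_subsets_at_top UNIV)"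
    using fock_has_sum[OF e e] unfolding has_sum_def by (intro tendsto_intros)
  then have "((\<lambda>J. sqrt (norm (ip (fock X) \<eta> \<eta> - sum ?q J))) \<longlongrightarrow> 0) (finite_subsets_at_top UNIV)" by simp
  then show ?thesis
    by (rule Lim_transform_eventually) (auto intro!: eventually_finite_subsets_at_top_weakI simp: eq)
qed

section \<open>The gauge action and its average over the torus\<close>

abbreviation "gU s \<equiv> gauge_unitary X (torus_pt s)"
abbreviation "gV s \<equiv> gauge_unitary X (\<lambda>i. cnj (torus_pt s i))"

lemma gU_apply: "\<eta> \<in> carrier (fock X) \<Longrightarrow> gU s \<eta> = (\<lambda>m. chr s m *\<^sub>C \<eta> m)"
  and gV_apply: "\<eta> \<in> carrier (fock X) \<Longrightarrow> gV s \<eta> = (\<lambda>m. cnj (chr s m) *\<^sub>C \<eta> m)"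
  unfolding gauge_unitary_def cnj_chr by (simp_all add: chr_def)

lemma phase_fock:
  assumes e: "\<eta> \<in> carrier (fock X)" and c: "\<And>m. cmod (c m) = 1"
  shows "(\<lambda>m. c m *\<^sub>C \<eta> m) \<in> carrier (fock X)" "mnorm (fock X) (\<lambda>m. c m *\<^sub>C \<eta> m) = mnorm (fock X) \<eta>"
proof -
  have "c m * cnj (c m) = 1" for m using c[of m] by (simp add: complex_norm_square[symmetric])
  then have q: "ip (fib X m) (c m *\<^sub>C \<eta> m) (c m *\<^sub>C \<eta> m) = ip (fib X m) (\<eta> m) (\<eta> m)" for m
    using fock_comp[OF e] by (simp add: F.ip_simps F.scaleC_closed scaleC_scaleC mult.commute)
  show "(\<lambda>m. c m *\<^sub>C \<eta> m) \<in> carrier (fock X)"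
    by (rule fockI) (use fock_comp[OF e] fock_summable[OF e] in \<open>auto simp: q F.scaleC_closed\<close>)
  show "mnorm (fock X) (\<lambda>m. c m *\<^sub>C \<eta> m) = mnorm (fock X) \<eta>" by (simp add: mnorm_def fock_simps(2) q)
qed

lemma gV_closed: "\<eta> \<in> carrier (fock X) \<Longrightarrow> gV s \<eta> \<in> carrier (fock X)"
  and mnorm_gV: "\<eta> \<in> carrier (fock X) \<Longrightarrow> mnorm (fock X) (gV s \<eta>) = mnorm (fock X) \<eta>"
  unfolding gV_apply by (simp_all add: phase_fock)

lemma ip_gU:
  assumes "\<zeta> \<in> carrier (fock X)" "\<eta> \<in> carrier (fock X)"
  shows "ip (fock X) \<zeta> (gU s \<eta>) = ip (fock X) (gV s \<zeta>) \<eta>"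
  unfolding gU_apply[OF assms(2)] gV_apply[OF assms(1)] fock_simps(2)
  using fock_comp[OF assms(1)] fock_comp[OF assms(2)] by (simp add: F.ip_simps)

lemma gauge_ip:
  assumes T: "T \<in> \<L> (fock X)" and z: "\<zeta> \<in> carrier (fock X)" and e: "\<eta> \<in> carrier (fock X)"
  shows "ip (fock X) \<zeta> (gauge X (torus_pt s) T \<eta>) = ip (fock X) (gV s \<zeta>) (T (gV s \<eta>))"
  unfolding gauge_def comp_apply using ip_gU[OF z K.L_closed[OF T gV_closed[OF e]]] .

lemma gV_dproj:
  assumes e: "\<eta> \<in> carrier (fock X)" and J: "finite J"
  shows "gV s (dproj J \<eta>) = (\<Sum>m\<in>J. cnj (chr s m) *\<^sub>C sgl m (\<eta> m))"
proof
  fix k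
  have "(\<Sum>m\<in>J. cnj (chr s m) *\<^sub>C sgl m (\<eta> m)) k = (\<Sum>m\<in>J. if m = k then cnj (chr s k) *\<^sub>C \<eta> k else 0)"
    unfolding sum_fun_apply by (intro sum.cong) (auto simp: scaleC_fun_def sgl_def)
  also have "\<dots> = (if k \<in> J then cnj (chr s k) *\<^sub>C \<eta> k else 0)" using J by simp
  also have "\<dots> = gV s (dproj J \<eta>) k"
    unfolding gV_apply[OF K.L_closed[OF dproj_L e]] by (simp add: dproj_apply[OF e])
  finally show "gV s (dproj J \<eta>) k = (\<Sum>m\<in>J. cnj (chr s m) *\<^sub>C sgl m (\<eta> m)) k" by simp
qed

lemma gauge_ip_finite:
  assumes T: "T \<in> \<L> (fock X)" and z: "\<zeta> \<in> carrier (fock X)" and e: "\<eta> \<in> carrier (fock X)" and J: "finite J"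
  shows "ip (fock X) (gV s (dproj J \<zeta>)) (T (gV s (dproj J \<eta>))) =
    (\<Sum>k\<in>J. \<Sum>m\<in>J. (chr s k * cnj (chr s m)) *\<^sub>C ip (fock X) (sgl k (\<zeta> k)) (T (sgl m (\<eta> m))))"
proof -
  note cz = sgl_closed[OF fock_comp[OF z]] and ce = sgl_closed[OF fock_comp[OF e]]
  have T1: "T (gV s (dproj J \<eta>)) = (\<Sum>m\<in>J. cnj (chr s m) *\<^sub>C T (sgl m (\<eta> m)))"
    unfolding gV_dproj[OF e J] using ce by (simp add: K.L_sum[OF T] K.scaleC_closed K.L_scaleC[OF T])
  note cT = K.L_closed[OF T ce]
  have cs: "(\<Sum>m\<in>J. cnj (chr s m) *\<^sub>C T (sgl m (\<eta> m))) \<in> carrier (fock X)" using cT by (intro K.sum_closed K.scaleC_closed)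
  show ?thesis unfolding T1 unfolding gV_dproj[OF z J]
    using cz cT cs by (simp add: K.ip_sum_left K.ip_sum_right K.scaleC_closed K.ip_scaleC_left K.ip_scaleC_right scaleC_sum_right scaleC_scaleC mult.commute)
qed

lemma has_integral_gauge_finite:
  assumes T: "T \<in> \<L> (fock X)" and z: "\<zeta> \<in> carrier (fock X)" and e: "\<eta> \<in> carrier (fock X)" and J: "finite J"
  shows "((\<lambda>s::(real, 'i) vec. ip (fock X) (gV s (dproj J \<zeta>)) (T (gV s (dproj J \<eta>)))) has_integral
     (\<Sum>m\<in>J. ip (fib X m) (\<zeta> m) (diag T \<eta> m))) (cbox 0 1)"
proof -
  have 1: "((\<lambda>s::(real, 'i) vec. (chr s k * cnj (chr s m)) *\<^sub>C a) has_integral (if k = m then 1 else 0) *\<^sub>C a) (cbox 0 1)" for k m and a :: 'a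
    using has_integral_linear[OF has_integral_chr[of k m] bounded_linear_scaleC_left[of a]] unfolding o_def .
  have "((\<lambda>s::(real, 'i) vec. \<Sum>k\<in>J. \<Sum>m\<in>J. (chr s k * cnj (chr s m)) *\<^sub>C ip (fock X) (sgl k (\<zeta> k)) (T (sgl m (\<eta> m)))) has_integral
     (\<Sum>k\<in>J. \<Sum>m\<in>J. (if k = m then 1 else 0) *\<^sub>C ip (fock X) (sgl k (\<zeta> k)) (T (sgl m (\<eta> m))))) (cbox 0 1)"
    by (intro has_integral_sum J 1)
  moreover have "(\<Sum>k\<in>J. \<Sum>m\<in>J. (if k = m then 1 else 0) *\<^sub>C ip (fock X) (sgl k (\<zeta> k)) (T (sgl m (\<eta> m)))) = (\<Sum>m\<in>J. ip (fib X m) (\<zeta> m) (diag T \<eta> m))"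
  proof (rule sum.cong[OF refl])
    fix k assume "k \<in> J"
    have "(\<Sum>m\<in>J. (if k = m then 1 else 0) *\<^sub>C ip (fock X) (sgl k (\<zeta> k)) (T (sgl m (\<eta> m))))
       = (\<Sum>m\<in>J. if k = m then ip (fock X) (sgl k (\<zeta> k)) (T (sgl m (\<eta> m))) else 0)" by (intro sum.cong) auto
    also have "\<dots> = ip (fock X) (sgl k (\<zeta> k)) (T (sgl k (\<eta> k)))" using J \<open>k \<in> J\<close> by simp
    also have "\<dots> = ip (fib X k) (\<zeta> k) (diag T \<eta> k)"
      using ip_sgl_left[OF fock_comp[OF z] K.L_closed[OF T sgl_closed[OF fock_comp[OF e]]]] by (simp add: diag_apply[OF e])
    finally show "(\<Sum>m\<in>J. (if k = m then 1 else 0) *\<^sub>C ip (fock X) (sgl k (\<zeta> k)) (T (sgl m (\<eta> m)))) = ip (fib X k) (\<zeta> k) (diag T \<eta> k)" .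
  qed
  ultimately show ?thesis unfolding gauge_ip_finite[OF T z e J] by simp
qed

lemma continuous_chr: "continuous_on S (\<lambda>s. chr s m)"
  unfolding chr_eq by (intro continuous_intros)

lemma gauge_trunc_bound:
  assumes T: "T \<in> \<L> (fock X)" and z: "\<zeta> \<in> carrier (fock X)" and e: "\<eta> \<in> carrier (fock X)"
  shows "norm (ip (fock X) (gV s (dproj J \<zeta>)) (T (gV s (dproj J \<eta>))) - ip (fock X) (gV s \<zeta>) (T (gV s \<eta>)))
     \<le> opnorm (fock X) T * (mnorm (fock X) (\<zeta> - dproj J \<zeta>) * mnorm (fock X) \<eta> + mnorm (fock X) (dproj J \<zeta>) * mnorm (fock X) (\<eta> - dproj J \<eta>))"
proof -
  let ?n = "mnorm (fock X)"
  have lin: "gV s \<eta> - gV s (dproj J \<eta>) = gV s (\<eta> - dproj J \<eta>)" if "\<eta> \<in> carrier (fock X)" for \<eta>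
    using that K.L_closed[OF dproj_L[of J] that] by (simp add: gV_apply K.diff_closed fun_eq_iff scaleC_diff_right)
  have bd: "norm (ip (fock X) (gV s \<alpha>) (T (gV s \<omega>))) \<le> opnorm (fock X) T * (?n \<alpha> * ?n \<omega>)"
    if "\<alpha> \<in> carrier (fock X)" "\<omega> \<in> carrier (fock X)" for \<alpha> \<omega>
  proof -
    have "norm (ip (fock X) (gV s \<alpha>) (T (gV s \<omega>))) \<le> ?n (gV s \<alpha>) * ?n (T (gV s \<omega>))"
      by (rule K.ip_CS[OF gV_closed[OF that(1)] K.L_closed[OF T gV_closed[OF that(2)]]])
    also have "\<dots> \<le> ?n (gV s \<alpha>) * (opnorm (fock X) T * ?n (gV s \<omega>))"
      by (intro mult_left_mono K.opnorm_bound[OF T] gV_closed that K.mnorm_nonneg)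
    finally show ?thesis using that by (simp add: mnorm_gV mult.left_commute)
  qed
  let ?z = "dproj J \<zeta>" and ?e = "dproj J \<eta>"
  have c: "?z \<in> carrier (fock X)" "?e \<in> carrier (fock X)" "\<zeta> - ?z \<in> carrier (fock X)" "\<eta> - ?e \<in> carrier (fock X)"
    using K.L_closed[OF dproj_L] z e K.diff_closed by auto
  have "ip (fock X) (gV s \<zeta>) (T (gV s \<eta>)) - ip (fock X) (gV s ?z) (T (gV s ?e)) =
     ip (fock X) (gV s (\<zeta> - ?z)) (T (gV s \<eta>)) + ip (fock X) (gV s ?z) (T (gV s (\<eta> - ?e)))"
    unfolding lin[OF z, symmetric] lin[OF e, symmetric]
    using gV_closed[OF z] gV_closed[OF e] gV_closed[OF c(1)] gV_closed[OF c(2)]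
    by (simp add: K.L_diff[OF T] K.ip_diff_left K.ip_diff_right K.L_closed[OF T] K.diff_closed)
  then have "norm (ip (fock X) (gV s ?z) (T (gV s ?e)) - ip (fock X) (gV s \<zeta>) (T (gV s \<eta>))) \<le>
     opnorm (fock X) T * (?n (\<zeta> - ?z) * ?n \<eta>) + opnorm (fock X) T * (?n ?z * ?n (\<eta> - ?e))"
    using bd[OF c(3) e] bd[OF c(1) c(4)] by (metis add_mono norm_minus_commute norm_triangle_le)
  then show ?thesis by (simp add: distrib_left)
qed

text \<open>On finitely many degrees the integrand is a trigonometric polynomial, and integration
  retains its diagonal terms. The truncation error is uniform in \<open>s\<close> because the gauge
  unitaries are isometric, so the integral commutes with the limit over finite sets of
  degrees.\<close>

lemma has_integral_gauge:
  assumes T: "T \<in> \<L> (fock X)" and z: "\<zeta> \<in> carrier (fock X)" and e: "\<eta> \<in> carrier (fock X)"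
  shows "((\<lambda>s::(real, 'i) vec. ip (fock X) \<zeta> (gauge X (\<lambda>i. cis (2 * pi * s $ i)) T \<eta>)) has_integral ip (fock X) \<zeta> (diag T \<eta>)) (cbox 0 1)"
proof -
  let ?n = "mnorm (fock X)"
  \<comment> \<open>The value 0 for infinite \<open>J\<close> is never reached along the filter; it
    makes continuity hold for every \<open>J\<close>.\<close>
  let ?f = "\<lambda>J (s::(real, 'i) vec). if finite J then ip (fock X) (gV s (dproj J \<zeta>)) (T (gV s (dproj J \<eta>))) else 0"
  let ?g = "\<lambda>s::(real, 'i) vec. ip (fock X) (gV s \<zeta>) (T (gV s \<eta>))"
  let ?B = "\<lambda>J. opnorm (fock X) T * (?n (\<zeta> - dproj J \<zeta>) * ?n \<eta> + ?n \<zeta> * ?n (\<eta> - dproj J \<eta>))"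
  have B0: "(?B \<longlongrightarrow> opnorm (fock X) T * (0 * ?n \<eta> + ?n \<zeta> * 0)) (finite_subsets_at_top UNIV)"
    by (intro tendsto_intros trunc_tendsto z e)
  have nz: "?n (dproj J \<zeta>) \<le> ?n \<zeta>" for J
  proof -
    have "opnorm (fock X) (dproj J) \<le> 1"
    proof (rule K.opnorm_le)
      fix \<xi> assume x: "\<xi> \<in> carrier (fock X)"
      have d: "dproj J \<xi> \<in> carrier (fock X)" by (rule K.L_closed[OF dproj_L x])
      have "(?n (dproj J \<xi>))\<^sup>2 = norm (ip (fock X) \<xi> (dproj J \<xi>))"
        using K.adj_ip[OF dproj_L[of J] x d] fun_cong[OF dproj_comp[of J J], of \<xi>] by (simp add: adj_dproj K.mnorm_square)
      also have "\<dots> \<le> ?n \<xi> * ?n (dproj J \<xi>)" by (rule K.ip_CS[OF x d])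
      finally have "?n (dproj J \<xi>) * ?n (dproj J \<xi>) \<le> ?n \<xi> * ?n (dproj J \<xi>)" by (simp add: power2_eq_square)
      then show "?n (dproj J \<xi>) \<le> 1 * ?n \<xi>"
        using K.mnorm_nonneg[of "dproj J \<xi>"] K.mnorm_nonneg[of \<xi>] by (cases "?n (dproj J \<xi>) = 0") (auto simp: mult_le_cancel_right)
    qed simp
    then show ?thesis using K.opnorm_bound[OF dproj_L z, of J] K.mnorm_nonneg[of \<zeta>]
      by (meson mult_left_le_one_le mult_right_mono order_trans K.opnorm_nonneg[OF dproj_L])
  qed
  have u: "uniform_limit (cbox 0 1) ?f ?g (finite_subsets_at_top UNIV)"
  proof (rule uniform_limitI)
    fix d :: real assume d: "d > 0"
    have "\<forall>\<^sub>F J in finite_subsets_at_top UNIV. ?B J < d"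
      using order_tendstoD(2)[OF B0, of d] d by simp
    moreover have "\<forall>\<^sub>F J in finite_subsets_at_top UNIV. finite (J :: ('i \<Rightarrow> nat) set)" by (rule eventually_finite_subsets_at_top_weakI)
    ultimately show "\<forall>\<^sub>F J in finite_subsets_at_top UNIV. \<forall>s\<in>cbox 0 1. dist (?f J s) (?g s) < d"
    proof eventually_elim
      case (elim J)
      have "dist (?f J s) (?g s) < d" for s
      proof -
        have "dist (?f J s) (?g s) \<le> opnorm (fock X) T * (?n (\<zeta> - dproj J \<zeta>) * ?n \<eta> + ?n (dproj J \<zeta>) * ?n (\<eta> - dproj J \<eta>))"
          using gauge_trunc_bound[OF T z e, of s J] elim(2) by (simp add: dist_norm)
        also have "\<dots> \<le> ?B J"
          by (intro mult_left_mono add_left_mono mult_right_mono nz K.mnorm_nonneg K.opnorm_nonneg T)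
        finally show ?thesis using elim(1) by linarith
      qed
      then show ?case by blast
    qed
  qed
  have cont: "continuous_on (cbox 0 1) (?f J)" for J
  proof (cases "finite J")
    case True
    have "continuous_on (cbox 0 1) (\<lambda>s::(real, 'i) vec. (chr s k * cnj (chr s m)) *\<^sub>C a)" for k m and a :: 'a
      by (rule bounded_linear.continuous_on[OF bounded_linear_scaleC_left]) (intro continuous_intros continuous_chr)
    then show ?thesis using True unfolding gauge_ip_finite[OF T z e True] by (simp add: continuous_on_sum)
  qed simp
  obtain I L where I: "\<And>J. (?f J has_integral I J) (cbox 0 1)" and L: "(?g has_integral L) (cbox 0 1)"
    and lim: "(I \<longlongrightarrow> L) (finite_subsets_at_top UNIV)"
    using uniform_limit_integral_cbox[OF u cont] by auto
  have IJ: "I J = (\<Sum>m\<in>J. ip (fib X m) (\<zeta> m) (diag T \<eta> m))" if "finite J" for J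
    using I[of J] has_integral_gauge_finite[OF T z e that] that has_integral_unique by auto
  have "((\<lambda>J. \<Sum>m\<in>J. ip (fib X m) (\<zeta> m) (diag T \<eta> m)) \<longlongrightarrow> L) (finite_subsets_at_top UNIV)"
    by (rule Lim_transform_eventually[OF lim]) (auto intro!: eventually_finite_subsets_at_top_weakI simp: IJ)
  moreover have "((\<lambda>J. \<Sum>m\<in>J. ip (fib X m) (\<zeta> m) (diag T \<eta> m)) \<longlongrightarrow> ip (fock X) \<zeta> (diag T \<eta>)) (finite_subsets_at_top UNIV)"
    using fock_has_sum[OF z K.L_closed[OF diag_L[OF T] e]] unfolding has_sum_def .
  ultimately have "L = ip (fock X) \<zeta> (diag T \<eta>)" using tendsto_unique by (metis finite_subsets_at_top_neq_bot)
  then show ?thesis using L gauge_ip[OF T z e] unfolding torus_pt_def by simp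
qed

lemma cond_exp_eq:
  assumes T: "T \<in> \<L> (fock X)" shows "cond_exp X T = diag T"
  unfolding cond_exp_def
proof (rule the_equality)
  show "diag T \<in> \<L> (fock X) \<and> (\<forall>\<zeta>\<in>carrier (fock X). \<forall>\<eta>\<in>carrier (fock X).
      ((\<lambda>s::(real, 'i) vec. ip (fock X) \<zeta> (gauge X (\<lambda>i. cis (2 * pi * s $ i)) T \<eta>)) has_integral ip (fock X) \<zeta> (diag T \<eta>)) (cbox 0 1))"
    using diag_L[OF T] has_integral_gauge[OF T] by blast
  fix S assume S: "S \<in> \<L> (fock X) \<and> (\<forall>\<zeta>\<in>carrier (fock X). \<forall>\<eta>\<in>carrier (fock X).
      ((\<lambda>s::(real, 'i) vec. ip (fock X) \<zeta> (gauge X (\<lambda>i. cis (2 * pi * s $ i)) T \<eta>)) has_integral ip (fock X) \<zeta> (S \<eta>)) (cbox 0 1))"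
  show "S = diag T"
  proof (rule K.L_eqI)
    fix \<eta> assume e: "\<eta> \<in> carrier (fock X)"
    show "S \<eta> = diag T \<eta>"
    proof (rule K.ip_eqI)
      fix \<zeta> assume z: "\<zeta> \<in> carrier (fock X)"
      show "ip (fock X) \<zeta> (S \<eta>) = ip (fock X) \<zeta> (diag T \<eta>)"
        using S z e has_integral_gauge[OF T z e] has_integral_unique by blast
    qed (use S e K.L_closed diag_L[OF T] in blast)+
  qed (use S diag_L[OF T] in auto)
qed

end

section \<open>KMS states\<close>

context finite_rank_system
begin

text \<open>Density principle: a function that satisfies a Lipschitz bound and vanishes on
  \<open>Alg\<close> vanishes on its closure. Linearity is deliberately left out of the assumptions,
  so that differences of two expressions in \<open>T\<close> can be used directly.\<close>

lemma NT_zeroI: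
  assumes h: "\<And>S. S \<in> Alg \<Longrightarrow> h S = (0::complex)"
    and bd: "\<And>S T. S \<in> NT X \<Longrightarrow> T \<in> NT X \<Longrightarrow> cmod (h T - h S) \<le> M * opnorm (fock X) (T - S)"
    and T: "T \<in> NT X"
  shows "h T = 0"
proof (rule ccontr)
  assume "h T \<noteq> 0"
  define e where "e = cmod (h T) / (\<bar>M\<bar> + 1)"
  have e: "e > 0" using \<open>h T \<noteq> 0\<close> by (simp add: e_def add_nonneg_pos)
  obtain S where S: "S \<in> Alg" "opnorm (fock X) (T - S) < e" using NT_approx[OF T e] by blast
  have n: "opnorm (fock X) (T - S) \<ge> 0" by (intro K.opnorm_nonneg K.L_minus NT_L T Alg_NT S)
  have "cmod (h T) \<le> M * opnorm (fock X) (T - S)" using bd[OF Alg_NT[OF S(1)] T] h[OF S(1)] by simp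
  also have "\<dots> \<le> (\<bar>M\<bar> + 1) * opnorm (fock X) (T - S)" using n by (intro mult_right_mono) auto
  also have "\<dots> < (\<bar>M\<bar> + 1) * e" using S(2) by (intro mult_strict_left_mono) auto
  also have "\<dots> = cmod (h T)" by (simp add: e_def)
  finally show False by simp
qed

lemma pi_dproj: "pi_rep X a \<circ> dproj S = dproj S \<circ> pi_rep X a"
  by (rule op_eqI) (auto simp: pi_L dproj_L K.L_comp dproj_sgl pi_sgl F.lact_closed K.L_zero[OF pi_L])

text \<open>Creation in a direction outside \<open>F\<close> does not change the coordinates of the
  degree in \<open>F\<close>.\<close>

lemma t_Q_set:
  assumes x: "\<xi> \<in> carrier (fib X (unit_vec i))" and i: "i \<notin> F"
  shows "t (unit_vec i) \<xi> \<circ> Q_set X x F = Q_set X x F \<circ> t (unit_vec i) \<xi>"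
proof -
  have "(\<forall>j\<in>F. (unit_vec i + k) j = 0) \<longleftrightarrow> (\<forall>j\<in>F. k j = 0)" for k using i by (auto simp: unit_vec_def)
  then show ?thesis unfolding Q_set_eq
    by (intro op_eqI) (auto simp: t_L[OF x] dproj_L K.L_comp dproj_sgl t_sgl[OF x] T.p_closed[OF x] K.L_zero[OF t_L[OF x]])
qed

lemma adj_Q_set: "adj (fock X) (Q_set X x F) = Q_set X x F"
  and adj_Q_proj: "adj (fock X) (Q_proj X x i) = Q_proj X x i"
  and Q_set_idem: "Q_set X x F \<circ> Q_set X x F = Q_set X x F"
  and Q_proj_idem: "Q_proj X x i \<circ> Q_proj X x i = Q_proj X x i"
  and pi_Q_set: "pi_rep X a \<circ> Q_set X x F = Q_set X x F \<circ> pi_rep X a"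
  by (simp_all only: Q_set_eq Q_proj_eq adj_dproj dproj_comp Int_absorb pi_dproj)

lemma tA_Q_set:
  assumes x: "\<xi> \<in> carrier (fib X (unit_vec i))" and i: "i \<notin> F"
  shows "tA (unit_vec i) \<xi> \<circ> Q_set X x F = Q_set X x F \<circ> tA (unit_vec i) \<xi>"
  using arg_cong[OF t_Q_set[OF x i], of "adj (fock X)"] t_L[OF x] dproj_L
  by (simp only: K.adj_comp Q_set_eq adj_dproj)

lemma Q_corner: "Q_set X x F \<circ> pi_rep X a \<circ> Q_set X x F = Q_set X x F \<circ> pi_rep X a"
proof -
  have "Q_set X x F \<circ> pi_rep X a \<circ> Q_set X x F = (Q_set X x F \<circ> Q_set X x F) \<circ> pi_rep X a"
    using pi_Q_set by (simp only: comp_assoc)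
  then show ?thesis by (simp only: Q_set_idem)
qed

text \<open>Levels are disjoint sets of degrees indexed by the \<open>F\<close>-part, so finite sums
  of them are again degree projections.\<close>

lemma dproj_levels:
  assumes "finite J" "J \<subseteq> degs F"
  shows "(\<Sum>n\<in>J. Q_level X x F n) = dproj {k. cpart F k \<in> J}"
proof (rule op_eqI)
  have n: "cpart F k = n \<longleftrightarrow> (\<forall>i\<in>F. k i = n i)" if "n \<in> J" for k n
    using that assms(2) by (auto simp: cpart_def degs_def supp_def fun_eq_iff subset_iff)
  have Q: "Q_level X x F n = dproj {k. cpart F k = n}" if "n \<in> J" for n
    using Q_level_eq'[of n F] that assms(2) n[OF that] by (auto simp: degs_def)
  show "(\<Sum>n\<in>J. Q_level X x F n) \<in> \<L> (fock X)" by (intro K.L_sum_op Alg_L Alg_Q_level)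
  show "dproj {k. cpart F k \<in> J} \<in> \<L> (fock X)" by (rule dproj_L)
  fix m \<xi> assume x: "\<xi> \<in> carrier (fib X m)"
  have "(\<Sum>n\<in>J. Q_level X x F n) (sgl m \<xi>) = (\<Sum>n\<in>J. Q_level X x F n (sgl m \<xi>))" by (rule sum_fun_apply)
  also have "\<dots> = (\<Sum>n\<in>J. if cpart F m = n then sgl m \<xi> else 0)"
    by (intro sum.cong refl) (simp add: Q dproj_sgl[OF x])
  also have "\<dots> = (if cpart F m \<in> J then sgl m \<xi> else 0)" using assms(1) by simp
  finally show "(\<Sum>n\<in>J. Q_level X x F n) (sgl m \<xi>) = dproj {k. cpart F k \<in> J} (sgl m \<xi>)"
    by (simp add: dproj_sgl[OF x])
qed

lemma operator_state_NT:
  assumes "\<phi> \<in> states (fock X) (NT X)" shows "operator_state (fock X) (NT X) \<phi>"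
  using assms cstar_subalgebra_NT Alg_NT[OF Alg_id] K.hilbert_module_axioms
  by (simp add: operator_state_def operator_state_axioms_def)

lemma t_tt: "\<xi> \<in> carrier (fib X n) \<Longrightarrow> tt X n \<xi> 0 (emb X 1) = t n \<xi>"
  by (simp add: t_emb pi_one K.adj_id K.comp_id_right t_L)

text \<open>Linearity extends the equality to \<open>Alg\<close>; contractivity of both states
  extends it to the closure.\<close>

lemma states_eqI:
  assumes \<phi>: "\<phi> \<in> states (fock X) (NT X)" and \<psi>: "\<psi> \<in> states (fock X) (NT X)"
    and eq: "\<And>n \<xi> m \<eta>. \<xi> \<in> carrier (fib X n) \<Longrightarrow> \<eta> \<in> carrier (fib X m) \<Longrightarrow> \<phi> (tt X n \<xi> m \<eta>) = \<psi> (tt X n \<xi> m \<eta>)"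
  shows "\<phi> = \<psi>"
proof
  interpret P: operator_state "fock X" "NT X" \<phi> by (rule operator_state_NT[OF \<phi>])
  interpret R: operator_state "fock X" "NT X" \<psi> by (rule operator_state_NT[OF \<psi>])
  fix T show "\<phi> T = \<psi> T"
  proof (cases "T \<in> NT X")
    case True
    have "\<phi> T - \<psi> T = 0"
    proof (rule NT_zeroI[OF _ _ True])
      fix S assume "S \<in> Alg"
      then show "\<phi> S - \<psi> S = 0"
      proof (induction rule: Alg.induct)
        case (Alg_step T \<xi> n \<eta> m)
        then show ?case using eq[OF Alg_step.hyps(2,3)]
          by (simp only: P.st_add[OF Alg_NT[OF Alg_tt] Alg_NT] R.st_add[OF Alg_NT[OF Alg_tt] Alg_NT]) simp
      qed (simp only: P.st_zero R.st_zero diff_self)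
    next
      fix S T assume ST: "S \<in> NT X" "T \<in> NT X"
      have "(\<phi> T - \<psi> T) - (\<phi> S - \<psi> S) = \<phi> (T - S) - \<psi> (T - S)" using ST by (simp only: P.st_minus R.st_minus) (simp only: algebra_simps)
      then show "cmod ((\<phi> T - \<psi> T) - (\<phi> S - \<psi> S)) \<le> 2 * opnorm (fock X) (T - S)"
        using norm_triangle_ineq4[of "\<phi> (T - S)" "\<psi> (T - S)"] P.st_bound[OF P.B_minus[OF ST(2,1)]] R.st_bound[OF P.B_minus[OF ST(2,1)]]
        by simp
    qed
    then show ?thesis by simp
  qed (simp add: P.st_off R.st_off)
qed

end

section \<open>Consequences of the KMS condition\<close>

locale kms_system = finite_rank_system +
  fixes \<beta> :: real and \<phi>
  assumes kms: "\<phi> \<in> KMS X \<beta>"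
begin

lemma kms_state: "\<phi> \<in> states (fock X) (NT X)"
  using kms by (simp add: KMS_def)

sublocale S: operator_state "fock X" "NT X" \<phi>
  by (rule operator_state_NT[OF kms_state])

lemma st_comp_bound:
  assumes "T \<in> NT X" "R \<in> NT X"
  shows "cmod (\<phi> (T \<circ> R)) \<le> opnorm (fock X) T * opnorm (fock X) R"
  using S.st_bound[OF S.B_comp[OF assms]] K.opnorm_comp[OF NT_L[OF assms(1)] NT_L[OF assms(2)]] by (rule order_trans)

text \<open>The condition is postulated between spanning elements only. Both sides are linear and
  bounded in \<open>R\<close>, so it extends from \<open>Alg\<close> to all of
  \<open>NT X\<close>.\<close>

lemma kms_tt:
  assumes x: "\<xi> \<in> carrier (fib X n)" and e: "\<eta> \<in> carrier (fib X m)" and R: "R \<in> NT X"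
  shows "\<phi> (tt X n \<xi> m \<eta> \<circ> R) = complex_of_real (exp (- (real (tdeg n) - real (tdeg m)) * \<beta>)) * \<phi> (R \<circ> tt X n \<xi> m \<eta>)"
proof -
  let ?T = "tt X n \<xi> m \<eta>" and ?c = "complex_of_real (exp (- (real (tdeg n) - real (tdeg m)) * \<beta>))"
  have T: "?T \<in> NT X" "?T \<in> \<L> (fock X)" using Alg_NT[OF Alg_tt[OF x e]] tt_L[OF x e] by auto
  have "\<phi> (?T \<circ> R) - ?c * \<phi> (R \<circ> ?T) = 0"
  proof (rule NT_zeroI[OF _ _ R])
    fix S assume "S \<in> Alg"
    then show "\<phi> (?T \<circ> S) - ?c * \<phi> (S \<circ> ?T) = 0"
    proof (induction rule: Alg.induct)
      case Alg_zero
      show ?case unfolding K.comp_zero_right[OF T(2)] K.comp_zero_left S.st_zero by simp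
    next
      case (Alg_step S \<zeta> k \<omega> w)
      let ?R = "tt X k \<zeta> w \<omega>"
      have R: "?R \<in> NT X" "S \<in> NT X" using Alg_step Alg_NT Alg_tt by auto
      have 1: "\<phi> (?T \<circ> (?R + S)) = \<phi> (?T \<circ> ?R) + \<phi> (?T \<circ> S)"
        unfolding K.comp_plus_right[OF T(2) NT_L[OF R(1)] NT_L[OF R(2)]] by (rule S.st_add[OF S.B_comp[OF T(1) R(1)] S.B_comp[OF T(1) R(2)]])
      have 2: "\<phi> ((?R + S) \<circ> ?T) = \<phi> (?R \<circ> ?T) + \<phi> (S \<circ> ?T)"
        unfolding K.comp_plus_left by (rule S.st_add[OF S.B_comp[OF R(1) T(1)] S.B_comp[OF R(2) T(1)]])
      have 3: "\<phi> (?T \<circ> ?R) = ?c * \<phi> (?R \<circ> ?T)" using kms x e Alg_step unfolding KMS_def by blast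
      show ?case unfolding 1 2 3 using Alg_step.IH by (simp only: distrib_left add_diff_add) simp
    qed
  next
    fix S R assume SR: "S \<in> NT X" "R \<in> NT X"
    let ?D = "R - S" and ?N = "opnorm (fock X)"
    have D: "?D \<in> NT X" using SR by (intro S.B_minus)
    have eq: "\<phi> (?T \<circ> R) - ?c * \<phi> (R \<circ> ?T) - (\<phi> (?T \<circ> S) - ?c * \<phi> (S \<circ> ?T)) = \<phi> (?T \<circ> ?D) - ?c * \<phi> (?D \<circ> ?T)"
      unfolding K.comp_minus_right[OF T(2) NT_L[OF SR(2)] NT_L[OF SR(1)]] K.comp_minus_left
      unfolding S.st_minus[OF S.B_comp[OF T(1) SR(2)] S.B_comp[OF T(1) SR(1)]] S.st_minus[OF S.B_comp[OF SR(2) T(1)] S.B_comp[OF SR(1) T(1)]]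
      by (simp only: right_diff_distrib) simp
    have "cmod (\<phi> (?T \<circ> ?D) - ?c * \<phi> (?D \<circ> ?T)) \<le> cmod (\<phi> (?T \<circ> ?D)) + cmod ?c * cmod (\<phi> (?D \<circ> ?T))"
      using norm_triangle_ineq4[of "\<phi> (?T \<circ> ?D)" "?c * \<phi> (?D \<circ> ?T)"] by (simp only: norm_mult)
    moreover have "cmod ?c * cmod (\<phi> (?D \<circ> ?T)) \<le> cmod ?c * (?N ?D * ?N ?T)"
      by (rule mult_left_mono[OF st_comp_bound[OF D T(1)] norm_ge_zero])
    moreover note st_comp_bound[OF T(1) D]
    ultimately show "cmod (\<phi> (?T \<circ> R) - ?c * \<phi> (R \<circ> ?T) - (\<phi> (?T \<circ> S) - ?c * \<phi> (S \<circ> ?T))) \<le> (?N ?T + cmod ?c * ?N ?T) * ?N ?D"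
      unfolding eq by (simp only: distrib_right mult.commute[of "?N ?T" "?N ?D"] mult.assoc)
  qed
  then show ?thesis by simp
qed

lemma kms_t:
  assumes x: "\<xi> \<in> carrier (fib X n)" and R: "R \<in> NT X"
  shows "\<phi> (t n \<xi> \<circ> R) = complex_of_real (exp (- real (tdeg n) * \<beta>)) * \<phi> (R \<circ> t n \<xi>)"
  using kms_tt[OF x emb_closed[of 1] R] unfolding t_tt[OF x] by (simp add: tdeg_def)

lemma kms_pi: "R \<in> NT X \<Longrightarrow> \<phi> (pi_rep X a \<circ> R) = \<phi> (R \<circ> pi_rep X a)"
  using kms_t[OF emb_closed, of R a] by (simp only: t_emb) (simp add: tdeg_def)

text \<open>Cauchy-Schwarz annihilates products beginning with the adjoint of \<open>T\<close>. A
  spanning element to its left is moved cyclically to the far right at the cost of a scalar, so the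
  left kernel behaves as a two-sided ideal.\<close>

lemma kms_ideal_zero:
  assumes T: "T \<in> NT X" and z: "\<phi> (adj (fock X) T \<circ> T) = 0" and S: "S \<in> NT X" and R: "R \<in> NT X"
  shows "\<phi> (S \<circ> adj (fock X) T \<circ> R) = 0"
proof -
  have T': "adj (fock X) T \<circ> R \<in> NT X" using T R by (intro S.B_simps)
  have zero: "\<phi> (adj (fock X) T \<circ> R') = 0" if "R' \<in> NT X" for R' using S.st_null(2)[OF T that z] .
  have "\<phi> (S \<circ> (adj (fock X) T \<circ> R)) = 0"
  proof (rule NT_zeroI[OF _ _ S])
    fix S assume "S \<in> Alg"
    then show "\<phi> (S \<circ> (adj (fock X) T \<circ> R)) = 0"
    proof (induction rule: Alg.induct)
      case Alg_zero
      show ?case unfolding K.comp_zero_left by (rule S.st_zero)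
    next
      case (Alg_step S \<zeta> k \<omega> w)
      have c: "tt X k \<zeta> w \<omega> \<in> NT X" "S \<in> NT X" using Alg_step Alg_NT Alg_tt by auto
      have "\<phi> (tt X k \<zeta> w \<omega> \<circ> (adj (fock X) T \<circ> R)) = 0"
        unfolding kms_tt[OF Alg_step.hyps(2,3) T'] comp_assoc[of "adj (fock X) T" R]
        using zero[OF S.B_comp[OF R c(1)]] by simp
      then show ?case unfolding K.comp_plus_left S.st_add[OF S.B_comp[OF c(1) T'] S.B_comp[OF c(2) T']] by (simp only: Alg_step.IH add_0)
    qed
  next
    fix S R' assume SR: "S \<in> NT X" "R' \<in> NT X"
    have "cmod (\<phi> ((R' - S) \<circ> (adj (fock X) T \<circ> R))) \<le> opnorm (fock X) (R' - S) * opnorm (fock X) (adj (fock X) T \<circ> R)"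
      by (rule st_comp_bound[OF S.B_minus[OF SR(2,1)] T'])
    then show "cmod (\<phi> (R' \<circ> (adj (fock X) T \<circ> R)) - \<phi> (S \<circ> (adj (fock X) T \<circ> R))) \<le> opnorm (fock X) (adj (fock X) T \<circ> R) * opnorm (fock X) (R' - S)"
      unfolding K.comp_minus_left S.st_minus[OF S.B_comp[OF SR(2) T'] S.B_comp[OF SR(1) T']] by (simp only: mult.commute)
  qed
  then show ?thesis by (simp only: comp_assoc)
qed

text \<open>Moving t(x_\<mu>) cyclically meets its adjoint, and \<pi>(a) between them becomes \<pi>
  of the inner product of x_\<mu> with a x_\<mu>. The functional inside \<open>Tr\<close> is not
  normalised; division by \<phi>(Q_F) will turn it into a tracial state.\<close>

lemma kms_Q_level:
  "\<phi> (Q_level X x F n \<circ> pi_rep X a) = complex_of_real (exp (- real (tdeg n) * \<beta>)) * Tr (\<lambda>b. \<phi> (Q_set X x F \<circ> pi_rep X b)) n (pi_rep X a)"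
proof -
  let ?Q = "Q_set X x F" and ?e = "complex_of_real (exp (- real (tdeg n) * \<beta>))"
  have Q: "?Q \<in> NT X" by (rule Alg_NT[OF Alg_Q_set])
  have "\<phi> (Q_level X x F n \<circ> pi_rep X a) = \<phi> (\<Sum>\<mu>\<in>wds n. t n (xw \<mu>) \<circ> (?Q \<circ> (tA n (xw \<mu>) \<circ> pi_rep X a)))"
    unfolding Q_level_def words_of_def[symmetric] K.comp_sum_left by (simp only: comp_assoc)
  also have "\<dots> = (\<Sum>\<mu>\<in>wds n. \<phi> (t n (xw \<mu>) \<circ> (?Q \<circ> (tA n (xw \<mu>) \<circ> pi_rep X a))))"
    using xw_closed by (intro S.st_sum S.B_comp Q Alg_NT Alg_t Alg_tA Alg_pi)
  also have "\<dots> = (\<Sum>\<mu>\<in>wds n. ?e * \<phi> (?Q \<circ> pi_rep X (ip (fock X) (sgl n (xw \<mu>)) (pi_rep X a (sgl n (xw \<mu>))))))"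
  proof (rule sum.cong[OF refl])
    fix \<mu> assume "\<mu> \<in> wds n"
    note c = xw_closed[OF this]
    have "\<phi> (t n (xw \<mu>) \<circ> (?Q \<circ> (tA n (xw \<mu>) \<circ> pi_rep X a))) = ?e * \<phi> ((?Q \<circ> (tA n (xw \<mu>) \<circ> pi_rep X a)) \<circ> t n (xw \<mu>))"
      by (rule kms_t[OF c]) (intro S.B_comp Q Alg_NT Alg_tA[OF c] Alg_pi)
    also have "(?Q \<circ> (tA n (xw \<mu>) \<circ> pi_rep X a)) \<circ> t n (xw \<mu>) = ?Q \<circ> (tA n (xw \<mu>) \<circ> (pi_rep X a \<circ> t n (xw \<mu>)))"
      by (simp only: comp_assoc)
    also have "tA n (xw \<mu>) \<circ> (pi_rep X a \<circ> t n (xw \<mu>)) = pi_rep X (ip (fib X n) (xw \<mu>) (lact (fib X n) a (xw \<mu>)))"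
      unfolding pi_t[OF c] by (rule tA_t[OF c F.lact_closed[OF c]])
    also have "ip (fib X n) (xw \<mu>) (lact (fib X n) a (xw \<mu>)) = ip (fock X) (sgl n (xw \<mu>)) (pi_rep X a (sgl n (xw \<mu>)))"
      using c by (simp add: pi_sgl ip_sgl_left sgl_closed F.lact_closed)
    finally show "\<phi> (t n (xw \<mu>) \<circ> (?Q \<circ> (tA n (xw \<mu>) \<circ> pi_rep X a)))
        = ?e * \<phi> (?Q \<circ> pi_rep X (ip (fock X) (sgl n (xw \<mu>)) (pi_rep X a (sgl n (xw \<mu>)))))" .
  qed
  finally show ?thesis unfolding Tr_def sum_distrib_left .
qed

lemma kms_level_zero: "\<phi> (Q_set X x F) = 0 \<Longrightarrow> R \<in> NT X \<Longrightarrow> \<phi> (Q_set X x F \<circ> R) = 0"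
  using S.st_null(2)[OF Alg_NT[OF Alg_Q_set]] by (simp only: adj_Q_set Q_set_idem)

text \<open>The levels \<open>Q\<^sub>F\<^sup>n\<close> are mutually orthogonal projections; if \<open>\<phi>\<close> gives them total mass one, then
  \<open>\<phi>\<close> is concentrated on them by the Cauchy-Schwarz inequality.\<close>

lemma kms_levels_has_sum:
  assumes hs: "((\<lambda>n. \<phi> (Q_level X x F n)) has_sum 1) (degs F)" and T: "T \<in> NT X"
  shows "((\<lambda>n. \<phi> (Q_level X x F n \<circ> T)) has_sum \<phi> T) (degs F)"
  unfolding has_sum_def
proof (rule Lim_null[THEN iffD2], rule Lim_null_comparison)
  let ?M = "Re (\<phi> (adj (fock X) T \<circ> T))"
  let ?g = "\<lambda>J. sqrt (Re (1 - (\<Sum>n\<in>J. \<phi> (Q_level X x F n))) * ?M)"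
  have "(?g \<longlongrightarrow> sqrt (Re (1 - 1) * ?M)) (finite_subsets_at_top (degs F))"
    using hs unfolding has_sum_def by (intro tendsto_intros)
  then show "(?g \<longlongrightarrow> 0) (finite_subsets_at_top (degs F))" by simp
  show "\<forall>\<^sub>F J in finite_subsets_at_top (degs F). norm ((\<Sum>n\<in>J. \<phi> (Q_level X x F n \<circ> T)) - \<phi> T) \<le> ?g J"
  proof (rule eventually_finite_subsets_at_top_weakI)
    fix J assume J: "finite J" "J \<subseteq> degs F"
    define P where "P = id_op (fock X) - (\<Sum>n\<in>J. Q_level X x F n)"
    have PQ: "(\<Sum>n\<in>J. Q_level X x F n) \<in> NT X" by (intro Alg_NT Alg_sum Alg_Q_level)
    have PN: "P \<in> NT X" unfolding P_def by (intro S.B_minus S.id_B PQ)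
    have Pd: "P = dproj (- {k. cpart F k \<in> J})" unfolding P_def dproj_levels[OF J] by (rule dproj_compl)
    have PP: "adj (fock X) P = P" "P \<circ> P = P" unfolding Pd by (simp_all only: adj_dproj dproj_comp Int_absorb)
    have 1: "\<phi> P = 1 - (\<Sum>n\<in>J. \<phi> (Q_level X x F n))"
      unfolding P_def S.st_minus[OF S.id_B PQ] S.st_id by (simp only: S.st_sum[OF Alg_NT[OF Alg_Q_level]])
    have "P \<circ> T = T - (\<Sum>n\<in>J. Q_level X x F n \<circ> T)"
      unfolding P_def K.comp_minus_left K.comp_id_left[OF NT_L[OF T]] K.comp_sum_left ..
    moreover have "(\<Sum>n\<in>J. Q_level X x F n \<circ> T) \<in> NT X" by (intro S.B_sum S.B_comp Alg_NT Alg_Q_level T)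
    ultimately have 2: "\<phi> (P \<circ> T) = \<phi> T - (\<Sum>n\<in>J. \<phi> (Q_level X x F n \<circ> T))"
      using S.st_minus[OF T] by (simp only: S.st_sum[OF S.B_comp[OF Alg_NT[OF Alg_Q_level] T]])
    have "(cmod (\<phi> (P \<circ> T)))\<^sup>2 \<le> Re (\<phi> P) * ?M" using S.st_CS(2)[OF PN T] by (simp only: PP)
    then show "norm ((\<Sum>n\<in>J. \<phi> (Q_level X x F n \<circ> T)) - \<phi> T) \<le> ?g J"
      unfolding 1 2 by (metis norm_minus_commute real_le_rsqrt)
  qed
qed

end

section \<open>From traces to equilibrium states\<close>

context finite_rank_system
begin

text \<open>Among the degrees p + k of the Gibbs sum only p = n has \<open>F\<close>-part
  \<open>n\<close>, because \<open>k\<close> vanishes on \<open>F\<close>; scaling then removes the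
  offset.\<close>

lemma W_level:
  assumes TF: "\<tau> \<in> T_F X x F \<beta>" and n: "n \<in> degs F" and k: "supp k \<subseteq> - F"
  shows "W F \<beta> \<tau> k (Q_level X x F n \<circ> pi_rep X a \<circ> Q_level X x F n)
    = complex_of_real (exp (- real (tdeg n) * \<beta>)) * Tr \<tau> n (pi_rep X a)"
proof -
  let ?S = "{q. \<forall>i\<in>F. q i = n i}"
  let ?f = "\<lambda>p. complex_of_real (exp (- (real (tdeg p) + real (tdeg k)) * \<beta>)) * Tr \<tau> (p + k) (dproj ?S \<circ> pi_rep X a \<circ> dproj ?S)"
  have Q: "Q_level X x F n = dproj ?S" using n by (intro Q_level_eq') (simp add: degs_def)
  note tau = TF_tracial[OF TF]
  have mem: "p + k \<in> ?S \<longleftrightarrow> p = n" if "p \<in> degs F" for p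
  proof -
    have "k i = 0" if "i \<in> F" for i using k that by (auto simp: supp_def)
    moreover have "p i = n i" if "i \<notin> F" for i using \<open>p \<in> degs F\<close> n that by (force simp: degs_def supp_def)
    ultimately show ?thesis by (auto simp: fun_eq_iff)
  qed
  have "exp (- (real (tdeg n) + real (tdeg k)) * \<beta>) * exp (real (tdeg k) * \<beta>) = exp (- real (tdeg n) * \<beta>)"
    by (simp add: exp_add[symmetric] algebra_simps)
  then have e: "complex_of_real (exp (- (real (tdeg n) + real (tdeg k)) * \<beta>)) * complex_of_real (exp (real (tdeg k) * \<beta>))
      = complex_of_real (exp (- real (tdeg n) * \<beta>))" by (simp only: of_real_mult[symmetric])
  have "(?f has_sum complex_of_real (exp (- real (tdeg n) * \<beta>)) * Tr \<tau> n (pi_rep X a)) (degs F)"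
  proof (rule has_sum_finite_neutralI[of "{n}"])
    show "?f p = 0" if "p \<in> degs F - {n}" for p
      using that mem[of p] by (simp only: Tr_dproj[OF tau pi_L]) auto
    have "?f n = complex_of_real (exp (- (real (tdeg n) + real (tdeg k)) * \<beta>)) * Tr \<tau> (n + k) (pi_rep X a)"
      using mem[OF n] by (simp only: Tr_dproj[OF tau pi_L] if_True refl)
    also have "\<dots> = complex_of_real (exp (- real (tdeg n) * \<beta>)) * Tr \<tau> n (pi_rep X a)"
      unfolding Tr_scale[OF TF k] mult.assoc[symmetric] e ..
    finally show "complex_of_real (exp (- real (tdeg n) * \<beta>)) * Tr \<tau> n (pi_rep X a) = sum ?f {n}" by simp
  qed (use n in auto)
  then show ?thesis unfolding W_def Q by (rule infsumI)
qed

lemma Phi_level: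
  assumes TF: "\<tau> \<in> T_F X x F \<beta>" and n: "n \<in> degs F"
  shows "Phi F \<beta> \<tau> (Q_level X x F n \<circ> pi_rep X a \<circ> Q_level X x F n)
    = complex_of_real (exp (- real (tdeg n) * \<beta>)) * Tr \<tau> n (pi_rep X a) / complex_of_real (cR F \<beta> \<tau>)"
  by (rule Phi_eventually[OF TF Alg_NT W_level[OF TF n supp_ray]]) (intro Alg_comp Alg_Q_level Alg_pi)

lemma Q_level_zero: "Q_level X x F 0 = Q_set X x F"
  using Q_level_eq'[of 0 F] by (simp add: Q_set_eq supp_def)

lemma Phi_Q_corner:
  assumes TF: "\<tau> \<in> T_F X x F \<beta>"
  shows "Phi F \<beta> \<tau> (Q_set X x F \<circ> pi_rep X a \<circ> Q_set X x F) = \<tau> a / complex_of_real (cR F \<beta> \<tau>)"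
  using Phi_level[OF TF, of 0 a] Tr_zero_pi[OF TF_tracial[OF TF]] by (simp add: Q_level_zero degs_def supp_def tdeg_def)

lemma Q_level_id: "n \<in> degs F \<Longrightarrow> Q_level X x F n \<circ> pi_rep X 1 \<circ> Q_level X x F n = Q_level X x F n"
  using Q_level_eq'[of n F] by (simp only: degs_def mem_Collect_eq pi_one K.comp_id_right[OF dproj_L] dproj_comp Int_absorb)

lemma Phi_Q_set:
  assumes TF: "\<tau> \<in> T_F X x F \<beta>"
  shows "Phi F \<beta> \<tau> (Q_set X x F) = 1 / complex_of_real (cR F \<beta> \<tau>)"
proof -
  have "Q_set X x F \<circ> pi_rep X 1 \<circ> Q_set X x F = Q_set X x F"
    using Q_level_id[of 0 F] by (simp add: Q_level_zero degs_def supp_def)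
  moreover have "\<tau> 1 = 1" using TF_tracial[OF TF] by (simp add: tracial_states_def)
  ultimately show ?thesis using Phi_Q_corner[OF TF, of 1] by simp
qed

lemma Phi_tt:
  assumes TF: "\<tau> \<in> T_F X x F \<beta>" and x: "\<xi> \<in> carrier (fib X n)" and e: "\<eta> \<in> carrier (fib X n)"
  shows "Phi F \<beta> \<tau> (tt X n \<xi> n \<eta>)
    = complex_of_real (exp (- real (tdeg n) * \<beta>)) * W F \<beta> \<tau> 0 (pi_rep X (ip (fib X n) \<eta> \<xi>)) / complex_of_real (cR F \<beta> \<tau>)"
proof (rule Phi_eventually[OF TF Alg_NT[OF Alg_tt[OF x e]], of "tdeg n"])
  fix j assume "tdeg n \<le> j"
  then have "cpart (- F) n \<le> ray F j" using tdeg_ge[of n] by (auto simp: le_fun_def cpart_def ray_def intro: order_trans)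
  then show "W F \<beta> \<tau> (ray F j) (tt X n \<xi> n \<eta>) = complex_of_real (exp (- real (tdeg n) * \<beta>)) * W F \<beta> \<tau> 0 (pi_rep X (ip (fib X n) \<eta> \<xi>))"
    by (rule W_tt[OF TF x e supp_ray])
qed

lemma Phi_tt_off:
  assumes TF: "\<tau> \<in> T_F X x F \<beta>" and x: "\<xi> \<in> carrier (fib X n)" and e: "\<eta> \<in> carrier (fib X m)" and nm: "n \<noteq> m"
  shows "Phi F \<beta> \<tau> (tt X n \<xi> m \<eta>) = 0"
  using Phi_eventually[OF TF Alg_NT[OF Alg_tt[OF x e]] W_tt_off[OF TF x e nm]] by simp

text \<open>\<open>Phi_t\<close> moves creation operators; taking adjoints gives the rule for
  annihilation operators, with the inverse factor. The KMS condition is obtained by moving the two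
  factors one after the other.\<close>

lemma Phi_kms:
  assumes TF: "\<tau> \<in> T_F X x F \<beta>" shows "Phi F \<beta> \<tau> \<in> KMS X \<beta>"
proof -
  interpret P: operator_state "fock X" "NT X" "Phi F \<beta> \<tau>" by (rule operator_state_NT[OF Phi_state[OF TF]])
  have tA: "Phi F \<beta> \<tau> (tA m \<eta> \<circ> R) = complex_of_real (exp (real (tdeg m) * \<beta>)) * Phi F \<beta> \<tau> (R \<circ> tA m \<eta>)"
    if e: "\<eta> \<in> carrier (fib X m)" and R: "R \<in> Alg" for m \<eta> R
  proof -
    note L = t_L[OF e] Alg_L[OF R]
    have "cnj (Phi F \<beta> \<tau> (t m \<eta> \<circ> adj (fock X) R)) = complex_of_real (exp (- real (tdeg m) * \<beta>)) * cnj (Phi F \<beta> \<tau> (adj (fock X) R \<circ> t m \<eta>))"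
      unfolding Phi_t[OF TF e Alg_adj[OF R]] by simp
    moreover have "cnj (Phi F \<beta> \<tau> (t m \<eta> \<circ> adj (fock X) R)) = Phi F \<beta> \<tau> (R \<circ> tA m \<eta>)"
      using P.st_adj[OF Alg_NT[OF Alg_comp[OF Alg_t[OF e] Alg_adj[OF R]]]] L
      by (simp only: K.adj_comp[OF L(1) K.adj_closed[OF L(2)]] K.adj_adj[OF L(2)])
    moreover have "cnj (Phi F \<beta> \<tau> (adj (fock X) R \<circ> t m \<eta>)) = Phi F \<beta> \<tau> (tA m \<eta> \<circ> R)"
      using P.st_adj[OF Alg_NT[OF Alg_comp[OF Alg_adj[OF R] Alg_t[OF e]]]] L
      by (simp only: K.adj_comp[OF K.adj_closed[OF L(2)] L(1)] K.adj_adj[OF L(2)])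
    ultimately have "Phi F \<beta> \<tau> (R \<circ> tA m \<eta>) = complex_of_real (exp (- real (tdeg m) * \<beta>)) * Phi F \<beta> \<tau> (tA m \<eta> \<circ> R)" by simp
    moreover have "complex_of_real (exp (real (tdeg m) * \<beta>)) * complex_of_real (exp (- real (tdeg m) * \<beta>)) = 1"
      by (simp only: of_real_mult[symmetric] exp_add[symmetric]) simp
    ultimately show ?thesis by (simp only: mult.assoc[symmetric] mult_1)
  qed
  show ?thesis unfolding KMS_def
  proof (intro CollectI conjI allI ballI)
    show "Phi F \<beta> \<tau> \<in> states (fock X) (NT X)" by (rule Phi_state[OF TF])
    fix n m k w \<xi> \<eta> \<zeta> \<omega>
    assume x: "\<xi> \<in> carrier (fib X n)" and e: "\<eta> \<in> carrier (fib X m)" and z: "\<zeta> \<in> carrier (fib X k)" and o: "\<omega> \<in> carrier (fib X w)"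
    let ?R = "tt X k \<zeta> w \<omega>"
    have R: "?R \<in> Alg" by (rule Alg_tt[OF z o])
    have "tt X n \<xi> m \<eta> \<circ> ?R = t n \<xi> \<circ> (tA m \<eta> \<circ> ?R)" by (simp only: comp_assoc)
    then have "Phi F \<beta> \<tau> (tt X n \<xi> m \<eta> \<circ> ?R) = complex_of_real (exp (- real (tdeg n) * \<beta>)) * Phi F \<beta> \<tau> ((tA m \<eta> \<circ> ?R) \<circ> t n \<xi>)"
      using Phi_t[OF TF x Alg_comp[OF Alg_tA[OF e] R]] by (simp only:)
    also have "(tA m \<eta> \<circ> ?R) \<circ> t n \<xi> = tA m \<eta> \<circ> (?R \<circ> t n \<xi>)" by (simp only: comp_assoc)
    also have "Phi F \<beta> \<tau> (tA m \<eta> \<circ> (?R \<circ> t n \<xi>)) = complex_of_real (exp (real (tdeg m) * \<beta>)) * Phi F \<beta> \<tau> ((?R \<circ> t n \<xi>) \<circ> tA m \<eta>)"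
      by (rule tA[OF e Alg_comp[OF R Alg_t[OF x]]])
    also have "(?R \<circ> t n \<xi>) \<circ> tA m \<eta> = ?R \<circ> tt X n \<xi> m \<eta>" by (simp only: comp_assoc)
    finally have "Phi F \<beta> \<tau> (tt X n \<xi> m \<eta> \<circ> ?R) =
       complex_of_real (exp (- real (tdeg n) * \<beta>)) * complex_of_real (exp (real (tdeg m) * \<beta>)) * Phi F \<beta> \<tau> (?R \<circ> tt X n \<xi> m \<eta>)"
      by (simp only: mult.assoc)
    moreover have "complex_of_real (exp (- real (tdeg n) * \<beta>)) * complex_of_real (exp (real (tdeg m) * \<beta>))
        = complex_of_real (exp (- (real (tdeg n) - real (tdeg m)) * \<beta>))"
      by (simp only: of_real_mult[symmetric] exp_add[symmetric]) (simp add: algebra_simps)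
    ultimately show "Phi F \<beta> \<tau> (tt X n \<xi> m \<eta> \<circ> ?R) = complex_of_real (exp (- (real (tdeg n) - real (tdeg m)) * \<beta>)) * Phi F \<beta> \<tau> (?R \<circ> tt X n \<xi> m \<eta>)"
      by (simp only:)
  qed
qed

lemma Phi_KMS_F:
  assumes TF: "\<tau> \<in> T_F X x F \<beta>" shows "Phi F \<beta> \<tau> \<in> KMS_F X x F \<beta>"
  unfolding KMS_F_def
proof (intro CollectI conjI allI impI)
  show "Phi F \<beta> \<tau> \<in> KMS X \<beta>" by (rule Phi_kms[OF TF])
  have c: "cR F \<beta> \<tau> \<noteq> 0" using cR_ge_1[OF TF] by simp
  have w: "((\<lambda>n. complex_of_real (wt \<beta> \<tau> n) / complex_of_real (cR F \<beta> \<tau>)) has_sum 1) (degs F)"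
    using has_sum_divide_const[OF wt_has_sum_c[OF TF], of "complex_of_real (cR F \<beta> \<tau>)"] c by (simp add: c_const_eq[OF TF])
  have l: "Phi F \<beta> \<tau> (Q_level X x F n) = complex_of_real (wt \<beta> \<tau> n) / complex_of_real (cR F \<beta> \<tau>)" if "n \<in> degs F" for n
    using Phi_level[OF TF that, of 1] wt_complex[OF TF, of n] by (simp only: Q_level_id[OF that]) (simp only: pi_one)
  show "((\<lambda>n. Phi F \<beta> \<tau> (Q_level X x F n)) has_sum 1) {n. supp n \<subseteq> F}"
    unfolding degs_def[symmetric] by (rule has_sum_cong[THEN iffD2, OF l w])
  fix i assume i: "i \<notin> F"
  \<comment> \<open>For j \<ge> 1 every degree in the Gibbs sum has a nonzero coordinate in
    direction \<open>i\<close>, so all its terms vanish on Q_i.\<close>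
  have "Phi F \<beta> \<tau> (Q_proj X x i) = 0 / complex_of_real (cR F \<beta> \<tau>)"
  proof (rule Phi_eventually[OF TF Alg_NT[OF Alg_Q_proj], of 1])
    fix j :: nat assume "1 \<le> j"
    then show "W F \<beta> \<tau> (ray F j) (Q_proj X x i) = 0"
      unfolding W_def Q_proj_eq Tr_dproj_id[OF TF_tracial[OF TF]] using i by (simp add: ray_def)
  qed
  then show "Phi F \<beta> \<tau> (Q_proj X x i) = 0" by simp
qed

lemma Phi_GKMS_F:
  assumes TF: "\<tau> \<in> T_F X x F \<beta>" shows "Phi F \<beta> \<tau> \<in> GKMS_F X x F \<beta>"
  unfolding GKMS_F_def
proof (intro CollectI conjI ballI)
  show "Phi F \<beta> \<tau> \<in> KMS_F X x F \<beta>" by (rule Phi_KMS_F[OF TF])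
  fix T assume T: "T \<in> NT X"
  show "Phi F \<beta> \<tau> T = Phi F \<beta> \<tau> (cond_exp X T)"
    unfolding cond_exp_eq[OF NT_L[OF T]] Phi_eq_lim[OF TF T] Phi_eq_lim[OF TF diag_NT[OF T]] W_def Tr_diag[OF TF_tracial[OF TF] NT_L[OF T]] ..
qed

text \<open>Each term is bounded by a constant times the corresponding term of the series for c,
  whence absolute summability; this permits grouping the words by degree, which gives the Gibbs sum
  of \<pi> of the inner product.\<close>

lemma word_series:
  assumes TF: "\<tau> \<in> T_F X x F \<beta>" and x: "\<xi> \<in> carrier (fib X n)" and e: "\<eta> \<in> carrier (fib X n)"
  defines "s \<equiv> \<lambda>\<mu>. complex_of_real (exp (- (real (tdeg n) + real (tdeg (wlen \<mu>))) * \<beta>)) *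
     \<tau> (ip (fib X (n + wlen \<mu>)) (pmul X n (wlen \<mu>) \<eta> (xw \<mu>)) (pmul X n (wlen \<mu>) \<xi> (xw \<mu>)))"
  shows "s summable_on words x F"
    and "(\<Sum>\<^sub>\<infinity>\<mu>\<in>words x F. s \<mu>) = complex_of_real (exp (- real (tdeg n) * \<beta>)) * W F \<beta> \<tau> 0 (pi_rep X (ip (fib X n) \<eta> \<xi>))"
proof -
  define b where "b = ip (fib X n) \<eta> \<xi>"
  let ?e = "\<lambda>n. complex_of_real (exp (- real (tdeg n) * \<beta>))"
  note pos = tracial_pos_functional[OF TF_tracial[OF TF]]
  have s: "s \<mu> = ?e n * (?e p * \<tau> (ip (fock X) (sgl p (xw \<mu>)) (pi_rep X b (sgl p (xw \<mu>)))))" if m: "\<mu> \<in> wds p" for \<mu> p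
  proof -
    have p: "wlen \<mu> = p" using m by (simp add: words_of_def)
    note c = xw_closed[OF m]
    have "complex_of_real (exp (- (real (tdeg n) + real (tdeg p)) * \<beta>)) = ?e n * ?e p"
      by (simp only: of_real_mult[symmetric] exp_add[symmetric]) (simp add: algebra_simps)
    then show ?thesis unfolding s_def p T.p_ip[OF e x c c] b_def[symmetric]
      using c by (simp add: pi_sgl ip_sgl_left sgl_closed F.lact_closed)
  qed
  have w: "\<mu> \<in> wds (wlen \<mu>)" if "\<mu> \<in> words x F" for \<mu> using that by (auto simp: words_of_def words_def)
  have sum_s: "(\<Sum>\<mu>\<in>wds p. s \<mu>) = ?e n * (?e p * Tr \<tau> p (pi_rep X b))" for p
    unfolding Tr_def sum_distrib_left by (intro sum.cong refl s)
  have "(\<lambda>\<mu>. cmod (c_term X x \<tau> \<beta> \<mu>)) summable_on words x F"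
  proof -
    have "cmod (c_term X x \<tau> \<beta> \<mu>) = Re (c_term X x \<tau> \<beta> \<mu>)" if "\<mu> \<in> words x F" for \<mu>
      using c_term_nonneg[OF TF_tracial[OF TF] that, of \<beta>] by (simp add: complex_nonneg_Reals_iff cmod_eq_Re)
    then show ?thesis using summable_on_Re[OF TF_summable[OF TF]] summable_on_cong by (metis (no_types, lifting))
  qed
  then have "(\<lambda>\<mu>. exp (- real (tdeg n) * \<beta>) * opnorm (fock X) (pi_rep X b) * cmod (c_term X x \<tau> \<beta> \<mu>)) summable_on words x F"
    by (rule summable_on_cmult_right)
  then have "(\<lambda>\<mu>. cmod (s \<mu>)) summable_on words x F"
  proof (rule Infinite_Sum.abs_summable_on_comparison_test')
    fix \<mu> assume "\<mu> \<in> words x F"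
    note m = w[OF this]
    let ?z = "sgl (wlen \<mu>) (xw \<mu>)"
    have "cmod (\<tau> (ip (fock X) ?z (pi_rep X b ?z))) \<le> opnorm (fock X) (pi_rep X b) * Re (\<tau> (ip (fock X) ?z ?z))"
      by (rule K.pos_functional_L_bound[OF pos pi_L sgl_closed[OF xw_closed[OF m]]])
    also have "\<dots> \<le> opnorm (fock X) (pi_rep X b) * cmod (\<tau> (ip (fock X) ?z ?z))"
      by (intro mult_left_mono complex_Re_le_cmod K.opnorm_nonneg pi_L)
    finally have "exp (- real (tdeg n) * \<beta>) * (exp (- real (tdeg (wlen \<mu>)) * \<beta>) * cmod (\<tau> (ip (fock X) ?z (pi_rep X b ?z))))
       \<le> exp (- real (tdeg n) * \<beta>) * (exp (- real (tdeg (wlen \<mu>)) * \<beta>) * (opnorm (fock X) (pi_rep X b) * cmod (\<tau> (ip (fock X) ?z ?z))))"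
      by (intro mult_left_mono) auto
    then show "cmod (s \<mu>) \<le> exp (- real (tdeg n) * \<beta>) * opnorm (fock X) (pi_rep X b) * cmod (c_term X x \<tau> \<beta> \<mu>)"
      unfolding s[OF m] c_term_eq[OF m] norm_mult norm_of_real abs_exp_cancel by (simp only: mult.assoc mult.left_commute)
  qed
  then show sm: "s summable_on words x F" by (rule abs_summable_summable)
  have "((\<lambda>p. ?e n * (?e p * Tr \<tau> p (pi_rep X b))) has_sum (\<Sum>\<^sub>\<infinity>\<mu>\<in>words x F. s \<mu>)) (degs F)"
    using words_has_sum[OF has_sum_infsum[OF sm]] unfolding sum_s .
  then have "(\<Sum>\<^sub>\<infinity>\<mu>\<in>words x F. s \<mu>) = (\<Sum>\<^sub>\<infinity>p\<in>degs F. ?e n * (?e p * Tr \<tau> p (pi_rep X b)))" by (simp add: infsumI)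
  also have "\<dots> = ?e n * (\<Sum>\<^sub>\<infinity>p\<in>degs F. ?e p * Tr \<tau> p (pi_rep X b))" by (rule infsum_cmult_right')
  also have "(\<Sum>\<^sub>\<infinity>p\<in>degs F. ?e p * Tr \<tau> p (pi_rep X b)) = W F \<beta> \<tau> 0 (pi_rep X b)" by (simp add: W_def tdeg_def)
  finally show "(\<Sum>\<^sub>\<infinity>\<mu>\<in>words x F. s \<mu>) = ?e n * W F \<beta> \<tau> 0 (pi_rep X (ip (fib X n) \<eta> \<xi>))" unfolding b_def .
qed

end

section \<open>From equilibrium states to traces\<close>

text \<open>The normalised compression of a state to the corner of Q_F, the explicit inverse of
  \<open>Phi F \<beta>\<close> on gauge invariant states of the class of \<open>F\<close>.\<close>

definition corner_trace :: "('i::{finite,linorder}, 'a::unital_cstar_algebra, 'x::complex_vector) prod_sys \<Rightarrow> ('i \<Rightarrow> 'x list) \<Rightarrow> 'i set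
    \<Rightarrow> (((('i \<Rightarrow> nat) \<Rightarrow> 'x) \<Rightarrow> ('i \<Rightarrow> nat) \<Rightarrow> 'x) \<Rightarrow> complex) \<Rightarrow> 'a \<Rightarrow> complex" where
  "corner_trace X x F \<phi> a = \<phi> (Q_set X x F \<circ> pi_rep X a \<circ> Q_set X x F) / \<phi> (Q_set X x F)"

locale kms_F_system = kms_system X x \<beta> \<phi>
  for X :: "('i::{finite,linorder}, 'a::unital_cstar_algebra, 'x::complex_vector) prod_sys" and x \<beta> \<phi> +
  fixes F :: "'i set"
  assumes levels: "((\<lambda>n. \<phi> (Q_level X x F n)) has_sum 1) (degs F)"
    and Q_zero: "\<And>i. i \<notin> F \<Longrightarrow> \<phi> (Q_proj X x i) = 0"
begin

abbreviation "Q \<equiv> Q_set X x F"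
abbreviation "\<tau> \<equiv> corner_trace X x F \<phi>"

lemma Q_NT: "Q \<in> NT X" and Q_L: "Q \<in> \<L> (fock X)" and pi_NT: "pi_rep X a \<in> NT X"
  using Alg_NT Alg_L Alg_Q_set Alg_pi by blast+

lemma Q_level_pi_one: "Q_level X x F n \<circ> pi_rep X 1 = Q_level X x F n"
  by (simp only: pi_one K.comp_id_right[OF Alg_L[OF Alg_Q_level]])

text \<open>If \<phi>(Q_F) were 0, Cauchy-Schwarz would annihilate \<phi>(Q_F \<pi>(b)) for all b,
  and by \<open>kms_Q_level\<close> every level would have mass 0 instead of total mass 1.\<close>

lemma Q_nonzero: "\<phi> Q \<noteq> 0"
proof
  assume "\<phi> Q = 0"
  then have "(\<lambda>b. \<phi> (Q \<circ> pi_rep X b)) = (\<lambda>b. 0)" using kms_level_zero pi_NT by blast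
  then have "\<phi> (Q_level X x F n) = 0" for n
    using kms_Q_level[of F n 1] by (simp only: Q_level_pi_one Tr_def sum.neutral_const mult_zero_right)
  then have "((\<lambda>n. 0) has_sum (1 :: complex)) (degs F)" using levels by simp
  then show False using has_sum_unique[OF has_sum_0[of "degs F" "\<lambda>_. 0::complex"]] by fastforce
qed

lemma Q_real: "\<phi> Q = complex_of_real (Re (\<phi> Q))" and Q_pos: "Re (\<phi> Q) > 0"
proof -
  have "\<phi> Q \<in> \<real>\<^sub>\<ge>\<^sub>0" using S.st_pos[OF Q_NT] by (simp only: adj_Q_set Q_set_idem)
  then show "\<phi> Q = complex_of_real (Re (\<phi> Q))" "Re (\<phi> Q) > 0"
    using Q_nonzero by (auto simp: complex_nonneg_Reals_iff complex_eq_iff)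
qed

lemma \<tau>_eq: "\<phi> (Q \<circ> pi_rep X a) = \<phi> Q * \<tau> a"
  using Q_nonzero by (simp add: corner_trace_def Q_corner)

lemma \<tau>_tracial: "\<tau> \<in> tracial_states"
proof -
  have QpN: "Q \<circ> pi_rep X a \<in> NT X" for a by (rule S.B_comp[OF Q_NT pi_NT])
  have inj: "a = b" if "\<phi> Q * a = \<phi> Q * b" for a b using that Q_nonzero by simp
  show ?thesis unfolding tracial_states_def
  proof (intro CollectI conjI allI)
    fix a b c
    show "\<tau> (a + b) = \<tau> a + \<tau> b"
      by (rule inj) (simp only: \<tau>_eq[symmetric] distrib_left pi_add K.comp_plus_right[OF Q_L pi_L pi_L] S.st_add[OF QpN QpN])
    show "\<tau> (c *\<^sub>C a) = c * \<tau> a"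
      by (rule inj) (simp only: \<tau>_eq[symmetric] mult.left_commute[of "\<phi> Q"] pi_scaleC K.comp_scale_right[OF Q_L pi_L] S.st_scaleC[OF QpN])
    have "\<phi> (Q \<circ> pi_rep X (star a * a)) \<in> \<real>\<^sub>\<ge>\<^sub>0"
    proof -
      have "adj (fock X) (pi_rep X a \<circ> Q) \<circ> (pi_rep X a \<circ> Q) = Q \<circ> pi_rep X (star a * a) \<circ> Q"
        by (simp only: K.adj_comp[OF pi_L Q_L] adj_Q_set adj_pi pi_mult comp_assoc)
      then show ?thesis using S.st_pos[OF S.B_comp[OF pi_NT Q_NT], of a] by (simp only: Q_corner)
    qed
    then show "\<tau> (star a * a) \<in> \<real>\<^sub>\<ge>\<^sub>0"
      using Q_pos unfolding \<tau>_eq by (subst (asm) Q_real) (auto simp: complex_nonneg_Reals_iff zero_le_mult_iff)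
    show "\<tau> 1 = 1" by (rule inj) (simp only: \<tau>_eq[symmetric] pi_one K.comp_id_right[OF Q_L] mult_1_right)
    have "\<phi> (Q \<circ> pi_rep X (a * b)) = \<phi> ((Q \<circ> pi_rep X a) \<circ> pi_rep X b)" by (simp only: pi_mult comp_assoc)
    also have "\<dots> = \<phi> (pi_rep X b \<circ> (Q \<circ> pi_rep X a))" by (rule kms_pi[symmetric, OF QpN])
    also have "pi_rep X b \<circ> (Q \<circ> pi_rep X a) = Q \<circ> pi_rep X (b * a)"
      by (simp only: comp_assoc[symmetric] pi_Q_set) (simp only: pi_mult comp_assoc)
    finally show "\<tau> (a * b) = \<tau> (b * a)" unfolding \<tau>_eq by (rule inj)
  qed
qed

lemma level_trace:
  "\<phi> (Q_level X x F n \<circ> pi_rep X a) = \<phi> Q * (complex_of_real (exp (- real (tdeg n) * \<beta>)) * Tr \<tau> n (pi_rep X a))"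
  unfolding kms_Q_level Tr_def \<tau>_eq sum_distrib_left by (simp only: mult.left_commute)

lemma levels_trace:
  "((\<lambda>n. complex_of_real (exp (- real (tdeg n) * \<beta>)) * Tr \<tau> n (pi_rep X a)) has_sum \<phi> (pi_rep X a) / \<phi> Q) (degs F)"
  using has_sum_divide_const[OF kms_levels_has_sum[OF levels pi_NT[of a]], of "\<phi> Q"] Q_nonzero by (simp add: level_trace)

lemma Q_proj_zero:
  assumes i: "i \<notin> F" and S: "S \<in> NT X" and R: "R \<in> NT X" shows "\<phi> (S \<circ> Q_proj X x i \<circ> R) = 0"
  using kms_ideal_zero[OF Alg_NT[OF Alg_Q_proj[of i]] _ S R] Q_zero[OF i] by (simp only: adj_Q_proj Q_proj_idem)

lemma P_proj_id: "i \<notin> F \<Longrightarrow> R \<in> NT X \<Longrightarrow> \<phi> (P_proj X x i \<circ> R) = \<phi> R"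
proof -
  assume i: "i \<notin> F" and R: "R \<in> NT X"
  have "P_proj X x i \<circ> R = R - (Q_proj X x i \<circ> R)"
    unfolding Q_proj_def K.comp_minus_left K.comp_id_left[OF NT_L[OF R]] by simp
  moreover have "\<phi> (Q_proj X x i \<circ> R) = 0"
    using Q_proj_zero[OF i S.id_B R] by (simp only: K.comp_id_left[OF Alg_L[OF Alg_Q_proj]])
  ultimately show ?thesis using S.st_minus[OF R S.B_comp[OF Alg_NT[OF Alg_Q_proj] R]] by (simp only: diff_zero)
qed

text \<open>Under \<phi> the projection P_i acts as the identity, since Q_i lies in the kernel.
  Expanding P_i and moving its creation operators cyclically gives the factor exp(-\<beta>); the
  annihilation operators pass Q_F because \<open>i\<close> is outside \<open>F\<close>.\<close>

lemma \<tau>_scaling: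
  assumes i: "i \<notin> F" shows "trace_scaling X x \<tau> \<beta> i"
  unfolding trace_scaling_def
proof
  fix a
  let ?e = "unit_vec i" and ?y = "\<lambda>j. x i ! j"
  note c = is_dec_closed[OF letters_dec, of _ i]
  have "\<phi> Q * \<tau> a = \<phi> (P_proj X x i \<circ> (Q \<circ> pi_rep X a))"
    unfolding P_proj_id[OF i S.B_comp[OF Q_NT pi_NT]] \<tau>_eq ..
  also have "\<dots> = \<phi> (\<Sum>j<length (x i). t ?e (?y j) \<circ> (tA ?e (?y j) \<circ> (Q \<circ> pi_rep X a)))"
    unfolding P_proj_def K.comp_sum_left by (simp only: comp_assoc)
  also have "\<dots> = (\<Sum>j<length (x i). \<phi> (t ?e (?y j) \<circ> (tA ?e (?y j) \<circ> (Q \<circ> pi_rep X a))))"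
    using c by (intro S.st_sum S.B_comp Q_NT pi_NT Alg_NT Alg_t Alg_tA)
  also have "\<dots> = (\<Sum>j<length (x i). complex_of_real (exp (- \<beta>)) * (\<phi> Q * \<tau> (ip (fib X ?e) (?y j) (lact (fib X ?e) a (?y j)))))"
  proof (rule sum.cong[OF refl])
    fix j assume "j \<in> {..<length (x i)}"
    note cj = c[OF this]
    have "\<phi> (t ?e (?y j) \<circ> (tA ?e (?y j) \<circ> (Q \<circ> pi_rep X a))) = complex_of_real (exp (- \<beta>)) * \<phi> ((tA ?e (?y j) \<circ> (Q \<circ> pi_rep X a)) \<circ> t ?e (?y j))"
      using kms_t[OF cj, of "tA ?e (?y j) \<circ> (Q \<circ> pi_rep X a)"] S.B_comp[OF Alg_NT[OF Alg_tA[OF cj]] S.B_comp[OF Q_NT pi_NT]]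
      by (simp only: tdeg_unit_vec) simp
    also have "(tA ?e (?y j) \<circ> (Q \<circ> pi_rep X a)) \<circ> t ?e (?y j) = (tA ?e (?y j) \<circ> Q) \<circ> (pi_rep X a \<circ> t ?e (?y j))"
      by (simp only: comp_assoc)
    also have "\<dots> = Q \<circ> (tA ?e (?y j) \<circ> (pi_rep X a \<circ> t ?e (?y j)))"
      unfolding tA_Q_set[OF cj i] by (simp only: comp_assoc)
    also have "\<dots> = Q \<circ> pi_rep X (ip (fib X ?e) (?y j) (lact (fib X ?e) a (?y j)))"
      unfolding pi_t[OF cj] tA_t[OF cj F.lact_closed[OF cj]] ..
    finally show "\<phi> (t ?e (?y j) \<circ> (tA ?e (?y j) \<circ> (Q \<circ> pi_rep X a))) =
        complex_of_real (exp (- \<beta>)) * (\<phi> Q * \<tau> (ip (fib X ?e) (?y j) (lact (fib X ?e) a (?y j))))" unfolding \<tau>_eq .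
  qed
  finally have "\<phi> Q * \<tau> a = \<phi> Q * (complex_of_real (exp (- \<beta>)) * (\<Sum>j<length (x i). \<tau> (ip (fib X ?e) (?y j) (lact (fib X ?e) a (?y j)))))"
    unfolding sum_distrib_left by (simp only: mult.left_commute)
  then have "\<tau> a = complex_of_real (exp (- \<beta>)) * (\<Sum>j<length (x i). \<tau> (ip (fib X ?e) (?y j) (lact (fib X ?e) a (?y j))))"
    using Q_nonzero by simp
  moreover have "complex_of_real (exp \<beta>) * complex_of_real (exp (- \<beta>)) = 1"
    by (simp only: of_real_mult[symmetric] exp_add[symmetric]) simp
  ultimately show "complex_of_real (exp \<beta>) * \<tau> a = (\<Sum>j<length (x i). \<tau> (ip (fib X ?e) (?y j) (lact (fib X ?e) a (?y j))))"
    by (simp only: mult.assoc[symmetric] mult_1)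
qed

text \<open>Finiteness of c is the summability of the masses of the levels divided by \<phi>(Q_F),
  unfolded from degrees to words by nonnegativity.\<close>

lemma \<tau>_T_F: "\<tau> \<in> T_F X x F \<beta>"
  unfolding T_F_def
proof (intro CollectI conjI allI impI)
  show "\<tau> \<in> tracial_states" by (rule \<tau>_tracial)
  show "trace_scaling X x \<tau> \<beta> i" if "i \<notin> F" for i by (rule \<tau>_scaling[OF that])
  note nn = c_term_nonneg[OF \<tau>_tracial]
  have "(\<lambda>\<mu>. Re (c_term X x \<tau> \<beta> \<mu>)) summable_on words x F"
  proof (rule words_summable_nonneg)
    have "(\<Sum>\<mu>\<in>wds p. Re (c_term X x \<tau> \<beta> \<mu>)) = Re (complex_of_real (exp (- real (tdeg p) * \<beta>)) * Tr \<tau> p (pi_rep X 1))" for p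
      using arg_cong[OF sum_c_term[of \<tau> \<beta> p], of Re] by (simp only: Re_sum pi_one)
    then show "(\<lambda>p. \<Sum>\<mu>\<in>wds p. Re (c_term X x \<tau> \<beta> \<mu>)) summable_on degs F"
      using has_sum_Re[OF levels_trace[of 1]] by (auto simp only: summable_on_def)
    show "0 \<le> Re (c_term X x \<tau> \<beta> \<mu>)" if "\<mu> \<in> words x F" for \<mu> using nn[OF that] by (simp add: complex_nonneg_Reals_iff)
  qed
  then have "(\<lambda>\<mu>. complex_of_real (Re (c_term X x \<tau> \<beta> \<mu>))) summable_on words x F" by (rule summable_on_of_real)
  moreover have "complex_of_real (Re (c_term X x \<tau> \<beta> \<mu>)) = c_term X x \<tau> \<beta> \<mu>" if "\<mu> \<in> words x F" for \<mu>
    using nn[OF that] by (simp add: complex_nonneg_Reals_iff complex_eq_iff)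
  ultimately show "c_term X x \<tau> \<beta> summable_on words x F" using summable_on_cong by (metis (no_types, lifting))
qed

text \<open>\<open>J\<close> consists of the elements that \<phi> annihilates between arbitrary
  factors. It is a closed ideal because \<phi> is bounded, and it contains the Q_i for
  \<open>i\<close> outside \<open>F\<close> by \<open>kms_ideal_zero\<close>, hence also the ideal
  they generate.\<close>

lemma \<tau>_ker_ideal:
  assumes a: "a \<in> ker_ideal X x (- F)" shows "\<tau> a = 0"
proof -
  define J where "J = {T \<in> NT X. \<forall>S\<in>NT X. \<forall>R\<in>NT X. \<phi> (S \<circ> T \<circ> R) = 0}"
  have JI: "T \<in> J" if "T \<in> NT X" "\<And>S R. S \<in> NT X \<Longrightarrow> R \<in> NT X \<Longrightarrow> \<phi> (S \<circ> T \<circ> R) = 0" for T using that by (simp add: J_def)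
  have JD: "T \<in> NT X" "S \<in> NT X \<Longrightarrow> R \<in> NT X \<Longrightarrow> \<phi> (S \<circ> T \<circ> R) = 0" if "T \<in> J" for T S R using that by (auto simp: J_def)
  have "closed_ideal (fock X) (NT X) J"
    unfolding closed_ideal_def closed_in_def
  proof (intro conjI ballI allI impI)
    show "J \<subseteq> NT X" by (auto simp: J_def)
    show "0 \<in> J"
    proof (rule JI[OF S.B_zero])
      fix S R assume "S \<in> NT X" "R \<in> NT X"
      then show "\<phi> (S \<circ> 0 \<circ> R) = 0" by (simp only: K.comp_zero_right[OF NT_L] K.comp_zero_left S.st_zero)
    qed
  next
    fix T T' assume T: "T \<in> J" "T' \<in> J"
    show "T + T' \<in> J"
    proof (rule JI[OF S.B_plus[OF JD(1)[OF T(1)] JD(1)[OF T(2)]]])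
      fix S R assume SR: "S \<in> NT X" "R \<in> NT X"
      then have c: "S \<circ> T \<circ> R \<in> NT X" "S \<circ> T' \<circ> R \<in> NT X" using T JD(1) S.B_comp by blast+
      show "\<phi> (S \<circ> (T + T') \<circ> R) = 0"
        unfolding K.comp_plus_right[OF NT_L[OF SR(1)] NT_L[OF JD(1)[OF T(1)]] NT_L[OF JD(1)[OF T(2)]]] K.comp_plus_left S.st_add[OF c]
        by (simp only: JD(2)[OF T(1) SR] JD(2)[OF T(2) SR] add_0)
    qed
  next
    fix T c assume T: "T \<in> J"
    show "c *\<^sub>C T \<in> J"
    proof (rule JI[OF S.B_scale[OF JD(1)[OF T]]])
      fix S R assume SR: "S \<in> NT X" "R \<in> NT X"
      then have c: "S \<circ> T \<circ> R \<in> NT X" using T JD(1) S.B_comp by blast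
      show "\<phi> (S \<circ> (c *\<^sub>C T) \<circ> R) = 0"
        unfolding K.comp_scale_right[OF NT_L[OF SR(1)] NT_L[OF JD(1)[OF T]]] K.comp_scale_left S.st_scaleC[OF c]
        by (simp only: JD(2)[OF T SR] mult_zero_right)
    qed
  next
    fix T S' assume T: "T \<in> J" and S': "S' \<in> NT X"
    show "S' \<circ> T \<in> J"
      by (rule JI[OF S.B_comp[OF S' JD(1)[OF T]]]) (simp only: comp_assoc[symmetric] JD(2)[OF T S.B_comp[OF _ S']])
    show "T \<circ> S' \<in> J"
    proof (rule JI[OF S.B_comp[OF JD(1)[OF T] S']])
      fix S R assume SR: "S \<in> NT X" "R \<in> NT X"
      have "S \<circ> (T \<circ> S') \<circ> R = S \<circ> T \<circ> (S' \<circ> R)" by (simp only: comp_assoc)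
      then show "\<phi> (S \<circ> (T \<circ> S') \<circ> R) = 0" using JD(2)[OF T SR(1) S.B_comp[OF S' SR(2)]] by (simp only:)
    qed
  next
    fix T assume T: "T \<in> NT X" and cl: "\<forall>\<epsilon>>0. \<exists>S\<in>J. opnorm (fock X) (T - S) < \<epsilon>"
    show "T \<in> J"
    proof (rule JI[OF T], rule ccontr)
      let ?N = "opnorm (fock X)"
      fix S R assume SR: "S \<in> NT X" "R \<in> NT X" and nz: "\<phi> (S \<circ> T \<circ> R) \<noteq> 0"
      define M where "M = ?N S * ?N R + 1"
      have M: "M > 0" "?N S * ?N R \<le> M" unfolding M_def
        using K.opnorm_nonneg[OF NT_L[OF SR(1)]] K.opnorm_nonneg[OF NT_L[OF SR(2)]] by (auto simp: add_nonneg_pos)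
      obtain T' where T': "T' \<in> J" "?N (T - T') < cmod (\<phi> (S \<circ> T \<circ> R)) / M"
        using cl nz M by (meson divide_pos_pos zero_less_norm_iff)
      let ?D = "T - T'"
      have D: "?D \<in> NT X" by (rule S.B_minus[OF T JD(1)[OF T'(1)]])
      have c: "S \<circ> T \<in> NT X" "S \<circ> T' \<in> NT X" "S \<circ> ?D \<in> NT X" using SR T JD(1)[OF T'(1)] D S.B_comp by blast+
      have "\<phi> (S \<circ> ?D \<circ> R) = \<phi> (S \<circ> T \<circ> R) - \<phi> (S \<circ> T' \<circ> R)"
        unfolding K.comp_minus_right[OF NT_L[OF SR(1)] NT_L[OF T] NT_L[OF JD(1)[OF T'(1)]]] K.comp_minus_left
        by (rule S.st_minus[OF S.B_comp[OF c(1) SR(2)] S.B_comp[OF c(2) SR(2)]])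
      then have "cmod (\<phi> (S \<circ> T \<circ> R)) \<le> ?N (S \<circ> ?D) * ?N R"
        using st_comp_bound[OF c(3) SR(2)] by (simp only: JD(2)[OF T'(1) SR] diff_zero)
      also have "\<dots> \<le> (?N S * ?N ?D) * ?N R"
        by (rule mult_right_mono[OF K.opnorm_comp[OF NT_L[OF SR(1)] NT_L[OF D]] K.opnorm_nonneg[OF NT_L[OF SR(2)]]])
      also have "\<dots> = (?N S * ?N R) * ?N ?D" by (simp only: mult.assoc mult.commute[of "?N ?D"])
      also have "\<dots> \<le> M * ?N ?D" by (rule mult_right_mono[OF M(2) K.opnorm_nonneg[OF NT_L[OF D]]])
      also have "\<dots> < cmod (\<phi> (S \<circ> T \<circ> R))" using T'(2) M(1) by (simp add: field_simps)
      finally show False by simp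
    qed
  qed
  moreover have "Q_proj X x ` (- F) \<subseteq> J"
    using JI[OF Alg_NT[OF Alg_Q_proj] Q_proj_zero] by auto
  ultimately have "ideal_generated (fock X) (NT X) (Q_proj X x ` (- F)) \<subseteq> J"
    unfolding ideal_generated_def by blast
  then have "pi_rep X a \<in> J" using a by (auto simp: ker_ideal_def)
  then have "\<phi> (Q \<circ> pi_rep X a \<circ> Q) = 0" using JD(2) Q_NT by blast
  then show ?thesis by (simp add: corner_trace_def)
qed

lemma W_\<tau>: "W F \<beta> \<tau> 0 (pi_rep X a) = \<phi> (pi_rep X a) / \<phi> Q"
  using infsumI[OF levels_trace[of a]] by (simp add: W_def tdeg_def)

lemma cR_\<tau>: "complex_of_real (cR F \<beta> \<tau>) = 1 / \<phi> Q"
  using W_id[OF \<tau>_T_F, of 0] W_\<tau>[of 1] by (simp add: pi_one S.st_id supp_def)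

text \<open>Gauge invariance removes the case of different degrees. In equal degrees one KMS step
  reduces both states to \<pi>(A), where \<phi> is recovered from the corner trace by summing over
  the levels.\<close>

lemma Phi_\<tau>:
  assumes G: "\<And>T. T \<in> NT X \<Longrightarrow> \<phi> T = \<phi> (cond_exp X T)"
  shows "Phi F \<beta> \<tau> = \<phi>"
proof (rule states_eqI[OF Phi_state[OF \<tau>_T_F] kms_state])
  fix n \<xi> m \<eta> assume x: "\<xi> \<in> carrier (fib X n)" and e: "\<eta> \<in> carrier (fib X m)"
  show "Phi F \<beta> \<tau> (tt X n \<xi> m \<eta>) = \<phi> (tt X n \<xi> m \<eta>)"
  proof (cases "n = m")
    case False
    have "\<phi> (tt X n \<xi> m \<eta>) = \<phi> 0"
      using G[OF Alg_NT[OF Alg_tt[OF x e]]] False by (simp only: cond_exp_eq[OF tt_L[OF x e]] diag_tt[OF x e] if_False)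
    then show ?thesis using Phi_tt_off[OF \<tau>_T_F x e False] by (simp only: S.st_zero)
  next
    case True
    note e' = e[folded True]
    have "\<phi> (tt X n \<xi> n \<eta>) = complex_of_real (exp (- real (tdeg n) * \<beta>)) * \<phi> (pi_rep X (ip (fib X n) \<eta> \<xi>))"
      using kms_t[OF x Alg_NT[OF Alg_tA[OF e']]] by (simp only: tA_t[OF e' x])
    moreover have "Phi F \<beta> \<tau> (tt X n \<xi> n \<eta>) = complex_of_real (exp (- real (tdeg n) * \<beta>)) * \<phi> (pi_rep X (ip (fib X n) \<eta> \<xi>))"
      unfolding Phi_tt[OF \<tau>_T_F x e'] W_\<tau> cR_\<tau> using Q_nonzero by simp
    ultimately show ?thesis using True by simp
  qed
qed

end

section \<open>Convexity\<close>

text \<open>\<open>f\<close> need not be affine: if its inverse sends proper convex combinations to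
  proper convex combinations, with weights of their own, then a segment through \<open>f a\<close>
  pulls back to a segment through \<open>a\<close>.\<close>

lemma extreme_point_image_subset:
  fixes f :: "'p::real_vector \<Rightarrow> 'q::real_vector"
  assumes bij: "bij_betw f D G"
    and conv: "\<And>u v l. u \<in> G \<Longrightarrow> v \<in> G \<Longrightarrow> l \<in> {0<..<1} \<Longrightarrow>
      \<exists>m\<in>{0<..<1}. inv_into D f (l *\<^sub>R u + (1 - l) *\<^sub>R v) = m *\<^sub>R inv_into D f u + (1 - m) *\<^sub>R inv_into D f v"
  shows "f ` {a. a extreme_point_of D} \<subseteq> {u. u extreme_point_of G}"
proof clarify
  fix a assume a: "a extreme_point_of D"
  let ?g = "inv_into D f"
  have aD: "a \<in> D" using a by (simp add: extreme_point_of_def)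
  have inj: "inj_on ?g G" using bij_betw_inv_into[OF bij] by (simp add: bij_betw_def)
  show "f a extreme_point_of G" unfolding extreme_point_of_def
  proof (intro conjI ballI notI)
    show "f a \<in> G" using bij aD by (auto simp: bij_betw_def)
    fix u v assume uv: "u \<in> G" "v \<in> G" and "f a \<in> open_segment u v"
    then obtain l where l: "0 < l" "l < 1" "f a = (1 - l) *\<^sub>R u + l *\<^sub>R v" and ne: "u \<noteq> v"
      by (auto simp: in_segment)
    \<comment> \<open>The parameter of the open segment belongs to the second endpoint, that of
      \<open>conv\<close> to the first; hence 1 - l.\<close>
    obtain m where m: "m \<in> {0<..<1}" "?g (f a) = m *\<^sub>R ?g u + (1 - m) *\<^sub>R ?g v"
      using conv[OF uv, of "1 - l"] l by auto
    have "a = (1 - (1 - m)) *\<^sub>R ?g u + (1 - m) *\<^sub>R ?g v" using m(2) bij_betw_inv_into_left[OF bij aD] by simp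
    moreover have "?g u \<noteq> ?g v" using inj_on_eq_iff[OF inj uv] ne by simp
    ultimately have "a \<in> open_segment (?g u) (?g v)" using m(1) unfolding in_segment by (intro conjI exI[of _ "1 - m"]) auto
    moreover have "?g u \<in> D" "?g v \<in> D" using bij_betw_inv_into[OF bij] uv by (auto simp: bij_betw_def)
    ultimately show False using a by (auto simp: extreme_point_of_def)
  qed
qed

text \<open>The inclusion is applied to \<open>f\<close> and to its inverse. The inverse of the
  inverse agrees with \<open>f\<close> only on \<open>D\<close>, which is why \<open>D\<close> is
  assumed closed under convex combinations.\<close>

lemma extreme_point_bij:
  fixes f :: "'p::real_vector \<Rightarrow> 'q::real_vector"
  assumes bij: "bij_betw f D G"
    and f: "\<And>a b l. a \<in> D \<Longrightarrow> b \<in> D \<Longrightarrow> l \<in> {0<..<1} \<Longrightarrow>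
      \<exists>m\<in>{0<..<1}. f (l *\<^sub>R a + (1 - l) *\<^sub>R b) = m *\<^sub>R f a + (1 - m) *\<^sub>R f b"
    and D: "\<And>a b l. a \<in> D \<Longrightarrow> b \<in> D \<Longrightarrow> l \<in> {0<..<1} \<Longrightarrow> l *\<^sub>R a + (1 - l) *\<^sub>R b \<in> D"
    and g: "\<And>u v l. u \<in> G \<Longrightarrow> v \<in> G \<Longrightarrow> l \<in> {0<..<1} \<Longrightarrow>
      \<exists>m\<in>{0<..<1}. inv_into D f (l *\<^sub>R u + (1 - l) *\<^sub>R v) = m *\<^sub>R inv_into D f u + (1 - m) *\<^sub>R inv_into D f v"
  shows "f ` {a. a extreme_point_of D} = {u. u extreme_point_of G}"
proof
  show "f ` {a. a extreme_point_of D} \<subseteq> {u. u extreme_point_of G}" by (rule extreme_point_image_subset[OF bij g])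
  let ?g = "inv_into D f"
  have bij': "bij_betw ?g G D" by (rule bij_betw_inv_into[OF bij])
  have inv: "inv_into G ?g a = f a" if "a \<in> D" for a
    using bij_betw_inv_into_left[OF bij that] bij that by (intro inv_into_f_eq) (auto simp: bij_betw_def bij'[unfolded bij_betw_def])
  have sub: "?g ` {u. u extreme_point_of G} \<subseteq> {a. a extreme_point_of D}"
  proof (rule extreme_point_image_subset[OF bij'])
    fix a b :: 'p and l :: real assume "a \<in> D" "b \<in> D" "l \<in> {0<..<1}"
    then show "\<exists>m\<in>{0<..<1}. inv_into G ?g (l *\<^sub>R a + (1 - l) *\<^sub>R b) = m *\<^sub>R inv_into G ?g a + (1 - m) *\<^sub>R inv_into G ?g b"
      using f D inv by simp
  qed
  have "u \<in> f ` {a. a extreme_point_of D}" if "u extreme_point_of G" for u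
  proof (rule image_eqI)
    show "?g u \<in> {a. a extreme_point_of D}" using sub that by blast
    show "u = f (?g u)" using that bij_betw_inv_into_right[OF bij] by (simp add: extreme_point_of_def)
  qed
  then show "{u. u extreme_point_of G} \<subseteq> f ` {a. a extreme_point_of D}" by blast
qed

lemma convex_fun_apply:
  fixes f g :: "'z \<Rightarrow> complex"
  shows "(l *\<^sub>R f + m *\<^sub>R g) z = complex_of_real l * f z + complex_of_real m * g z"
  by (simp add: scaleR_fun_def scaleR_conv_of_real)

lemma nonneg_Reals_convex: "0 \<le> l \<Longrightarrow> l \<le> 1 \<Longrightarrow> z \<in> \<real>\<^sub>\<ge>\<^sub>0 \<Longrightarrow> w \<in> \<real>\<^sub>\<ge>\<^sub>0 \<Longrightarrow> complex_of_real l * z + complex_of_real (1 - l) * w \<in> \<real>\<^sub>\<ge>\<^sub>0"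
  by (simp add: complex_nonneg_Reals_iff)

section \<open>The bijection and its independence of the decomposition\<close>

context finite_rank_system
begin

abbreviation (input) "trace_dom F \<beta> \<equiv> {\<tau> \<in> T_F X x F \<beta>. \<forall>a\<in>ker_ideal X x (- F). \<tau> a = 0}"

text \<open>The traces of the fibres do not depend on the frame, so neither do the Gibbs sums; one
  map can thus serve all decompositions at once.\<close>

lemma Phi_dec:
  assumes y: "unit_decomposition X y"
  shows "finite_rank_system.Phi X y F \<beta> = Phi F \<beta>"
proof (intro ext)
  interpret Y: finite_rank_system X y by (rule finite_rank_system.intro[OF product_system_unital_axioms finite_rank_system_axioms.intro[OF y]])
  fix \<tau> T
  show "Y.Phi F \<beta> \<tau> T = Phi F \<beta> \<tau> T"
  proof (cases "\<tau> \<in> tracial_states \<and> T \<in> NT X")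
    case True
    have "Y.Tr \<tau> p S = Tr \<tau> p S" if "S \<in> \<L> (fock X)" for p S
      unfolding Tr_dec[OF conjunct1[OF True] Y.xw_dec that] Y.Tr_def ..
    then have "Y.W F \<beta> \<tau> k S = W F \<beta> \<tau> k S" if "S \<in> \<L> (fock X)" for k S
      using that unfolding Y.W_def W_def by simp
    then show ?thesis using True unfolding Y.Phi_def Phi_def by (simp add: NT_L K.L_id_op)
  qed (auto simp: Y.Phi_def Phi_def)
qed

lemma GKMS_F_system: "\<phi> \<in> GKMS_F X x F \<beta> \<Longrightarrow> kms_F_system X x \<beta> \<phi> F"
  using finite_rank_system_axioms
  by (auto simp: kms_F_system_def kms_system_def kms_system_axioms_def kms_F_system_axioms_def GKMS_F_def KMS_F_def degs_def)

lemma corner_trace_dom: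
  assumes "\<phi> \<in> GKMS_F X x F \<beta>" shows "corner_trace X x F \<phi> \<in> trace_dom F \<beta>"
proof -
  interpret kms_F_system X x \<beta> \<phi> F by (rule GKMS_F_system[OF assms])
  show ?thesis using \<tau>_T_F \<tau>_ker_ideal by blast
qed

lemma Phi_corner_trace:
  assumes "\<phi> \<in> GKMS_F X x F \<beta>" shows "Phi F \<beta> (corner_trace X x F \<phi>) = \<phi>"
proof -
  interpret kms_F_system X x \<beta> \<phi> F by (rule GKMS_F_system[OF assms])
  show ?thesis by (rule Phi_\<tau>) (use assms in \<open>simp add: GKMS_F_def\<close>)
qed

lemma corner_trace_Phi:
  assumes TF: "\<tau> \<in> T_F X x F \<beta>" shows "corner_trace X x F (Phi F \<beta> \<tau>) = \<tau>"
  using cR_ge_1[OF TF] by (auto simp: corner_trace_def Phi_Q_corner[OF TF] Phi_Q_set[OF TF] simp del: comp_apply)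

lemma bij_Phi: "bij_betw (Phi F \<beta>) (trace_dom F \<beta>) (GKMS_F X x F \<beta>)"
  by (rule bij_betwI[where g = "corner_trace X x F"])
    (use corner_trace_dom Phi_GKMS_F Phi_corner_trace corner_trace_Phi in auto)

lemma inv_Phi:
  assumes "\<phi> \<in> GKMS_F X x F \<beta>" shows "inv_into (trace_dom F \<beta>) (Phi F \<beta>) \<phi> = corner_trace X x F \<phi>"
  by (rule inv_into_f_eq) (rule bij_betw_imp_inj_on[OF bij_Phi] corner_trace_dom[OF assms] Phi_corner_trace[OF assms])+

section \<open>Convex combinations of traces\<close>

context
  fixes F :: "'i set" and \<beta> l :: real and \<tau>\<^sub>1 \<tau>\<^sub>2 :: "'a \<Rightarrow> complex"
  assumes T1: "\<tau>\<^sub>1 \<in> T_F X x F \<beta>" and T2: "\<tau>\<^sub>2 \<in> T_F X x F \<beta>" and l: "l \<in> {0<..<1}"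
begin

abbreviation (input) "\<tau>\<^sub>0 \<equiv> l *\<^sub>R \<tau>\<^sub>1 + (1 - l) *\<^sub>R \<tau>\<^sub>2"

lemma convex_tracial: "\<tau>\<^sub>0 \<in> tracial_states"
proof -
  have 1: "\<tau>\<^sub>1 \<in> tracial_states" "\<tau>\<^sub>2 \<in> tracial_states" using TF_tracial T1 T2 by blast+
  then have pos: "\<tau>\<^sub>1 (star a * a) \<in> \<real>\<^sub>\<ge>\<^sub>0" "\<tau>\<^sub>2 (star a * a) \<in> \<real>\<^sub>\<ge>\<^sub>0" for a by (auto simp: tracial_states_def)
  have "complex_of_real l * \<tau>\<^sub>1 (star a * a) + complex_of_real (1 - l) * \<tau>\<^sub>2 (star a * a) \<in> \<real>\<^sub>\<ge>\<^sub>0" for a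
    using l by (intro nonneg_Reals_convex pos) auto
  then show ?thesis using 1 unfolding tracial_states_def mem_Collect_eq convex_fun_apply
    by (simp add: distrib_left mult.left_commute)
qed

lemma convex_c_term: "c_term X x \<tau>\<^sub>0 \<beta> \<mu> = complex_of_real l * c_term X x \<tau>\<^sub>1 \<beta> \<mu> + complex_of_real (1 - l) * c_term X x \<tau>\<^sub>2 \<beta> \<mu>"
  unfolding c_term_def convex_fun_apply by (simp add: algebra_simps)

lemma convex_T_F: "\<tau>\<^sub>0 \<in> T_F X x F \<beta>"
  unfolding T_F_def
proof (intro CollectI conjI allI impI)
  show "\<tau>\<^sub>0 \<in> tracial_states" by (rule convex_tracial)
  have "c_term X x \<tau>\<^sub>0 \<beta> = (\<lambda>\<mu>. complex_of_real l * c_term X x \<tau>\<^sub>1 \<beta> \<mu> + complex_of_real (1 - l) * c_term X x \<tau>\<^sub>2 \<beta> \<mu>)"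
    by (rule ext) (rule convex_c_term)
  then show "c_term X x \<tau>\<^sub>0 \<beta> summable_on words x F"
    using summable_on_add[OF summable_on_cmult_right[OF TF_summable[OF T1]] summable_on_cmult_right[OF TF_summable[OF T2]]] by simp
  fix i assume "i \<notin> F"
  then have "trace_scaling X x \<tau>\<^sub>1 \<beta> i" "trace_scaling X x \<tau>\<^sub>2 \<beta> i" using TF_scaling T1 T2 by blast+
  then show "trace_scaling X x \<tau>\<^sub>0 \<beta> i"
    unfolding trace_scaling_def convex_fun_apply sum.distrib sum_distrib_left[symmetric] distrib_left by (metis mult.left_commute)
qed

lemma convex_cR: "cR F \<beta> \<tau>\<^sub>0 = l * cR F \<beta> \<tau>\<^sub>1 + (1 - l) * cR F \<beta> \<tau>\<^sub>2"
proof -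
  have "c_const X x F \<tau>\<^sub>0 \<beta> = complex_of_real l * c_const X x F \<tau>\<^sub>1 \<beta> + complex_of_real (1 - l) * c_const X x F \<tau>\<^sub>2 \<beta>"
    unfolding c_const_def convex_c_term
    by (simp only: infsum_add[OF summable_on_cmult_right[OF TF_summable[OF T1]] summable_on_cmult_right[OF TF_summable[OF T2]]] infsum_cmult_right')
  then show ?thesis unfolding c_const_eq[OF T1] c_const_eq[OF T2] c_const_eq[OF convex_T_F]
    by (simp only: of_real_mult[symmetric] of_real_add[symmetric] of_real_eq_iff)
qed

lemma convex_W:
  assumes T: "T \<in> \<L> (fock X)" and k: "supp k \<subseteq> - F"
  shows "W F \<beta> \<tau>\<^sub>0 k T = complex_of_real l * W F \<beta> \<tau>\<^sub>1 k T + complex_of_real (1 - l) * W F \<beta> \<tau>\<^sub>2 k T"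
proof -
  have "Tr \<tau>\<^sub>0 p T = complex_of_real l * Tr \<tau>\<^sub>1 p T + complex_of_real (1 - l) * Tr \<tau>\<^sub>2 p T" for p
    unfolding Tr_def convex_fun_apply sum.distrib sum_distrib_left ..
  then have "W F \<beta> \<tau>\<^sub>0 k T = (\<Sum>\<^sub>\<infinity>p\<in>degs F.
      complex_of_real l * (complex_of_real (exp (- (real (tdeg p) + real (tdeg k)) * \<beta>)) * Tr \<tau>\<^sub>1 (p + k) T) +
      complex_of_real (1 - l) * (complex_of_real (exp (- (real (tdeg p) + real (tdeg k)) * \<beta>)) * Tr \<tau>\<^sub>2 (p + k) T))"
    unfolding W_def by (simp only: distrib_left mult.left_commute)
  then show ?thesis unfolding W_def
    by (simp only: infsum_add[OF summable_on_cmult_right[OF W_summable[OF T1 T k]] summable_on_cmult_right[OF W_summable[OF T2 T k]]] infsum_cmult_right')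
qed

text \<open>Before normalisation the construction is a limit of Gibbs sums and therefore linear in
  the trace.\<close>

lemma convex_Phi_apply:
  "complex_of_real (cR F \<beta> \<tau>\<^sub>0) * Phi F \<beta> \<tau>\<^sub>0 T =
    complex_of_real l * (complex_of_real (cR F \<beta> \<tau>\<^sub>1) * Phi F \<beta> \<tau>\<^sub>1 T) + complex_of_real (1 - l) * (complex_of_real (cR F \<beta> \<tau>\<^sub>2) * Phi F \<beta> \<tau>\<^sub>2 T)"
proof (cases "T \<in> NT X")
  case T: True
  have lim: "(\<lambda>j. W F \<beta> \<tau> (ray F j) T) \<longlonglongrightarrow> complex_of_real (cR F \<beta> \<tau>) * Phi F \<beta> \<tau> T" if "\<tau> \<in> T_F X x F \<beta>" for \<tau>
  proof -
    have "(\<lambda>j. complex_of_real (cR F \<beta> \<tau>) * (W F \<beta> \<tau> (ray F j) T / complex_of_real (cR F \<beta> \<tau>))) \<longlonglongrightarrow> complex_of_real (cR F \<beta> \<tau>) * Phi F \<beta> \<tau> T"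
      by (intro tendsto_intros Phi_lim that T)
    then show ?thesis using cR_ge_1[OF that] by simp
  qed
  have "(\<lambda>j. W F \<beta> \<tau>\<^sub>0 (ray F j) T) \<longlonglongrightarrow>
    complex_of_real l * (complex_of_real (cR F \<beta> \<tau>\<^sub>1) * Phi F \<beta> \<tau>\<^sub>1 T) + complex_of_real (1 - l) * (complex_of_real (cR F \<beta> \<tau>\<^sub>2) * Phi F \<beta> \<tau>\<^sub>2 T)"
    unfolding convex_W[OF NT_L[OF T] supp_ray] by (intro tendsto_add tendsto_mult_left lim T1 T2)
  then show ?thesis using lim[OF convex_T_F] LIMSEQ_unique by blast
qed (simp add: Phi_def)

lemma convex_Phi:
  "Phi F \<beta> \<tau>\<^sub>0 = (complex_of_real l * c_const X x F \<tau>\<^sub>1 \<beta> / c_const X x F \<tau>\<^sub>0 \<beta>) *\<^sub>C Phi F \<beta> \<tau>\<^sub>1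
     + (complex_of_real (1 - l) * c_const X x F \<tau>\<^sub>2 \<beta> / c_const X x F \<tau>\<^sub>0 \<beta>) *\<^sub>C Phi F \<beta> \<tau>\<^sub>2"
proof
  fix T
  have c: "complex_of_real (cR F \<beta> \<tau>\<^sub>0) \<noteq> 0" using cR_ge_1[OF convex_T_F] by simp
  have "Phi F \<beta> \<tau>\<^sub>0 T = (complex_of_real (cR F \<beta> \<tau>\<^sub>0) * Phi F \<beta> \<tau>\<^sub>0 T) / complex_of_real (cR F \<beta> \<tau>\<^sub>0)" using c by simp
  also have "\<dots> = (complex_of_real l * complex_of_real (cR F \<beta> \<tau>\<^sub>1) / complex_of_real (cR F \<beta> \<tau>\<^sub>0)) * Phi F \<beta> \<tau>\<^sub>1 T
     + (complex_of_real (1 - l) * complex_of_real (cR F \<beta> \<tau>\<^sub>2) / complex_of_real (cR F \<beta> \<tau>\<^sub>0)) * Phi F \<beta> \<tau>\<^sub>2 T"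
    unfolding convex_Phi_apply by (simp add: add_divide_distrib mult.assoc)
  finally show "Phi F \<beta> \<tau>\<^sub>0 T = ((complex_of_real l * c_const X x F \<tau>\<^sub>1 \<beta> / c_const X x F \<tau>\<^sub>0 \<beta>) *\<^sub>C Phi F \<beta> \<tau>\<^sub>1
     + (complex_of_real (1 - l) * c_const X x F \<tau>\<^sub>2 \<beta> / c_const X x F \<tau>\<^sub>0 \<beta>) *\<^sub>C Phi F \<beta> \<tau>\<^sub>2) T"
    unfolding c_const_eq[OF T1] c_const_eq[OF T2] c_const_eq[OF convex_T_F]
    by (simp only: plus_fun_def scaleC_fun_def scaleC_complex_def)
qed

text \<open>The weights add up to 1 because the normalising constant is affine in the trace, and
  they are positive because the constants are at least 1.\<close>

lemma convex_Phi_real: "\<exists>m\<in>{0<..<1}. Phi F \<beta> \<tau>\<^sub>0 = m *\<^sub>R Phi F \<beta> \<tau>\<^sub>1 + (1 - m) *\<^sub>R Phi F \<beta> \<tau>\<^sub>2"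
proof -
  define c where "c = cR F \<beta> \<tau>\<^sub>0"
  define m where "m = l * cR F \<beta> \<tau>\<^sub>1 / c"
  have c: "c = l * cR F \<beta> \<tau>\<^sub>1 + (1 - l) * cR F \<beta> \<tau>\<^sub>2" unfolding c_def by (rule convex_cR)
  have p: "l * cR F \<beta> \<tau>\<^sub>1 > 0" "(1 - l) * cR F \<beta> \<tau>\<^sub>2 > 0"
    using l cR_ge_1[OF T1] cR_ge_1[OF T2] by (auto intro!: mult_pos_pos)
  have m': "1 - m = (1 - l) * cR F \<beta> \<tau>\<^sub>2 / c" unfolding m_def using p c by (simp add: field_simps)
  have "m \<in> {0<..<1}" using p c unfolding m_def by (auto simp: divide_simps)
  moreover have "Phi F \<beta> \<tau>\<^sub>0 = m *\<^sub>R Phi F \<beta> \<tau>\<^sub>1 + (1 - m) *\<^sub>R Phi F \<beta> \<tau>\<^sub>2"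
    unfolding scaleC_of_real[of m, symmetric] scaleC_of_real[of "1 - m", symmetric]
    unfolding m' unfolding m_def c_def of_real_mult of_real_divide
    using convex_Phi unfolding c_const_eq[OF T1] c_const_eq[OF T2] c_const_eq[OF convex_T_F] .
  ultimately show ?thesis by blast
qed

end

lemma convex_dom:
  assumes "\<tau>\<^sub>1 \<in> trace_dom F \<beta>" "\<tau>\<^sub>2 \<in> trace_dom F \<beta>" "l \<in> {0<..<1}"
  shows "l *\<^sub>R \<tau>\<^sub>1 + (1 - l) *\<^sub>R \<tau>\<^sub>2 \<in> trace_dom F \<beta>"
  using assms convex_T_F[of \<tau>\<^sub>1 F \<beta> \<tau>\<^sub>2 l] by (auto simp: scaleR_fun_def)

section \<open>Convex combinations of states\<close>

context
  fixes F :: "'i set" and \<beta> l :: real and \<phi>\<^sub>1 \<phi>\<^sub>2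
  assumes G1: "\<phi>\<^sub>1 \<in> GKMS_F X x F \<beta>" and G2: "\<phi>\<^sub>2 \<in> GKMS_F X x F \<beta>" and l: "l \<in> {0<..<1}"
begin

abbreviation (input) "\<phi>\<^sub>0 \<equiv> l *\<^sub>R \<phi>\<^sub>1 + (1 - l) *\<^sub>R \<phi>\<^sub>2"

lemma convex_GKMS_F: "\<phi>\<^sub>0 \<in> GKMS_F X x F \<beta>"
proof -
  interpret P: kms_F_system X x \<beta> \<phi>\<^sub>1 F by (rule GKMS_F_system[OF G1])
  interpret R: kms_F_system X x \<beta> \<phi>\<^sub>2 F by (rule GKMS_F_system[OF G2])
  have st: "\<phi>\<^sub>0 \<in> states (fock X) (NT X)"
    unfolding states_def mem_Collect_eq convex_fun_apply
  proof (intro conjI allI ballI impI)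
    fix S T c assume T: "T \<in> NT X"
    show "complex_of_real l * \<phi>\<^sub>1 (c *\<^sub>C T) + complex_of_real (1 - l) * \<phi>\<^sub>2 (c *\<^sub>C T) = c * (complex_of_real l * \<phi>\<^sub>1 T + complex_of_real (1 - l) * \<phi>\<^sub>2 T)"
      unfolding P.S.st_scaleC[OF T] R.S.st_scaleC[OF T] by (simp only: distrib_left mult.left_commute)
    show "complex_of_real l * \<phi>\<^sub>1 (adj (fock X) T \<circ> T) + complex_of_real (1 - l) * \<phi>\<^sub>2 (adj (fock X) T \<circ> T) \<in> \<real>\<^sub>\<ge>\<^sub>0"
      using l by (intro nonneg_Reals_convex P.S.st_pos R.S.st_pos T) auto
    fix S assume S: "S \<in> NT X"
    show "complex_of_real l * \<phi>\<^sub>1 (S + T) + complex_of_real (1 - l) * \<phi>\<^sub>2 (S + T)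
       = complex_of_real l * \<phi>\<^sub>1 S + complex_of_real (1 - l) * \<phi>\<^sub>2 S + (complex_of_real l * \<phi>\<^sub>1 T + complex_of_real (1 - l) * \<phi>\<^sub>2 T)"
      unfolding P.S.st_add[OF S T] R.S.st_add[OF S T] by (simp only: distrib_left add_ac)
  qed (simp_all add: P.S.st_off R.S.st_off P.S.st_id R.S.st_id)
  have kms: "\<phi>\<^sub>0 \<in> KMS X \<beta>"
    unfolding KMS_def
  proof (intro CollectI conjI allI ballI)
    fix n m k w \<xi> \<eta> \<zeta> \<omega>
    assume c: "\<xi> \<in> carrier (fib X n)" "\<eta> \<in> carrier (fib X m)" "\<zeta> \<in> carrier (fib X k)" "\<omega> \<in> carrier (fib X w)"
    let ?e = "complex_of_real (exp (- (real (tdeg n) - real (tdeg m)) * \<beta>))"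
    have R: "tt X k \<zeta> w \<omega> \<in> NT X" by (rule Alg_NT[OF Alg_tt[OF c(3,4)]])
    show "\<phi>\<^sub>0 (tt X n \<xi> m \<eta> \<circ> tt X k \<zeta> w \<omega>) = ?e * \<phi>\<^sub>0 (tt X k \<zeta> w \<omega> \<circ> tt X n \<xi> m \<eta>)"
      unfolding convex_fun_apply P.kms_tt[OF c(1,2) R] R.kms_tt[OF c(1,2) R] by (simp only: distrib_left mult.left_commute)
  qed (rule st)
  have "((\<lambda>n. \<phi>\<^sub>0 (Q_level X x F n)) has_sum complex_of_real l * 1 + complex_of_real (1 - l) * 1) (degs F)"
    unfolding convex_fun_apply by (intro has_sum_add has_sum_cmult_right P.levels R.levels)
  then have "((\<lambda>n. \<phi>\<^sub>0 (Q_level X x F n)) has_sum 1) {n. supp n \<subseteq> F}" by (simp add: degs_def)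
  then have "\<phi>\<^sub>0 \<in> KMS_F X x F \<beta>"
    using kms P.Q_zero R.Q_zero unfolding KMS_F_def by (simp add: scaleR_fun_def)
  then show ?thesis using G1 G2 unfolding GKMS_F_def by (simp add: scaleR_fun_def)
qed

lemma GKMS_F_Q_set: "\<phi> \<in> GKMS_F X x F \<beta> \<Longrightarrow> \<phi> (Q_set X x F) = complex_of_real (Re (\<phi> (Q_set X x F)))"
    "\<phi> \<in> GKMS_F X x F \<beta> \<Longrightarrow> Re (\<phi> (Q_set X x F)) > 0"
  using kms_F_system.Q_real[OF GKMS_F_system] kms_F_system.Q_pos[OF GKMS_F_system] by blast+

text \<open>The compression to the corner is linear in the state until it is divided by the mass of
  Q_F; nonzero masses of both states allow the two quotients to be restored.\<close>

lemma convex_corner_trace: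
  "corner_trace X x F \<phi>\<^sub>0 = (complex_of_real l * \<phi>\<^sub>1 (Q_set X x F) / \<phi>\<^sub>0 (Q_set X x F)) *\<^sub>C corner_trace X x F \<phi>\<^sub>1
     + (complex_of_real (1 - l) * \<phi>\<^sub>2 (Q_set X x F) / \<phi>\<^sub>0 (Q_set X x F)) *\<^sub>C corner_trace X x F \<phi>\<^sub>2"
proof
  fix a
  have "\<phi>\<^sub>1 (Q_set X x F) \<noteq> 0" "\<phi>\<^sub>2 (Q_set X x F) \<noteq> 0"
    using GKMS_F_Q_set(2)[OF G1] GKMS_F_Q_set(2)[OF G2] by auto
  then show "corner_trace X x F \<phi>\<^sub>0 a = ((complex_of_real l * \<phi>\<^sub>1 (Q_set X x F) / \<phi>\<^sub>0 (Q_set X x F)) *\<^sub>C corner_trace X x F \<phi>\<^sub>1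
     + (complex_of_real (1 - l) * \<phi>\<^sub>2 (Q_set X x F) / \<phi>\<^sub>0 (Q_set X x F)) *\<^sub>C corner_trace X x F \<phi>\<^sub>2) a"
    unfolding corner_trace_def plus_fun_def[of "_ *\<^sub>C _"] scaleC_fun_def scaleC_complex_def convex_fun_apply[of l \<phi>\<^sub>1 "1 - l" \<phi>\<^sub>2]
    by (simp add: add_divide_distrib mult.assoc del: comp_apply)
qed

lemma convex_corner_trace_real:
  "\<exists>m\<in>{0<..<1}. corner_trace X x F \<phi>\<^sub>0 = m *\<^sub>R corner_trace X x F \<phi>\<^sub>1 + (1 - m) *\<^sub>R corner_trace X x F \<phi>\<^sub>2"
proof -
  let ?q = "\<lambda>\<phi>. Re (\<phi> (Q_set X x F))"
  define m where "m = l * ?q \<phi>\<^sub>1 / ?q \<phi>\<^sub>0"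
  have c: "?q \<phi>\<^sub>0 = l * ?q \<phi>\<^sub>1 + (1 - l) * ?q \<phi>\<^sub>2" by (simp add: scaleR_fun_def)
  have p: "l * ?q \<phi>\<^sub>1 > 0" "(1 - l) * ?q \<phi>\<^sub>2 > 0"
    using l GKMS_F_Q_set(2)[OF G1] GKMS_F_Q_set(2)[OF G2] by (auto intro!: mult_pos_pos)
  have m': "1 - m = (1 - l) * ?q \<phi>\<^sub>2 / ?q \<phi>\<^sub>0" unfolding m_def using p unfolding c by (simp add: field_simps)
  have "m \<in> {0<..<1}" using p unfolding m_def c by (auto simp: divide_simps)
  moreover have "corner_trace X x F \<phi>\<^sub>0 = m *\<^sub>R corner_trace X x F \<phi>\<^sub>1 + (1 - m) *\<^sub>R corner_trace X x F \<phi>\<^sub>2"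
    unfolding scaleC_of_real[of m, symmetric] scaleC_of_real[of "1 - m", symmetric]
    unfolding m' unfolding m_def of_real_mult of_real_divide
    unfolding GKMS_F_Q_set(1)[OF G1, symmetric] GKMS_F_Q_set(1)[OF G2, symmetric] GKMS_F_Q_set(1)[OF convex_GKMS_F, symmetric]
    by (rule convex_corner_trace)
  ultimately show ?thesis by blast
qed

end

lemma extreme_Phi: "Phi F \<beta> ` {\<tau>. \<tau> extreme_point_of trace_dom F \<beta>} = {\<phi>. \<phi> extreme_point_of GKMS_F X x F \<beta>}"
proof (rule extreme_point_bij[OF bij_Phi])
  fix \<tau>\<^sub>1 \<tau>\<^sub>2 and l :: real assume a: "\<tau>\<^sub>1 \<in> trace_dom F \<beta>" "\<tau>\<^sub>2 \<in> trace_dom F \<beta>" "l \<in> {0<..<1}"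
  then show "l *\<^sub>R \<tau>\<^sub>1 + (1 - l) *\<^sub>R \<tau>\<^sub>2 \<in> trace_dom F \<beta>" by (rule convex_dom)
  show "\<exists>m\<in>{0<..<1}. Phi F \<beta> (l *\<^sub>R \<tau>\<^sub>1 + (1 - l) *\<^sub>R \<tau>\<^sub>2) = m *\<^sub>R Phi F \<beta> \<tau>\<^sub>1 + (1 - m) *\<^sub>R Phi F \<beta> \<tau>\<^sub>2"
    using a by (intro convex_Phi_real) auto
next
  fix \<phi>\<^sub>1 \<phi>\<^sub>2 and l :: real assume a: "\<phi>\<^sub>1 \<in> GKMS_F X x F \<beta>" "\<phi>\<^sub>2 \<in> GKMS_F X x F \<beta>" "l \<in> {0<..<1}"
  show "\<exists>m\<in>{0<..<1}. inv_into (trace_dom F \<beta>) (Phi F \<beta>) (l *\<^sub>R \<phi>\<^sub>1 + (1 - l) *\<^sub>R \<phi>\<^sub>2)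
     = m *\<^sub>R inv_into (trace_dom F \<beta>) (Phi F \<beta>) \<phi>\<^sub>1 + (1 - m) *\<^sub>R inv_into (trace_dom F \<beta>) (Phi F \<beta>) \<phi>\<^sub>2"
    unfolding inv_Phi[OF a(1)] inv_Phi[OF a(2)] inv_Phi[OF convex_GKMS_F[OF a]] by (rule convex_corner_trace_real[OF a])
qed

text \<open>For \<open>F = {}\<close> the projection Q_F is the identity, so the normalising
  constant is 1 and the corner formula is a statement about \<pi>(A).\<close>

lemma Phi_empty:
  assumes TF: "\<tau> \<in> T_F X x {} \<beta>" shows "Phi {} \<beta> \<tau> (pi_rep X a) = \<tau> a"
proof -
  have Q: "Q_set X x {} = id_op (fock X)" by (simp add: Q_set_def)
  interpret P: operator_state "fock X" "NT X" "Phi {} \<beta> \<tau>" by (rule operator_state_NT[OF Phi_state[OF TF]])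
  have "1 / complex_of_real (cR {} \<beta> \<tau>) = 1" using Phi_Q_set[OF TF] unfolding Q P.st_id by simp
  moreover have "Q_set X x {} \<circ> pi_rep X a \<circ> Q_set X x {} = pi_rep X a"
    unfolding Q by (simp only: K.comp_id_left[OF pi_L] K.comp_id_right[OF pi_L])
  ultimately show ?thesis using Phi_Q_corner[OF TF, of a] by simp
qed

text \<open>The only word supported in the empty set is the empty one, so the summability condition
  holds for every trace.\<close>

lemma AVT_eq: "AVT X x \<beta> = T_F X x {} \<beta>"
proof -
  have "words x {} \<subseteq> {\<lambda>_. []}" by (auto simp: words_def supp_def)
  then have "finite (words x {})" by (rule finite_subset) simp
  then show ?thesis by (auto simp: AVT_def T_F_def)
qed

end

theorem theorem4p4:
  fixes X :: "('i::{finite,linorder}, 'a::unital_cstar_algebra, 'x::complex_vector) prod_sys"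
    and \<beta> :: real
  assumes "unital_product_system X" and "finite_rank X" and "\<beta> > 0"
  shows
    "(\<exists>\<Phi>. \<forall>x. unit_decomposition X x \<longrightarrow>
       (let D = {\<tau> \<in> AVT X x \<beta>. \<forall>a\<in>ker_ideal X x UNIV. \<tau> a = 0}; G = GKMS_F X x {} \<beta> in
         bij_betw \<Phi> D G \<and>
         (\<forall>\<tau>\<in>D. \<forall>a. \<Phi> \<tau> (pi_rep X a) = \<tau> a) \<and>
         \<Phi> ` {\<tau>. \<tau> extreme_point_of D} = {\<phi>. \<phi> extreme_point_of G}))
     \<and>
     (\<forall>F. F \<noteq> {} \<longrightarrow> (\<exists>\<Phi>. \<forall>x. unit_decomposition X x \<longrightarrow>
       (let D = {\<tau> \<in> T_F X x F \<beta>. \<forall>a\<in>ker_ideal X x (- F). \<tau> a = 0}; G = GKMS_F X x F \<beta>;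
            c = (\<lambda>\<tau>. c_const X x F \<tau> \<beta>); Q = Q_set X x F in
         bij_betw \<Phi> D G \<and>
         (\<forall>\<tau>\<in>D. \<Phi> \<tau> Q * c \<tau> = 1 \<and> (\<forall>a. \<Phi> \<tau> (Q \<circ> pi_rep X a \<circ> Q) = \<Phi> \<tau> Q * \<tau> a)) \<and>
         (\<forall>\<tau>\<in>D. \<forall>n m. \<forall>\<xi>\<in>carrier (fib X n). \<forall>\<eta>\<in>carrier (fib X m).
            (n \<noteq> m \<longrightarrow> \<Phi> \<tau> (tt X n \<xi> m \<eta>) = 0) \<and>
            (n = m \<longrightarrow>
              (let s = (\<lambda>\<mu>. complex_of_real (exp (- (real (tdeg n) + real (tdeg (wlen \<mu>))) * \<beta>)) *
                     \<tau> (ip (fib X (n + wlen \<mu>))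
                          (pmul X n (wlen \<mu>) \<eta> (word_elt X x \<mu>))
                          (pmul X n (wlen \<mu>) \<xi> (word_elt X x \<mu>))))
               in s summable_on words x F \<and>
                  \<Phi> \<tau> (tt X n \<xi> m \<eta>) = inverse (c \<tau>) * (\<Sum>\<^sub>\<infinity>\<mu>\<in>words x F. s \<mu>)))) \<and>
         (\<forall>\<tau>\<^sub>1\<in>D. \<forall>\<tau>\<^sub>2\<in>D. \<forall>l\<in>{0<..<1}. let \<tau> = l *\<^sub>R \<tau>\<^sub>1 + (1 - l) *\<^sub>R \<tau>\<^sub>2 in
            \<tau> \<in> D \<and>
            \<Phi> \<tau> = (of_real l * c \<tau>\<^sub>1 / c \<tau>) *\<^sub>C \<Phi> \<tau>\<^sub>1 + (of_real (1 - l) * c \<tau>\<^sub>2 / c \<tau>) *\<^sub>C \<Phi> \<tau>\<^sub>2) \<and>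
         (\<forall>\<phi>\<^sub>1\<in>G. \<forall>\<phi>\<^sub>2\<in>G. \<forall>l\<in>{0<..<1}. let \<phi> = l *\<^sub>R \<phi>\<^sub>1 + (1 - l) *\<^sub>R \<phi>\<^sub>2; \<Psi> = inv_into D \<Phi> in
            \<phi> \<in> G \<and>
            \<Psi> \<phi> = (of_real l * \<phi>\<^sub>1 Q / \<phi> Q) *\<^sub>C \<Psi> \<phi>\<^sub>1 + (of_real (1 - l) * \<phi>\<^sub>2 Q / \<phi> Q) *\<^sub>C \<Psi> \<phi>\<^sub>2) \<and>
         \<Phi> ` {\<tau>. \<tau> extreme_point_of D} = {\<phi>. \<phi> extreme_point_of G})))"
proof -
  obtain x\<^sub>0 where x0: "unit_decomposition X x\<^sub>0" using assms(2) by (auto simp: finite_rank_def)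
  have sys: "finite_rank_system X x" if "unit_decomposition X x" for x
    using assms(1) that by (simp add: finite_rank_system_def product_system_unital_def finite_rank_system_axioms_def)
  \<comment> \<open>An auxiliary decomposition defines the map; \<open>Phi_dec\<close> identifies it
    with the one belonging to any given decomposition.\<close>
  interpret O: finite_rank_system X x\<^sub>0 by (rule sys[OF x0])
  show ?thesis
  proof (intro conjI allI impI, goal_cases)
    case 1
    show ?case
    proof (intro exI[of _ "O.Phi {} \<beta>"] allI impI, goal_cases)
      case (1 x)
      then interpret Y: finite_rank_system X x by (rule sys)
      show ?case
        unfolding Let_def Y.Phi_dec[OF x0] Y.AVT_eq using Y.bij_Phi[of "{}" \<beta>] Y.extreme_Phi[of "{}" \<beta>] Y.Phi_empty by simp
    qed
  next
    case (2 F)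
    show ?case
    proof (intro exI[of _ "O.Phi F \<beta>"] allI impI, goal_cases)
      case (1 x)
      then interpret Y: finite_rank_system X x by (rule sys)
      have c: "complex_of_real (Y.cR F \<beta> \<tau>) \<noteq> 0" if "\<tau> \<in> T_F X x F \<beta>" for \<tau> using Y.cR_ge_1[OF that] by simp
      show ?case unfolding Let_def Y.Phi_dec[OF x0]
      proof (intro conjI ballI allI impI, goal_cases)
        case 1 show ?case by (rule Y.bij_Phi)
      next
        case (2 \<tau>)
        then have TF: "\<tau> \<in> T_F X x F \<beta>" by simp
        show ?case using c[OF TF] by (simp add: Y.Phi_Q_set[OF TF] Y.c_const_eq[OF TF])
      next
        case (3 \<tau> a)
        then have TF: "\<tau> \<in> T_F X x F \<beta>" by simp
        show ?case unfolding Y.Phi_Q_corner[OF TF] Y.Phi_Q_set[OF TF] by simp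
      next
        case (4 \<tau> n m \<xi> \<eta>)
        then show ?case using Y.Phi_tt_off by simp
      next
        case (5 \<tau> n m \<xi> \<eta>)
        then show ?case using Y.word_series(1)[of \<tau> F \<beta> \<xi> n \<eta>] by simp
      next
        case (6 \<tau> n m \<xi> \<eta>)
        then have h: "\<tau> \<in> T_F X x F \<beta>" "\<xi> \<in> carrier (fib X n)" "\<eta> \<in> carrier (fib X n)" by auto
        show ?case unfolding 6(4)[symmetric] Y.Phi_tt[OF h] Y.word_series(2)[OF h] Y.c_const_eq[OF h(1)]
          by (simp add: field_simps)
      next
        case (7 \<tau>\<^sub>1 \<tau>\<^sub>2 l) then show ?case by (rule Y.convex_dom)
      next
        case (8 \<tau>\<^sub>1 \<tau>\<^sub>2 l) then show ?case by (intro Y.convex_Phi) auto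
      next
        case (9 \<phi>\<^sub>1 \<phi>\<^sub>2 l) then show ?case by (rule Y.convex_GKMS_F)
      next
        case (10 \<phi>\<^sub>1 \<phi>\<^sub>2 l)
        then show ?case unfolding Y.inv_Phi[OF 10(1)] Y.inv_Phi[OF 10(2)] Y.inv_Phi[OF Y.convex_GKMS_F[OF 10]]
          by (rule Y.convex_corner_trace)
      next
        case 11 show ?case by (rule Y.extreme_Phi)
      qed
    qed
  qed
qed

end
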